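(* Let $N=(G,u,b,\tau,T)$ be an undirected network over time in which $B=\sum_{v:\,b_v>0}b_v$ units of flow can be sent within the time horizon $T$. Then there exists an orientation $\overrightarrow{N}$ of $N$ in which at least $B/2$ units of flow can be sent within time horizon $2T$. Such an orientation, together with a flow over time (transshipment over time) in $\overrightarrow{N}$ with this property, can be computed in polynomial time.
   Context: An undirected network over time $N=(G,u,b,\tau,T)$ consists of a finite undirected (multi)graph $G=(V,E)$, capacities $u_e\ge 0$ and transit times $\tau_e\ge 0$ for $e\in E$, balances $b_v\in\mathbb{R}$ with $\sum_v b_v=0$, and a time horizon $T\ge 0$. Sources are $S^+=\{v: b_v>0\}$, sinks $S^-=\{v:b_v<0\}$. An orientation of $N$ replaces every edge $\{v,w\}$ by exactly one of the arcs $(v,w),(w,v)$ with the same capacity and transit time (parallel edges oriented independently). A flow over time with horizon $\Theta$ in a directed network assigns to each arc $e$ a Lebesgue-integrable inflow rate $f_e:[0,\Theta)\to\mathbb{R}_{\ge0}$ with $f_e\le u_e$ and $f_e(\theta)=0$ for $\theta\ge \Theta-\tau_e$; flow entering at $\theta$ leaves at $\theta+\tau_e$. With excess $\mathrm{ex}(v,\theta)=\sum_{e\in\delta^-(v)}\int_0^{\theta-\tau_e}f_e-\sum_{e\in\delta^+(v)}\int_0^{\theta}f_e$, flow conservation requires: $\mathrm{ex}(v,\Theta)=0$ and $\mathrm{ex}(v,\theta)\ge0$ for non-terminals; $-b_v\le\mathrm{ex}(v,\theta)\le0$ for sources; $0\le\mathrm{ex}(v,\theta)\le-b_v$ for sinks.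 The value is $\sum_{v\in S^-}\mathrm{ex}(v,\Theta)$. In an undirected network flow may use each edge in both directions, the inflow rates in both directions together bounded by $u_e$, each direction with transit time $\tau_e$. "$x$ units of flow can be sent within time horizon $\Theta$" means a flow over time with horizon $\Theta$ satisfying these constraints and of value at least $x$ exists. *)

theory Defs
  imports
    "HOL-Analysis.Analysis"
    "HOL-Computational_Algebra.Polynomial"
    "HOL-Library.Uprod"
    "HOL-Library.Log_Nat"
    "Graph_Theory.Digraph"
begin

section \<open>Flows over time in directed networks\<close>

text \<open>
  A rate \<open>f a \<theta>\<close> is meaningful for \<open>0 \<le> \<theta> < \<Theta>\<close> only; no definition below
  depends on values outside this range.
\<close>

definition inflow_rates ::
  "('v, 'a) pre_digraph \<Rightarrow> ('a \<Rightarrow> real) \<Rightarrow> real \<Rightarrow> ('a \<Rightarrow> real \<Rightarrow> real) \<Rightarrow> bool" where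
  "inflow_rates G \<tau> \<Theta> f \<longleftrightarrow>
     (\<forall>a\<in>arcs G. set_integrable lebesgue {0..<\<Theta>} (f a) \<and>
        (\<forall>\<theta>\<in>{0..<\<Theta>}. 0 \<le> f a \<theta> \<and> (\<Theta> - \<tau> a \<le> \<theta> \<longrightarrow> f a \<theta> = 0)))"

text \<open>For \<open>\<theta> < \<tau> a\<close> the first interval is empty, so nothing has arrived yet.\<close>

definition excess ::
  "('v, 'a) pre_digraph \<Rightarrow> ('a \<Rightarrow> real) \<Rightarrow> ('a \<Rightarrow> real \<Rightarrow> real) \<Rightarrow> 'v \<Rightarrow> real \<Rightarrow> real" where
  "excess G \<tau> f v \<theta> =
     (\<Sum>a\<in>in_arcs G v. set_lebesgue_integral lebesgue {0..<\<theta> - \<tau> a} (f a)) -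
     (\<Sum>a\<in>out_arcs G v. set_lebesgue_integral lebesgue {0..<\<theta>} (f a))"

definition flow_conservation ::
  "('v, 'a) pre_digraph \<Rightarrow> ('a \<Rightarrow> real) \<Rightarrow> ('v \<Rightarrow> real) \<Rightarrow> real \<Rightarrow>
     ('a \<Rightarrow> real \<Rightarrow> real) \<Rightarrow> bool" where
  "flow_conservation G \<tau> b \<Theta> f \<longleftrightarrow>
     (\<forall>v\<in>verts G.
        (b v = 0 \<longrightarrow> excess G \<tau> f v \<Theta> = 0 \<and> (\<forall>\<theta>\<in>{0..\<Theta>}. 0 \<le> excess G \<tau> f v \<theta>)) \<and>
        (b v > 0 \<longrightarrow> (\<forall>\<theta>\<in>{0..\<Theta>}. - b v \<le> excess G \<tau> f v \<theta> \<and> excess G \<tau> f v \<theta> \<le> 0)) \<and>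
        (b v < 0 \<longrightarrow> (\<forall>\<theta>\<in>{0..\<Theta>}. 0 \<le> excess G \<tau> f v \<theta> \<and> excess G \<tau> f v \<theta> \<le> - b v)))"

definition flow_value ::
  "('v, 'a) pre_digraph \<Rightarrow> ('a \<Rightarrow> real) \<Rightarrow> ('v \<Rightarrow> real) \<Rightarrow> real \<Rightarrow>
     ('a \<Rightarrow> real \<Rightarrow> real) \<Rightarrow> real" where
  "flow_value G \<tau> b \<Theta> f = (\<Sum>v\<in>{v \<in> verts G. b v < 0}. excess G \<tau> f v \<Theta>)"

definition flow_over_time ::
  "('v, 'a) pre_digraph \<Rightarrow> ('a \<Rightarrow> real) \<Rightarrow> ('a \<Rightarrow> real) \<Rightarrow> ('v \<Rightarrow> real) \<Rightarrow> real \<Rightarrow>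
     ('a \<Rightarrow> real \<Rightarrow> real) \<Rightarrow> bool" where
  "flow_over_time G u \<tau> b \<Theta> f \<longleftrightarrow>
     inflow_rates G \<tau> \<Theta> f \<and>
     (\<forall>a\<in>arcs G. \<forall>\<theta>\<in>{0..<\<Theta>}. f a \<theta> \<le> u a) \<and>
     flow_conservation G \<tau> b \<Theta> f"


section \<open>Undirected networks over time and their orientations\<close>

record ('v, 'e) network =
  nodes :: "'v set"
  edges :: "'e set"
  ends :: "'e \<Rightarrow> 'v uprod"
  capacity :: "'e \<Rightarrow> real"
  transit :: "'e \<Rightarrow> real"
  balance :: "'v \<Rightarrow> real"
  horizon :: real

text \<open>Parallel edges and loops are both allowed.\<close>

definition undirected_network_over_time :: "('v, 'e) network \<Rightarrow> bool" where
  "undirected_network_over_time N \<longleftrightarrow>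
     finite (nodes N) \<and> finite (edges N) \<and>
     (\<forall>e\<in>edges N. set_uprod (ends N e) \<subseteq> nodes N \<and> 0 \<le> capacity N e \<and> 0 \<le> transit N e) \<and>
     (\<Sum>v\<in>nodes N. balance N v) = 0 \<and>
     0 \<le> horizon N"

definition total_supply :: "('v, 'e) network \<Rightarrow> real" where
  "total_supply N = (\<Sum>v\<in>{v \<in> nodes N. balance N v > 0}. balance N v)"

text \<open>
  The arc \<open>(e, v, w)\<close> stands for using the edge \<open>e\<close> from \<open>v\<close> to \<open>w\<close>.
\<close>

definition bidirected :: "('v, 'e) network \<Rightarrow> ('v, 'e \<times> 'v \<times> 'v) pre_digraph" where
  "bidirected N =
     \<lparr> verts = nodes N,
       arcs = {(e, v, w). e \<in> edges N \<and> Upair v w = ends N e},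
       tail = (\<lambda>(e, v, w). v),
       head = (\<lambda>(e, v, w). w) \<rparr>"

definition undirected_flow_over_time ::
  "('v, 'e) network \<Rightarrow> real \<Rightarrow> ('e \<times> 'v \<times> 'v \<Rightarrow> real \<Rightarrow> real) \<Rightarrow> bool" where
  "undirected_flow_over_time N \<Theta> f \<longleftrightarrow>
     inflow_rates (bidirected N) (transit N \<circ> fst) \<Theta> f \<and>
     (\<forall>e\<in>edges N. \<forall>\<theta>\<in>{0..<\<Theta>}.
        (\<Sum>a\<in>{a \<in> arcs (bidirected N). fst a = e}. f a \<theta>) \<le> capacity N e) \<and>
     flow_conservation (bidirected N) (transit N \<circ> fst) (balance N) \<Theta> f"

definition can_be_sent :: "('v, 'e) network \<Rightarrow> real \<Rightarrow> real \<Rightarrow> bool" where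
  "can_be_sent N x \<Theta> \<longleftrightarrow>
     (\<exists>f. undirected_flow_over_time N \<Theta> f \<and>
          x \<le> flow_value (bidirected N) (transit N \<circ> fst) (balance N) \<Theta> f)"

text \<open>
  An orientation keeps every edge as the name of its single arc, so capacities and transit
  times carry over literally.
\<close>

definition orientation :: "('v, 'e) network \<Rightarrow> ('v, 'e) pre_digraph \<Rightarrow> bool" where
  "orientation N G \<longleftrightarrow>
     verts G = nodes N \<and> arcs G = edges N \<and>
     (\<forall>e\<in>edges N. Upair (tail G e) (head G e) = ends N e)"

definition oriented_flow_of_value ::
  "('v, 'e) network \<Rightarrow> ('v, 'e) pre_digraph \<Rightarrow> real \<Rightarrow> real \<Rightarrow> ('e \<Rightarrow> real \<Rightarrow> real) \<Rightarrow> bool" where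
  "oriented_flow_of_value N G x \<Theta> f \<longleftrightarrow>
     flow_over_time G (capacity N) (transit N) (balance N) \<Theta> f \<and>
     x \<le> flow_value G (transit N) (balance N) \<Theta> f"

definition can_be_sent_oriented ::
  "('v, 'e) network \<Rightarrow> ('v, 'e) pre_digraph \<Rightarrow> real \<Rightarrow> real \<Rightarrow> bool" where
  "can_be_sent_oriented N G x \<Theta> \<longleftrightarrow> (\<exists>f. oriented_flow_of_value N G x \<Theta> f)"


section \<open>Polynomial-time computation\<close>

text \<open>
  The machine model is a structured random access machine with logarithmic cost: the memory
  consists of integer arrays, and every operation is charged the binary length of all numbers
  it touches, array indices included.  Up to polynomials, running times agree with those of
  Turing machines.
\<close>

datatype exp =
    Const int
  | Read string exp
  | Add exp exp
  | Sub exp exp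
  | Mul exp exp
  | Quot exp exp
  | Less exp exp

datatype com =
    Skip
  | Assign string exp exp
  | Seq com com
  | If exp com com
  | While exp com

type_synonym memory = "string \<Rightarrow> int \<Rightarrow> int"

fun eval_exp :: "memory \<Rightarrow> exp \<Rightarrow> int" where
  "eval_exp s (Const c) = c"
| "eval_exp s (Read x e) = s x (eval_exp s e)"
| "eval_exp s (Add d e) = eval_exp s d + eval_exp s e"
| "eval_exp s (Sub d e) = eval_exp s d - eval_exp s e"
| "eval_exp s (Mul d e) = eval_exp s d * eval_exp s e"
| "eval_exp s (Quot d e) = eval_exp s d div eval_exp s e"
| "eval_exp s (Less d e) = (if eval_exp s d < eval_exp s e then 1 else 0)"

text \<open>One extra unit pays for the sign, so that every number has positive cost.\<close>

definition bits :: "int \<Rightarrow> nat" where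
  "bits i = Suc (nat (bitlen \<bar>i\<bar>))"

fun exp_cost :: "memory \<Rightarrow> exp \<Rightarrow> nat" where
  "exp_cost s (Const c) = bits c"
| "exp_cost s (Read x e) = bits (eval_exp s (Read x e)) + exp_cost s e"
| "exp_cost s (Add d e) = bits (eval_exp s (Add d e)) + exp_cost s d + exp_cost s e"
| "exp_cost s (Sub d e) = bits (eval_exp s (Sub d e)) + exp_cost s d + exp_cost s e"
| "exp_cost s (Mul d e) = bits (eval_exp s (Mul d e)) + exp_cost s d + exp_cost s e"
| "exp_cost s (Quot d e) = bits (eval_exp s (Quot d e)) + exp_cost s d + exp_cost s e"
| "exp_cost s (Less d e) = bits (eval_exp s (Less d e)) + exp_cost s d + exp_cost s e"

text \<open>
  \<open>exec c s t s'\<close>: started in memory \<open>s\<close>, the program \<open>c\<close> halts in memory \<open>s'\<close> at cost \<open>t\<close>.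
  \<open>Assign x d e\<close> is the array assignment \<open>x[d] := e\<close>.
\<close>

inductive exec :: "com \<Rightarrow> memory \<Rightarrow> nat \<Rightarrow> memory \<Rightarrow> bool" where
  exec_Skip: "exec Skip s 1 s"
| exec_Assign:
    "exec (Assign x d e) s (1 + exp_cost s d + exp_cost s e)
       (s(x := (s x)(eval_exp s d := eval_exp s e)))"
| exec_Seq:
    "exec c s t s' \<Longrightarrow> exec d s' t' s'' \<Longrightarrow> exec (Seq c d) s (1 + t + t') s''"
| exec_If_true:
    "eval_exp s e \<noteq> 0 \<Longrightarrow> exec c s t s' \<Longrightarrow> exec (If e c d) s (1 + exp_cost s e + t) s'"
| exec_If_false:
    "eval_exp s e = 0 \<Longrightarrow> exec d s t s' \<Longrightarrow> exec (If e c d) s (1 + exp_cost s e + t) s'"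
| exec_While_true:
    "eval_exp s e \<noteq> 0 \<Longrightarrow> exec c s t s' \<Longrightarrow> exec (While e c) s' t' s'' \<Longrightarrow>
       exec (While e c) s (1 + exp_cost s e + t + t') s''"
| exec_While_false:
    "eval_exp s e = 0 \<Longrightarrow> exec (While e c) s (1 + exp_cost s e) s"

definition initial_memory :: "int list \<Rightarrow> memory" where
  "initial_memory xs =
     (\<lambda>x i. if x = ''in'' \<and> 0 \<le> i \<and> i < int (length xs) then xs ! nat i else 0)"

text \<open>
  A search problem: on every instance satisfying the promise, the program has to leave some
  correct answer in the array \<open>out\<close>.
\<close>

definition computable_in_polynomial_time ::
  "('i \<Rightarrow> int list) \<Rightarrow> ('i \<Rightarrow> bool) \<Rightarrow> ('i \<Rightarrow> (int \<Rightarrow> int) \<Rightarrow> bool) \<Rightarrow> bool" where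
  "computable_in_polynomial_time encode promise correct \<longleftrightarrow>
     (\<exists>(c :: com) (p :: nat poly). \<forall>i. promise i \<longrightarrow>
        (\<exists>t s. exec c (initial_memory (encode i)) t s \<and>
               t \<le> poly p (\<Sum>x\<leftarrow>encode i. bits x) \<and>
               correct i (s ''out'')))"


section \<open>Encoding of networks, orientations and flows\<close>

text \<open>
  Finite descriptions of networks with rational data: vertices and edges are numbered
  consecutively from \<open>0\<close>; an edge is listed as (end, end, capacity, transit time).
\<close>

record rational_network =
  balance_list :: "rat list"
  edge_list :: "(nat \<times> nat \<times> rat \<times> rat) list"
  time_horizon :: rat

definition network_of :: "rational_network \<Rightarrow> (nat, nat) network" where
  "network_of I =
     \<lparr> nodes = {..<length (balance_list I)},
       edges = {..<length (edge_list I)},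
       ends = (\<lambda>e. case edge_list I ! e of (v, w, u, \<tau>) \<Rightarrow> Upair v w),
       capacity = (\<lambda>e. case edge_list I ! e of (v, w, u, \<tau>) \<Rightarrow> of_rat u),
       transit = (\<lambda>e. case edge_list I ! e of (v, w, u, \<tau>) \<Rightarrow> of_rat \<tau>),
       balance = (\<lambda>v. of_rat (balance_list I ! v)),
       horizon = of_rat (time_horizon I) \<rparr>"

definition encode_rat :: "rat \<Rightarrow> int list" where
  "encode_rat r = [fst (quotient_of r), snd (quotient_of r)]"

definition encode_network :: "rational_network \<Rightarrow> int list" where
  "encode_network I =
     [int (length (balance_list I)), int (length (edge_list I))] @
     encode_rat (time_horizon I) @
     concat (map encode_rat (balance_list I)) @
     concat (map (\<lambda>(v, w, u, \<tau>). [int v, int w] @ encode_rat u @ encode_rat \<tau>) (edge_list I))"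

text \<open>
  Layout of an answer for a network with \<open>m\<close> edges: cell \<open>e < m\<close> tells whether edge \<open>e\<close> is
  oriented as listed (\<open>0\<close>) or reversed; cell \<open>m\<close> holds a number \<open>K\<close>; then follow \<open>K\<close> blocks of
  seven cells, each consisting of an edge \<open>e\<close> and three fractions \<open>r\<close>, \<open>s\<close>, \<open>x\<close>.  A block
  contributes rate \<open>x\<close> to the inflow of \<open>e\<close> during \<open>[r, s)\<close>; contributions are added up, so
  that the flow rates are explicitly given step functions.
\<close>

definition output_orientation :: "rational_network \<Rightarrow> (int \<Rightarrow> int) \<Rightarrow> (nat, nat) pre_digraph" where
  "output_orientation I out =
     \<lparr> verts = {..<length (balance_list I)},
       arcs = {..<length (edge_list I)},
       tail = (\<lambda>e. case edge_list I ! e of (v, w, _) \<Rightarrow> if out (int e) = 0 then v else w),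
       head = (\<lambda>e. case edge_list I ! e of (v, w, _) \<Rightarrow> if out (int e) = 0 then w else v) \<rparr>"

definition block_start :: "rational_network \<Rightarrow> nat \<Rightarrow> int" where
  "block_start I k = int (length (edge_list I)) + 1 + 7 * int k"

definition block_count :: "rational_network \<Rightarrow> (int \<Rightarrow> int) \<Rightarrow> nat" where
  "block_count I out = nat (out (int (length (edge_list I))))"

text \<open>
  As unused cells contain \<open>0\<close>, positivity of the denominators forces every block to have
  actually been written.
\<close>

definition wellformed_output :: "rational_network \<Rightarrow> (int \<Rightarrow> int) \<Rightarrow> bool" where
  "wellformed_output I out \<longleftrightarrow>
     0 \<le> out (int (length (edge_list I))) \<and>
     (\<forall>k<block_count I out. let i = block_start I k in
        0 \<le> out i \<and> out i < int (length (edge_list I)) \<and>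
        0 < out (i + 2) \<and> 0 < out (i + 4) \<and> 0 < out (i + 6))"

definition fraction_at :: "(int \<Rightarrow> int) \<Rightarrow> int \<Rightarrow> real" where
  "fraction_at out i = real_of_int (out i) / real_of_int (out (i + 1))"

definition output_flow :: "rational_network \<Rightarrow> (int \<Rightarrow> int) \<Rightarrow> nat \<Rightarrow> real \<Rightarrow> real" where
  "output_flow I out e \<theta> =
     (\<Sum>k<block_count I out. let i = block_start I k in
        if out i = int e \<and> \<theta> \<in> {fraction_at out (i + 1)..<fraction_at out (i + 3)}
        then fraction_at out (i + 5) else 0)"

end

theory Submission
  imports Defs
begin

text \<open>
  Averaging a flow over time of value \<open>B\<close> over \<open>[0, T]\<close> and cancelling opposite directions gives a static
  flow \<open>x\<close> with \<open>\<bar>x e\<bar> \<le> u e * T\<close> that satisfies the balances.  Every unit on an arc is in transit for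
  \<open>\<tau>\<close> time units and in the network for at most \<open>T\<close>, hence \<open>\<Sum>e. \<tau> e * \<bar>x e\<bar> \<le> T * B\<close>.  Orient the edges
  along \<open>x\<close>, decompose \<open>\<bar>x\<bar>\<close> into paths, and send the amount \<open>d P\<close> of a path of length \<open>\<ell> P\<close> at rate
  \<open>d P / (2 * T)\<close> during \<open>[0, 2 * T - \<ell> P)\<close>.  The rates respect the capacities, and the value is at least
  \<open>\<Sum>P. d P * (2 * T - \<ell> P) / (2 * T) \<ge> (2 * T * B - T * B) / (2 * T) = B / 2\<close>.  Paths with \<open>\<ell> P > 2 * T\<close>
  are not used and only improve the bound.

  The argument needs only that \<open>x\<close> maximizes \<open>2 * T\<close> times the value minus \<open>\<Sum>e. \<tau> e * \<bar>x e\<bar>\<close>.  Such an \<open>x\<close> is a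
  circulation of least cost after adding a node that is joined to all terminals; for rational data it is
  found in polynomial time by scaling the capacities and augmenting along paths of least reduced cost.
\<close>

section \<open>Weakest preconditions for the random access machine\<close>

text \<open>A path may lose everything: the fraction \<open>\<ell> P / (2 * T)\<close> of its amount
  is not delivered. Only the sum of the losses is under control, because
  \<open>\<Sum>P. d P * \<ell> P\<close> is at most the transit cost of \<open>x\<close>, hence at
  most \<open>T * B\<close>; over a window of \<open>2 * T\<close> this is a loss of at most
  \<open>B / 2\<close>, which explains the two constants of the theorem. The program is promised a
  flow over time but never sees one, so it cannot average. It uses the averaged flow only as a
  competitor: the maximum of its objective is at least \<open>2 * T * B - T * B = T * B\<close>.
  This number is the constant \<open>C\<close> of \<open>partial_schedule\<close>, and it suffices
  even if the optimal \<open>x\<close> misses some balances. The existence part for real data and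
  the program thus share one scheduling argument. For the running time, steps are counted first and
  bits afterwards: two computed numbers are never multiplied, so one step lengthens numbers by an
  additive amount only, and polynomially many steps have polynomial cost. For \<open>T = 0\<close>
  there is no rate \<open>d P / (2 * T)\<close>; then the promise forces all balances to be
  0.\<close>

text \<open>
  The parameter \<open>q\<close> bounds the number of iterations of every single execution of a loop, which is
  all that is needed for a polynomial time bound.
\<close>

primrec run :: "nat \<Rightarrow> com \<Rightarrow> memory \<Rightarrow> memory \<Rightarrow> bool" where
  "run q Skip = (\<lambda>s r. r = s)"
| "run q (Assign x d e) = (\<lambda>s r. r = s(x := (s x)(eval_exp s d := eval_exp s e)))"
| "run q (Seq c d) = run q c OO run q d"
| "run q (If e c d) = (\<lambda>s. if eval_exp s e \<noteq> 0 then run q c s else run q d s)"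
| "run q (While e c) =
     (\<lambda>s r. (\<exists>j\<le>q. ((\<lambda>s r. eval_exp s e \<noteq> 0 \<and> run q c s r) ^^ j) s r) \<and> eval_exp r e = 0)"

text \<open>Demanding an outcome makes this total correctness: \<open>run\<close> has one only if
  every loop stops within \<open>q\<close> rounds.\<close>

definition wp :: "nat \<Rightarrow> com \<Rightarrow> (memory \<Rightarrow> bool) \<Rightarrow> memory \<Rightarrow> bool" where
  "wp q c Q s \<longleftrightarrow> (\<exists>r. run q c s r \<and> Q r)"

lemma wp_Skip [simp]: "wp q Skip Q s \<longleftrightarrow> Q s"
  and wp_Assign [simp]:
    "wp q (Assign x a e) Q s \<longleftrightarrow> Q (s(x := (s x)(eval_exp s a := eval_exp s e)))"
  and wp_Seq [simp]: "wp q (Seq c d) Q s \<longleftrightarrow> wp q c (wp q d Q) s"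
  and wp_If [simp]:
    "wp q (If e c d) Q s \<longleftrightarrow> (if eval_exp s e \<noteq> 0 then wp q c Q s else wp q d Q s)"
  by (auto simp: wp_def[abs_def])

lemma wp_mono: "wp q c Q s \<Longrightarrow> (\<And>r. Q r \<Longrightarrow> Q' r) \<Longrightarrow> wp q c Q' s"
  by (auto simp: wp_def)

section \<open>Frame conditions and rules for loops\<close>

fun assigned :: "com \<Rightarrow> string set" where
  "assigned Skip = {}"
| "assigned (Assign x d e) = {x}"
| "assigned (Seq c d) = assigned c \<union> assigned d"
| "assigned (If e c d) = assigned c \<union> assigned d"
| "assigned (While e c) = assigned c"

definition agree :: "string set \<Rightarrow> memory \<Rightarrow> memory \<Rightarrow> bool" where
  "agree X s r \<longleftrightarrow> (\<forall>x. x \<notin> X \<longrightarrow> r x = s x)"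

lemma agreeD: "agree X s r \<Longrightarrow> x \<notin> X \<Longrightarrow> r x = s x"
  by (simp add: agree_def)

lemma agree_refl: "agree X s s"
  by (simp add: agree_def)

lemma agree_trans: "agree X s r \<Longrightarrow> agree X r t \<Longrightarrow> agree X s t"
  by (simp add: agree_def)

lemma relpowp_agree:
  assumes "\<And>s r. R s r \<Longrightarrow> agree X s r"
  shows "(R ^^ j) s r \<Longrightarrow> agree X s r"
proof (induction j arbitrary: r)
  case 0
  then show ?case by (simp add: agree_refl)
next
  case (Suc j)
  from Suc.prems obtain r' where "(R ^^ j) s r'" "R r' r" by auto
  then show ?case using Suc.IH assms agree_trans by blast
qed

lemma run_agree: "run q c s r \<Longrightarrow> agree (assigned c) s r"
proof (induction c arbitrary: s r)
  case (While e c)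
  let ?R = "\<lambda>s r. eval_exp s e \<noteq> 0 \<and> run q c s r"
  from While.prems obtain j where j: "(?R ^^ j) s r" by auto
  have "agree (assigned c) s r"
    by (rule relpowp_agree[OF _ j]) (use While.IH in blast)
  then show ?case by simp
next
  case (Seq c d)
  from Seq.prems obtain r' where "run q c s r'" "run q d r' r" by auto
  from \<open>run q c s r'\<close>[THEN Seq.IH(1)] \<open>run q d r' r\<close>[THEN Seq.IH(2)]
  show ?case by (simp add: agree_def)
next
  case (If e c1 c2)
  show ?case
  proof (cases "eval_exp s e = 0")
    case True
    then have "agree (assigned c2) s r" using If.prems If.IH(2) by simp
    then show ?thesis by (simp add: agree_def)
  next
    case False
    then have "agree (assigned c1) s r" using If.prems If.IH(1) by simp
    then show ?thesis by (simp add: agree_def)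
  qed
qed (simp_all add: agree_def)

text \<open>The specifications below mention only what a command computes; that all other arrays are
  unchanged is read off \<open>assigned\<close> and enters through this rule. Sequences of commands
  are verified by chaining it.\<close>

lemma wp_frameI:
  assumes "wp q c Q s" "\<And>r. Q r \<Longrightarrow> agree (assigned c) s r \<Longrightarrow> Q' r"
  shows "wp q c Q' s"
  using assms run_agree unfolding wp_def by blast

text \<open>The initial value of the variant bounds the number of rounds, so
  \<open>\<mu> s \<le> q\<close> is the only place where the iteration bound has to be justified.
  Invariants need not repeat frame information, since \<open>agree\<close> relates every
  intermediate memory to the start \<open>s\<close>.\<close>

lemma wp_While:
  fixes \<mu> :: "memory \<Rightarrow> nat"
  assumes I: "I s" and q: "\<mu> s \<le> q"
    and body: "\<And>r. I r \<Longrightarrow> agree (assigned c) s r \<Longrightarrow> eval_exp r e \<noteq> 0 \<Longrightarrow>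
      wp q c (\<lambda>r'. I r' \<and> \<mu> r' < \<mu> r) r"
    and exit: "\<And>r. I r \<Longrightarrow> agree (assigned c) s r \<Longrightarrow> eval_exp r e = 0 \<Longrightarrow> Q r"
  shows "wp q (While e c) Q s"
proof -
  let ?R = "\<lambda>s r. eval_exp s e \<noteq> 0 \<and> run q c s r"
  have "\<exists>j\<le>\<mu> r. \<exists>t. (?R ^^ j) r t \<and> eval_exp t e = 0 \<and> Q t"
    if "I r" "agree (assigned c) s r" for r
    using that
  proof (induction "\<mu> r" arbitrary: r rule: less_induct)
    case less
    show ?case
    proof (cases "eval_exp r e = 0")
      case True
      then show ?thesis using exit less.prems by (intro exI[of _ 0]) auto
    next
      case False
      obtain r' where r': "run q c r r'" "I r'" "\<mu> r' < \<mu> r"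
        using body[OF less.prems False] by (auto simp: wp_def)
      have "agree (assigned c) s r'"
        using less.prems(2) run_agree[OF r'(1)] by (rule agree_trans)
      from less.hyps[OF r'(3,2) this] obtain j t where
        "j \<le> \<mu> r'" "(?R ^^ j) r' t" "eval_exp t e = 0 \<and> Q t" by auto
      then show ?thesis using False r' relpowp_Suc_I2[of ?R r r' j t]
        by (intro exI[of _ "Suc j"]) auto
    qed
  qed
  from this[OF I agree_refl] q show ?thesis unfolding wp_def by (auto intro: order_trans)
qed

abbreviation V :: "string \<Rightarrow> exp" where
  "V x \<equiv> Read x (Const 0)"

abbreviation Set_var :: "string \<Rightarrow> exp \<Rightarrow> com" where
  "Set_var x \<equiv> Assign x (Const 0)"

definition For :: "string \<Rightarrow> exp \<Rightarrow> com \<Rightarrow> com" where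
  "For i e c = Seq (Set_var i (Const 0))
     (While (Less (V i) e) (Seq c (Set_var i (Add (V i) (Const 1)))))"

lemma assigned_For [simp]: "assigned (For i e c) = insert i (assigned c)"
  by (auto simp: For_def)

text \<open>The guard is evaluated anew in every round, hence the condition that \<open>e\<close>
  keeps the value \<open>N\<close>. The invariant for \<open>j + 1\<close> is required of the memory
  in which the counter has already been increased, and the body has to leave the counter
  alone.\<close>

lemma wp_For:
  assumes N: "0 \<le> N" "N \<le> int q"
    and I0: "I 0 (s(i := (s i)(0 := 0)))"
    and bound: "\<And>j r. I j r \<Longrightarrow> agree (insert i (assigned c)) s r \<Longrightarrow> eval_exp r e = N"
    and body: "\<And>j r. I j r \<Longrightarrow> agree (insert i (assigned c)) s r \<Longrightarrow> 0 \<le> j \<Longrightarrow> j < N \<Longrightarrow> r i 0 = j \<Longrightarrow>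
      wp q c (\<lambda>r'. I (j + 1) (r'(i := (r' i)(0 := j + 1))) \<and> r' i 0 = j) r"
    and exit: "\<And>r. I N r \<Longrightarrow> agree (insert i (assigned c)) s r \<Longrightarrow> Q r"
  shows "wp q (For i e c) Q s"
proof -
  let ?s = "s(i := (s i)(0 := 0))"
  have ag: "agree (insert i (assigned c)) s r"
    if "agree (assigned (Seq c (Set_var i (Add (V i) (Const 1))))) ?s r" for r
    using that by (auto simp: agree_def)
  have "wp q (While (Less (V i) e) (Seq c (Set_var i (Add (V i) (Const 1))))) Q ?s"
  proof (rule wp_While[where I = "\<lambda>r. 0 \<le> r i 0 \<and> r i 0 \<le> N \<and> I (r i 0) r" and \<mu> = "\<lambda>r. nat (N - r i 0)"])
    fix r
    assume r: "0 \<le> r i 0 \<and> r i 0 \<le> N \<and> I (r i 0) r"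
      "agree (assigned (Seq c (Set_var i (Add (V i) (Const 1))))) ?s r"
      "eval_exp r (Less (V i) e) \<noteq> 0"
    with bound[OF _ ag[OF r(2)], of "r i 0"] have "r i 0 < N" by (auto split: if_splits)
    with r body[OF _ ag[OF r(2)], of "r i 0"] have
      "wp q c (\<lambda>r'. I (r i 0 + 1) (r'(i := (r' i)(0 := r i 0 + 1))) \<and> r' i 0 = r i 0) r" by auto
    then show "wp q (Seq c (Set_var i (Add (V i) (Const 1))))
      (\<lambda>r'. (0 \<le> r' i 0 \<and> r' i 0 \<le> N \<and> I (r' i 0) r') \<and> nat (N - r' i 0) < nat (N - r i 0)) r"
      unfolding wp_Seq by (rule wp_mono) (use r \<open>r i 0 < N\<close> in auto)
  next
    fix r
    assume r: "0 \<le> r i 0 \<and> r i 0 \<le> N \<and> I (r i 0) r"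
      "agree (assigned (Seq c (Set_var i (Add (V i) (Const 1))))) ?s r"
      "eval_exp r (Less (V i) e) = 0"
    with bound[OF _ ag[OF r(2)], of "r i 0"] have "r i 0 = N" by (auto split: if_splits)
    with r exit[OF _ ag[OF r(2)]] show "Q r" by auto
  qed (use I0 N in auto)
  then show ?thesis by (simp add: For_def)
qed

section \<open>Polynomial running time\<close>

text \<open>Bounds the number of elementary steps when no loop exceeds \<open>q\<close> rounds. For
  a fixed program it is a polynomial in \<open>q\<close>, of degree at most the nesting depth of its
  loops.\<close>

fun step_bound :: "nat \<Rightarrow> com \<Rightarrow> nat" where
  "step_bound q Skip = 1"
| "step_bound q (Assign x d e) = 1"
| "step_bound q (Seq c d) = 1 + step_bound q c + step_bound q d"
| "step_bound q (If e c d) = 1 + step_bound q c + step_bound q d"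
| "step_bound q (While e c) = 1 + q * (1 + step_bound q c)"

text \<open>
  A product may only be formed with a constant or with a cell of the array \<open>F\<close>, which is never
  written; then each step lengthens the numbers in memory by a bounded amount.
\<close>

fun tame_exp :: "string \<Rightarrow> exp \<Rightarrow> bool" where
  "tame_exp F (Const c) = True"
| "tame_exp F (Read x e) = tame_exp F e"
| "tame_exp F (Add d e) = (tame_exp F d \<and> tame_exp F e)"
| "tame_exp F (Sub d e) = (tame_exp F d \<and> tame_exp F e)"
| "tame_exp F (Mul d e) =
     (tame_exp F d \<and> tame_exp F e \<and> (case e of Const c \<Rightarrow> True | Read x e' \<Rightarrow> x = F | _ \<Rightarrow> False))"
| "tame_exp F (Quot d e) = (tame_exp F d \<and> tame_exp F e)"
| "tame_exp F (Less d e) = (tame_exp F d \<and> tame_exp F e)"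

fun tame :: "string \<Rightarrow> com \<Rightarrow> bool" where
  "tame F Skip = True"
| "tame F (Assign x d e) = (x \<noteq> F \<and> tame_exp F d \<and> tame_exp F e)"
| "tame F (Seq c d) = (tame F c \<and> tame F d)"
| "tame F (If e c d) = (tame_exp F e \<and> tame F c \<and> tame F d)"
| "tame F (While e c) = (tame_exp F e \<and> tame F c)"

text \<open>The number of bits by which the value of an expression can outgrow the memory. It adds
  up over subexpressions; in the clause for \<open>Mul\<close>, \<open>W\<close> pays for a right
  factor read from the input, while a constant factor is paid for by its own growth.\<close>

fun growth :: "nat \<Rightarrow> exp \<Rightarrow> nat" where
  "growth W (Const c) = bits c"
| "growth W (Read x e) = growth W e"
| "growth W (Add d e) = 1 + growth W d + growth W e"
| "growth W (Sub d e) = 1 + growth W d + growth W e"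
| "growth W (Mul d e) = W + growth W d + growth W e"
| "growth W (Quot d e) = growth W d + growth W e"
| "growth W (Less d e) = 1 + growth W d + growth W e"

fun exp_size :: "exp \<Rightarrow> nat" where
  "exp_size (Const c) = 1"
| "exp_size (Read x e) = 1 + exp_size e"
| "exp_size (Add d e) = 1 + exp_size d + exp_size e"
| "exp_size (Sub d e) = 1 + exp_size d + exp_size e"
| "exp_size (Mul d e) = 1 + exp_size d + exp_size e"
| "exp_size (Quot d e) = 1 + exp_size d + exp_size e"
| "exp_size (Less d e) = 1 + exp_size d + exp_size e"

fun max_growth :: "nat \<Rightarrow> com \<Rightarrow> nat" where
  "max_growth W Skip = 0"
| "max_growth W (Assign x d e) = growth W d + growth W e"
| "max_growth W (Seq c d) = max_growth W c + max_growth W d"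
| "max_growth W (If e c d) = growth W e + max_growth W c + max_growth W d"
| "max_growth W (While e c) = growth W e + max_growth W c"

fun max_size :: "com \<Rightarrow> nat" where
  "max_size Skip = 0"
| "max_size (Assign x d e) = exp_size d + exp_size e"
| "max_size (Seq c d) = max_size c + max_size d"
| "max_size (If e c d) = exp_size e + max_size c + max_size d"
| "max_size (While e c) = exp_size e + max_size c"

section \<open>Bit lengths of values and the cost of a run\<close>

definition bounded_memory :: "nat \<Rightarrow> memory \<Rightarrow> bool" where
  "bounded_memory B s \<longleftrightarrow> (\<forall>x i. \<bar>s x i\<bar> < 2 ^ B)"

lemma abs_less_bits: "\<bar>i\<bar> < 2 ^ bits i"
proof (cases "i = 0")
  case False
  then have "\<bar>i\<bar> < 2 ^ nat (bitlen \<bar>i\<bar>)" using bitlen_bounds[of "\<bar>i\<bar>"] by simp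
  also have "\<dots> \<le> 2 ^ bits i" by (simp add: bits_def)
  finally show ?thesis .
qed (simp add: bits_def)

lemma bits_le: "\<bar>i\<bar> < 2 ^ B \<Longrightarrow> bits i \<le> Suc B"
proof -
  assume "\<bar>i\<bar> < 2 ^ B"
  then have "bitlen \<bar>i\<bar> \<le> int B" unfolding bitlen_le_iff_power by simp
  then show ?thesis by (simp add: bits_def)
qed

text \<open>\<open>div\<close> rounds down, which can enlarge the modulus only of a negative
  quotient; but the exact quotient is at least \<open>- \<bar>a\<bar>\<close> when
  \<open>\<bar>b\<bar> \<ge> 1\<close>, and this is an integer, so rounding down does not pass it.
  For \<open>b = 0\<close> the result is 0.\<close>

lemma abs_div_le: "\<bar>a div b\<bar> \<le> \<bar>a :: int\<bar>"
proof (cases "b = 0")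
  case False
  then have "1 \<le> \<bar>b\<bar>" by simp
  have "\<bar>a\<bar> \<ge> \<bar>a div b\<bar>"
  proof (cases "a \<ge> 0")
    case True
    show ?thesis
    proof (cases "b > 0")
      case True
      have "a div b * 1 \<le> a div b * b" 
        by (intro mult_left_mono) (use True \<open>a \<ge> 0\<close> in \<open>auto simp: pos_imp_zdiv_nonneg_iff\<close>)
      also have "\<dots> \<le> a" using True by (simp add: div_mult_mod_eq minus_mod_eq_div_mult[symmetric])
      finally show ?thesis using True \<open>a \<ge> 0\<close> by (simp add: pos_imp_zdiv_nonneg_iff)
    next
      case f: False
      then have b: "b < 0" using False by simp
      have "a div b \<le> 0" using b True by (simp add: div_nonneg_neg_le0)
      moreover have "- a \<le> a div b"
      proof -
        have "(- a) * b \<ge> a" using b True mult_left_mono[of 1 "-b" a] by simp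
        then have "a div b \<ge> ((-a)*b) div b" using b by (intro zdiv_mono1_neg) auto
        moreover have "((-a)*b) div b = -a" by (rule nonzero_mult_div_cancel_right) (use b in simp)
        ultimately show ?thesis by linarith
      qed
      ultimately show ?thesis using True by simp
    qed
  next
    case an: False
    show ?thesis
    proof (cases "b > 0")
      case True
      have "a div b \<le> 0" using True an by (simp add: div_neg_pos_less0 less_imp_le)
      moreover have "a \<le> a div b"
      proof -
        have "a * b \<le> a" using an True mult_left_mono_neg[of 1 b a] by simp
        then have "(a * b) div b \<le> a div b" using True by (intro zdiv_mono1) auto
        then show ?thesis using True by simp
      qed
      ultimately show ?thesis using an by simp
    next
      case f: False
      then have b: "b < 0" using False by simp
      have "0 \<le> a div b" using b an by (simp add: neg_imp_zdiv_nonneg_iff)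
      moreover have "a div b \<le> - a"
      proof -
        have "(-a) * b \<le> a" using b an mult_left_mono[of 1 "-b" "-a"] by simp
        then have "a div b \<le> ((-a)*b) div b" using b by (intro zdiv_mono1_neg) auto
        moreover have "((-a)*b) div b = -a" by (rule nonzero_mult_div_cancel_right) (use b in simp)
        ultimately show ?thesis by linarith
      qed
      ultimately show ?thesis using an by simp
    qed
  qed
  then show ?thesis .
qed simp

lemma pow2_le: "a \<le> b \<Longrightarrow> (2::int) ^ a \<le> 2 ^ b"
  by simp

lemma eval_exp_bound:
  assumes s: "bounded_memory B s" and F: "\<forall>i. \<bar>s F i\<bar> < 2 ^ W" and "tame_exp F e"
  shows "\<bar>eval_exp s e\<bar> < 2 ^ (B + growth W e)"
  using assms(3)
proof (induction e)
  case (Const c)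
  then show ?case using abs_less_bits[of c] order.strict_trans2[OF _ pow2_le] by auto
next
  case (Read x e)
  have "\<bar>s x (eval_exp s e)\<bar> < 2 ^ B" using s by (auto simp: bounded_memory_def)
  also have "\<dots> \<le> 2 ^ (B + growth W (Read x e))" by (rule pow2_le) simp
  finally show ?case by simp
next
  case (Add d e)
  have "\<bar>eval_exp s d\<bar> < 2 ^ (B + growth W d + growth W e)" "\<bar>eval_exp s e\<bar> < 2 ^ (B + growth W d + growth W e)"
    using Add by (auto intro: order.strict_trans2[OF _ pow2_le])
  then show ?case by (simp add: algebra_simps power_add)
next
  case (Sub d e)
  have "\<bar>eval_exp s d\<bar> < 2 ^ (B + growth W d + growth W e)" "\<bar>eval_exp s e\<bar> < 2 ^ (B + growth W d + growth W e)"
    using Sub by (auto intro: order.strict_trans2[OF _ pow2_le])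
  then show ?case by (simp add: algebra_simps power_add)
next
  case (Mul d e)
  have d: "\<bar>eval_exp s d\<bar> < 2 ^ (B + growth W d)" using Mul by simp
  have e: "\<bar>eval_exp s e\<bar> < 2 ^ (W + growth W e)"
  proof (cases e)
    case (Const c)
    then show ?thesis using abs_less_bits[of c] order.strict_trans2[OF _ pow2_le] by auto
  next
    case (Read x e')
    then have "\<bar>eval_exp s e\<bar> < 2 ^ W" using F Mul.prems by auto
    also have "\<dots> \<le> 2 ^ (W + growth W e)" by (rule pow2_le) simp
    finally show ?thesis .
  qed (use Mul.prems in auto)
  have "\<bar>eval_exp s d\<bar> * \<bar>eval_exp s e\<bar> < 2 ^ (B + growth W d) * 2 ^ (W + growth W e)"
    by (rule mult_strict_mono) (use d e in auto)
  then show ?case by (simp add: abs_mult power_add[symmetric] algebra_simps)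
next
  case (Quot d e)
  have "\<bar>eval_exp s (Quot d e)\<bar> \<le> \<bar>eval_exp s d\<bar>" by (simp add: abs_div_le)
  also have "\<dots> < 2 ^ (B + growth W d)" using Quot by simp
  also have "\<dots> \<le> 2 ^ (B + growth W (Quot d e))" by (rule pow2_le) simp
  finally show ?case .
next
  case (Less d e)
  have "\<bar>eval_exp s (Less d e)\<bar> < 2 ^ 1" by simp
  also have "\<dots> \<le> 2 ^ (B + growth W (Less d e))" by (rule pow2_le) simp
  finally show ?case .
qed

lemma exp_cost_bound:
  assumes s: "bounded_memory B s" and F: "\<forall>i. \<bar>s F i\<bar> < 2 ^ W" and "tame_exp F e"
    and "B + growth W e \<le> C"
  shows "exp_cost s e \<le> exp_size e * (C + 1)"
proof -
  have b: "bits (eval_exp s e) \<le> Suc C" if "tame_exp F e" "B + growth W e \<le> C" for e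
    using bits_le[OF eval_exp_bound[OF s F that(1)]] that(2) by simp
  show ?thesis using assms(3,4)
  proof (induction e)
    case (Const c) then show ?case using b[of "Const c"] by simp
  next
    case (Read x e) then show ?case using b[of "Read x e"] by simp
  next
    case (Add d e) then show ?case using b[of "Add d e"] by (simp add: algebra_simps)
  next
    case (Sub d e) then show ?case using b[of "Sub d e"] by (simp add: algebra_simps)
  next
    case (Mul d e) then show ?case using b[of "Mul d e"] by (simp add: algebra_simps)
  next
    case (Quot d e) then show ?case using b[of "Quot d e"] by (simp add: algebra_simps)
  next
    case (Less d e) then show ?case using b[of "Less d e"] by (simp add: algebra_simps)
  qed
qed

lemma bounded_memory_mono: "bounded_memory B s \<Longrightarrow> B \<le> B' \<Longrightarrow> bounded_memory B' s"
  unfolding bounded_memory_def by (meson order.strict_trans2 pow2_le)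

text \<open>Bit lengths grow additively: an elementary step lengthens the numbers in memory by at
  most \<open>g\<close> bits, so they never exceed \<open>B + g * step_bound q c\<close> bits, and
  intermediate values have at most \<open>g\<close> more, which \<open>C\<close> covers. A step then
  costs at most \<open>(z + 1) * (C + 1)\<close>. The array \<open>F\<close> keeps its length
  \<open>W\<close>, as \<open>tame\<close> forbids writing it.\<close>

lemma run_exec:
  assumes "run q c s r" "tame F c" "max_growth W c \<le> g" "max_size c \<le> z"
    and "bounded_memory B s" "\<forall>i. \<bar>s F i\<bar> < 2 ^ W" "B + g * step_bound q c + g \<le> C"
  shows "\<exists>t. exec c s t r \<and> t \<le> step_bound q c * (z + 1) * (C + 1) \<and>
    bounded_memory (B + g * step_bound q c) r \<and> (\<forall>i. \<bar>r F i\<bar> < 2 ^ W)"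
  using assms
proof (induction c arbitrary: s r B)
  case Skip
  then have "exec Skip s 1 r" using exec_Skip by simp
  then show ?case using Skip by (intro exI[of _ 1]) (auto intro: bounded_memory_mono)
next
  case (Assign x d e)
  let ?t = "1 + exp_cost s d + exp_cost s e"
  have r: "r = s(x := (s x)(eval_exp s d := eval_exp s e))" using Assign.prems by simp
  have *: "B + growth W d \<le> C" "B + growth W e \<le> C" using Assign.prems by auto
  have "exp_cost s d \<le> exp_size d * (C + 1)" "exp_cost s e \<le> exp_size e * (C + 1)"
    using Assign.prems * exp_cost_bound[of B s F W] by auto
  then have "?t \<le> 1 + (exp_size d + exp_size e) * (C + 1)" by (simp add: algebra_simps)
  also have "\<dots> \<le> 1 + z * (C + 1)" using Assign.prems(4) by (intro add_left_mono mult_right_mono) auto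
  also have "\<dots> \<le> step_bound q (Assign x d e) * (z + 1) * (C + 1)" by simp
  finally have t: "?t \<le> step_bound q (Assign x d e) * (z + 1) * (C + 1)" .
  have v: "\<bar>eval_exp s e\<bar> < 2 ^ (B + g)"
    using eval_exp_bound[of B s F W e] Assign.prems by (auto intro: order.strict_trans2[OF _ pow2_le])
  have b: "bounded_memory (B + g) s" using Assign.prems bounded_memory_mono by auto
  have "bounded_memory (B + g * step_bound q (Assign x d e)) r" using v b r by (auto simp: bounded_memory_def)
  moreover have "\<forall>i. \<bar>r F i\<bar> < 2 ^ W" using Assign.prems r by auto
  moreover have "exec (Assign x d e) s ?t r" unfolding r by (rule exec_Assign)
  ultimately show ?case using t by blast
next
  case (Seq c d)
  define A where "A = (z + 1) * (C + 1)"
  let ?k = "step_bound q c" and ?l = "step_bound q d"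
  from Seq.prems(1) obtain r' where r': "run q c s r'" "run q d r' r" by auto
  have C: "B + g * ?k + g \<le> C" "B + g * ?k + g * ?l + g \<le> C"
    using Seq.prems(7) by (auto simp: algebra_simps)
  have "\<exists>t. exec c s t r' \<and> t \<le> ?k * A \<and>
    bounded_memory (B + g * ?k) r' \<and> (\<forall>i. \<bar>r' F i\<bar> < 2 ^ W)"
    unfolding A_def mult.assoc[symmetric]
    by (rule Seq.IH(1)[OF r'(1) _ _ _ Seq.prems(5,6) C(1)]) (use Seq.prems in auto)
  then obtain t where t: "exec c s t r'" "t \<le> ?k * A"
    "bounded_memory (B + g * ?k) r'" "\<forall>i. \<bar>r' F i\<bar> < 2 ^ W" by blast
  have "\<exists>u. exec d r' u r \<and> u \<le> ?l * A \<and>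
    bounded_memory (B + g * ?k + g * ?l) r \<and> (\<forall>i. \<bar>r F i\<bar> < 2 ^ W)"
    unfolding A_def mult.assoc[symmetric]
    by (rule Seq.IH(2)[OF r'(2) _ _ _ t(3,4) C(2)]) (use Seq.prems in auto)
  then obtain u where u: "exec d r' u r" "u \<le> ?l * A"
    "bounded_memory (B + g * ?k + g * ?l) r" "\<forall>i. \<bar>r F i\<bar> < 2 ^ W" by blast
  have "exec (Seq c d) s (1 + t + u) r" using t(1) u(1) by (rule exec_Seq)
  moreover have "1 \<le> A" by (simp add: A_def)
  then have "1 + t + u \<le> step_bound q (Seq c d) * A"
    using t(2) u(2) by (simp add: distrib_right)
  moreover have "bounded_memory (B + g * step_bound q (Seq c d)) r"
    by (rule bounded_memory_mono[OF u(3)]) (simp add: algebra_simps)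
  ultimately show ?case using u(4) unfolding mult.assoc A_def by blast
next
  case (If e c d)
  define A where "A = (z + 1) * (C + 1)"
  let ?k = "step_bound q c" and ?l = "step_bound q d"
  have C: "B + g * ?k + g \<le> C" "B + g * ?l + g \<le> C"
    using If.prems(7) by (auto simp: algebra_simps)
  have "exp_cost s e \<le> exp_size e * (C + 1)"
    using If.prems C exp_cost_bound[of B s F W e C] by simp
  also have "\<dots> \<le> z * (C + 1)" using If.prems by (intro mult_right_mono) auto
  finally have ce: "1 + exp_cost s e \<le> A" by (simp add: A_def)
  show ?case
  proof (cases "eval_exp s e = 0")
    case False
    have "\<exists>t. exec c s t r \<and> t \<le> ?k * A \<and>
      bounded_memory (B + g * ?k) r \<and> (\<forall>i. \<bar>r F i\<bar> < 2 ^ W)"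
      unfolding A_def mult.assoc[symmetric]
      by (rule If.IH(1)[OF _ _ _ _ If.prems(5,6) C(1)]) (use If.prems False in auto)
    then obtain t where t: "exec c s t r" "t \<le> ?k * A"
      "bounded_memory (B + g * ?k) r" "\<forall>i. \<bar>r F i\<bar> < 2 ^ W" by blast
    have "exec (If e c d) s (1 + exp_cost s e + t) r" using False t(1) by (rule exec_If_true)
    moreover have "1 + exp_cost s e + t \<le> step_bound q (If e c d) * A"
      using t(2) ce by (simp add: distrib_right)
    moreover have "bounded_memory (B + g * step_bound q (If e c d)) r"
      by (rule bounded_memory_mono[OF t(3)]) (simp add: algebra_simps)
    ultimately show ?thesis using t(4) unfolding mult.assoc A_def by blast
  next
    case True
    have "\<exists>t. exec d s t r \<and> t \<le> ?l * A \<and>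
      bounded_memory (B + g * ?l) r \<and> (\<forall>i. \<bar>r F i\<bar> < 2 ^ W)"
      unfolding A_def mult.assoc[symmetric]
      by (rule If.IH(2)[OF _ _ _ _ If.prems(5,6) C(2)]) (use If.prems True in auto)
    then obtain t where t: "exec d s t r" "t \<le> ?l * A"
      "bounded_memory (B + g * ?l) r" "\<forall>i. \<bar>r F i\<bar> < 2 ^ W" by blast
    have "exec (If e c d) s (1 + exp_cost s e + t) r" using True t(1) by (rule exec_If_false)
    moreover have "1 + exp_cost s e + t \<le> step_bound q (If e c d) * A"
      using t(2) ce by (simp add: distrib_right)
    moreover have "bounded_memory (B + g * step_bound q (If e c d)) r"
      by (rule bounded_memory_mono[OF t(3)]) (simp add: algebra_simps)
    ultimately show ?thesis using t(4) unfolding mult.assoc A_def by blast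
  qed
next
  case (While e c)
  define k where "k = 1 + step_bound q c"
  define A where "A = (z + 1) * (C + 1)"
  let ?R = "\<lambda>s r. eval_exp s e \<noteq> 0 \<and> run q c s r"
  from While.prems(1) obtain j where j: "j \<le> q" "(?R ^^ j) s r" and r: "eval_exp r e = 0" by auto
  have cost: "1 + exp_cost s e \<le> A" if "bounded_memory B s" "\<forall>i. \<bar>s F i\<bar> < 2 ^ W" "B + g \<le> C" for s B
  proof -
    have "exp_cost s e \<le> exp_size e * (C + 1)"
      using While.prems exp_cost_bound[OF that(1,2), of e C] that by simp
    also have "\<dots> \<le> z * (C + 1)" using While.prems by (intro mult_right_mono) auto
    finally show ?thesis by (simp add: A_def)
  qed
  \<comment> \<open>Induction over the rounds with \<open>B\<close> generalized, as every round may
    start from numbers that are \<open>g * k\<close> bits longer than those of the round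
    before.\<close>
  have *: "\<exists>t. exec (While e c) s t r \<and> t \<le> (1 + j * k) * A \<and>
      bounded_memory (B + g * (1 + j * k)) r \<and> (\<forall>i. \<bar>r F i\<bar> < 2 ^ W)"
    if "(?R ^^ j) s r" "bounded_memory B s" "\<forall>i. \<bar>s F i\<bar> < 2 ^ W" "B + g * (1 + j * k) + g \<le> C" for s B j
    using that
  proof (induction j arbitrary: s B)
    case 0
    then have "s = r" by simp
    have "exec (While e c) r (1 + exp_cost r e) r" using r by (rule exec_While_false)
    moreover have "1 + exp_cost r e \<le> A" using cost[of B r] 0 by simp
    moreover have "bounded_memory (B + g) r" using 0 bounded_memory_mono[of B r "B + g"] by simp
    ultimately show ?case using 0(3) \<open>s = r\<close> by auto
  next
    case (Suc j)
    have jk: "B + g * (1 + Suc j * k) = B + g * k + g * (1 + j * k)" by (simp add: algebra_simps)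
    have gk: "g * k = g * step_bound q c + g" by (simp add: k_def)
    from relpowp_Suc_D2[OF Suc.prems(1)] obtain r' where
      r': "eval_exp s e \<noteq> 0" "run q c s r'" "(?R ^^ j) r' r" by auto
    have "B + g * step_bound q c + g \<le> C" using Suc.prems(4) jk gk by linarith
    have "\<exists>t. exec c s t r' \<and> t \<le> step_bound q c * A \<and>
      bounded_memory (B + g * step_bound q c) r' \<and> (\<forall>i. \<bar>r' F i\<bar> < 2 ^ W)"
      unfolding A_def mult.assoc[symmetric]
      by (rule While.IH[OF r'(2) _ _ _ Suc.prems(2,3)])
        (use While.prems(2-4) \<open>B + g * step_bound q c + g \<le> C\<close> in auto)
    then obtain t where t: "exec c s t r'"
      "t \<le> step_bound q c * A" "bounded_memory (B + g * step_bound q c) r'" "\<forall>i. \<bar>r' F i\<bar> < 2 ^ W"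
      by blast
    have "bounded_memory (B + g * k) r'" by (rule bounded_memory_mono[OF t(3)]) (simp add: gk)
    from Suc.IH[OF r'(3) this t(4)] Suc.prems(4) jk obtain u where u: "exec (While e c) r' u r"
      "u \<le> (1 + j * k) * A" "bounded_memory (B + g * k + g * (1 + j * k)) r"
      "\<forall>i. \<bar>r F i\<bar> < 2 ^ W" by auto
    have "exec (While e c) s (1 + exp_cost s e + t + u) r" using r'(1) t(1) u(1) by (rule exec_While_true)
    moreover have "1 + exp_cost s e + t + u \<le> (1 + Suc j * k) * A"
    proof -
      have "1 + exp_cost s e \<le> A" using cost[OF Suc.prems(2,3)] Suc.prems(4) by simp
      moreover have "(1 + Suc j * k) * A = A + step_bound q c * A + (1 + j * k) * A"
        by (simp add: k_def algebra_simps)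
      ultimately show ?thesis using t(2) u(2) by linarith
    qed
    ultimately show ?case using u(3,4) jk by metis
  qed
  have jq: "1 + j * k \<le> step_bound q (While e c)" using j(1) mult_right_mono[OF j(1), of k] by (simp add: k_def)
  have "B + g * (1 + j * k) + g \<le> C"
    using While.prems(7) mult_left_mono[OF jq, of g] by linarith
  from *[OF j(2) While.prems(5,6) this] obtain t where t: "exec (While e c) s t r"
    "t \<le> (1 + j * k) * A" "bounded_memory (B + g * (1 + j * k)) r" "\<forall>i. \<bar>r F i\<bar> < 2 ^ W" by auto
  have "t \<le> step_bound q (While e c) * A" using t(2) mult_right_mono[OF jq, of A] by linarith
  moreover have "bounded_memory (B + g * step_bound q (While e c)) r"
    by (rule bounded_memory_mono[OF t(3)]) (use mult_left_mono[OF jq, of g] in linarith)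
  ultimately show ?case using t(1,4) unfolding mult.assoc A_def by blast
qed

definition poly_fun :: "(nat \<Rightarrow> nat) \<Rightarrow> bool" where
  "poly_fun f \<longleftrightarrow> (\<exists>p. \<forall>x. f x = poly p x)"

lemma poly_fun_const: "poly_fun (\<lambda>x. c)"
  unfolding poly_fun_def by (intro exI[of _ "[:c:]"]) simp

lemma poly_fun_id: "poly_fun (\<lambda>x. x)"
  unfolding poly_fun_def by (intro exI[of _ "[:0, 1:]"]) simp

lemma poly_fun_add: "poly_fun f \<Longrightarrow> poly_fun g \<Longrightarrow> poly_fun (\<lambda>x. f x + g x)"
  unfolding poly_fun_def by (metis poly_add)

lemma poly_fun_mult: "poly_fun f \<Longrightarrow> poly_fun g \<Longrightarrow> poly_fun (\<lambda>x. f x * g x)"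
  unfolding poly_fun_def by (metis poly_mult)

lemmas poly_funs = poly_fun_const poly_fun_id poly_fun_add poly_fun_mult

lemma poly_fun_step_bound: "poly_fun f \<Longrightarrow> poly_fun (\<lambda>x. step_bound (f x) c)"
  by (induction c) (auto intro!: poly_funs simp del: One_nat_def)

lemma poly_fun_growth: "poly_fun (\<lambda>x. growth x e)"
  by (induction e) (auto intro!: poly_funs simp del: One_nat_def)

lemma poly_fun_max_growth: "poly_fun (\<lambda>x. max_growth x c)"
  by (induction c) (auto intro!: poly_funs poly_fun_growth simp del: One_nat_def)

text \<open>The input length \<open>L\<close> has three roles: it is the bit bound \<open>B\<close>
  of the initial memory, the bit bound \<open>W\<close> of the input array, and the argument of the
  iteration bound \<open>q\<close>. The program is fixed, so the resulting cost bound is a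
  polynomial in \<open>L\<close> alone.\<close>

lemma polynomial_time:
  assumes "tame ''in'' c" "poly_fun q"
    and wp: "\<And>i. promise i \<Longrightarrow>
      wp (q (\<Sum>x\<leftarrow>encode i. bits x)) c (\<lambda>s. correct i (s ''out'')) (initial_memory (encode i))"
  shows "computable_in_polynomial_time encode promise correct"
proof -
  define C where "C L = L + max_growth L c * step_bound (q L) c + max_growth L c" for L
  have "poly_fun (\<lambda>L. step_bound (q L) c * (max_size c + 1) * (C L + 1))"
    unfolding C_def using assms(2)
    by (intro poly_funs poly_fun_step_bound poly_fun_max_growth)
  then obtain p where p: "\<And>L. step_bound (q L) c * (max_size c + 1) * (C L + 1) = poly p L"
    by (auto simp: poly_fun_def)
  have "\<exists>t s. exec c (initial_memory (encode i)) t s \<and>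
      t \<le> poly p (\<Sum>x\<leftarrow>encode i. bits x) \<and> correct i (s ''out'')" if i: "promise i" for i
  proof -
    define L where "L = (\<Sum>x\<leftarrow>encode i. bits x)"
    have m: "\<bar>initial_memory (encode i) x j\<bar> < 2 ^ L" for x j
    proof -
      have "\<bar>y\<bar> < 2 ^ L" if "y \<in> set (encode i)" for y
      proof -
        have "bits y \<le> L" unfolding L_def using that by (intro member_le_sum_list) auto
        then show ?thesis using abs_less_bits[of y] pow2_le[of "bits y" L] by linarith
      qed
      then show ?thesis unfolding initial_memory_def by (auto simp: nat_less_iff)
    qed
    obtain r where r: "run (q L) c (initial_memory (encode i)) r" "correct i (r ''out'')"
      using wp[OF i] by (auto simp: wp_def L_def)
    from run_exec[OF r(1) assms(1) order_refl order_refl, of L L "C L"] m p[of L] r(2)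
    show ?thesis unfolding L_def[symmetric] by (auto simp: bounded_memory_def C_def)
  qed
  then show ?thesis unfolding computable_in_polynomial_time_def by blast
qed

section \<open>Minimum cost circulations\<close>

text \<open>
  Arcs are the integers in \<open>{0..<M}\<close>.  Conservation is expressed by testing against all potentials,
  which is equivalent to flow conservation at every node.
\<close>

definition circulation :: "int \<Rightarrow> (int \<Rightarrow> int) \<Rightarrow> (int \<Rightarrow> int) \<Rightarrow> (int \<Rightarrow> int) \<Rightarrow> bool" where
  "circulation M t h x \<longleftrightarrow> (\<forall>\<pi> :: int \<Rightarrow> int. (\<Sum>a\<in>{0..<M}. x a * (\<pi> (h a) - \<pi> (t a))) = 0)"

text \<open>Complementary slackness with \<open>\<pi>\<close> as dual solution:
  \<open>c a + \<pi> (t a) - \<pi> (h a)\<close> is the reduced cost, and no residual arc has a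
  negative one if backward arcs are counted with the opposite sign.\<close>

definition optimal ::
  "int \<Rightarrow> (int \<Rightarrow> int) \<Rightarrow> (int \<Rightarrow> int) \<Rightarrow> (int \<Rightarrow> int) \<Rightarrow> (int \<Rightarrow> int) \<Rightarrow> (int \<Rightarrow> int) \<Rightarrow> (int \<Rightarrow> int) \<Rightarrow> bool" where
  "optimal M t h c k x \<pi> \<longleftrightarrow> (\<forall>a\<in>{0..<M}. 0 \<le> x a \<and> x a \<le> k a \<and>
     (x a < k a \<longrightarrow> 0 \<le> c a + \<pi> (t a) - \<pi> (h a)) \<and> (0 < x a \<longrightarrow> c a + \<pi> (t a) - \<pi> (h a) \<le> 0))"

text \<open>Potentials cancel on circulations, so costs may be replaced by reduced costs; then
  complementary slackness makes every single term of the difference nonnegative. The competitor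
  \<open>y\<close> is real because an averaged flow need not be integral.\<close>

lemma optimal_cost_le:
  fixes y :: "int \<Rightarrow> real"
  assumes opt: "optimal M t h c k x \<pi>" and circ: "circulation M t h x"
    and y: "\<And>a. a \<in> {0..<M} \<Longrightarrow> 0 \<le> y a \<and> y a \<le> k a"
    and ycirc: "\<And>\<pi> :: int \<Rightarrow> real. (\<Sum>a\<in>{0..<M}. y a * (\<pi> (h a) - \<pi> (t a))) = 0"
  shows "real_of_int (\<Sum>a\<in>{0..<M}. c a * x a) \<le> (\<Sum>a\<in>{0..<M}. c a * y a)"
proof -
  let ?r = "\<lambda>a. real_of_int (c a + \<pi> (t a) - \<pi> (h a))"
  have "0 \<le> (\<Sum>a\<in>{0..<M}. ?r a * (y a - x a))"
  proof (rule sum_nonneg)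
    fix a assume a: "a \<in> {0..<M}"
    have o: "0 \<le> x a \<and> x a \<le> k a \<and>
      (x a < k a \<longrightarrow> 0 \<le> c a + \<pi> (t a) - \<pi> (h a)) \<and> (0 < x a \<longrightarrow> c a + \<pi> (t a) - \<pi> (h a) \<le> 0)"
      using opt a unfolding optimal_def by blast
    show "0 \<le> ?r a * (y a - x a)"
    proof (cases "y a \<ge> x a")
      case True
      show ?thesis
      proof (cases "x a < k a")
        case True
        then have "0 \<le> ?r a" using o by (metis of_int_0_le_iff)
        then show ?thesis using \<open>y a \<ge> x a\<close> by simp
      next
        case False
        then have "y a = x a" using o y[OF a] True by auto
        then show ?thesis by simp
      qed
    next
      case False
      then have "0 < x a" using y[OF a] by auto
      then have "?r a \<le> 0" using o by (metis of_int_le_0_iff)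
      then show ?thesis using False by (intro mult_nonpos_nonpos) auto
    qed
  qed
  also have "\<dots> = (\<Sum>a\<in>{0..<M}. c a * y a) - real_of_int (\<Sum>a\<in>{0..<M}. c a * x a)
      - (\<Sum>a\<in>{0..<M}. y a * (real_of_int (\<pi> (h a)) - real_of_int (\<pi> (t a))))
      + real_of_int (\<Sum>a\<in>{0..<M}. x a * (\<pi> (h a) - \<pi> (t a)))"
    by (simp add: sum_subtractf[symmetric] sum.distrib[symmetric] of_int_sum algebra_simps)
  also have "\<dots> = (\<Sum>a\<in>{0..<M}. c a * y a) - real_of_int (\<Sum>a\<in>{0..<M}. c a * x a)"
    using ycirc[of "\<lambda>i. real_of_int (\<pi> i)"] circ by (simp add: circulation_def)
  finally show ?thesis by simp
qed

lemma optimal_double: "optimal M t h c k x \<pi> \<Longrightarrow> optimal M t h c (\<lambda>a. 2 * k a) (\<lambda>a. 2 * x a) \<pi>"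
  by (auto simp: optimal_def)

lemma circulation_double: "circulation M t h x \<Longrightarrow> circulation M t h (\<lambda>a. 2 * x a)"
  by (simp add: circulation_def mult.assoc sum_distrib_left[symmetric])

text \<open>
  \<open>pred_path w p i js\<close>: following predecessors \<open>p\<close> leads from \<open>i\<close> back to \<open>w\<close> through the
  list \<open>js\<close> of distinct nodes, which contains \<open>i\<close> but not \<open>w\<close>.
\<close>

fun pred_path :: "int \<Rightarrow> (int \<Rightarrow> int) \<Rightarrow> int \<Rightarrow> int list \<Rightarrow> bool" where
  "pred_path w p i [] \<longleftrightarrow> i = w"
| "pred_path w p i (j # js) \<longleftrightarrow> i = j \<and> j \<noteq> w \<and> j \<notin> set js \<and> pred_path w p (p j) js"

text \<open>
  Node \<open>j\<close> is entered from node \<open>p j\<close> through the residual arc \<open>b j\<close>, forwards if \<open>d j = 1\<close> and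
  backwards if \<open>d j = -1\<close>.
\<close>

definition entered ::
  "int \<Rightarrow> (int \<Rightarrow> int) \<Rightarrow> (int \<Rightarrow> int) \<Rightarrow> (int \<Rightarrow> int) \<Rightarrow> (int \<Rightarrow> int) \<Rightarrow>
    (int \<Rightarrow> int) \<Rightarrow> (int \<Rightarrow> int) \<Rightarrow> (int \<Rightarrow> int) \<Rightarrow> int \<Rightarrow> bool" where
  "entered M t h k x p b d j \<longleftrightarrow> b j \<in> {0..<M} \<and>
     (d j = 1 \<and> t (b j) = p j \<and> h (b j) = j \<and> x (b j) < k (b j) \<or>
      d j = - 1 \<and> h (b j) = p j \<and> t (b j) = j \<and> 0 < x (b j))"

lemma pred_path_distinct: "pred_path w p i js \<Longrightarrow> distinct js \<and> w \<notin> set js"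
  by (induction js arbitrary: i) auto

lemma pred_path_head_in: "pred_path w p i js \<Longrightarrow> i = w \<or> i \<in> set js"
  by (cases js) auto

lemma pred_path_cong:
  "pred_path w p i js \<Longrightarrow> (\<And>j. j \<in> set js \<Longrightarrow> p' j = p j) \<Longrightarrow> pred_path w p' i js"
  by (induction js arbitrary: i) auto

lemma pred_path_closed: "pred_path w p i js \<Longrightarrow> j \<in> set js \<Longrightarrow> p j \<in> insert w (set js)"
proof (induction js arbitrary: i)
  case (Cons l js)
  then show ?case using pred_path_head_in[of w p "p l" js] by (cases "j = l") auto
qed simp

text \<open>The predecessor of a node comes later in the list, so two nodes cannot precede each
  other. This excludes traversing one arc in both directions.\<close>

lemma pred_path_no_two_cycle:
  assumes "pred_path w p i js" "j \<in> set js" "p j \<in> set js"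
  shows "p (p j) \<noteq> j"
  using assms
proof (induction js arbitrary: i)
  case (Cons l js)
  then have path: "pred_path w p (p l) js" and l: "l \<notin> set js" by auto
  have pl: "p l = w \<or> p l \<in> set js" using pred_path_head_in[OF path] .
  have w: "w \<notin> set (l # js)" using pred_path_distinct[OF Cons.prems(1)] by simp
  note closed = pred_path_closed[OF path]
  show ?case
  proof (cases "j = l")
    case True
    with Cons.prems(3) pl w l have "p j \<in> set js" by auto
    then have "p (p j) \<in> insert w (set js)" by (rule closed)
    then show ?thesis using True l w by auto
  next
    case False
    then have j: "j \<in> set js" using Cons.prems by auto
    have "p j \<in> set js" using closed[OF j] Cons.prems(3) w by auto
    with Cons.IH[OF path j] show ?thesis .
  qed
qed simp

text \<open>If two different nodes were entered through the same arc, it would be used once forwards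
  and once backwards, and the nodes would be predecessors of each other.\<close>

lemma entered_inj_on:
  assumes path: "pred_path w p i js" and e: "\<And>j. j \<in> set js \<Longrightarrow> entered M t h k x p b d j"
  shows "inj_on b (set js)"
proof (rule inj_onI)
  fix j l assume jl: "j \<in> set js" "l \<in> set js" "b j = b l"
  show "j = l"
  proof (rule ccontr)
    assume "j \<noteq> l"
    with e[OF jl(1)] e[OF jl(2)] jl(3) have "p j = l \<and> p l = j" by (auto simp: entered_def)
    with pred_path_no_two_cycle[OF path jl(1)] jl(2) show False by auto
  qed
qed

text \<open>Being a sum over the list, this can be unfolded from either end. It has two uses:
  \<open>\<epsilon> = 1\<close> with the directions \<open>d\<close> augments along a residual path,
  and a negative \<open>\<epsilon>\<close> with constant direction 1 takes flow off a path.\<close>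

definition push :: "int \<Rightarrow> (int \<Rightarrow> int) \<Rightarrow> (int \<Rightarrow> int) \<Rightarrow> int list \<Rightarrow> (int \<Rightarrow> int) \<Rightarrow> (int \<Rightarrow> int)" where
  "push \<epsilon> b d js x = (\<lambda>a. x a + \<epsilon> * (\<Sum>j\<leftarrow>js. if b j = a then d j else 0))"

lemma push_Nil [simp]: "push \<epsilon> b d [] x = x"
  by (simp add: push_def)

lemma push_snoc: "push \<epsilon> b d (js @ [j]) x = (push \<epsilon> b d js x)(b j := push \<epsilon> b d js x (b j) + \<epsilon> * d j)"
  by (auto simp: push_def algebra_simps)

lemma push_Cons: "push \<epsilon> b d (j # js) x = push \<epsilon> b d js (x(b j := x (b j) + \<epsilon> * d j))"
  by (auto simp: push_def algebra_simps)

lemma push_other: "a \<notin> b ` set js \<Longrightarrow> push \<epsilon> b d js x a = x a"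
  by (induction js) (auto simp: push_def)

lemma push_at:
  assumes "distinct js" "inj_on b (set js)" "j \<in> set js"
  shows "push \<epsilon> b d js x (b j) = x (b j) + \<epsilon> * d j"
  using assms
proof (induction js arbitrary: x)
  case (Cons l js)
  show ?case
  proof (cases "j = l")
    case True
    have "b j \<notin> b ` set js" using Cons.prems True by (auto simp: inj_on_def)
    then show ?thesis using True by (simp add: push_Cons push_other)
  next
    case False
    then have "j \<in> set js" "b l \<noteq> b j" using Cons.prems by (auto simp: inj_on_def)
    then show ?thesis using Cons by (simp add: push_Cons inj_on_insert)
  qed
qed simp

text \<open>The step into \<open>j\<close> changes the sum by
  \<open>\<epsilon> * (\<pi> j - \<pi> (p j))\<close>, whether its arc is used forwards or
  backwards; along the predecessors this telescopes.\<close>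

lemma push_potential:
  assumes "pred_path w p i js" and "\<And>j. j \<in> set js \<Longrightarrow> entered M t h k x p b d j"
  shows "(\<Sum>a\<in>{0..<M}. push \<epsilon> b d js y a * (\<pi> (h a) - \<pi> (t a))) =
    (\<Sum>a\<in>{0..<M}. y a * (\<pi> (h a) - \<pi> (t a))) + \<epsilon> * (\<pi> i - \<pi> w)"
  using assms
proof (induction js arbitrary: i y)
  case (Cons j js)
  let ?g = "\<lambda>a. \<pi> (h a) - \<pi> (t a)"
  have e: "entered M t h k x p b d j" using Cons.prems(2) by simp
  then have bj: "b j \<in> {0..<M}" by (simp add: entered_def)
  have "(\<Sum>a\<in>{0..<M}. (y(b j := y (b j) + \<epsilon> * d j)) a * ?g a) =
    (\<Sum>a\<in>{0..<M}. y a * ?g a + (if a = b j then \<epsilon> * d j * ?g a else 0))"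
    by (rule sum.cong) (auto simp: algebra_simps)
  also have "\<dots> = (\<Sum>a\<in>{0..<M}. y a * ?g a) + \<epsilon> * d j * ?g (b j)"
    unfolding sum.distrib using bj by (subst sum.delta) auto
  also have "d j * ?g (b j) = \<pi> j - \<pi> (p j)"
    using e by (auto simp: entered_def)
  then have "\<epsilon> * d j * ?g (b j) = \<epsilon> * (\<pi> j - \<pi> (p j))" by (simp add: mult.assoc)
  finally have *: "(\<Sum>a\<in>{0..<M}. (y(b j := y (b j) + \<epsilon> * d j)) a * ?g a) =
    (\<Sum>a\<in>{0..<M}. y a * ?g a) + \<epsilon> * (\<pi> j - \<pi> (p j))" .
  have "(\<Sum>a\<in>{0..<M}. push \<epsilon> b d (j # js) y a * ?g a) =
    (\<Sum>a\<in>{0..<M}. (y(b j := y (b j) + \<epsilon> * d j)) a * ?g a) + \<epsilon> * (\<pi> (p j) - \<pi> w)"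
    unfolding push_Cons by (rule Cons.IH) (use Cons.prems in auto)
  also have "\<dots> = (\<Sum>a\<in>{0..<M}. y a * ?g a) + \<epsilon> * (\<pi> j - \<pi> w)"
    unfolding * by (simp add: algebra_simps)
  finally show ?case using Cons.prems(1) by simp
qed simp

text \<open>The path leads from the head of \<open>a\<close> to its tail and \<open>a\<close> closes
  it to a cycle, so the two boundary terms cancel. The flow \<open>x\<close> that decides which arcs
  are residual may differ from the circulation \<open>y\<close>, as happens in the path
  decomposition.\<close>

lemma circulation_push:
  assumes circ: "circulation M t h y" and a: "a \<in> {0..<M}"
    and path: "pred_path (h a) p (t a) js"
    and e: "\<And>j. j \<in> set js \<Longrightarrow> entered M t h k x p b d j"
    and na: "a \<notin> b ` set js"
  shows "circulation M t h ((push \<epsilon> b d js y)(a := y a + \<epsilon>))"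
  unfolding circulation_def
proof
  fix \<pi> :: "int \<Rightarrow> int"
  let ?g = "\<lambda>a. \<pi> (h a) - \<pi> (t a)"
  have "(\<Sum>c\<in>{0..<M}. ((push \<epsilon> b d js y)(a := y a + \<epsilon>)) c * ?g c) =
    (\<Sum>c\<in>{0..<M}. push \<epsilon> b d js y c * ?g c + (if c = a then \<epsilon> * ?g c else 0))"
    using push_other[OF na, of \<epsilon> d y] by (intro sum.cong) (auto simp: algebra_simps)
  also have "\<dots> = (\<Sum>c\<in>{0..<M}. push \<epsilon> b d js y c * ?g c) + \<epsilon> * ?g a"
    unfolding sum.distrib using a by (subst sum.delta) auto
  also have "\<dots> = 0"
    using push_potential[OF path e, where \<epsilon>=\<epsilon> and y=y and \<pi>=\<pi>] circ
    by (simp add: circulation_def algebra_simps)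
  finally show "(\<Sum>c\<in>{0..<M}. ((push \<epsilon> b d js y)(a := y a + \<epsilon>)) c * ?g c) = 0" .
qed

lemma optimal_raise_capacity:
  assumes opt: "optimal M t h c k x \<pi>" and "0 \<le> c a + \<pi> (t a) - \<pi> (h a)"
  shows "optimal M t h c (k(a := k a + 1)) x \<pi>"
  using assms by (force simp: optimal_def)

text \<open>The arcs of the path have reduced cost 0, so no change of their flow within the
  capacities violates a sign condition. The arc \<open>a\<close> has negative reduced cost; hence it
  is not on the path, it is saturated, and it stays so when flow and capacity both grow by
  one.\<close>

lemma optimal_augment:
  assumes opt: "optimal M t h c k x \<pi>" and a: "a \<in> {0..<M}"
    and neg: "c a + \<pi> (t a) - \<pi> (h a) < 0"
    and path: "pred_path (h a) p (t a) js"
    and e: "\<And>j. j \<in> set js \<Longrightarrow> entered M t h k x p b d j"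
    and tight: "\<And>j. j \<in> set js \<Longrightarrow> c (b j) + \<pi> (t (b j)) - \<pi> (h (b j)) = 0"
  shows "optimal M t h c (k(a := k a + 1)) ((push 1 b d js x)(a := x a + 1)) \<pi>"
    and "a \<notin> b ` set js"
proof -
  show na: "a \<notin> b ` set js" using neg tight by force
  have dist: "distinct js" using pred_path_distinct[OF path] by simp
  have inj: "inj_on b (set js)" by (rule entered_inj_on[OF path e])
  have xa: "x a = k a" using opt a neg by (force simp: optimal_def)
  show "optimal M t h c (k(a := k a + 1)) ((push 1 b d js x)(a := x a + 1)) \<pi>"
    unfolding optimal_def
  proof
    fix l assume l: "l \<in> {0..<M}"
    have o: "0 \<le> x l \<and> x l \<le> k l \<and> (x l < k l \<longrightarrow> 0 \<le> c l + \<pi> (t l) - \<pi> (h l)) \<and>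
      (0 < x l \<longrightarrow> c l + \<pi> (t l) - \<pi> (h l) \<le> 0)" using opt l unfolding optimal_def by blast
    let ?y = "(push 1 b d js x)(a := x a + 1)"
    show "0 \<le> ?y l \<and> ?y l \<le> (k(a := k a + 1)) l \<and>
      (?y l < (k(a := k a + 1)) l \<longrightarrow> 0 \<le> c l + \<pi> (t l) - \<pi> (h l)) \<and>
      (0 < ?y l \<longrightarrow> c l + \<pi> (t l) - \<pi> (h l) \<le> 0)"
    proof (cases "l = a")
      case True
      then show ?thesis using o neg xa by auto
    next
      case False
      show ?thesis
      proof (cases "l \<in> b ` set js")
        case True
        then obtain j where j: "j \<in> set js" "l = b j" by auto
        then show ?thesis using False o push_at[OF dist inj j(1), of 1 d x] e[OF j(1)] tight[OF j(1)]
          by (auto simp: entered_def)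
      next
        case l: False
        then show ?thesis using False o push_other[OF l, of 1 d x] by auto
      qed
    qed
  qed
qed

section \<open>Searching for an augmenting path\<close>

text \<open>Only arcs between marked and unmarked nodes change their reduced cost. Residual arcs
  that leave the marked set lose \<open>e\<close>, which they can afford by \<open>fwd\<close> and
  \<open>bwd\<close>; residual arcs that enter it gain \<open>e\<close>.\<close>

lemma optimal_raise_potential:
  fixes S :: "int \<Rightarrow> int"
  assumes opt: "optimal M t h c k x \<pi>"
    and nodes: "\<And>a. a \<in> {0..<M} \<Longrightarrow> t a \<in> {0..n} \<and> h a \<in> {0..n}"
    and S: "\<And>i. i \<in> {0..n} \<Longrightarrow> S i \<in> {0, 1}"
    and e: "0 \<le> e"
    and fwd: "\<And>a. a \<in> {0..<M} \<Longrightarrow> x a < k a \<Longrightarrow> S (t a) = 1 \<Longrightarrow> S (h a) = 0 \<Longrightarrow>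
      e \<le> c a + \<pi> (t a) - \<pi> (h a)"
    and bwd: "\<And>a. a \<in> {0..<M} \<Longrightarrow> 0 < x a \<Longrightarrow> S (h a) = 1 \<Longrightarrow> S (t a) = 0 \<Longrightarrow>
      e \<le> - (c a + \<pi> (t a) - \<pi> (h a))"
    and \<pi>': "\<And>i. i \<in> {0..n} \<Longrightarrow> \<pi>' i = \<pi> i + (if S i = 0 then e else 0)"
  shows "optimal M t h c k x \<pi>'"
  unfolding optimal_def
proof
  fix a assume a: "a \<in> {0..<M}"
  have "0 \<le> x a \<and> x a \<le> k a \<and> (x a < k a \<longrightarrow> 0 \<le> c a + \<pi> (t a) - \<pi> (h a)) \<and>
      (0 < x a \<longrightarrow> c a + \<pi> (t a) - \<pi> (h a) \<le> 0)"
    using opt a unfolding optimal_def by blast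
  moreover have "S (t a) = 0 \<or> S (t a) = 1" "S (h a) = 0 \<or> S (h a) = 1"
    using S[of "t a"] S[of "h a"] nodes[OF a] by auto
  moreover have "\<pi>' (t a) = \<pi> (t a) + (if S (t a) = 0 then e else 0)"
    "\<pi>' (h a) = \<pi> (h a) + (if S (h a) = 0 then e else 0)"
    using \<pi>' nodes[OF a] by auto
  ultimately show "0 \<le> x a \<and> x a \<le> k a \<and> (x a < k a \<longrightarrow> 0 \<le> c a + \<pi>' (t a) - \<pi>' (h a)) \<and>
      (0 < x a \<longrightarrow> c a + \<pi>' (t a) - \<pi>' (h a) \<le> 0)"
    using fwd[OF a] bwd[OF a] e by (elim disjE) auto
qed

text \<open>Confining the path to \<open>X\<close> makes it robust: neither raising potentials nor
  overwriting the search arrays at nodes outside \<open>X\<close> affects it.\<close>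

definition reaches ::
  "int \<Rightarrow> (int \<Rightarrow> int) \<Rightarrow> (int \<Rightarrow> int) \<Rightarrow> (int \<Rightarrow> int) \<Rightarrow> (int \<Rightarrow> int) \<Rightarrow> (int \<Rightarrow> int) \<Rightarrow>
    (int \<Rightarrow> int) \<Rightarrow> (int \<Rightarrow> int) \<Rightarrow> (int \<Rightarrow> int) \<Rightarrow> (int \<Rightarrow> int) \<Rightarrow> int \<Rightarrow> int set \<Rightarrow> int \<Rightarrow> bool" where
  "reaches M t h c k x \<pi> p b d w X j \<longleftrightarrow> (\<exists>js. pred_path w p j js \<and> set js \<subseteq> X \<and>
     (\<forall>i\<in>set js. entered M t h k x p b d i \<and> c (b i) + \<pi> (t (b i)) - \<pi> (h (b i)) = 0))"

lemma reaches_raise_potential: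
  assumes "reaches M t h c k x \<pi> p b d w X j" "w \<in> X" "\<And>i. i \<in> X \<Longrightarrow> \<pi>' i = \<pi> i"
  shows "reaches M t h c k x \<pi>' p b d w X j"
proof -
  from assms(1) obtain js where js: "pred_path w p j js" "set js \<subseteq> X"
    "\<And>i. i \<in> set js \<Longrightarrow> entered M t h k x p b d i \<and> c (b i) + \<pi> (t (b i)) - \<pi> (h (b i)) = 0"
    by (auto simp: reaches_def)
  have "c (b i) + \<pi>' (t (b i)) - \<pi>' (h (b i)) = 0" if "i \<in> set js" for i
  proof -
    have "p i \<in> X" "i \<in> X" using pred_path_closed[OF js(1) that] js(2) assms(2) that by auto
    then have "\<pi>' (p i) = \<pi> (p i)" "\<pi>' i = \<pi> i" using assms(3) by auto
    then show ?thesis using js(3)[OF that] by (auto simp: entered_def)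
  qed
  with js show ?thesis unfolding reaches_def by blast
qed

lemma reaches_insert_old:
  assumes "reaches M t h c k x \<pi> p b d w X j" "f \<notin> X"
  shows "reaches M t h c k x \<pi> (p(f := u)) (b(f := A)) (d(f := o')) w (insert f X) j"
proof -
  from assms(1) obtain js where js: "pred_path w p j js" "set js \<subseteq> X"
    "\<And>i. i \<in> set js \<Longrightarrow> entered M t h k x p b d i \<and> c (b i) + \<pi> (t (b i)) - \<pi> (h (b i)) = 0"
    by (auto simp: reaches_def)
  have ne: "i \<noteq> f" if "i \<in> set js" for i using that js(2) assms(2) by auto
  have "pred_path w (p(f := u)) j js" by (rule pred_path_cong[OF js(1)]) (use ne in auto)
  moreover have "entered M t h k x (p(f := u)) (b(f := A)) (d(f := o')) i \<and>
      c ((b(f := A)) i) + \<pi> (t ((b(f := A)) i)) - \<pi> (h ((b(f := A)) i)) = 0" if "i \<in> set js" for i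
    using js(3)[OF that] ne[OF that] by (simp add: entered_def)
  ultimately show ?thesis using js(2) unfolding reaches_def by blast
qed

lemma reaches_insert_new:
  assumes "reaches M t h c k x \<pi> p b d w X u" "f \<notin> X" "f \<noteq> w"
    and "entered M t h k x (p(f := u)) (b(f := A)) (d(f := o')) f"
    and "c A + \<pi> (t A) - \<pi> (h A) = 0"
  shows "reaches M t h c k x \<pi> (p(f := u)) (b(f := A)) (d(f := o')) w (insert f X) f"
proof -
  from assms(1) obtain js where js: "pred_path w p u js" "set js \<subseteq> X"
    "\<And>i. i \<in> set js \<Longrightarrow> entered M t h k x p b d i \<and> c (b i) + \<pi> (t (b i)) - \<pi> (h (b i)) = 0"
    by (auto simp: reaches_def)
  have f: "f \<notin> set js" using js(2) assms(2) by auto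
  then have ne: "i \<noteq> f" if "i \<in> set js" for i using that by auto
  have "pred_path w (p(f := u)) u js" by (rule pred_path_cong[OF js(1)]) (use ne in auto)
  then have "pred_path w (p(f := u)) f (f # js)" using f assms(3) by simp
  moreover have "entered M t h k x (p(f := u)) (b(f := A)) (d(f := o')) i \<and>
      c ((b(f := A)) i) + \<pi> (t ((b(f := A)) i)) - \<pi> (h ((b(f := A)) i)) = 0" if "i \<in> set js" for i
    using js(3)[OF that] ne[OF that] by (simp add: entered_def)
  then have "\<forall>i\<in>set (f # js). entered M t h k x (p(f := u)) (b(f := A)) (d(f := o')) i \<and>
      c ((b(f := A)) i) + \<pi> (t ((b(f := A)) i)) - \<pi> (h ((b(f := A)) i)) = 0"
    using assms(4,5) by simp
  moreover have "set (f # js) \<subseteq> insert f X" using js(2) by auto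
  ultimately show ?thesis unfolding reaches_def by blast
qed

text \<open>
  The arrays \<open>t, h, c, k, x\<close> hold tails, heads, costs, capacities and flow of the arcs in \<open>{0..<M}\<close>, and \<open>y\<close>
  the potentials of the nodes in \<open>{0..n}\<close>.  The search marks nodes in \<open>S\<close> and stores the predecessor of a
  node in \<open>p\<close>, the arc in between in \<open>b\<close> and its direction in \<open>d\<close>; \<open>e\<close> is the least reduced cost of a
  residual arc that leaves the marked nodes, \<open>A\<close> this arc, \<open>o\<close> its direction and \<open>f\<close> its far end.
\<close>

definition reduced_cost :: "exp \<Rightarrow> exp" where
  "reduced_cost a = Sub (Add (Read ''c'' a) (Read ''y'' (Read ''t'' a))) (Read ''y'' (Read ''h'' a))"

text \<open>Marks are 0 or 1, so comparing the marks of the two ends tests whether the arc leaves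
  the marked set in the respective direction.\<close>

definition scan_arc :: com where
  "scan_arc =
    Seq (Set_var ''r'' (reduced_cost (V ''v'')))
    (Seq (If (Less (Read ''x'' (V ''v'')) (Read ''k'' (V ''v'')))
      (If (Less (Read ''S'' (Read ''h'' (V ''v''))) (Read ''S'' (Read ''t'' (V ''v''))))
        (If (Less (V ''r'') (V ''e''))
          (Seq (Set_var ''e'' (V ''r''))
          (Seq (Set_var ''f'' (Read ''h'' (V ''v'')))
          (Seq (Set_var ''A'' (V ''v'')) (Set_var ''o'' (Const 1)))))
          Skip) Skip) Skip)
     (If (Less (Const 0) (Read ''x'' (V ''v'')))
      (If (Less (Read ''S'' (Read ''t'' (V ''v''))) (Read ''S'' (Read ''h'' (V ''v''))))
        (If (Less (Sub (Const 0) (V ''r'')) (V ''e''))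
          (Seq (Set_var ''e'' (Sub (Const 0) (V ''r'')))
          (Seq (Set_var ''f'' (Read ''t'' (V ''v'')))
          (Seq (Set_var ''A'' (V ''v'')) (Set_var ''o'' (Const (- 1))))))
          Skip) Skip) Skip))"

text \<open>The minimum starts at the remaining limit \<open>l\<close>, and \<open>f = - 1\<close>
  stands for no arc. Thus the raise never exceeds the limit, and the limit is used up if no leaving
  residual arc is strictly cheaper.\<close>

definition search_step :: com where
  "search_step =
    Seq (Set_var ''e'' (V ''l''))
    (Seq (Set_var ''f'' (Const (- 1)))
    (Seq (For ''v'' (V ''M'') scan_arc)
    (Seq (For ''i'' (Add (V ''n'') (Const 1))
      (If (Less (Read ''S'' (V ''i'')) (Const 1))
        (Assign ''y'' (V ''i'') (Add (Read ''y'' (V ''i'')) (V ''e''))) Skip))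
    (Seq (Set_var ''l'' (Sub (V ''l'') (V ''e'')))
    (If (Less (Const (- 1)) (V ''f''))
      (Seq (Assign ''S'' (V ''f'') (Const 1))
      (Seq (Assign ''b'' (V ''f'') (V ''A''))
      (Seq (Assign ''d'' (V ''f'') (V ''o''))
      (If (Less (Const 0) (V ''o''))
        (Assign ''p'' (V ''f'') (Read ''t'' (V ''A'')))
        (Assign ''p'' (V ''f'') (Read ''h'' (V ''A'')))))))
      Skip)))))"

text \<open>
  Dijkstra's algorithm from node \<open>s\<close> in the residual network with respect to reduced costs.  It
  stops when the goal \<open>g\<close> is reached or its potential has been raised by the limit \<open>l\<close>.
\<close>

definition search :: com where
  "search =
    Seq (For ''i'' (Add (V ''n'') (Const 1)) (Assign ''S'' (V ''i'') (Const 0)))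
    (Seq (Assign ''S'' (V ''s'') (Const 1))
    (While (Less (Read ''S'' (V ''g'')) (Less (Const 0) (V ''l''))) search_step))"

definition scanned :: "memory \<Rightarrow> int \<Rightarrow> int \<Rightarrow> int \<Rightarrow> int \<Rightarrow> int \<Rightarrow> bool" where
  "scanned s a e f A o' \<longleftrightarrow> 0 \<le> e \<and> e \<le> s ''l'' 0 \<and>
     (\<forall>l\<in>{0..<a}.
       (s ''x'' l < s ''k'' l \<longrightarrow> s ''S'' (s ''t'' l) = 1 \<longrightarrow> s ''S'' (s ''h'' l) = 0 \<longrightarrow>
          e \<le> s ''c'' l + s ''y'' (s ''t'' l) - s ''y'' (s ''h'' l)) \<and>
       (0 < s ''x'' l \<longrightarrow> s ''S'' (s ''h'' l) = 1 \<longrightarrow> s ''S'' (s ''t'' l) = 0 \<longrightarrow>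
          e \<le> - (s ''c'' l + s ''y'' (s ''t'' l) - s ''y'' (s ''h'' l)))) \<and>
     (if f = - 1 then e = s ''l'' 0 else
       A \<in> {0..<s ''M'' 0} \<and> e < s ''l'' 0 \<and>
       (o' = 1 \<and> f = s ''h'' A \<and> s ''S'' (s ''t'' A) = 1 \<and> s ''S'' (s ''h'' A) = 0 \<and>
          s ''x'' A < s ''k'' A \<and> e = s ''c'' A + s ''y'' (s ''t'' A) - s ''y'' (s ''h'' A) \<or>
        o' = - 1 \<and> f = s ''t'' A \<and> s ''S'' (s ''h'' A) = 1 \<and> s ''S'' (s ''t'' A) = 0 \<and>
          0 < s ''x'' A \<and> e = - (s ''c'' A + s ''y'' (s ''t'' A) - s ''y'' (s ''h'' A))))"

lemma wp_scan:
  assumes opt: "optimal (s ''M'' 0) (s ''t'') (s ''h'') (s ''c'') (s ''k'') (s ''x'') (s ''y'')"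
    and M: "0 \<le> s ''M'' 0" "s ''M'' 0 \<le> int q"
    and nodes: "\<And>a. a \<in> {0..<s ''M'' 0} \<Longrightarrow> s ''t'' a \<in> {0..s ''n'' 0} \<and> s ''h'' a \<in> {0..s ''n'' 0}"
    and S: "\<And>i. i \<in> {0..s ''n'' 0} \<Longrightarrow> s ''S'' i \<in> {0, 1}"
    and e: "s ''e'' 0 = s ''l'' 0" "0 \<le> s ''l'' 0" "s ''f'' 0 = - 1"
  shows "wp q (For ''v'' (V ''M'') scan_arc)
    (\<lambda>r. scanned s (s ''M'' 0) (r ''e'' 0) (r ''f'' 0) (r ''A'' 0) (r ''o'' 0)) s"
proof (rule wp_For[where I = "\<lambda>a r. scanned s a (r ''e'' 0) (r ''f'' 0) (r ''A'' 0) (r ''o'' 0)"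
      and N = "s ''M'' 0"])
  fix a r
  assume sc: "scanned s a (r ''e'' 0) (r ''f'' 0) (r ''A'' 0) (r ''o'' 0)"
    and ag: "agree (insert ''v'' (assigned scan_arc)) s r"
    and a: "0 \<le> a" "a < s ''M'' 0" "r ''v'' 0 = a"
  have eq: "r ''c'' = s ''c''" "r ''y'' = s ''y''" "r ''t'' = s ''t''" "r ''h'' = s ''h''" "r ''x'' = s ''x''"
    "r ''k'' = s ''k''" "r ''S'' = s ''S''"
    using ag by (auto simp: scan_arc_def elim!: agreeD)
  have na: "s ''t'' a \<in> {0..s ''n'' 0} \<and> s ''h'' a \<in> {0..s ''n'' 0}" using nodes a by auto
  then have Sa: "s ''S'' (s ''t'' a) = 0 \<or> s ''S'' (s ''t'' a) = 1" "s ''S'' (s ''h'' a) = 0 \<or> s ''S'' (s ''h'' a) = 1"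
    using S[of "s ''t'' a"] S[of "s ''h'' a"] by auto
  have o: "(s ''x'' a < s ''k'' a \<longrightarrow> 0 \<le> s ''c'' a + s ''y'' (s ''t'' a) - s ''y'' (s ''h'' a)) \<and>
     (0 < s ''x'' a \<longrightarrow> s ''c'' a + s ''y'' (s ''t'' a) - s ''y'' (s ''h'' a) \<le> 0)"
    using opt a unfolding optimal_def by auto
  have ivl: "{0..<a + 1} = insert a {0..<a}" using a by auto
  have f: "s ''t'' a \<noteq> - 1" "s ''h'' a \<noteq> - 1" using na by auto
  define \<rho> where "\<rho> = s ''c'' a + s ''y'' (s ''t'' a) - s ''y'' (s ''h'' a)"
  let ?e = "r ''e'' 0"
  consider (fwd) "s ''x'' a < s ''k'' a" "s ''S'' (s ''h'' a) = 0" "s ''S'' (s ''t'' a) = 1" "\<rho> < ?e"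
    | (bwd) "0 < s ''x'' a" "s ''S'' (s ''h'' a) = 1" "s ''S'' (s ''t'' a) = 0" "- \<rho> < ?e"
    | (none) "\<not> (s ''x'' a < s ''k'' a \<and> s ''S'' (s ''h'' a) = 0 \<and> s ''S'' (s ''t'' a) = 1 \<and> \<rho> < ?e)"
       "\<not> (0 < s ''x'' a \<and> s ''S'' (s ''h'' a) = 1 \<and> s ''S'' (s ''t'' a) = 0 \<and> - \<rho> < ?e)" by blast
  then show "wp q scan_arc (\<lambda>r'. scanned s (a + 1) ((r'(''v'' := (r' ''v'')(0 := a + 1))) ''e'' 0)
      ((r'(''v'' := (r' ''v'')(0 := a + 1))) ''f'' 0) ((r'(''v'' := (r' ''v'')(0 := a + 1))) ''A'' 0)
      ((r'(''v'' := (r' ''v'')(0 := a + 1))) ''o'' 0) \<and> r' ''v'' 0 = a) r"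
  proof cases
    case fwd
    have "scanned s (a + 1) \<rho> (s ''h'' a) a 1"
      using sc fwd o f a unfolding scanned_def ivl by (auto simp: \<rho>_def)
    then show ?thesis using fwd a
      by (simp add: scan_arc_def reduced_cost_def eq \<rho>_def[symmetric])
  next
    case bwd
    have "scanned s (a + 1) (- \<rho>) (s ''t'' a) a (- 1)"
      using sc bwd o f a unfolding scanned_def ivl by (auto simp: \<rho>_def)
    then show ?thesis using bwd a
      by (simp add: scan_arc_def reduced_cost_def eq \<rho>_def[symmetric])
  next
    case none
    have "s ''x'' a < s ''k'' a \<longrightarrow> s ''S'' (s ''t'' a) = 1 \<longrightarrow> s ''S'' (s ''h'' a) = 0 \<longrightarrow> ?e \<le> \<rho>"
      "0 < s ''x'' a \<longrightarrow> s ''S'' (s ''h'' a) = 1 \<longrightarrow> s ''S'' (s ''t'' a) = 0 \<longrightarrow> ?e \<le> - \<rho>"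
      using none by linarith+
    then have sc': "scanned s (a + 1) (r ''e'' 0) (r ''f'' 0) (r ''A'' 0) (r ''o'' 0)"
      using sc unfolding scanned_def ivl \<rho>_def ball_insert by blast
    have c: "\<not> s ''x'' a < s ''k'' a \<or> \<not> s ''S'' (s ''h'' a) < s ''S'' (s ''t'' a) \<or> \<not> \<rho> < ?e"
      "\<not> 0 < s ''x'' a \<or> \<not> s ''S'' (s ''t'' a) < s ''S'' (s ''h'' a) \<or> \<not> - \<rho> < ?e"
      using none Sa by linarith+
    from c sc' a show ?thesis
      by (elim disjE) (simp_all add: scan_arc_def reduced_cost_def eq \<rho>_def[symmetric])
  qed
next
  show "scanned s 0 ((s(''v'' := (s ''v'')(0 := 0))) ''e'' 0) ((s(''v'' := (s ''v'')(0 := 0))) ''f'' 0)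
      ((s(''v'' := (s ''v'')(0 := 0))) ''A'' 0) ((s(''v'' := (s ''v'')(0 := 0))) ''o'' 0)"
    using e by (simp add: scanned_def)
next
  fix j r assume "agree (insert ''v'' (assigned scan_arc)) s r"
  then have "r ''M'' = s ''M''" by (rule agreeD) (simp add: scan_arc_def)
  then show "eval_exp r (V ''M'') = s ''M'' 0" by simp
qed (use M in auto)

definition marked :: "memory \<Rightarrow> int set" where
  "marked r = {i \<in> {0..r ''n'' 0}. r ''S'' i = 1}"

text \<open>\<open>l\<close> is what remains of the limit. All raises were made while the goal was
  unmarked, so its potential has grown by exactly the amount spent. A marked goal forces
  \<open>0 < l\<close>, so the final value of \<open>l\<close> tells the two outcomes of the search
  apart.\<close>

definition search_inv :: "memory \<Rightarrow> memory \<Rightarrow> bool" where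
  "search_inv s r \<longleftrightarrow>
     optimal (s ''M'' 0) (s ''t'') (s ''h'') (s ''c'') (s ''k'') (s ''x'') (r ''y'') \<and>
     r ''y'' (s ''s'' 0) = s ''y'' (s ''s'' 0) \<and>
     r ''y'' (s ''g'' 0) = s ''y'' (s ''g'' 0) + (s ''l'' 0 - r ''l'' 0) \<and> 0 \<le> r ''l'' 0 \<and>
     (\<forall>i\<in>{0..s ''n'' 0}. r ''S'' i \<in> {0, 1}) \<and> r ''S'' (s ''s'' 0) = 1 \<and>
     (r ''S'' (s ''g'' 0) = 1 \<longrightarrow> 0 < r ''l'' 0) \<and>
     (\<forall>j\<in>marked r. reaches (s ''M'' 0) (s ''t'') (s ''h'') (s ''c'') (s ''k'') (s ''x'') (r ''y'')
        (r ''p'') (r ''b'') (r ''d'') (s ''s'' 0) (marked r) j)"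

lemma wp_raise:
  assumes "0 \<le> s ''n'' 0" "s ''n'' 0 < int q"
  shows "wp q (For ''i'' (Add (V ''n'') (Const 1))
      (If (Less (Read ''S'' (V ''i'')) (Const 1))
        (Assign ''y'' (V ''i'') (Add (Read ''y'' (V ''i'')) (V ''e''))) Skip))
    (\<lambda>r. \<forall>i\<in>{0..s ''n'' 0}. r ''y'' i = s ''y'' i + (if s ''S'' i < 1 then s ''e'' 0 else 0)) s"
proof (rule wp_For[where N = "s ''n'' 0 + 1" and I = "\<lambda>j r. \<forall>i. r ''y'' i =
      s ''y'' i + (if 0 \<le> i \<and> i < j \<and> s ''S'' i < 1 then s ''e'' 0 else 0)"])
  fix j r assume "agree (insert ''i'' (assigned (If (Less (Read ''S'' (V ''i'')) (Const 1))
        (Assign ''y'' (V ''i'') (Add (Read ''y'' (V ''i'')) (V ''e''))) Skip))) s r"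
  then have eq: "r ''n'' = s ''n''" "r ''S'' = s ''S''" "r ''e'' = s ''e''" by (auto elim: agreeD)
  then show "eval_exp r (Add (V ''n'') (Const 1)) = s ''n'' 0 + 1" by simp
  assume I: "\<forall>i. r ''y'' i = s ''y'' i + (if 0 \<le> i \<and> i < j \<and> s ''S'' i < 1 then s ''e'' 0 else 0)"
    and "0 \<le> j" "r ''i'' 0 = j"
  then show "wp q (If (Less (Read ''S'' (V ''i'')) (Const 1))
        (Assign ''y'' (V ''i'') (Add (Read ''y'' (V ''i'')) (V ''e''))) Skip)
      (\<lambda>r'. (\<forall>i. (r'(''i'' := (r' ''i'')(0 := j + 1))) ''y'' i =
        s ''y'' i + (if 0 \<le> i \<and> i < j + 1 \<and> s ''S'' i < 1 then s ''e'' 0 else 0)) \<and> r' ''i'' 0 = j) r"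
    using eq by (auto simp: less_Suc_eq zle_add1_eq_le order.order_iff_strict)
qed (use assms in auto)

text \<open>The raise makes the cheapest leaving residual arc tight, so that its far end can be
  marked; if there is no arc below the remaining limit, the raise uses up the limit instead and ends
  the search.\<close>

lemma wp_search_step:
  assumes inv: "search_inv s r"
    and eq: "r ''t'' = s ''t''" "r ''h'' = s ''h''" "r ''c'' = s ''c''" "r ''k'' = s ''k''" "r ''x'' = s ''x''"
      "r ''M'' = s ''M''" "r ''n'' = s ''n''"
    and M: "0 \<le> s ''M'' 0" "s ''M'' 0 \<le> int q" and n: "0 \<le> s ''n'' 0" "s ''n'' 0 < int q"
    and nodes: "\<And>a. a \<in> {0..<s ''M'' 0} \<Longrightarrow> s ''t'' a \<in> {0..s ''n'' 0} \<and> s ''h'' a \<in> {0..s ''n'' 0}"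
    and sg: "s ''s'' 0 \<in> {0..s ''n'' 0}" "s ''g'' 0 \<in> {0..s ''n'' 0}"
    and cont: "r ''S'' (s ''g'' 0) = 0" "0 < r ''l'' 0"
  shows "wp q search_step (\<lambda>r'. search_inv s r' \<and>
    (r' ''l'' 0 = 0 \<and> marked r' = marked r \<or> 0 < r' ''l'' 0 \<and> (\<exists>f\<in>{0..s ''n'' 0} - marked r. marked r' = insert f (marked r)))) r"
proof -
  have opt: "optimal (s ''M'' 0) (s ''t'') (s ''h'') (s ''c'') (s ''k'') (s ''x'') (r ''y'')"
    and ys: "r ''y'' (s ''s'' 0) = s ''y'' (s ''s'' 0)"
    and yg: "r ''y'' (s ''g'' 0) = s ''y'' (s ''g'' 0) + (s ''l'' 0 - r ''l'' 0)"
    and S: "\<And>i. i \<in> {0..s ''n'' 0} \<Longrightarrow> r ''S'' i \<in> {0, 1}" and Ss: "r ''S'' (s ''s'' 0) = 1"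
    and reach: "\<And>j. j \<in> marked r \<Longrightarrow> reaches (s ''M'' 0) (s ''t'') (s ''h'') (s ''c'') (s ''k'') (s ''x'') (r ''y'')
        (r ''p'') (r ''b'') (r ''d'') (s ''s'' 0) (marked r) j"
    using inv by (auto simp: search_inv_def)
  define r1 where "r1 = r(''e'' := (r ''e'')(0 := r ''l'' 0), ''f'' := (r ''f'')(0 := - 1))"
  have "wp q (For ''v'' (V ''M'') scan_arc)
    (\<lambda>r. scanned r1 (r1 ''M'' 0) (r ''e'' 0) (r ''f'' 0) (r ''A'' 0) (r ''o'' 0)) r1"
  proof (rule wp_scan)
    have r1: "r1 ''t'' = s ''t''" "r1 ''h'' = s ''h''" "r1 ''c'' = s ''c''" "r1 ''k'' = s ''k''"
      "r1 ''x'' = s ''x''" "r1 ''M'' = s ''M''" "r1 ''n'' = s ''n''" "r1 ''y'' = r ''y''" "r1 ''S'' = r ''S''"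
      by (simp_all add: r1_def eq)
    show "optimal (r1 ''M'' 0) (r1 ''t'') (r1 ''h'') (r1 ''c'') (r1 ''k'') (r1 ''x'') (r1 ''y'')"
      unfolding r1 by (rule opt)
    show "0 \<le> r1 ''M'' 0" "r1 ''M'' 0 \<le> int q" unfolding r1 by (fact M)+
    show "r1 ''t'' a \<in> {0..r1 ''n'' 0} \<and> r1 ''h'' a \<in> {0..r1 ''n'' 0}"
      if "a \<in> {0..<r1 ''M'' 0}" for a using that unfolding r1 by (rule nodes)
    show "r1 ''S'' i \<in> {0, 1}" if "i \<in> {0..r1 ''n'' 0}" for i using that unfolding r1 by (rule S)
    show "r1 ''e'' 0 = r1 ''l'' 0" "0 \<le> r1 ''l'' 0" "r1 ''f'' 0 = - 1"
      using cont by (simp_all add: r1_def)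
  qed
  note scan = this
  define n where "n = s ''n'' 0"
  define Q where "Q r' \<longleftrightarrow> search_inv s r' \<and>
    (r' ''l'' 0 = 0 \<and> marked r' = marked r \<or> 0 < r' ''l'' 0 \<and> (\<exists>f\<in>{0..n} - marked r. marked r' = insert f (marked r)))" for r'
  have "wp q (For ''v'' (V ''M'') scan_arc) (wp q (For ''i'' (Add (V ''n'') (Const 1))
      (If (Less (Read ''S'' (V ''i'')) (Const 1))
        (Assign ''y'' (V ''i'') (Add (Read ''y'' (V ''i'')) (V ''e''))) Skip))
     (wp q (Seq (Set_var ''l'' (Sub (V ''l'') (V ''e'')))
      (If (Less (Const (- 1)) (V ''f''))
      (Seq (Assign ''S'' (V ''f'') (Const 1))
      (Seq (Assign ''b'' (V ''f'') (V ''A''))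
      (Seq (Assign ''d'' (V ''f'') (V ''o''))
      (If (Less (Const 0) (V ''o''))
        (Assign ''p'' (V ''f'') (Read ''t'' (V ''A'')))
        (Assign ''p'' (V ''f'') (Read ''h'' (V ''A'')))))))
      Skip)) Q)) r1"
  proof (rule wp_frameI[OF scan])
    fix r2 assume sc: "scanned r1 (r1 ''M'' 0) (r2 ''e'' 0) (r2 ''f'' 0) (r2 ''A'' 0) (r2 ''o'' 0)"
      and ag: "agree (assigned (For ''v'' (V ''M'') scan_arc)) r1 r2"
    have ag2: "r2 x = r1 x" if "x \<notin> {''v'', ''r'', ''e'', ''f'', ''A'', ''o''}" for x
      using that by (intro agreeD[OF ag]) (simp add: scan_arc_def)
    have r2: "r2 ''S'' = r ''S''" "r2 ''n'' = s ''n''" "r2 ''y'' = r ''y''" "r2 ''l'' = r ''l''"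
      "r2 ''p'' = r ''p''" "r2 ''b'' = r ''b''" "r2 ''d'' = r ''d''" "r2 ''t'' = s ''t''" "r2 ''h'' = s ''h''"
      "r2 ''M'' = s ''M''"
      by (simp_all add: ag2) (simp_all add: r1_def eq)
    have r1: "r1 ''S'' = r ''S''" "r1 ''y'' = r ''y''" "r1 ''l'' = r ''l''" "r1 ''t'' = s ''t''" "r1 ''h'' = s ''h''"
      "r1 ''M'' = s ''M''" "r1 ''c'' = s ''c''" "r1 ''k'' = s ''k''" "r1 ''x'' = s ''x''"
      by (simp_all add: r1_def eq)
    show "wp q (For ''i'' (Add (V ''n'') (Const 1))
      (If (Less (Read ''S'' (V ''i'')) (Const 1))
        (Assign ''y'' (V ''i'') (Add (Read ''y'' (V ''i'')) (V ''e''))) Skip))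
     (wp q (Seq (Set_var ''l'' (Sub (V ''l'') (V ''e'')))
      (If (Less (Const (- 1)) (V ''f''))
      (Seq (Assign ''S'' (V ''f'') (Const 1))
      (Seq (Assign ''b'' (V ''f'') (V ''A''))
      (Seq (Assign ''d'' (V ''f'') (V ''o''))
      (If (Less (Const 0) (V ''o''))
        (Assign ''p'' (V ''f'') (Read ''t'' (V ''A'')))
        (Assign ''p'' (V ''f'') (Read ''h'' (V ''A'')))))))
      Skip)) Q) r2"
    proof (rule wp_frameI[OF wp_raise])
      fix r3
      assume y3: "\<forall>i\<in>{0..r2 ''n'' 0}. r3 ''y'' i = r2 ''y'' i + (if r2 ''S'' i < 1 then r2 ''e'' 0 else 0)"
        and ag: "agree (assigned (For ''i'' (Add (V ''n'') (Const 1)) (If (Less (Read ''S'' (V ''i'')) (Const 1))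
          (Assign ''y'' (V ''i'') (Add (Read ''y'' (V ''i'')) (V ''e''))) Skip))) r2 r3"
      have ag3: "r3 x = r2 x" if "x \<notin> {''i'', ''y''}" for x
        using that by (intro agreeD[OF ag]) simp
      have r3: "r3 ''S'' = r ''S''" "r3 ''n'' = s ''n''" "r3 ''l'' = r ''l''"
        "r3 ''p'' = r ''p''" "r3 ''b'' = r ''b''" "r3 ''d'' = r ''d''" "r3 ''t'' = s ''t''" "r3 ''h'' = s ''h''"
        "r3 ''e'' = r2 ''e''" "r3 ''f'' = r2 ''f''" "r3 ''A'' = r2 ''A''" "r3 ''o'' = r2 ''o''"
        by (simp_all add: ag3 r2)
      define e f A o' where "e = r2 ''e'' 0" and "f = r2 ''f'' 0" and "A = r2 ''A'' 0" and "o' = r2 ''o'' 0"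
      note sc = sc[folded e_def f_def A_def o'_def, unfolded scanned_def r1]
      have e: "0 \<le> e" "e \<le> r ''l'' 0" using sc by auto
      have y: "r3 ''y'' i = r ''y'' i + (if r ''S'' i = 0 then e else 0)" if "i \<in> {0..n}" for i
        using y3 that S[of i] by (auto simp: r2 e_def n_def)
      have opt3: "optimal (s ''M'' 0) (s ''t'') (s ''h'') (s ''c'') (s ''k'') (s ''x'') (r3 ''y'')"
        by (rule optimal_raise_potential[OF opt, where n = n and S = "r ''S''" and e = e])
          (use nodes S e sc y in \<open>auto simp: n_def\<close>)
      have mk: "marked r = {i \<in> {0..n}. r ''S'' i = 1}" by (simp add: marked_def eq n_def)
      have reach3: "reaches (s ''M'' 0) (s ''t'') (s ''h'') (s ''c'') (s ''k'') (s ''x'') (r3 ''y'')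
        (r ''p'') (r ''b'') (r ''d'') (s ''s'' 0) (marked r) j" if "j \<in> marked r" for j
        by (rule reaches_raise_potential[OF reach[OF that]]) (use y sg Ss in \<open>auto simp: mk n_def\<close>)
      have ys3: "r3 ''y'' (s ''s'' 0) = s ''y'' (s ''s'' 0)" using y sg Ss ys by (simp add: n_def)
      have yg3: "r3 ''y'' (s ''g'' 0) = s ''y'' (s ''g'' 0) + (s ''l'' 0 - (r ''l'' 0 - e))"
        using y sg cont yg by (simp add: n_def)
      define P where "P p b d X = (\<forall>j\<in>X. reaches (s ''M'' 0) (s ''t'') (s ''h'') (s ''c'') (s ''k'')
        (s ''x'') (r3 ''y'') p b d (s ''s'' 0) X j)" for p b d X
      have QI: "Q r4" if "r4 ''y'' = r3 ''y''" "r4 ''n'' = s ''n''" "r4 ''l'' 0 = r ''l'' 0 - e"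
        "r4 ''S'' = (r ''S'')(f := 1)" "f \<in> {0..n}" "r ''S'' f = 0" "e < r ''l'' 0"
        "P (r4 ''p'') (r4 ''b'') (r4 ''d'') (insert f (marked r))" for r4
      proof -
        have m4: "marked r4 = insert f (marked r)"
          using that(2,4,5) by (auto simp: marked_def eq n_def)
        have "f \<notin> marked r" using that(6) by (simp add: marked_def)
        then show ?thesis unfolding Q_def search_inv_def
          using m4 that opt3 ys3 yg3 S Ss by (auto simp: P_def n_def)
      qed
      show "wp q (Seq (Set_var ''l'' (Sub (V ''l'') (V ''e'')))
      (If (Less (Const (- 1)) (V ''f''))
      (Seq (Assign ''S'' (V ''f'') (Const 1))
      (Seq (Assign ''b'' (V ''f'') (V ''A''))
      (Seq (Assign ''d'' (V ''f'') (V ''o''))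
      (If (Less (Const 0) (V ''o''))
        (Assign ''p'' (V ''f'') (Read ''t'' (V ''A'')))
        (Assign ''p'' (V ''f'') (Read ''h'' (V ''A'')))))))
      Skip)) Q r3"
      proof (cases "f = - 1")
        case True
        then have "e = r ''l'' 0" using sc by simp
        define r4 where "r4 = r3(''l'' := (r3 ''l'')(0 := 0))"
        have m4: "marked r4 = marked r" by (simp add: marked_def r4_def r3 eq)
        have "Q r4" unfolding Q_def search_inv_def m4
          using opt3 ys3 yg3 S Ss reach3 cont \<open>e = r ''l'' 0\<close>
          by (simp add: r4_def r3)
        then show ?thesis using True \<open>e = r ''l'' 0\<close> by (simp add: r3 r4_def e_def f_def)
      next
        case False
        have A: "A \<in> {0..<s ''M'' 0}" "e < r ''l'' 0" using sc False by auto
        then have nA: "s ''t'' A \<in> {0..n}" "s ''h'' A \<in> {0..n}" using nodes by (auto simp: n_def)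
        have dir: "o' = 1 \<and> f = s ''h'' A \<and> r ''S'' (s ''t'' A) = 1 \<and> r ''S'' (s ''h'' A) = 0 \<and>
          s ''x'' A < s ''k'' A \<and> e = s ''c'' A + r ''y'' (s ''t'' A) - r ''y'' (s ''h'' A) \<or>
          o' = - 1 \<and> f = s ''t'' A \<and> r ''S'' (s ''h'' A) = 1 \<and> r ''S'' (s ''t'' A) = 0 \<and>
          0 < s ''x'' A \<and> e = - (s ''c'' A + r ''y'' (s ''t'' A) - r ''y'' (s ''h'' A))"
          using sc False by simp
        then have f: "f \<in> {0..n}" "r ''S'' f = 0" using nA by auto
        then have f': "f \<notin> marked r" "f \<noteq> s ''s'' 0" "- 1 < f" using Ss by (auto simp: marked_def)
        \<comment> \<open>Up to sign, \<open>e\<close> is the reduced cost of \<open>A\<close>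
          before the raise, and exactly one end of \<open>A\<close> was raised, namely
          \<open>f\<close>.\<close>
        have tight: "s ''c'' A + r3 ''y'' (s ''t'' A) - r3 ''y'' (s ''h'' A) = 0"
          using dir y nA by auto
        define u where "u = (if 0 < o' then s ''t'' A else s ''h'' A)"
        have u: "u \<in> marked r" using dir nA by (auto simp: u_def mk)
        have "entered (s ''M'' 0) (s ''t'') (s ''h'') (s ''k'') (s ''x'') ((r ''p'')(f := u))
          ((r ''b'')(f := A)) ((r ''d'')(f := o')) f"
          using dir A by (auto simp: entered_def u_def)
        from reaches_insert_new[OF reach3[OF u] f'(1,2) this tight] reaches_insert_old[OF reach3 f'(1)]
        have "P ((r ''p'')(f := u)) ((r ''b'')(f := A)) ((r ''d'')(f := o')) (insert f (marked r))"
          unfolding P_def by blast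
        then show ?thesis
          using f f' A(2) by (auto simp: r3 e_def[symmetric] f_def[symmetric] A_def[symmetric] o'_def[symmetric] u_def intro!: QI)
      qed
    qed (use n in \<open>simp_all add: r2\<close>)
  qed
  then show ?thesis
    unfolding search_step_def wp_Seq by (simp add: r1_def Q_def[abs_def] n_def)
qed

lemma wp_search:
  assumes opt: "optimal (s ''M'' 0) (s ''t'') (s ''h'') (s ''c'') (s ''k'') (s ''x'') (s ''y'')"
    and M: "0 \<le> s ''M'' 0" "s ''M'' 0 \<le> int q" and n: "0 \<le> s ''n'' 0" "s ''n'' 0 + 2 \<le> int q"
    and nodes: "\<And>a. a \<in> {0..<s ''M'' 0} \<Longrightarrow> s ''t'' a \<in> {0..s ''n'' 0} \<and> s ''h'' a \<in> {0..s ''n'' 0}"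
    and sg: "s ''s'' 0 \<in> {0..s ''n'' 0}" "s ''g'' 0 \<in> {0..s ''n'' 0}"
    and l: "0 < s ''l'' 0"
  shows "wp q search (\<lambda>r. optimal (s ''M'' 0) (s ''t'') (s ''h'') (s ''c'') (s ''k'') (s ''x'') (r ''y'') \<and>
     r ''y'' (s ''s'' 0) = s ''y'' (s ''s'' 0) \<and>
     r ''y'' (s ''g'' 0) = s ''y'' (s ''g'' 0) + (s ''l'' 0 - r ''l'' 0) \<and>
     (r ''l'' 0 = 0 \<or> 0 < r ''l'' 0 \<and> reaches (s ''M'' 0) (s ''t'') (s ''h'') (s ''c'') (s ''k'')
        (s ''x'') (r ''y'') (r ''p'') (r ''b'') (r ''d'') (s ''s'' 0) {0..s ''n'' 0} (s ''g'' 0))) s"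
proof -
  let ?Q = "\<lambda>r. optimal (s ''M'' 0) (s ''t'') (s ''h'') (s ''c'') (s ''k'') (s ''x'') (r ''y'') \<and>
     r ''y'' (s ''s'' 0) = s ''y'' (s ''s'' 0) \<and>
     r ''y'' (s ''g'' 0) = s ''y'' (s ''g'' 0) + (s ''l'' 0 - r ''l'' 0) \<and>
     (r ''l'' 0 = 0 \<or> 0 < r ''l'' 0 \<and> reaches (s ''M'' 0) (s ''t'') (s ''h'') (s ''c'') (s ''k'')
        (s ''x'') (r ''y'') (r ''p'') (r ''b'') (r ''d'') (s ''s'' 0) {0..s ''n'' 0} (s ''g'' 0))"
  let ?clear = "For ''i'' (Add (V ''n'') (Const 1)) (Assign ''S'' (V ''i'') (Const 0))"
  let ?loop = "While (Less (Read ''S'' (V ''g'')) (Less (Const 0) (V ''l''))) search_step"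
  have "wp q ?clear (\<lambda>r. \<forall>i\<in>{0..s ''n'' 0}. r ''S'' i = 0) s"
  proof (rule wp_For[where N = "s ''n'' 0 + 1" and I = "\<lambda>j r. \<forall>i\<in>{0..<j}. r ''S'' i = 0"])
    fix j r assume "agree (insert ''i'' (assigned (Assign ''S'' (V ''i'') (Const 0)))) s r"
    then have "r ''n'' = s ''n''" by (auto elim: agreeD)
    then show "eval_exp r (Add (V ''n'') (Const 1)) = s ''n'' 0 + 1" by simp
  qed (use n in auto)
  then have "wp q ?clear (wp q (Seq (Assign ''S'' (V ''s'') (Const 1)) ?loop) ?Q) s"
  proof (rule wp_frameI)
    fix r assume S: "\<forall>i\<in>{0..s ''n'' 0}. r ''S'' i = 0" and ag: "agree (assigned ?clear) s r"
    have r: "r x = s x" if "x \<noteq> ''i''" "x \<noteq> ''S''" for x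
      using that by (intro agreeD[OF ag]) simp
    define r1 where "r1 = r(''S'' := (r ''S'')(s ''s'' 0 := 1))"
    have r1: "r1 x = s x" if "x \<noteq> ''i''" "x \<noteq> ''S''" for x using that by (simp add: r1_def r)
    have S1: "r1 ''S'' i = (if i = s ''s'' 0 then 1 else 0)" if "i \<in> {0..s ''n'' 0}" for i
      using that S by (simp add: r1_def)
    have m1: "marked r1 = {s ''s'' 0}" using S1 sg by (auto simp: marked_def r1 split: if_splits)
    have inv1: "search_inv s r1"
      unfolding search_inv_def m1 using opt sg S1 l
      by (auto simp: r1 reaches_def intro!: exI[of _ "[]"])
    \<comment> \<open>Every round marks a new node, except for a last one that exhausts the limit;
      the additional unit in the variant pays for that one.\<close>
    have "wp q ?loop ?Q r1"
    proof (rule wp_While[where I = "search_inv s" and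
          \<mu> = "\<lambda>r. card ({0..s ''n'' 0} - marked r) + (if 0 < r ''l'' 0 then 1 else 0)"])
      show "search_inv s r1" by (rule inv1)
      have "card ({0..s ''n'' 0} - marked r1) \<le> card {0..s ''n'' 0}" by (intro card_mono) auto
      also have "\<dots> + 1 \<le> q" using n by simp
      finally show "card ({0..s ''n'' 0} - marked r1) + (if 0 < r1 ''l'' 0 then 1 else 0) \<le> q" by simp
    next
      fix r2 assume I: "search_inv s r2" and ag: "agree (assigned search_step) r1 r2"
      have r2': "r2 x = s x" if "x \<in> {''t'', ''h'', ''c'', ''k'', ''x'', ''M'', ''n'', ''g'', ''s''}" for x
      proof -
        have "r2 x = r1 x" using that by (intro agreeD[OF ag]) (auto simp: search_step_def scan_arc_def)
        also have "\<dots> = s x" using that by (intro r1) auto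
        finally show ?thesis .
      qed
      have r2: "r2 ''t'' = s ''t''" "r2 ''h'' = s ''h''" "r2 ''c'' = s ''c''" "r2 ''k'' = s ''k''"
        "r2 ''x'' = s ''x''" "r2 ''M'' = s ''M''" "r2 ''n'' = s ''n''" "r2 ''g'' = s ''g''" "r2 ''s'' = s ''s''"
        by (rule r2', simp)+
      have Sg: "r2 ''S'' (s ''g'' 0) \<in> {0, 1}" using I sg by (auto simp: search_inv_def)
      have l2: "0 \<le> r2 ''l'' 0" using I by (simp add: search_inv_def)
      {
        assume "eval_exp r2 (Less (Read ''S'' (V ''g'')) (Less (Const 0) (V ''l''))) \<noteq> 0"
        then have cont: "r2 ''S'' (s ''g'' 0) = 0" "0 < r2 ''l'' 0"
          using Sg by (auto simp: r2 split: if_splits)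
        show "wp q search_step (\<lambda>r'. search_inv s r' \<and>
          card ({0..s ''n'' 0} - marked r') + (if 0 < r' ''l'' 0 then 1 else 0) <
          card ({0..s ''n'' 0} - marked r2) + (if 0 < r2 ''l'' 0 then 1 else 0)) r2"
        proof (rule wp_frameI[OF wp_search_step[OF I]])
          fix r3 assume 3: "search_inv s r3 \<and> (r3 ''l'' 0 = 0 \<and> marked r3 = marked r2 \<or> 0 < r3 ''l'' 0 \<and>
            (\<exists>f\<in>{0..s ''n'' 0} - marked r2. marked r3 = insert f (marked r2)))"
          show "search_inv s r3 \<and>
            card ({0..s ''n'' 0} - marked r3) + (if 0 < r3 ''l'' 0 then 1 else 0) <
            card ({0..s ''n'' 0} - marked r2) + (if 0 < r2 ''l'' 0 then 1 else 0)"
          proof (cases "r3 ''l'' 0 = 0")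
            case True
            then show ?thesis using 3 cont by simp
          next
            case False
            then obtain f where "f \<in> {0..s ''n'' 0} - marked r2" "marked r3 = insert f (marked r2)"
              using 3 by auto
            then have "card ({0..s ''n'' 0} - marked r3) < card ({0..s ''n'' 0} - marked r2)"
              by (intro psubset_card_mono) auto
            then show ?thesis using 3 cont by simp
          qed
        qed (use M n nodes sg cont in \<open>simp_all add: r2\<close>)
      }
      {
        assume "eval_exp r2 (Less (Read ''S'' (V ''g'')) (Less (Const 0) (V ''l''))) = 0"
        then have "r2 ''S'' (s ''g'' 0) = 1 \<or> r2 ''l'' 0 = 0"
          using Sg l2 by (auto simp: r2 split: if_splits)
        then show "?Q r2"
        proof
          assume "r2 ''S'' (s ''g'' 0) = 1"
          then have "s ''g'' 0 \<in> marked r2" "0 < r2 ''l'' 0" "marked r2 \<subseteq> {0..s ''n'' 0}"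
            using I sg by (auto simp: marked_def r2 search_inv_def)
          then show ?thesis using I by (fastforce simp: search_inv_def reaches_def)
        qed (use I in \<open>simp add: search_inv_def\<close>)
      }
    qed
    then show "wp q (Seq (Assign ''S'' (V ''s'') (Const 1)) ?loop) ?Q r"
      by (simp add: r1_def r)
  qed
  then show ?thesis unfolding search_def by simp
qed

section \<open>Following a path and computing a minimum cost circulation\<close>

lemma wp_Seq_fun: "wp q (Seq c d) Q = wp q c (wp q d Q)"
  by (rule ext) simp

definition trace :: "com \<Rightarrow> com" where
  "trace c = Seq (Set_var ''u'' (V ''g''))
     (While (Sub (V ''u'') (V ''s'')) (Seq c (Set_var ''u'' (Read ''p'' (V ''u'')))))"

lemma assigned_trace [simp]: "assigned (trace c) = insert ''u'' (assigned c)"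
  by (auto simp: trace_def)

lemma wp_trace:
  assumes path: "pred_path (s ''s'' 0) (s ''p'') (s ''g'' 0) js" and len: "length js \<le> q"
    and c: "''s'' \<notin> assigned c" "''p'' \<notin> assigned c" "''u'' \<notin> assigned c"
    and I0: "I [] (s(''u'' := (s ''u'')(0 := s ''g'' 0)))"
    and body: "\<And>l j l' r. js = l @ j # l' \<Longrightarrow> I l r \<Longrightarrow> r ''u'' 0 = j \<Longrightarrow>
      agree (insert ''u'' (assigned c)) s r \<Longrightarrow>
      wp q c (\<lambda>r'. I (l @ [j]) (r'(''u'' := (r' ''u'')(0 := s ''p'' j)))) r"
    and exit: "\<And>r. I js r \<Longrightarrow> agree (insert ''u'' (assigned c)) s r \<Longrightarrow> Q r"
  shows "wp q (trace c) Q s"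
proof -
  let ?s = "s(''u'' := (s ''u'')(0 := s ''g'' 0))"
  let ?c = "Seq c (Set_var ''u'' (Read ''p'' (V ''u'')))"
  define J where "J r l' \<longleftrightarrow> pred_path (s ''s'' 0) (s ''p'') (r ''u'' 0) l' \<and> (\<exists>l. js = l @ l' \<and> I l r)" for r l'
  \<comment> \<open>The part of the path still to be visited is not stored anywhere. It is
    determined by the current node \<open>u\<close>, because predecessor paths to the same end are
    unique, so its length can serve as variant.\<close>
  define \<mu> where "\<mu> r = (LEAST k. \<exists>l'. length l' = k \<and> J r l')" for r
  have uniq: "l = l'" if "pred_path w p i l" "pred_path w p i l'" for w p i and l l' :: "int list"
    using that
  proof (induction l arbitrary: i l')
    case Nil then show ?case by (cases l') auto
  next
    case (Cons j l) then show ?case by (cases l') auto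
  qed
  have \<mu>: "\<mu> r = length l'" if "J r l'" for r l'
    unfolding \<mu>_def
  proof (rule Least_equality)
    fix k assume "\<exists>l. length l = k \<and> J r l"
    then show "length l' \<le> k" using uniq that unfolding J_def by blast
  qed (use that in auto)
  have J0: "J ?s js" using path I0 by (auto simp: J_def)
  have "wp q (While (Sub (V ''u'') (V ''s'')) ?c) Q ?s"
  proof (rule wp_While[where I = "\<lambda>r. \<exists>l'. J r l'" and \<mu> = \<mu>])
    show "\<exists>l'. J ?s l'" using J0 by blast
    show "\<mu> ?s \<le> q" using \<mu>[OF J0] len by simp
  next
    fix r assume "\<exists>l'. J r l'" and ag: "agree (assigned ?c) ?s r"
    then obtain l' where J: "J r l'" by blast
    have ag': "agree (insert ''u'' (assigned c)) s r" using ag by (auto simp: agree_def)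
    have r: "r ''s'' = s ''s''" "r ''p'' = s ''p''" by (rule agreeD[OF ag'], simp add: c)+
    {
      assume "eval_exp r (Sub (V ''u'') (V ''s'')) \<noteq> 0"
      then have "l' \<noteq> []" using J by (auto simp: J_def r)
      then obtain j l'' where l': "l' = j # l''" by (cases l') auto
      with J obtain l where l: "js = l @ j # l''" "I l r" "r ''u'' 0 = j"
        "pred_path (s ''s'' 0) (s ''p'') (s ''p'' j) l''" by (auto simp: J_def)
      from body[OF l(1,2,3) ag'] have
        "wp q c (\<lambda>r'. I (l @ [j]) (r'(''u'' := (r' ''u'')(0 := s ''p'' j)))) r" .
      then have "wp q c (wp q (Set_var ''u'' (Read ''p'' (V ''u''))) (\<lambda>r'. (\<exists>l'. J r' l') \<and> \<mu> r' < \<mu> r)) r"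
      proof (rule wp_frameI)
        fix r' assume I: "I (l @ [j]) (r'(''u'' := (r' ''u'')(0 := s ''p'' j)))"
          and a: "agree (assigned c) r r'"
        have r': "r' ''u'' = r ''u''" "r' ''p'' = s ''p''"
          using agreeD[OF a, of "''u''"] agreeD[OF a, of "''p''"] c r by auto
        have J': "J (r'(''u'' := (r' ''u'')(0 := s ''p'' j))) l''"
          unfolding J_def using l I by (auto intro!: exI[of _ "l @ [j]"])
        show "wp q (Set_var ''u'' (Read ''p'' (V ''u''))) (\<lambda>r'. (\<exists>l'. J r' l') \<and> \<mu> r' < \<mu> r) r'"
          using J' \<mu>[OF J'] \<mu>[OF J] l' by (auto simp: r' l(3))
      qed
      then show "wp q ?c (\<lambda>r'. (\<exists>l'. J r' l') \<and> \<mu> r' < \<mu> r) r" by simp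
    }
    {
      assume "eval_exp r (Sub (V ''u'') (V ''s'')) = 0"
      then have "r ''u'' 0 = s ''s'' 0" by (simp add: r)
      then have "l' = []" using J pred_path_distinct[of _ _ _ l'] by (cases l') (auto simp: J_def)
      then have "I js r" using J by (auto simp: J_def)
      then show "Q r" using ag' by (rule exit)
    }
  qed
  then show ?thesis by (simp add: trace_def)
qed

definition augment :: com where
  "augment = trace (Assign ''x'' (Read ''b'' (V ''u''))
     (Add (Read ''x'' (Read ''b'' (V ''u''))) (Read ''d'' (V ''u''))))"

lemma wp_augment:
  assumes "pred_path (s ''s'' 0) (s ''p'') (s ''g'' 0) js" "length js \<le> q"
  shows "wp q augment (\<lambda>r. r ''x'' = push 1 (s ''b'') (s ''d'') js (s ''x'')) s"
  unfolding augment_def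
proof (rule wp_trace[where I = "\<lambda>l r. r ''x'' = push 1 (s ''b'') (s ''d'') l (s ''x'')", OF assms])
  fix l j l' r
  assume "r ''x'' = push 1 (s ''b'') (s ''d'') l (s ''x'')" "r ''u'' 0 = j"
    and ag: "agree (insert ''u'' (assigned (Assign ''x'' (Read ''b'' (V ''u''))
     (Add (Read ''x'' (Read ''b'' (V ''u''))) (Read ''d'' (V ''u'')))))) s r"
  moreover have "r ''b'' = s ''b''" "r ''d'' = s ''d''" by (rule agreeD[OF ag], simp)+
  ultimately show "wp q (Assign ''x'' (Read ''b'' (V ''u''))
     (Add (Read ''x'' (Read ''b'' (V ''u''))) (Read ''d'' (V ''u''))))
     (\<lambda>r'. (r'(''u'' := (r' ''u'')(0 := s ''p'' j))) ''x'' = push 1 (s ''b'') (s ''d'') (l @ [j]) (s ''x'')) r"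
    by (simp add: push_snoc)
qed simp_all

text \<open>
  Raising the capacity of \<open>a\<close> can only violate the optimality condition of \<open>a\<close> itself, by its reduced cost
  \<open>r\<close>.  Either the search raises the potential of the tail by \<open>-r\<close>, or one unit is sent around the cycle found.
\<close>

definition raise_capacity :: com where
  "raise_capacity =
    Seq (Set_var ''r'' (reduced_cost (V ''a'')))
    (Seq (If (Less (V ''r'') (Const 0))
      (Seq (Set_var ''s'' (Read ''h'' (V ''a'')))
      (Seq (Set_var ''g'' (Read ''t'' (V ''a'')))
      (Seq (Set_var ''l'' (Sub (Const 0) (V ''r'')))
      (Seq search
      (If (Less (Const 0) (V ''l''))
        (Seq augment (Assign ''x'' (V ''a'') (Add (Read ''x'' (V ''a'')) (Const 1))))
        Skip)))))
      Skip)
    (Assign ''k'' (V ''a'') (Add (Read ''k'' (V ''a'')) (Const 1))))"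

text \<open>The bound \<open>n + 2\<close> admits one search round for each of the nodes
  \<open>0\<close> to \<open>n\<close> and one more that exhausts the limit.\<close>

definition good_state :: "memory \<Rightarrow> nat \<Rightarrow> bool" where
  "good_state s q \<longleftrightarrow>
     optimal (s ''M'' 0) (s ''t'') (s ''h'') (s ''c'') (s ''k'') (s ''x'') (s ''y'') \<and>
     circulation (s ''M'' 0) (s ''t'') (s ''h'') (s ''x'') \<and>
     0 \<le> s ''M'' 0 \<and> s ''M'' 0 \<le> int q \<and> 0 \<le> s ''n'' 0 \<and> s ''n'' 0 + 2 \<le> int q \<and>
     (\<forall>a\<in>{0..<s ''M'' 0}. s ''t'' a \<in> {0..s ''n'' 0} \<and> s ''h'' a \<in> {0..s ''n'' 0})"

definition search_vars :: "string set" where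
  "search_vars = {''r'', ''s'', ''g'', ''l'', ''i'', ''S'', ''e'', ''f'', ''v'', ''A'', ''o'', ''y'', ''b'', ''d'', ''p'', ''u''}"

lemma search_frame:
  assumes "agree (assigned search) s r"
  shows "x \<notin> {''i'', ''S'', ''e'', ''f'', ''l'', ''v'', ''r'', ''A'', ''o'', ''y'', ''b'', ''d'', ''p''} \<Longrightarrow> r x = s x"
  by (rule agreeD[OF assms]) (auto simp: search_def search_step_def scan_arc_def)

lemma assigned_raise_capacity: "assigned raise_capacity \<subseteq> insert ''x'' (insert ''k'' search_vars)"
  by (auto simp: raise_capacity_def augment_def search_def search_step_def scan_arc_def search_vars_def)

lemma reaches_length:
  assumes "pred_path w p j js" "set js \<subseteq> {0..n}" "0 \<le> n" "n + 2 \<le> int q"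
  shows "length js \<le> q"
proof -
  have "length js = card (set js)" using pred_path_distinct[OF assms(1)] by (simp add: distinct_card)
  also have "\<dots> \<le> card {0..n}" by (intro card_mono assms(2)) auto
  finally show ?thesis using assms(3,4) by simp
qed

lemma wp_raise_capacity:
  assumes good: "good_state s q" and a: "s ''a'' 0 \<in> {0..<s ''M'' 0}"
  shows "wp q raise_capacity
    (\<lambda>r. good_state r q \<and> r ''k'' = (s ''k'')(s ''a'' 0 := s ''k'' (s ''a'' 0) + 1)) s"
proof -
  define a where "a = s ''a'' 0"
  have a': "a \<in> {0..<s ''M'' 0}" using assms by (simp add: a_def)
  define \<rho> where "\<rho> = s ''c'' a + s ''y'' (s ''t'' a) - s ''y'' (s ''h'' a)"
  have opt: "optimal (s ''M'' 0) (s ''t'') (s ''h'') (s ''c'') (s ''k'') (s ''x'') (s ''y'')"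
    and circ: "circulation (s ''M'' 0) (s ''t'') (s ''h'') (s ''x'')"
    and dim: "0 \<le> s ''M'' 0" "s ''M'' 0 \<le> int q" "0 \<le> s ''n'' 0" "s ''n'' 0 + 2 \<le> int q"
    and nodes: "\<And>a. a \<in> {0..<s ''M'' 0} \<Longrightarrow> s ''t'' a \<in> {0..s ''n'' 0} \<and> s ''h'' a \<in> {0..s ''n'' 0}"
    using good by (auto simp: good_state_def)
  show ?thesis
  proof (cases "\<rho> < 0")
    case False
    define r where "r = s(''r'' := (s ''r'')(0 := \<rho>), ''k'' := (s ''k'')(a := s ''k'' a + 1))"
    have "optimal (s ''M'' 0) (s ''t'') (s ''h'') (s ''c'') ((s ''k'')(a := s ''k'' a + 1)) (s ''x'') (s ''y'')"
      by (rule optimal_raise_capacity[OF opt]) (use False in \<open>simp add: \<rho>_def\<close>)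
    then have "good_state r q" unfolding good_state_def using circ dim nodes by (simp add: r_def)
    then show ?thesis using False
      by (simp add: raise_capacity_def reduced_cost_def a_def[symmetric] \<rho>_def[symmetric] r_def)
  next
    case True
    define r where "r = s(''r'' := (s ''r'')(0 := \<rho>), ''s'' := (s ''s'')(0 := s ''h'' a),
      ''g'' := (s ''g'')(0 := s ''t'' a), ''l'' := (s ''l'')(0 := - \<rho>))"
    have r: "r ''M'' = s ''M''" "r ''t'' = s ''t''" "r ''h'' = s ''h''" "r ''c'' = s ''c''" "r ''k'' = s ''k''"
      "r ''x'' = s ''x''" "r ''y'' = s ''y''" "r ''n'' = s ''n''" "r ''s'' 0 = s ''h'' a" "r ''g'' 0 = s ''t'' a"
      "r ''l'' 0 = - \<rho>" "r ''a'' = s ''a''"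
      by (simp_all add: r_def)
    define Q where "Q r' \<longleftrightarrow> good_state r' q \<and> r' ''k'' = (s ''k'')(a := s ''k'' a + 1)" for r'
    have "wp q search (\<lambda>r'. optimal (s ''M'' 0) (s ''t'') (s ''h'') (s ''c'') (s ''k'') (s ''x'') (r' ''y'') \<and>
       r' ''y'' (s ''h'' a) = s ''y'' (s ''h'' a) \<and>
       r' ''y'' (s ''t'' a) = s ''y'' (s ''t'' a) + (- \<rho> - r' ''l'' 0) \<and>
       (r' ''l'' 0 = 0 \<or> 0 < r' ''l'' 0 \<and> reaches (s ''M'' 0) (s ''t'') (s ''h'') (s ''c'') (s ''k'')
        (s ''x'') (r' ''y'') (r' ''p'') (r' ''b'') (r' ''d'') (s ''h'' a) {0..s ''n'' 0} (s ''t'' a))) r"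
      by (rule wp_search[of r, unfolded r])
        (use opt dim nodes nodes[OF a'] True in auto)
    then have "wp q search (wp q (Seq (If (Less (Const 0) (V ''l''))
        (Seq augment (Assign ''x'' (V ''a'') (Add (Read ''x'' (V ''a'')) (Const 1)))) Skip)
        (Assign ''k'' (V ''a'') (Add (Read ''k'' (V ''a'')) (Const 1)))) Q) r"
    proof (rule wp_frameI)
      fix r1 assume r1: "optimal (s ''M'' 0) (s ''t'') (s ''h'') (s ''c'') (s ''k'') (s ''x'') (r1 ''y'') \<and>
       r1 ''y'' (s ''h'' a) = s ''y'' (s ''h'' a) \<and>
       r1 ''y'' (s ''t'' a) = s ''y'' (s ''t'' a) + (- \<rho> - r1 ''l'' 0) \<and>
       (r1 ''l'' 0 = 0 \<or> 0 < r1 ''l'' 0 \<and> reaches (s ''M'' 0) (s ''t'') (s ''h'') (s ''c'') (s ''k'')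
        (s ''x'') (r1 ''y'') (r1 ''p'') (r1 ''b'') (r1 ''d'') (s ''h'' a) {0..s ''n'' 0} (s ''t'' a))"
        and ag: "agree (assigned search) r r1"
      have eq: "r1 ''M'' = s ''M''" "r1 ''t'' = s ''t''" "r1 ''h'' = s ''h''" "r1 ''c'' = s ''c''" "r1 ''k'' = s ''k''"
        "r1 ''x'' = s ''x''" "r1 ''n'' = s ''n''" "r1 ''s'' 0 = s ''h'' a" "r1 ''g'' 0 = s ''t'' a" "r1 ''a'' = s ''a''"
        by (simp_all add: search_frame[OF ag] r)
      \<comment> \<open>The search started at the head of \<open>a\<close>, whose potential is
        unchanged, and aimed at its tail, whose potential rose by the part of
        \<open>- \<rho>\<close> that was spent. The reduced cost of \<open>a\<close> is therefore
        the negative of what is left.\<close>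
      have rc: "s ''c'' a + r1 ''y'' (s ''t'' a) - r1 ''y'' (s ''h'' a) = - r1 ''l'' 0"
        using r1 by (simp add: \<rho>_def)
      show "wp q (Seq (If (Less (Const 0) (V ''l''))
        (Seq augment (Assign ''x'' (V ''a'') (Add (Read ''x'' (V ''a'')) (Const 1)))) Skip)
        (Assign ''k'' (V ''a'') (Add (Read ''k'' (V ''a'')) (Const 1)))) Q r1"
      proof (cases "r1 ''l'' 0 = 0")
        case True
        define r2 where "r2 = r1(''k'' := (s ''k'')(a := s ''k'' a + 1))"
        have "optimal (s ''M'' 0) (s ''t'') (s ''h'') (s ''c'') ((s ''k'')(a := s ''k'' a + 1)) (s ''x'') (r1 ''y'')"
          by (rule optimal_raise_capacity) (use r1 rc True in auto)
        then have "Q r2" unfolding Q_def good_state_def using circ dim nodes by (simp add: r2_def eq)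
        then show ?thesis using True by (simp add: eq r2_def a_def[symmetric])
      next
        case False
        with r1 obtain js where l: "0 < r1 ''l'' 0" and js: "pred_path (s ''h'' a) (r1 ''p'') (s ''t'' a) js"
          "set js \<subseteq> {0..s ''n'' 0}"
          "\<And>i. i \<in> set js \<Longrightarrow> entered (s ''M'' 0) (s ''t'') (s ''h'') (s ''k'') (s ''x'') (r1 ''p'') (r1 ''b'') (r1 ''d'') i"
          "\<And>i. i \<in> set js \<Longrightarrow> s ''c'' (r1 ''b'' i) + r1 ''y'' (s ''t'' (r1 ''b'' i)) - r1 ''y'' (s ''h'' (r1 ''b'' i)) = 0"
          by (auto simp: reaches_def)
        define x' where "x' = push 1 (r1 ''b'') (r1 ''d'') js (s ''x'')"
        have opt1: "optimal (s ''M'' 0) (s ''t'') (s ''h'') (s ''c'') (s ''k'') (s ''x'') (r1 ''y'')"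
          using r1 by blast
        have neg: "s ''c'' a + r1 ''y'' (s ''t'' a) - r1 ''y'' (s ''h'' a) < 0" using rc l by simp
        note aug = optimal_augment[OF opt1 a' neg js(1,3,4), folded x'_def]
        have circ': "circulation (s ''M'' 0) (s ''t'') (s ''h'') (x'(a := s ''x'' a + 1))"
          unfolding x'_def by (rule circulation_push[OF circ a' js(1,3) aug(2)])
        have xa: "x' a = s ''x'' a" unfolding x'_def by (rule push_other[OF aug(2)])
        have "wp q augment (\<lambda>r. r ''x'' = x') r1"
          unfolding x'_def using wp_augment[of r1 js q] js(1) reaches_length[OF js(1,2) dim(3,4)] by (simp add: eq)
        then have "wp q augment (wp q (Assign ''x'' (V ''a'') (Add (Read ''x'' (V ''a'')) (Const 1)))
           (wp q (Assign ''k'' (V ''a'') (Add (Read ''k'' (V ''a'')) (Const 1))) Q)) r1"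
        proof (rule wp_frameI)
          fix r2 assume x2: "r2 ''x'' = x'" and ag2: "agree (assigned augment) r1 r2"
          have ag2': "r2 z = r1 z" if "z \<notin> {''u'', ''x''}" for z
            using that by (intro agreeD[OF ag2]) (simp add: augment_def)
          have eq2: "r2 ''M'' = s ''M''" "r2 ''t'' = s ''t''" "r2 ''h'' = s ''h''" "r2 ''c'' = s ''c''" "r2 ''k'' = s ''k''"
            "r2 ''n'' = s ''n''" "r2 ''a'' = s ''a''" "r2 ''y'' = r1 ''y''"
            by (simp_all add: ag2' eq)
          define r3 where "r3 = r2(''x'' := x'(a := s ''x'' a + 1), ''k'' := (s ''k'')(a := s ''k'' a + 1))"
          have "Q r3" unfolding Q_def good_state_def
            using aug(1) circ' dim nodes by (simp add: r3_def eq2)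
          then show "wp q (Assign ''x'' (V ''a'') (Add (Read ''x'' (V ''a'')) (Const 1)))
             (wp q (Assign ''k'' (V ''a'') (Add (Read ''k'' (V ''a'')) (Const 1))) Q) r2"
            by (simp add: eq2 x2 r3_def a_def[symmetric] xa)
        qed
        then show ?thesis using l by simp
      qed
    qed
    then show ?thesis using True
      by (simp add: wp_Seq_fun raise_capacity_def reduced_cost_def a_def[symmetric] \<rho>_def[symmetric] r_def Q_def[abs_def])
  qed
qed

definition scale_arc :: com where
  "scale_arc =
    Seq (Assign ''k'' (V ''a'') (Add (Read ''k'' (V ''a'')) (Read ''k'' (V ''a''))))
      (Assign ''x'' (V ''a'') (Add (Read ''x'' (V ''a'')) (Read ''x'' (V ''a''))))"

text \<open>
  Capacity scaling: the capacities are \<open>\<lfloor>U / P\<rfloor>\<close> for decreasing powers \<open>P\<close> of two.  Halving \<open>P\<close> doubles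
  flow and capacities, up to one unit per arc.
\<close>

definition min_cost :: com where
  "min_cost =
    While (Less (Const 1) (V ''P''))
      (Seq (Set_var ''P'' (Quot (V ''P'') (Const 2)))
      (Seq (For ''a'' (V ''M'') scale_arc)
      (For ''a'' (V ''M'')
        (If (Less (Read ''k'' (V ''a'')) (Quot (Read ''U'' (V ''a'')) (V ''P''))) raise_capacity Skip))))"

lemma wp_scale:
  assumes M: "0 \<le> s ''M'' 0" "s ''M'' 0 \<le> int q"
  shows "wp q (For ''a'' (V ''M'') scale_arc) (\<lambda>r. \<forall>a\<in>{0..<s ''M'' 0}. r ''k'' a = 2 * s ''k'' a \<and> r ''x'' a = 2 * s ''x'' a) s"
proof (rule wp_For[where N = "s ''M'' 0" and I = "\<lambda>j r. \<forall>a. r ''k'' a = (if a \<in> {0..<j} then 2 * s ''k'' a else s ''k'' a) \<and>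
    r ''x'' a = (if a \<in> {0..<j} then 2 * s ''x'' a else s ''x'' a)"])
  fix j r assume ag: "agree (insert ''a'' (assigned scale_arc)) s r"
  show "eval_exp r (V ''M'') = s ''M'' 0" using agreeD[OF ag, of "''M''"] by (simp add: scale_arc_def)
  assume "\<forall>a. r ''k'' a = (if a \<in> {0..<j} then 2 * s ''k'' a else s ''k'' a) \<and>
    r ''x'' a = (if a \<in> {0..<j} then 2 * s ''x'' a else s ''x'' a)" "r ''a'' 0 = j" "0 \<le> j"
  then show "wp q scale_arc (\<lambda>r'. (\<forall>a. (r'(''a'' := (r' ''a'')(0 := j + 1))) ''k'' a = (if a \<in> {0..<j + 1} then 2 * s ''k'' a else s ''k'' a) \<and>
    (r'(''a'' := (r' ''a'')(0 := j + 1))) ''x'' a = (if a \<in> {0..<j + 1} then 2 * s ''x'' a else s ''x'' a)) \<and> r' ''a'' 0 = j) r"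
    by (auto simp: scale_arc_def)
qed (use M in auto)

lemma optimal_cong:
  assumes "optimal M t h c k x \<pi>" "\<And>a. a \<in> {0..<M} \<Longrightarrow> k' a = k a \<and> x' a = x a"
  shows "optimal M t h c k' x' \<pi>"
  using assms by (simp add: optimal_def)

lemma circulation_cong:
  assumes "circulation M t h x" "\<And>a. a \<in> {0..<M} \<Longrightarrow> x' a = x a"
  shows "circulation M t h x'"
  using assms by (simp add: circulation_def)

lemma wp_min_cost:
  assumes good: "good_state s q" and P: "s ''P'' 0 = 2 ^ j" "j < q"
    and U: "\<And>a. a \<in> {0..<s ''M'' 0} \<Longrightarrow> 0 \<le> s ''U'' a \<and> s ''k'' a = s ''U'' a div 2 ^ j"
  shows "wp q min_cost (\<lambda>r. good_state r q \<and> (\<forall>a\<in>{0..<s ''M'' 0}. r ''k'' a = s ''U'' a)) s"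
  unfolding min_cost_def
proof (rule wp_While[where \<mu> = "\<lambda>r. nat (bitlen (r ''P'' 0))" and
    I = "\<lambda>r. good_state r q \<and> (\<exists>j. r ''P'' 0 = 2 ^ j) \<and>
      (\<forall>a\<in>{0..<s ''M'' 0}. r ''k'' a = s ''U'' a div r ''P'' 0)"])
  show "good_state s q \<and> (\<exists>j. s ''P'' 0 = 2 ^ j) \<and>
      (\<forall>a\<in>{0..<s ''M'' 0}. s ''k'' a = s ''U'' a div s ''P'' 0)"
    using good P U by auto
  have "bitlen (2 ^ j) = int j + 1" using bitlen_pow2[of 1 j] by (simp add: bitlen_def floorlog_def)
  then show "nat (bitlen (s ''P'' 0)) \<le> q" using P by simp
next
  fix r
  let ?body = "Seq (Set_var ''P'' (Quot (V ''P'') (Const 2)))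
      (Seq (For ''a'' (V ''M'') scale_arc)
      (For ''a'' (V ''M'')
        (If (Less (Read ''k'' (V ''a'')) (Quot (Read ''U'' (V ''a'')) (V ''P''))) raise_capacity Skip)))"
  assume I: "good_state r q \<and> (\<exists>j. r ''P'' 0 = 2 ^ j) \<and>
      (\<forall>a\<in>{0..<s ''M'' 0}. r ''k'' a = s ''U'' a div r ''P'' 0)"
    and ag: "agree (assigned ?body) s r"
  have ag0: "r x = s x" if "x \<notin> {''P'', ''a'', ''x'', ''k''}" "x \<notin> search_vars" for x
    by (rule agreeD[OF ag]) (use that assigned_raise_capacity in \<open>auto simp: scale_arc_def\<close>)
  have r: "r ''M'' = s ''M''" "r ''U'' = s ''U''" by (rule ag0; simp add: search_vars_def)+
  {
    assume "eval_exp r (Less (Const 1) (V ''P'')) = 0"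
    then have "r ''P'' 0 \<le> 1" by (simp split: if_splits)
    moreover obtain i where i: "r ''P'' 0 = 2 ^ i" using I by blast
    ultimately have "r ''P'' 0 = 1" by (simp add: order_antisym)
    then show "good_state r q \<and> (\<forall>a\<in>{0..<s ''M'' 0}. r ''k'' a = s ''U'' a)" using I by simp
  }
  assume "eval_exp r (Less (Const 1) (V ''P'')) \<noteq> 0"
  then have "1 < r ''P'' 0" by (simp split: if_splits)
  moreover obtain i where "r ''P'' 0 = 2 ^ i" using I by blast
  ultimately obtain i where i: "r ''P'' 0 = 2 ^ Suc i" by (cases i) auto
  define P where "P = (2::int) ^ i"
  have P0: "0 < P" by (simp add: P_def)
  define r1 where "r1 = r(''P'' := (r ''P'')(0 := P))"
  define Q where "Q r' \<longleftrightarrow> (good_state r' q \<and> (\<exists>j. r' ''P'' 0 = 2 ^ j) \<and>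
      (\<forall>a\<in>{0..<s ''M'' 0}. r' ''k'' a = s ''U'' a div r' ''P'' 0)) \<and>
      nat (bitlen (r' ''P'' 0)) < nat (bitlen (r ''P'' 0))" for r'
  have dim: "0 \<le> s ''M'' 0" "s ''M'' 0 \<le> int q" using I by (auto simp: good_state_def r)
  have bl: "nat (bitlen P) < nat (bitlen (r ''P'' 0))"
    unfolding P_def i using bitlen_pow2[of 1 i] bitlen_pow2[of 1 "Suc i"] by (simp add: bitlen_def floorlog_def)
  have "wp q (For ''a'' (V ''M'') scale_arc) (\<lambda>r'. \<forall>a\<in>{0..<s ''M'' 0}. r' ''k'' a = 2 * r ''k'' a \<and> r' ''x'' a = 2 * r ''x'' a) r1"
    using wp_scale[of r1 q] dim by (simp add: r1_def r)
  then have "wp q (For ''a'' (V ''M'') scale_arc) (wp q (For ''a'' (V ''M'')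
        (If (Less (Read ''k'' (V ''a'')) (Quot (Read ''U'' (V ''a'')) (V ''P''))) raise_capacity Skip)) Q) r1"
  proof (rule wp_frameI)
    fix r2 assume kx: "\<forall>a\<in>{0..<s ''M'' 0}. r2 ''k'' a = 2 * r ''k'' a \<and> r2 ''x'' a = 2 * r ''x'' a"
      and ag2: "agree (assigned (For ''a'' (V ''M'') scale_arc)) r1 r2"
    have ag2': "r2 z = r1 z" if "z \<notin> {''a'', ''k'', ''x''}" for z
      using that by (intro agreeD[OF ag2]) (simp add: scale_arc_def)
    have r2: "r2 ''M'' = s ''M''" "r2 ''U'' = s ''U''" "r2 ''P'' 0 = P" "r2 ''t'' = r ''t''" "r2 ''h'' = r ''h''"
      "r2 ''c'' = r ''c''" "r2 ''y'' = r ''y''" "r2 ''n'' = r ''n''"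
      by (simp_all add: ag2') (simp_all add: r1_def r)
    have good2: "good_state r2 q"
      unfolding good_state_def r2
    proof (intro conjI)
      show "optimal (s ''M'' 0) (r ''t'') (r ''h'') (r ''c'') (r2 ''k'') (r2 ''x'') (r ''y'')"
        by (rule optimal_cong[OF optimal_double[of _ _ _ _ "r ''k''" "r ''x''"]]) (use I kx in \<open>auto simp: good_state_def r\<close>)
      show "circulation (s ''M'' 0) (r ''t'') (r ''h'') (r2 ''x'')"
        by (rule circulation_cong[OF circulation_double[of _ _ _ "r ''x''"]]) (use I kx in \<open>auto simp: good_state_def r\<close>)
    qed (use I in \<open>auto simp: good_state_def r\<close>)
    \<comment> \<open>Doubling \<open>U div (2 * P)\<close> gives \<open>U div P\<close> up to its
      last binary digit, so at most one call of \<open>raise_capacity\<close> per arc is called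
      for.\<close>
    have k2: "r2 ''k'' a \<in> {s ''U'' a div P, s ''U'' a div P - 1}" if "a \<in> {0..<s ''M'' 0}" for a
    proof -
      have "r2 ''k'' a = 2 * (s ''U'' a div (P * 2))" using kx that I i by (auto simp: P_def mult.commute)
      also have "s ''U'' a div (P * 2) = s ''U'' a div P div 2" by (simp add: zdiv_zmult2_eq)
      finally show ?thesis by auto
    qed
    show "wp q (For ''a'' (V ''M'')
        (If (Less (Read ''k'' (V ''a'')) (Quot (Read ''U'' (V ''a'')) (V ''P''))) raise_capacity Skip)) Q r2"
    proof (rule wp_For[where N = "s ''M'' 0" and I = "\<lambda>j r3. good_state r3 q \<and>
        (\<forall>a\<in>{0..<j}. r3 ''k'' a = s ''U'' a div P) \<and> (\<forall>a\<in>{j..<s ''M'' 0}. r3 ''k'' a = r2 ''k'' a)"])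
      fix j r3
      assume ag3: "agree (insert ''a'' (assigned (If (Less (Read ''k'' (V ''a''))
        (Quot (Read ''U'' (V ''a'')) (V ''P''))) raise_capacity Skip))) r2 r3"
      have ag3': "r3 z = r2 z" if "z \<notin> {''a'', ''x'', ''k''}" "z \<notin> search_vars" for z
        by (rule agreeD[OF ag3]) (use that assigned_raise_capacity in auto)
      have r3: "r3 ''M'' = s ''M''" "r3 ''U'' = s ''U''" "r3 ''P'' 0 = P"
        by (simp_all add: ag3' search_vars_def r2)
      show "eval_exp r3 (V ''M'') = s ''M'' 0" by (simp add: r3)
      assume I3: "good_state r3 q \<and>
        (\<forall>a\<in>{0..<j}. r3 ''k'' a = s ''U'' a div P) \<and> (\<forall>a\<in>{j..<s ''M'' 0}. r3 ''k'' a = r2 ''k'' a)"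
        and j: "0 \<le> j" "j < s ''M'' 0" "r3 ''a'' 0 = j"
      have set_a: "good_state (r'(''a'' := z)) q = good_state r' q" for r' z
        by (simp add: good_state_def)
      have ivl: "{0..<j + 1} = insert j {0..<j}" "{j..<s ''M'' 0} = insert j {j + 1..<s ''M'' 0}"
        using j by auto
      show "wp q (If (Less (Read ''k'' (V ''a''))
          (Quot (Read ''U'' (V ''a'')) (V ''P''))) raise_capacity Skip)
        (\<lambda>r'. (good_state (r'(''a'' := (r' ''a'')(0 := j + 1))) q \<and>
          (\<forall>a\<in>{0..<j + 1}. (r'(''a'' := (r' ''a'')(0 := j + 1))) ''k'' a = s ''U'' a div P) \<and>
          (\<forall>a\<in>{j + 1..<s ''M'' 0}. (r'(''a'' := (r' ''a'')(0 := j + 1))) ''k'' a = r2 ''k'' a)) \<and>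
          r' ''a'' 0 = j) r3"
      proof (cases "r3 ''k'' j < s ''U'' j div P")
        case True
        then have kj: "r3 ''k'' j + 1 = s ''U'' j div P" using k2[of j] I3 j by auto
        have "wp q raise_capacity (\<lambda>r. good_state r q \<and> r ''k'' = (r3 ''k'')(j := r3 ''k'' j + 1)) r3"
          using wp_raise_capacity[of r3 q] I3 j by (simp add: r3)
        then have "wp q raise_capacity (\<lambda>r'. (good_state (r'(''a'' := (r' ''a'')(0 := j + 1))) q \<and>
          (\<forall>a\<in>{0..<j + 1}. (r'(''a'' := (r' ''a'')(0 := j + 1))) ''k'' a = s ''U'' a div P) \<and>
          (\<forall>a\<in>{j + 1..<s ''M'' 0}. (r'(''a'' := (r' ''a'')(0 := j + 1))) ''k'' a = r2 ''k'' a)) \<and>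
          r' ''a'' 0 = j) r3"
        proof (rule wp_frameI)
          fix r4 assume 4: "good_state r4 q \<and> r4 ''k'' = (r3 ''k'')(j := r3 ''k'' j + 1)"
            and ag4: "agree (assigned raise_capacity) r3 r4"
          have "r4 ''a'' = r3 ''a''"
            by (rule agreeD[OF ag4]) (use assigned_raise_capacity in \<open>auto simp: search_vars_def\<close>)
          then show "(good_state (r4(''a'' := (r4 ''a'')(0 := j + 1))) q \<and>
          (\<forall>a\<in>{0..<j + 1}. (r4(''a'' := (r4 ''a'')(0 := j + 1))) ''k'' a = s ''U'' a div P) \<and>
          (\<forall>a\<in>{j + 1..<s ''M'' 0}. (r4(''a'' := (r4 ''a'')(0 := j + 1))) ''k'' a = r2 ''k'' a)) \<and>
          r4 ''a'' 0 = j"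
            using 4 I3 kj j by (auto simp: set_a ivl)
        qed
        then show ?thesis using True j by (simp add: r3)
      next
        case False
        then have "r3 ''k'' j = s ''U'' j div P" using k2[of j] I3 j by auto
        then show ?thesis using I3 j by (auto simp: r3 set_a ivl)
      qed
    next
      fix r3
      assume ag3: "agree (insert ''a'' (assigned (If (Less (Read ''k'' (V ''a''))
        (Quot (Read ''U'' (V ''a'')) (V ''P''))) raise_capacity Skip))) r2 r3"
        and I3: "good_state r3 q \<and> (\<forall>a\<in>{0..<s ''M'' 0}. r3 ''k'' a = s ''U'' a div P) \<and>
          (\<forall>a\<in>{s ''M'' 0..<s ''M'' 0}. r3 ''k'' a = r2 ''k'' a)"
      have "r3 ''P'' = r2 ''P''"
        by (rule agreeD[OF ag3]) (use assigned_raise_capacity in \<open>auto simp: search_vars_def\<close>)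
      then show "Q r3" using I3 bl by (auto simp: Q_def r2 P_def)
    qed (use dim good2 in \<open>auto simp: good_state_def\<close>)
  qed
  then show "wp q ?body (\<lambda>r'. (good_state r' q \<and> (\<exists>j. r' ''P'' 0 = 2 ^ j) \<and>
      (\<forall>a\<in>{0..<s ''M'' 0}. r' ''k'' a = s ''U'' a div r' ''P'' 0)) \<and>
      nat (bitlen (r' ''P'' 0)) < nat (bitlen (r ''P'' 0))) r"
    by (simp add: Q_def[abs_def] r1_def i P_def)
qed

section \<open>Averaging a flow over time\<close>

lemma set_integrable_lebesgue_subset:
  fixes f :: "real \<Rightarrow> real"
  assumes "set_integrable lebesgue {0..<T} f" "\<theta> \<le> T"
  shows "set_integrable lebesgue {0..<\<theta>} f"
  by (rule set_integrable_subset[OF assms(1)]) (use assms(2) in auto)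

text \<open>Every unit of flow on an arc is in transit for exactly \<open>\<tau>\<close> time units.\<close>

lemma transit_integral:
  fixes f :: "real \<Rightarrow> real"
  assumes int: "set_integrable lebesgue {0..<T} f" and T: "0 \<le> T" and \<tau>: "0 \<le> \<tau>"
    and zero: "\<And>\<theta>. 0 \<le> \<theta> \<Longrightarrow> \<theta> < T \<Longrightarrow> T - \<tau> \<le> \<theta> \<Longrightarrow> f \<theta> = 0"
  defines "F \<theta> \<equiv> set_lebesgue_integral lebesgue {0..<\<theta>} f"
  shows "F (T - \<tau>) = F T"
    and "((\<lambda>\<theta>. F \<theta> - F (\<theta> - \<tau>)) has_integral \<tau> * F T) {0..T}"
proof -
  have F: "F \<theta> = integral UNIV (\<lambda>x. if x \<in> {0..<\<theta>} then f x else 0)" if "\<theta> \<le> T" for \<theta>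
    unfolding F_def integral_restrict_UNIV
    by (rule set_lebesgue_integral_eq_integral) (rule set_integrable_lebesgue_subset[OF int that])
  have late: "F \<theta> = F T" if "T - \<tau> \<le> \<theta>" "\<theta> \<le> T" for \<theta>
  proof -
    have "(\<lambda>x. if x \<in> {0..<\<theta>} then f x else 0) = (\<lambda>x. if x \<in> {0..<T} then f x else 0)"
    proof
      fix x
      show "(if x \<in> {0..<\<theta>} then f x else 0) = (if x \<in> {0..<T} then f x else 0)"
        using zero[of x] that by auto
    qed
    then show ?thesis using F[of \<theta>] F[of T] that by simp
  qed
  show "F (T - \<tau>) = F T" by (rule late) (use \<tau> in auto)
  \<comment> \<open>Extended by 0, the rate can be integrated from \<open>- \<tau>\<close> on, which
    makes \<open>F\<close> continuous on an interval that contains all shifted arguments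
    \<open>\<theta> - \<tau>\<close>.\<close>
  define g where "g x = (if x \<in> {0..<T} then f x else 0)" for x
  have "f integrable_on {0..<T}" using set_lebesgue_integral_eq_integral(1)[OF int] .
  then have "g integrable_on UNIV" unfolding g_def by (simp only: integrable_restrict_UNIV)
  then have g: "g integrable_on {a..b}" for a b by (rule integrable_on_subinterval) simp
  have FG: "F \<theta> = integral {- \<tau>..\<theta>} g" if "\<theta> \<le> T" for \<theta>
  proof -
    have "integral UNIV (\<lambda>x. if x \<in> {0..<\<theta>} then f x else 0) =
        integral UNIV (\<lambda>x. if x \<in> {- \<tau>..\<theta>} then g x else 0)"
      by (rule integral_spike[of "{\<theta>}"]) (use that \<tau> in \<open>auto simp: g_def\<close>)
    then show ?thesis using F[OF that] by (simp only: integral_restrict_UNIV)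
  qed
  have "continuous_on {- \<tau>..T} (\<lambda>\<theta>. integral {- \<tau>..\<theta>} g)" by (rule indefinite_integral_continuous_1[OF g])
  then have "continuous_on {- \<tau>..T} F" by (rule continuous_on_eq) (simp add: FG)
  then have Fint: "F integrable_on {- \<tau>..T}" by (rule integrable_continuous_interval)
  then have Fi: "F integrable_on {a..b}" if "- \<tau> \<le> a" "b \<le> T" for a b
    by (rule integrable_on_subinterval) (use that in auto)
  have early: "F \<theta> = 0" if "\<theta> \<le> 0" for \<theta>
    using that by (simp add: F_def set_lebesgue_integral_def)
  have "((\<lambda>\<theta>. F (1 *\<^sub>R \<theta> + - \<tau>)) has_integral integral {- \<tau>..T - \<tau>} F /\<^sub>R 1 ^ DIM(real))
      (cbox ((- \<tau> - - \<tau>) /\<^sub>R 1) ((T - \<tau> - - \<tau>) /\<^sub>R 1))"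
    using Fi[of "- \<tau>" "T - \<tau>"] \<tau> by (intro has_integral_affinity') (auto simp: integrable_integral)
  then have shift: "((\<lambda>\<theta>. F (\<theta> - \<tau>)) has_integral integral {- \<tau>..T - \<tau>} F) {0..T}" by simp
  have "((\<lambda>\<theta>. F \<theta> - F (\<theta> - \<tau>)) has_integral integral {0..T} F - integral {- \<tau>..T - \<tau>} F) {0..T}"
    by (rule has_integral_diff[OF _ shift]) (use Fi[of 0 T] \<tau> in \<open>auto simp: integrable_integral\<close>)
  \<comment> \<open>The two integrals differ only at the ends: \<open>F\<close> vanishes on
    \<open>[- \<tau>, 0]\<close> and has its final value \<open>F T\<close> on
    \<open>[T - \<tau>, T]\<close>.\<close>
  moreover have "integral {0..T} F - integral {- \<tau>..T - \<tau>} F = \<tau> * F T"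
  proof -
    have "integral {- \<tau>..0} F + integral {0..T} F = integral {- \<tau>..T} F"
      by (rule Henstock_Kurzweil_Integration.integral_combine) (use \<tau> T Fint in auto)
    moreover have "integral {- \<tau>..T - \<tau>} F + integral {T - \<tau>..T} F = integral {- \<tau>..T} F"
      by (rule Henstock_Kurzweil_Integration.integral_combine) (use \<tau> T Fint in auto)
    moreover have "integral {- \<tau>..0} F = integral {- \<tau>..0} (\<lambda>_. 0)"
      by (intro integral_cong early) auto
    moreover have "integral {T - \<tau>..T} F = integral {T - \<tau>..T} (\<lambda>_. F T)"
      by (intro integral_cong late) auto
    then have "integral {T - \<tau>..T} F = \<tau> * F T" using \<tau> by simp
    ultimately show ?thesis by simp
  qed
  ultimately show "((\<lambda>\<theta>. F \<theta> - F (\<theta> - \<tau>)) has_integral \<tau> * F T) {0..T}" by simp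
qed

section \<open>Total flow on the arcs of the bidirected network\<close>

lemma finite_bidirected_arcs:
  fixes N :: "('v, 'e) network"
  assumes fin: "finite (edges N)"
  shows "finite (arcs (bidirected N))"
proof -
  have "finite {(v, w). Upair v w = u}" for u :: "'v uprod"
  proof (cases u)
    case (Upair a b)
    have "{(v, w). Upair v w = u} \<subseteq> {(a, b), (b, a)}" by (auto simp: Upair)
    then show ?thesis by (rule finite_subset) auto
  qed
  then have "finite (SIGMA e:edges N. {(v, w). Upair v w = ends N e})" using fin by (intro finite_SigmaI)
  then show ?thesis by (rule finite_subset[rotated]) (auto simp: bidirected_def)
qed

text \<open>Every arc occurs once among the arcs into its head and once among those out of its tail.
  The sum of all excesses is thus minus the amount of flow in transit.\<close>

lemma sum_excess:
  assumes "finite (verts G)" "finite (arcs G)" "\<And>a. a \<in> arcs G \<Longrightarrow> tail G a \<in> verts G \<and> head G a \<in> verts G"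
  shows "(\<Sum>v\<in>verts G. excess G \<tau> f v \<theta>) =
    (\<Sum>a\<in>arcs G. set_lebesgue_integral lebesgue {0..<\<theta> - \<tau> a} (f a) - set_lebesgue_integral lebesgue {0..<\<theta>} (f a))"
proof -
  have "(\<Sum>v\<in>verts G. \<Sum>a\<in>in_arcs G v. g a) = (\<Sum>a\<in>arcs G. g a)"
    "(\<Sum>v\<in>verts G. \<Sum>a\<in>out_arcs G v. g a) = (\<Sum>a\<in>arcs G. g a)" for g :: "'b \<Rightarrow> real"
    unfolding in_arcs_def out_arcs_def using assms by (auto intro!: sum.group)
  then show ?thesis unfolding excess_def sum_subtractf by simp
qed

text \<open>\<open>z a\<close> is the total inflow of \<open>a\<close> during \<open>[0, T)\<close>.
  The sinks can absorb no more than \<open>B\<close>, so a value of \<open>B\<close> forces every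
  terminal to meet its balance exactly. The cost bound arises by integrating the flow in transit
  over time: it is minus the sum of all excesses, which at each moment is at least
  \<open>- B\<close>.\<close>

lemma average_flow:
  fixes N :: "('v, 'e) network"
  assumes N: "undirected_network_over_time N" and send: "can_be_sent N (total_supply N) (horizon N)"
  obtains z :: "'e \<times> 'v \<times> 'v \<Rightarrow> real" where
    "\<And>a. a \<in> arcs (bidirected N) \<Longrightarrow> 0 \<le> z a"
    "\<And>e. e \<in> edges N \<Longrightarrow> (\<Sum>a\<in>{a \<in> arcs (bidirected N). fst a = e}. z a) \<le> capacity N e * horizon N"
    "\<And>v. v \<in> nodes N \<Longrightarrow>
      (\<Sum>a\<in>out_arcs (bidirected N) v. z a) - (\<Sum>a\<in>in_arcs (bidirected N) v. z a) = balance N v"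
    "(\<Sum>a\<in>arcs (bidirected N). transit N (fst a) * z a) \<le> horizon N * total_supply N"
proof -
  define G where "G = bidirected N"
  define \<tau> :: "'e \<times> 'v \<times> 'v \<Rightarrow> real" where "\<tau> = transit N \<circ> fst"
  define T where "T = horizon N"
  define b where "b = balance N"
  from N have fin: "finite (nodes N)" "finite (edges N)"
    and ed: "\<And>e. e \<in> edges N \<Longrightarrow> set_uprod (ends N e) \<subseteq> nodes N \<and> 0 \<le> capacity N e \<and> 0 \<le> transit N e"
    and bal: "(\<Sum>v\<in>nodes N. b v) = 0" and T: "0 \<le> T"
    by (auto simp: undirected_network_over_time_def T_def b_def)
  from send obtain f where f: "undirected_flow_over_time N T f"
    "total_supply N \<le> flow_value G \<tau> b T f"
    by (auto simp: can_be_sent_def G_def \<tau>_def T_def b_def)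
  have finG: "finite (verts G)" "finite (arcs G)"
    using fin finite_bidirected_arcs[OF fin(2)] by (auto simp: G_def bidirected_def)
  have arcs: "tail G a \<in> verts G \<and> head G a \<in> verts G \<and> 0 \<le> \<tau> a \<and> fst a \<in> edges N" if "a \<in> arcs G" for a
  proof -
    obtain e v w where a: "a = (e, v, w)" by (cases a)
    moreover have "e \<in> edges N" "Upair v w = ends N e"
      using that by (auto simp: a G_def bidirected_def)
    moreover from this have "v \<in> set_uprod (ends N e)" "w \<in> set_uprod (ends N e)"
      by (metis insertCI set_uprod_simps)+
    ultimately show ?thesis using ed[of e] by (auto simp: G_def bidirected_def \<tau>_def)
  qed
  have rates: "set_integrable lebesgue {0..<T} (f a)" "\<And>\<theta>. \<theta> \<in> {0..<T} \<Longrightarrow> 0 \<le> f a \<theta>"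
    "\<And>\<theta>. \<theta> \<in> {0..<T} \<Longrightarrow> T - \<tau> a \<le> \<theta> \<Longrightarrow> f a \<theta> = 0" if "a \<in> arcs G" for a
    using f(1) that by (auto simp: undirected_flow_over_time_def inflow_rates_def G_def \<tau>_def)
  have cap: "(\<Sum>a\<in>{a \<in> arcs G. fst a = e}. f a \<theta>) \<le> capacity N e" if "e \<in> edges N" "\<theta> \<in> {0..<T}" for e \<theta>
    using f(1) that by (auto simp: undirected_flow_over_time_def G_def)
  have vG: "verts G = nodes N" by (simp add: G_def bidirected_def)
  have cons: "b v = 0 \<Longrightarrow> excess G \<tau> f v T = 0"
    "b v = 0 \<Longrightarrow> 0 \<le> excess G \<tau> f v \<theta>"
    "b v > 0 \<Longrightarrow> - b v \<le> excess G \<tau> f v \<theta>"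
    "b v < 0 \<Longrightarrow> 0 \<le> excess G \<tau> f v \<theta>"
    "b v < 0 \<Longrightarrow> excess G \<tau> f v \<theta> \<le> - b v"
    if "v \<in> nodes N" "\<theta> \<in> {0..T}" for v \<theta>
    using f(1) that unfolding undirected_flow_over_time_def flow_conservation_def vG[symmetric]
    by (auto simp: G_def \<tau>_def b_def)
  define F where "F a \<theta> = set_lebesgue_integral lebesgue {0..<\<theta>} (f a)" for a \<theta>
  have F: "F a (T - \<tau> a) = F a T" "((\<lambda>\<theta>. F a \<theta> - F a (\<theta> - \<tau> a)) has_integral \<tau> a * F a T) {0..T}"
    if "a \<in> arcs G" for a
    using transit_integral[of T "f a" "\<tau> a"] rates[OF that] arcs[OF that] T by (auto simp: F_def)
  have ex: "excess G \<tau> f v \<theta> = (\<Sum>a\<in>in_arcs G v. F a (\<theta> - \<tau> a)) - (\<Sum>a\<in>out_arcs G v. F a \<theta>)" for v \<theta>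
    by (simp add: excess_def F_def)
  have exT: "excess G \<tau> f v T = (\<Sum>a\<in>in_arcs G v. F a T) - (\<Sum>a\<in>out_arcs G v. F a T)" for v
    unfolding ex using F(1) by (auto intro!: sum.cong)
  have sum_ex: "(\<Sum>v\<in>nodes N. excess G \<tau> f v \<theta>) = (\<Sum>a\<in>arcs G. F a (\<theta> - \<tau> a) - F a \<theta>)" for \<theta>
    using sum_excess[OF finG] arcs by (simp add: vG F_def)
  let ?P = "{v \<in> nodes N. 0 < b v}" and ?M = "{v \<in> nodes N. b v < 0}"
  have split: "(\<Sum>v\<in>nodes N. g v) = (\<Sum>v\<in>?P. g v) + (\<Sum>v\<in>?M. g v) + (\<Sum>v\<in>{v \<in> nodes N. b v = 0}. g v)"
    for g :: "'v \<Rightarrow> real"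
  proof -
    have "nodes N = (?P \<union> ?M) \<union> {v \<in> nodes N. b v = 0}" by auto
    then have "(\<Sum>v\<in>nodes N. g v) = (\<Sum>v\<in>(?P \<union> ?M) \<union> {v \<in> nodes N. b v = 0}. g v)" by simp
    also have "\<dots> = (\<Sum>v\<in>?P \<union> ?M. g v) + (\<Sum>v\<in>{v \<in> nodes N. b v = 0}. g v)"
      by (rule sum.union_disjoint) (use fin in auto)
    also have "(\<Sum>v\<in>?P \<union> ?M. g v) = (\<Sum>v\<in>?P. g v) + (\<Sum>v\<in>?M. g v)"
      by (rule sum.union_disjoint) (use fin in auto)
    finally show ?thesis .
  qed
  have B: "total_supply N = (\<Sum>v\<in>?P. b v)" by (simp add: total_supply_def b_def)
  have BM: "(\<Sum>v\<in>?M. - b v) = total_supply N"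
    using split[of b] bal unfolding B sum_negf by simp
  have TT: "T \<in> {0..T}" using T by simp
  have "(\<Sum>v\<in>?M. - b v - excess G \<tau> f v T) \<le> 0"
    using f(2) BM by (simp add: flow_value_def vG sum_subtractf)
  moreover have nn: "0 \<le> - b v - excess G \<tau> f v T" if "v \<in> ?M" for v
    using cons(5)[of v T] that TT by auto
  ultimately have "(\<Sum>v\<in>?M. - b v - excess G \<tau> f v T) = 0"
    by (meson order_antisym sum_nonneg)
  then have exM: "excess G \<tau> f v T = - b v" if "v \<in> ?M" for v
    using sum_nonneg_eq_0_iff[of ?M "\<lambda>v. - b v - excess G \<tau> f v T"] nn that fin by auto
  \<comment> \<open>At time \<open>T\<close> nothing is in transit, since the inflow into
    \<open>a\<close> stops at \<open>T - \<tau> a\<close>.\<close>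
  have "(\<Sum>v\<in>nodes N. excess G \<tau> f v T) = 0" unfolding sum_ex using F(1) by simp
  then have "(\<Sum>v\<in>?P. excess G \<tau> f v T) = - total_supply N"
    unfolding split[of "\<lambda>v. excess G \<tau> f v T"] using exM cons(1)[OF _ TT] BM by simp
  then have "(\<Sum>v\<in>?P. excess G \<tau> f v T + b v) = 0" by (simp add: sum.distrib B)
  moreover have "0 \<le> excess G \<tau> f v T + b v" if "v \<in> ?P" for v using cons(3)[of v T] that TT by auto
  ultimately have exP: "excess G \<tau> f v T + b v = 0" if "v \<in> ?P" for v
    using sum_nonneg_eq_0_iff[of ?P "\<lambda>v. excess G \<tau> f v T + b v"] that fin by auto
  have node: "(\<Sum>a\<in>out_arcs G v. F a T) - (\<Sum>a\<in>in_arcs G v. F a T) = b v" if "v \<in> nodes N" for v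
    using exM[of v] exP[of v] cons(1)[OF that TT] that exT[of v] by (cases "b v" "0::real" rule: linorder_cases) auto
  have cost: "(\<Sum>a\<in>arcs G. \<tau> a * F a T) \<le> T * total_supply N"
  proof (rule has_integral_le)
    show "((\<lambda>\<theta>. \<Sum>a\<in>arcs G. F a \<theta> - F a (\<theta> - \<tau> a)) has_integral (\<Sum>a\<in>arcs G. \<tau> a * F a T)) {0..T}"
      using F(2) finG by (intro has_integral_sum) auto
    show "((\<lambda>_. total_supply N) has_integral T * total_supply N) {0..T}"
      using has_integral_const_real[of "total_supply N" 0 T] T by simp
    fix \<theta> assume \<theta>: "\<theta> \<in> {0..T}"
    have "(\<Sum>v\<in>?P. - b v) \<le> (\<Sum>v\<in>?P. excess G \<tau> f v \<theta>)"
      by (rule sum_mono) (use cons(3)[OF _ \<theta>] in auto)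
    moreover have "0 \<le> (\<Sum>v\<in>?M. excess G \<tau> f v \<theta>)"
      by (rule sum_nonneg) (use cons(4)[OF _ \<theta>] in auto)
    moreover have "0 \<le> (\<Sum>v\<in>{v \<in> nodes N. b v = 0}. excess G \<tau> f v \<theta>)"
      by (rule sum_nonneg) (use cons(2)[OF _ \<theta>] in auto)
    ultimately have "(\<Sum>v\<in>?P. - b v) \<le> (\<Sum>v\<in>nodes N. excess G \<tau> f v \<theta>)"
      unfolding split[of "\<lambda>v. excess G \<tau> f v \<theta>"] by linarith
    then show "(\<Sum>a\<in>arcs G. F a \<theta> - F a (\<theta> - \<tau> a)) \<le> total_supply N"
      unfolding sum_ex B sum_negf by (simp add: sum_subtractf)
  qed
  have Fint: "F a T = integral {0..<T} (f a)" "f a integrable_on {0..<T}" if "a \<in> arcs G" for a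
    unfolding F_def using set_lebesgue_integral_eq_integral[OF rates(1)[OF that]] by auto
  have capT: "(\<Sum>a\<in>{a \<in> arcs G. fst a = e}. F a T) \<le> capacity N e * T" if e: "e \<in> edges N" for e
  proof -
    have const: "((\<lambda>\<theta>. capacity N e) has_integral capacity N e * T) {0..<T}"
    proof (rule iffD1[OF has_integral_spike_set_eq])
      show "((\<lambda>\<theta>. capacity N e) has_integral capacity N e * T) {0..T}"
        using has_integral_const_real[of "capacity N e" 0 T] T by (simp add: mult.commute)
      show "negligible {x \<in> {0..T} - {0..<T}. capacity N e \<noteq> 0}"
        by (rule negligible_subset[of "{T}"]) auto
      show "negligible {x \<in> {0..<T} - {0..T}. capacity N e \<noteq> 0}"
        by (rule negligible_subset[of "{T}"]) auto
    qed
    have "(\<Sum>a\<in>{a \<in> arcs G. fst a = e}. F a T) = integral {0..<T} (\<lambda>\<theta>. \<Sum>a\<in>{a \<in> arcs G. fst a = e}. f a \<theta>)"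
      using finG Fint by (subst integral_sum) auto
    also have "\<dots> \<le> integral {0..<T} (\<lambda>\<theta>. capacity N e)"
    proof (rule integral_le)
      show "(\<lambda>\<theta>. \<Sum>a\<in>{a \<in> arcs G. fst a = e}. f a \<theta>) integrable_on {0..<T}"
        by (rule integrable_sum) (use finG Fint in auto)
    qed (use const cap[OF e] in \<open>auto intro: has_integral_integrable\<close>)
    also have "\<dots> = capacity N e * T" using const by (rule integral_unique)
    finally show ?thesis .
  qed
  have "0 \<le> F a T" if "a \<in> arcs G" for a
    unfolding F_def set_lebesgue_integral_def
    by (rule integral_nonneg_AE) (use rates(2)[OF that] in \<open>auto simp: indicator_def\<close>)
  from that[of "\<lambda>a. F a T"] this capT node cost show ?thesis
    unfolding G_def[symmetric] T_def[symmetric] b_def[symmetric] by (auto simp: \<tau>_def)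
qed

lemma average_net_flow:
  fixes N :: "('v, 'e) network"
  assumes N: "undirected_network_over_time N" and send: "can_be_sent N (total_supply N) (horizon N)"
    and pq: "\<And>e. e \<in> edges N \<Longrightarrow> ends N e = Upair (p e) (q e)"
  obtains x :: "'e \<Rightarrow> real" where
    "\<And>e. e \<in> edges N \<Longrightarrow> \<bar>x e\<bar> \<le> capacity N e * horizon N"
    "\<And>v. v \<in> nodes N \<Longrightarrow> (\<Sum>e\<in>edges N. x e * (of_bool (p e = v) - of_bool (q e = v))) = balance N v"
    "(\<Sum>e\<in>edges N. transit N e * \<bar>x e\<bar>) \<le> horizon N * total_supply N"
proof -
  let ?A = "arcs (bidirected N)"
  obtain z where z: "\<And>a. a \<in> ?A \<Longrightarrow> 0 \<le> z a"
    "\<And>e. e \<in> edges N \<Longrightarrow> (\<Sum>a\<in>{a \<in> ?A. fst a = e}. z a) \<le> capacity N e * horizon N"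
    "\<And>v. v \<in> nodes N \<Longrightarrow>
      (\<Sum>a\<in>out_arcs (bidirected N) v. z a) - (\<Sum>a\<in>in_arcs (bidirected N) v. z a) = balance N v"
    "(\<Sum>a\<in>?A. transit N (fst a) * z a) \<le> horizon N * total_supply N"
    using average_flow[OF N send] by blast
  have fin: "finite (edges N)" and \<tau>: "\<And>e. e \<in> edges N \<Longrightarrow> 0 \<le> transit N e"
    using N by (auto simp: undirected_network_over_time_def)
  note finA = finite_bidirected_arcs[OF fin]
  have arcs_e: "{a \<in> ?A. fst a = e} = {(e, p e, q e), (e, q e, p e)}" if "e \<in> edges N" for e
    using that pq[OF that] by (auto simp: bidirected_def)
  have in_A: "(e, p e, q e) \<in> ?A" "(e, q e, p e) \<in> ?A" if "e \<in> edges N" for e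
    using arcs_e[OF that] by auto
  \<comment> \<open>For a loop, \<open>(e, p e, q e)\<close> and \<open>(e, q e, p e)\<close> are
    the same arc, which must not be counted twice.\<close>
  have sum_e: "(\<Sum>a\<in>{a \<in> ?A. fst a = e}. g a) =
      g (e, p e, q e) + (if p e = q e then 0 else g (e, q e, p e))" if "e \<in> edges N" for g :: "_ \<Rightarrow> real" and e
    unfolding arcs_e[OF that] by auto
  have sum_A: "(\<Sum>a\<in>?A. g a) = (\<Sum>e\<in>edges N. g (e, p e, q e) + (if p e = q e then 0 else g (e, q e, p e)))"
    for g :: "_ \<Rightarrow> real"
  proof -
    have "(\<Sum>a\<in>?A. g a) = (\<Sum>e\<in>edges N. \<Sum>a\<in>{a \<in> ?A. fst a = e}. g a)"
      by (rule sum.group[symmetric]) (use finA fin in \<open>auto simp: bidirected_def\<close>)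
    also have "\<dots> = (\<Sum>e\<in>edges N. g (e, p e, q e) + (if p e = q e then 0 else g (e, q e, p e)))"
      using sum_e by (intro sum.cong) auto
    finally show ?thesis .
  qed
  define x where "x e = z (e, p e, q e) - z (e, q e, p e)" for e
  have abs: "\<bar>x e\<bar> \<le> z (e, p e, q e) + (if p e = q e then 0 else z (e, q e, p e))" if "e \<in> edges N" for e
    using z(1)[OF in_A(1)[OF that]] z(1)[OF in_A(2)[OF that]] by (auto simp: x_def)
  show ?thesis
  proof (rule that)
    show "\<bar>x e\<bar> \<le> capacity N e * horizon N" if "e \<in> edges N" for e
      using abs[OF that] z(2)[OF that] sum_e[OF that, of z] by linarith
    have "(\<Sum>e\<in>edges N. transit N e * \<bar>x e\<bar>) \<le>
        (\<Sum>e\<in>edges N. transit N e * z (e, p e, q e) + (if p e = q e then 0 else transit N e * z (e, q e, p e)))"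
    proof (rule sum_mono)
      fix e assume e: "e \<in> edges N"
      show "transit N e * \<bar>x e\<bar> \<le>
        transit N e * z (e, p e, q e) + (if p e = q e then 0 else transit N e * z (e, q e, p e))"
        using mult_left_mono[OF abs[OF e] \<tau>[OF e]] by (auto simp: algebra_simps split: if_splits)
    qed
    then show "(\<Sum>e\<in>edges N. transit N e * \<bar>x e\<bar>) \<le> horizon N * total_supply N"
      using z(4) sum_A[of "\<lambda>a. transit N (fst a) * z a"] by (simp cong: if_cong)
    fix v assume v: "v \<in> nodes N"
    have "(\<Sum>a\<in>out_arcs (bidirected N) v. z a) = (\<Sum>a\<in>?A. z a * of_bool (fst (snd a) = v))"
      unfolding out_arcs_def by (subst sum.inter_filter[OF finA]) (auto intro!: sum.cong simp: bidirected_def)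
    moreover have "(\<Sum>a\<in>in_arcs (bidirected N) v. z a) = (\<Sum>a\<in>?A. z a * of_bool (snd (snd a) = v))"
      unfolding in_arcs_def by (subst sum.inter_filter[OF finA]) (auto intro!: sum.cong simp: bidirected_def)
    ultimately have "balance N v = (\<Sum>a\<in>?A. z a * (of_bool (fst (snd a) = v) - of_bool (snd (snd a) = v)))"
      using z(3)[OF v] by (simp add: sum_subtractf right_diff_distrib)
    also have "\<dots> = (\<Sum>e\<in>edges N. x e * (of_bool (p e = v) - of_bool (q e = v)))"
      unfolding sum_A by (rule sum.cong) (auto simp: x_def algebra_simps)
    finally show "(\<Sum>e\<in>edges N. x e * (of_bool (p e = v) - of_bool (q e = v))) = balance N v" ..
  qed
qed

section \<open>Scheduling a static flow along paths\<close>

text \<open>A block \<open>(a, r, s, \<rho>)\<close> sends flow into arc \<open>a\<close> at rate \<open>\<rho>\<close> during \<open>[r, s)\<close>.\<close>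

type_synonym 'a block = "'a \<times> real \<times> real \<times> real"

definition block_flow :: "'a block list \<Rightarrow> 'a \<Rightarrow> real \<Rightarrow> real" where
  "block_flow bl a \<theta> = (\<Sum>(c, r, s, \<rho>)\<leftarrow>bl. if c = a \<and> r \<le> \<theta> \<and> \<theta> < s then \<rho> else 0)"

text \<open>The length of the part of \<open>[r, s)\<close> before time \<open>\<theta>\<close>;
  multiplied by the rate, it is the amount that a block has sent by then.\<close>

definition overlap :: "real \<Rightarrow> real \<Rightarrow> real \<Rightarrow> real" where
  "overlap r s \<theta> = max 0 (min s \<theta> - r)"

lemma overlap_shift: "overlap (r - \<tau>) (s - \<tau>) (\<theta> - \<tau>) = overlap r s \<theta>"
  by (auto simp: overlap_def)

lemma block_flow_Nil [simp]: "block_flow [] a \<theta> = 0"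
  by (simp add: block_flow_def)

lemma block_flow_Cons: "block_flow ((c, r, s, \<rho>) # bl) a \<theta> =
    (if c = a \<and> r \<le> \<theta> \<and> \<theta> < s then \<rho> else 0) + block_flow bl a \<theta>"
  by (simp add: block_flow_def)

lemma block_flow_append: "block_flow (bl @ bl') a \<theta> = block_flow bl a \<theta> + block_flow bl' a \<theta>"
  by (simp add: block_flow_def)

lemma block_integral:
  assumes "0 \<le> r"
  shows "set_integrable lebesgue {0..<\<theta>} (\<lambda>x. if r \<le> x \<and> x < s then \<rho> else 0 :: real)" (is ?A)
    and "set_lebesgue_integral lebesgue {0..<\<theta>} (\<lambda>x. if r \<le> x \<and> x < s then \<rho> else 0) = \<rho> * overlap r s \<theta>" (is ?B)
proof -
  have eq: "(\<lambda>x. indicator {0..<\<theta>} x *\<^sub>R (if r \<le> x \<and> x < s then \<rho> else 0)) =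
      (\<lambda>x. \<rho> * indicator {r..<min s \<theta>} x)"
    using assms by (auto simp: indicator_def fun_eq_iff)
  define m where "m = min s \<theta>"
  have emeas: "emeasure lebesgue {r..<m} = ennreal (max 0 (m - r))"
    by (cases "r \<le> m") (simp_all add: max_def)
  then have int: "integrable lebesgue (\<lambda>x. \<rho> * indicator {r..<min s \<theta>} x)"
    unfolding m_def by (intro integrable_mult_right integrable_real_indicator) auto
  show ?A unfolding set_integrable_def eq by (rule int)
  have "integral\<^sup>L lebesgue (indicator {r..<min s \<theta>} :: real \<Rightarrow> real) = overlap r s \<theta>"
    using emeas unfolding m_def by (simp add: measure_def overlap_def)
  then show ?B unfolding set_lebesgue_integral_def eq by simp
qed

lemma block_flow_integral:
  assumes "\<And>c r s \<rho>. (c, r, s, \<rho>) \<in> set bl \<Longrightarrow> 0 \<le> r"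
  shows "set_integrable lebesgue {0..<\<theta>} (block_flow bl a)"
    and "set_lebesgue_integral lebesgue {0..<\<theta>} (block_flow bl a) =
      (\<Sum>(c, r, s, \<rho>)\<leftarrow>bl. if c = a then \<rho> * overlap r s \<theta> else 0)"
  using assms
proof (induction bl)
  case Nil
  { case 1 show ?case by (simp add: set_integrable_def block_flow_def) }
  { case 2 show ?case by (simp add: set_lebesgue_integral_def block_flow_def) }
next
  case (Cons B bl)
  obtain c r s \<rho> where B: "B = (c, r, s, \<rho>)" by (cases B)
  have IH: "set_integrable lebesgue {0..<\<theta>} (block_flow bl a)"
    "set_lebesgue_integral lebesgue {0..<\<theta>} (block_flow bl a) =
      (\<Sum>(c, r, s, \<rho>)\<leftarrow>bl. if c = a then \<rho> * overlap r s \<theta> else 0)"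
    if "\<And>c r s \<rho>. (c, r, s, \<rho>) \<in> set (B # bl) \<Longrightarrow> 0 \<le> r"
    using Cons.IH that by (meson list.set_intros(2))+
  define g where "g \<theta> = (if c = a \<and> r \<le> \<theta> \<and> \<theta> < s then \<rho> else 0)" for \<theta>
  have f: "block_flow (B # bl) a = (\<lambda>\<theta>. g \<theta> + block_flow bl a \<theta>)"
    by (auto simp: B block_flow_Cons g_def)
  have g: "set_integrable lebesgue {0..<\<theta>} g \<and>
    set_lebesgue_integral lebesgue {0..<\<theta>} g = (if c = a then \<rho> * overlap r s \<theta> else 0)" if "0 \<le> r"
  proof (cases "c = a")
    case True
    then have "g = (\<lambda>x. if r \<le> x \<and> x < s then \<rho> else 0)" by (auto simp: g_def)
    then show ?thesis using block_integral[OF that] True by simp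
  next
    case False
    then have "g = (\<lambda>x. 0)" by (auto simp: g_def)
    then show ?thesis using False by (simp add: set_integrable_def set_lebesgue_integral_def)
  qed
  {
    case 1
    then have "0 \<le> r" using B by auto
    then show ?case unfolding f using g IH(1)[OF 1] by (intro set_integral_add) auto
  }
  {
    case 2
    then have "0 \<le> r" using B by auto
    then show ?case unfolding f using g IH[OF 2] by (subst set_integral_add(2)) (auto simp: B)
  }
qed

lemma block_flow_excess:
  assumes fin: "finite (arcs G)"
    and bl: "\<And>c r s \<rho>. (c, r, s, \<rho>) \<in> set bl \<Longrightarrow> c \<in> arcs G \<and> 0 \<le> r"
  shows "excess G \<tau> (block_flow bl) v \<theta> = (\<Sum>(c, r, s, \<rho>)\<leftarrow>bl. \<rho> *
    (of_bool (head G c = v) * overlap r s (\<theta> - \<tau> c) - of_bool (tail G c = v) * overlap r s \<theta>))"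
proof -
  have "excess G \<tau> (block_flow bl) v \<theta> =
    (\<Sum>a\<in>in_arcs G v. \<Sum>(c, r, s, \<rho>)\<leftarrow>bl. if c = a then \<rho> * overlap r s (\<theta> - \<tau> a) else 0) -
    (\<Sum>a\<in>out_arcs G v. \<Sum>(c, r, s, \<rho>)\<leftarrow>bl. if c = a then \<rho> * overlap r s \<theta> else 0)"
    unfolding excess_def using block_flow_integral(2)[of bl] bl by auto
  also have "\<dots> = (\<Sum>(c, r, s, \<rho>)\<leftarrow>bl. \<rho> *
    (of_bool (head G c = v) * overlap r s (\<theta> - \<tau> c) - of_bool (tail G c = v) * overlap r s \<theta>))"
    using bl
  proof (induction bl)
    case (Cons B bl)
    obtain c r s \<rho> where B: "B = (c, r, s, \<rho>)" by (cases B)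
    have c: "c \<in> arcs G" using Cons.prems B by auto
    have "(\<Sum>a\<in>in_arcs G v. if c = a then \<rho> * overlap r s (\<theta> - \<tau> a) else 0) =
        \<rho> * of_bool (head G c = v) * overlap r s (\<theta> - \<tau> c)"
      "(\<Sum>a\<in>out_arcs G v. if c = a then \<rho> * overlap r s \<theta> else 0) =
        \<rho> * of_bool (tail G c = v) * overlap r s \<theta>"
      using fin c by (auto simp: in_arcs_def out_arcs_def)
    moreover note Cons.IH
    moreover have "c \<in> arcs G \<and> 0 \<le> r" if "(c, r, s, \<rho>) \<in> set bl" for c r s \<rho>
      using Cons.prems that by auto
    ultimately show ?case by (simp add: B sum.distrib algebra_simps)
  qed simp
  finally show ?thesis .
qed

text \<open>
  The blocks along a path, listed from its end to its start: \<open>[r, s)\<close> is the period during which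
  flow arrives at the end of the path.
\<close>

fun path_blocks :: "('a \<Rightarrow> real) \<Rightarrow> real \<Rightarrow> real \<Rightarrow> real \<Rightarrow> 'a list \<Rightarrow> 'a block list" where
  "path_blocks \<tau> \<rho> r s [] = []"
| "path_blocks \<tau> \<rho> r s (a # p) = (a, r - \<tau> a, s - \<tau> a, \<rho>) # path_blocks \<tau> \<rho> (r - \<tau> a) (s - \<tau> a) p"

fun back_walk :: "('v, 'a) pre_digraph \<Rightarrow> 'v \<Rightarrow> 'a list \<Rightarrow> 'v \<Rightarrow> bool" where
  "back_walk G v [] w \<longleftrightarrow> v = w"
| "back_walk G v (a # p) w \<longleftrightarrow> a \<in> arcs G \<and> head G a = v \<and> back_walk G (tail G a) p w"

text \<open>The start of the path has the earliest period, shifted back by the whole length.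
  Choosing \<open>r\<close> as the length of the path lets it start at time 0.\<close>

lemma path_blocks_in:
  assumes "(a, r', s', \<rho>') \<in> set (path_blocks \<tau> \<rho> r s p)" "\<And>a. a \<in> set p \<Longrightarrow> 0 \<le> \<tau> a"
  shows "a \<in> set p \<and> \<rho>' = \<rho> \<and> s' + \<tau> a \<le> s \<and> r - (\<Sum>a\<leftarrow>p. \<tau> a) \<le> r'"
  using assms
proof (induction p arbitrary: r s)
  case (Cons c p)
  have nn: "0 \<le> (\<Sum>a\<leftarrow>p. \<tau> a)" using Cons.prems(2) by (intro sum_list_nonneg) auto
  show ?case
  proof (cases "(a, r', s', \<rho>') = (c, r - \<tau> c, s - \<tau> c, \<rho>)")
    case True
    then show ?thesis using nn by auto
  next
    case False
    then have "(a, r', s', \<rho>') \<in> set (path_blocks \<tau> \<rho> (r - \<tau> c) (s - \<tau> c) p)" using Cons.prems(1) by auto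
    from Cons.IH[OF this] Cons.prems(2) show ?thesis by fastforce
  qed
qed simp

text \<open>As the arcs of the path are distinct, at most one of its blocks concerns
  \<open>a\<close>.\<close>

lemma path_blocks_flow:
  assumes "distinct p" "0 \<le> \<rho>"
  shows "block_flow (path_blocks \<tau> \<rho> r s p) a \<theta> \<le> (if a \<in> set p then \<rho> else 0)"
  using assms
proof (induction p arbitrary: r s)
  case (Cons c p)
  have "block_flow (path_blocks \<tau> \<rho> (r - \<tau> c) (s - \<tau> c) p) a \<theta> \<le> (if a \<in> set p then \<rho> else 0)"
    by (rule Cons.IH) (use Cons.prems in auto)
  then show ?case using Cons.prems by (auto simp: block_flow_Cons)
qed simp

text \<open>What leaves one arc of the path enters the next one at the same moment, so the
  contributions of inner nodes cancel and nothing is stored on the way.\<close>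

lemma path_blocks_excess:
  assumes "back_walk G v p w"
  shows "(\<Sum>(c, r, s, \<rho>)\<leftarrow>path_blocks \<tau> \<rho> r s p. \<rho> *
      (of_bool (head G c = u) * overlap r s (\<theta> - \<tau> c) - of_bool (tail G c = u) * overlap r s \<theta>)) =
    \<rho> * (of_bool (u = v) * overlap r s \<theta> -
      of_bool (u = w) * overlap (r - (\<Sum>a\<leftarrow>p. \<tau> a)) (s - (\<Sum>a\<leftarrow>p. \<tau> a)) \<theta>)"
  using assms
proof (induction p arbitrary: v r s)
  case (Cons a p)
  then show ?case
    using Cons.IH[of "tail G a" "r - \<tau> a" "s - \<tau> a"]
    by (auto simp: overlap_shift algebra_simps)
qed simp

text \<open>
  The static flow \<open>x\<close> and the terminal amounts \<open>y\<close> are what remains to be scheduled.  Amounts are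
  sent at rate \<open>1 / (2 * T)\<close>, hence a path of length \<open>\<ell>\<close> delivers the fraction
  \<open>(2 * T - \<ell>) / (2 * T)\<close> of its amount; \<open>C\<close> is a lower bound for \<open>2 * T\<close> times the total value.
\<close>

definition partial_schedule ::
  "('v, 'a) pre_digraph \<Rightarrow> ('a \<Rightarrow> real) \<Rightarrow> ('a \<Rightarrow> real) \<Rightarrow> ('v \<Rightarrow> real) \<Rightarrow> real \<Rightarrow> real \<Rightarrow>
    'a block list \<Rightarrow> ('a \<Rightarrow> real) \<Rightarrow> ('v \<Rightarrow> real) \<Rightarrow> bool" where
  "partial_schedule G u \<tau> b T C bl x y \<longleftrightarrow>
     (\<forall>(a, r, s, \<rho>)\<in>set bl. a \<in> arcs G \<and> 0 \<le> r \<and> 0 \<le> \<rho> \<and> s + \<tau> a \<le> 2 * T) \<and>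
     (\<forall>a\<in>arcs G. 0 \<le> x a \<and> (\<forall>\<theta>. block_flow bl a \<theta> + x a / (2 * T) \<le> u a)) \<and>
     (\<forall>v\<in>verts G. \<forall>\<theta>\<in>{0..2 * T}. let X = excess G \<tau> (block_flow bl) v \<theta> in
        (b v = 0 \<longrightarrow> X = 0) \<and>
        (0 < b v \<longrightarrow> 0 \<le> y v \<and> - (b v - y v) \<le> X \<and> X \<le> 0) \<and>
        (b v < 0 \<longrightarrow> y v \<le> 0 \<and> 0 \<le> X \<and> X \<le> y v - b v)) \<and>
     C \<le> 2 * T * flow_value G \<tau> b (2 * T) (block_flow bl) +
       2 * T * (\<Sum>v\<in>{v \<in> verts G. 0 < b v}. y v) - (\<Sum>a\<in>arcs G. \<tau> a * x a)"

section \<open>Scheduling one path after the other\<close>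

lemma excess_no_blocks: "excess G \<tau> (block_flow []) v \<theta> = 0"
proof -
  have "block_flow [] a = (\<lambda>_. 0)" for a :: 'b by (simp add: fun_eq_iff)
  then show ?thesis by (simp add: excess_def set_lebesgue_integral_def)
qed

lemma partial_schedule_init:
  assumes T: "0 \<le> T"
    and x: "\<And>a. a \<in> arcs G \<Longrightarrow> 0 \<le> x a \<and> x a \<le> u a * T \<and> 0 \<le> u a"
    and y: "\<And>v. v \<in> verts G \<Longrightarrow> (0 < b v \<longrightarrow> 0 \<le> y v \<and> y v \<le> b v) \<and> (b v < 0 \<longrightarrow> y v \<le> 0 \<and> b v \<le> y v)"
    and C: "C \<le> 2 * T * (\<Sum>v\<in>{v \<in> verts G. 0 < b v}. y v) - (\<Sum>a\<in>arcs G. \<tau> a * x a)"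
  shows "partial_schedule G u \<tau> b T C [] x y"
proof -
  \<comment> \<open>The bound \<open>x a \<le> u a * T\<close> even gives \<open>u a / 2\<close>.
    For \<open>T = 0\<close> the quotient is 0 by convention.\<close>
  have "x a / (2 * T) \<le> u a" if "a \<in> arcs G" for a
  proof (cases "T = 0")
    case False
    then have "x a / (2 * T) \<le> u a * T / (2 * T)" using x[OF that] T by (intro divide_right_mono) auto
    also have "\<dots> = u a / 2" using False by simp
    also have "\<dots> \<le> u a" using x[OF that] by simp
    finally show ?thesis .
  qed (use x that in auto)
  moreover have "flow_value G \<tau> b (2 * T) (block_flow []) = 0"
    by (simp only: flow_value_def excess_no_blocks sum.neutral_const)
  ultimately show ?thesis
    unfolding partial_schedule_def excess_no_blocks using x y C by (simp add: Let_def)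
qed

text \<open>Once no supply remains, the leftover flow \<open>x\<close> enters the bound only through
  its nonnegative transit cost and can be discarded.\<close>

lemma partial_schedule_final:
  assumes sch: "partial_schedule G u \<tau> b T C bl x y" and T: "0 \<le> T" and fin: "finite (arcs G)"
    and y: "\<And>v. v \<in> verts G \<Longrightarrow> 0 < b v \<Longrightarrow> y v = 0"
    and \<tau>: "\<And>a. a \<in> arcs G \<Longrightarrow> 0 \<le> \<tau> a"
  shows "flow_over_time G u \<tau> b (2 * T) (block_flow bl)"
    and "C \<le> 2 * T * flow_value G \<tau> b (2 * T) (block_flow bl)"
    and "0 \<le> flow_value G \<tau> b (2 * T) (block_flow bl)"
proof -
  have bl: "c \<in> arcs G \<and> 0 \<le> r \<and> 0 \<le> \<rho> \<and> s + \<tau> c \<le> 2 * T" if "(c, r, s, \<rho>) \<in> set bl" for c r s \<rho>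
    using sch that by (auto simp: partial_schedule_def)
  have x: "0 \<le> x a" "block_flow bl a \<theta> + x a / (2 * T) \<le> u a" if "a \<in> arcs G" for a \<theta>
    using sch that by (auto simp: partial_schedule_def)
  have ex: "(b v = 0 \<longrightarrow> excess G \<tau> (block_flow bl) v \<theta> = 0) \<and>
    (0 < b v \<longrightarrow> - b v \<le> excess G \<tau> (block_flow bl) v \<theta> \<and> excess G \<tau> (block_flow bl) v \<theta> \<le> 0) \<and>
    (b v < 0 \<longrightarrow> 0 \<le> excess G \<tau> (block_flow bl) v \<theta> \<and> excess G \<tau> (block_flow bl) v \<theta> \<le> - b v)"
    if "v \<in> verts G" "\<theta> \<in> {0..2 * T}" for v \<theta>
  proof -
    have "let X = excess G \<tau> (block_flow bl) v \<theta> in (b v = 0 \<longrightarrow> X = 0) \<and>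
        (0 < b v \<longrightarrow> 0 \<le> y v \<and> - (b v - y v) \<le> X \<and> X \<le> 0) \<and>
        (b v < 0 \<longrightarrow> y v \<le> 0 \<and> 0 \<le> X \<and> X \<le> y v - b v)"
      using sch that unfolding partial_schedule_def by blast
    then show ?thesis using y[OF that(1)] by (auto simp: Let_def)
  qed
  have nn: "0 \<le> block_flow bl a \<theta>" for a \<theta>
    unfolding block_flow_def by (rule sum_list_nonneg) (use bl in auto)
  have late: "block_flow bl a \<theta> = 0" if "2 * T - \<tau> a \<le> \<theta>" for a \<theta>
  proof -
    have "(\<lambda>(c, r, s, \<rho>). if c = a \<and> r \<le> \<theta> \<and> \<theta> < s then \<rho> else 0) B = 0" if "B \<in> set bl" for B
      using bl that \<open>2 * T - \<tau> a \<le> \<theta>\<close> by (cases B) fastforce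
    then have "map (\<lambda>(c, r, s, \<rho>). if c = a \<and> r \<le> \<theta> \<and> \<theta> < s then \<rho> else 0) bl = map (\<lambda>_. 0) bl"
      by (intro map_cong) auto
    then show ?thesis unfolding block_flow_def by (simp only:) simp
  qed
  show "flow_over_time G u \<tau> b (2 * T) (block_flow bl)"
    unfolding flow_over_time_def inflow_rates_def flow_conservation_def
  proof (intro conjI ballI impI)
    fix a assume a: "a \<in> arcs G"
    show "set_integrable lebesgue {0..<2 * T} (block_flow bl a)"
      by (rule block_flow_integral) (use bl in auto)
    fix \<theta> show "block_flow bl a \<theta> \<le> u a" using x(1)[OF a] x(2)[OF a, of \<theta>] T divide_nonneg_nonneg[of "x a" "2 * T"] by linarith
  qed (use nn late ex T in auto)
  show "0 \<le> flow_value G \<tau> b (2 * T) (block_flow bl)"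
    unfolding flow_value_def by (rule sum_nonneg) (use ex T in auto)
  have "0 \<le> (\<Sum>a\<in>arcs G. \<tau> a * x a)" by (rule sum_nonneg) (use x \<tau> in auto)
  moreover have "(\<Sum>v\<in>{v \<in> verts G. 0 < b v}. y v) = 0" by (rule sum.neutral) (use y in auto)
  ultimately show "C \<le> 2 * T * flow_value G \<tau> b (2 * T) (block_flow bl)"
    using sch by (simp add: partial_schedule_def)
qed

text \<open>The capacities are respected because the rate \<open>\<delta> / (2 * T)\<close> merely
  moves from the reserve for \<open>x\<close> to the schedule. The bound \<open>C\<close> persists
  because the path delivers at least \<open>\<delta> * (2 * T - l) / (2 * T)\<close>, where
  \<open>l\<close> is its length. If \<open>l > 2 * T\<close>, the blocks are empty periods and the
  amount is given up; the lower bound is negative then.\<close>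

lemma partial_schedule_path:
  assumes sch: "partial_schedule G u \<tau> b T C bl x y" and T: "0 < T"
    and fin: "finite (arcs G)" "finite (verts G)"
    and \<tau>: "\<And>a. a \<in> arcs G \<Longrightarrow> 0 \<le> \<tau> a"
    and path: "back_walk G v p w" "distinct p" "set p \<subseteq> arcs G"
    and vw: "v \<in> verts G" "w \<in> verts G" "b v < 0" "0 < b w"
    and \<delta>: "0 \<le> \<delta>" "\<delta> \<le> y w" "\<delta> \<le> - y v" "\<And>a. a \<in> set p \<Longrightarrow> \<delta> \<le> x a"
  shows "partial_schedule G u \<tau> b T C
    (bl @ path_blocks \<tau> (\<delta> / (2 * T)) (\<Sum>a\<leftarrow>p. \<tau> a) (2 * T) p)
    (\<lambda>a. if a \<in> set p then x a - \<delta> else x a) (y(w := y w - \<delta>, v := y v + \<delta>))"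
proof -
  define \<rho> where "\<rho> = \<delta> / (2 * T)"
  define l where "l = (\<Sum>a\<leftarrow>p. \<tau> a)"
  define pb where "pb = path_blocks \<tau> \<rho> l (2 * T) p"
  have \<rho>: "0 \<le> \<rho>" "\<rho> * (2 * T) = \<delta>" using T \<delta>(1) by (auto simp: \<rho>_def)
  have l: "0 \<le> l" unfolding l_def by (rule sum_list_nonneg) (use path(3) \<tau> in auto)
  have wv: "w \<noteq> v" using vw by auto
  have bl: "c \<in> arcs G \<and> 0 \<le> r \<and> 0 \<le> \<rho>' \<and> s + \<tau> c \<le> 2 * T" if "(c, r, s, \<rho>') \<in> set bl" for c r s \<rho>'
    using sch that by (auto simp: partial_schedule_def)
  have pb: "c \<in> arcs G \<and> 0 \<le> r \<and> 0 \<le> \<rho>' \<and> s + \<tau> c \<le> 2 * T" if "(c, r, s, \<rho>') \<in> set pb" for c r s \<rho>'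
    using path_blocks_in[OF that[unfolded pb_def]] path(3) \<tau> \<rho> by (auto simp: l_def)
  have ex: "excess G \<tau> (block_flow (bl @ pb)) z \<theta> = excess G \<tau> (block_flow bl) z \<theta> +
    \<rho> * (of_bool (z = v) * overlap l (2 * T) \<theta> - of_bool (z = w) * overlap 0 (2 * T - l) \<theta>)" for z \<theta>
  proof -
    have "excess G \<tau> (block_flow (bl @ pb)) z \<theta> = excess G \<tau> (block_flow bl) z \<theta> +
      (\<Sum>(c, r, s, \<rho>)\<leftarrow>pb. \<rho> *
        (of_bool (head G c = z) * overlap r s (\<theta> - \<tau> c) - of_bool (tail G c = z) * overlap r s \<theta>))"
    proof -
      have "c \<in> arcs G \<and> 0 \<le> r" if "(c, r, s, \<rho>') \<in> set (bl @ pb)" for c r s \<rho>'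
        using bl pb that by auto
      then have "excess G \<tau> (block_flow (bl @ pb)) z \<theta> = (\<Sum>(c, r, s, \<rho>)\<leftarrow>bl @ pb. \<rho> *
        (of_bool (head G c = z) * overlap r s (\<theta> - \<tau> c) - of_bool (tail G c = z) * overlap r s \<theta>))"
        by (rule block_flow_excess[OF fin(1)])
      moreover have "excess G \<tau> (block_flow bl) z \<theta> = (\<Sum>(c, r, s, \<rho>)\<leftarrow>bl. \<rho> *
        (of_bool (head G c = z) * overlap r s (\<theta> - \<tau> c) - of_bool (tail G c = z) * overlap r s \<theta>))"
        by (rule block_flow_excess[OF fin(1)]) (use bl in auto)
      ultimately show ?thesis by simp
    qed
    then show ?thesis unfolding pb_def path_blocks_excess[OF path(1)] by (simp add: l_def)
  qed
  have ov: "0 \<le> \<rho> * overlap r s \<theta>" "\<rho> * overlap r s \<theta> \<le> \<delta>" if "0 \<le> r" "s \<le> 2 * T" for r s \<theta>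
  proof -
    show "0 \<le> \<rho> * overlap r s \<theta>" using \<rho> by (simp add: overlap_def)
    have "overlap r s \<theta> \<le> 2 * T" using that T by (simp add: overlap_def)
    then show "\<rho> * overlap r s \<theta> \<le> \<delta>" using \<rho> mult_left_mono by metis
  qed
  let ?x = "\<lambda>a. if a \<in> set p then x a - \<delta> else x a" and ?y = "y(w := y w - \<delta>, v := y v + \<delta>)"
  have "partial_schedule G u \<tau> b T C (bl @ pb) ?x ?y"
    unfolding partial_schedule_def
  proof (intro conjI ballI allI)
    fix B assume "B \<in> set (bl @ pb)"
    moreover obtain c r s \<rho>' where B: "B = (c, r, s, \<rho>')" by (cases B)
    ultimately have "(c, r, s, \<rho>') \<in> set bl \<or> (c, r, s, \<rho>') \<in> set pb" by simp
    then show "case B of (a, r, s, \<rho>) \<Rightarrow> a \<in> arcs G \<and> 0 \<le> r \<and> 0 \<le> \<rho> \<and> s + \<tau> a \<le> 2 * T"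
      unfolding B using bl pb by blast
  next
    fix a assume a: "a \<in> arcs G"
    have xa: "0 \<le> x a" "\<And>\<theta>. block_flow bl a \<theta> + x a / (2 * T) \<le> u a"
      using sch a by (auto simp: partial_schedule_def)
    show "0 \<le> ?x a" using xa(1) \<delta>(4) by auto
    fix \<theta>
    have "block_flow pb a \<theta> \<le> (if a \<in> set p then \<rho> else 0)"
      unfolding pb_def by (rule path_blocks_flow[OF path(2) \<rho>(1)])
    then show "block_flow (bl @ pb) a \<theta> + ?x a / (2 * T) \<le> u a"
      using xa(2)[of \<theta>] by (auto simp: block_flow_append \<rho>_def diff_divide_distrib split: if_splits)
  next
    fix z \<theta> assume z: "z \<in> verts G" "\<theta> \<in> {0..2 * T}"
    have old: "(b z = 0 \<longrightarrow> excess G \<tau> (block_flow bl) z \<theta> = 0) \<and>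
      (0 < b z \<longrightarrow> 0 \<le> y z \<and> - (b z - y z) \<le> excess G \<tau> (block_flow bl) z \<theta> \<and>
        excess G \<tau> (block_flow bl) z \<theta> \<le> 0) \<and>
      (b z < 0 \<longrightarrow> y z \<le> 0 \<and> 0 \<le> excess G \<tau> (block_flow bl) z \<theta> \<and>
        excess G \<tau> (block_flow bl) z \<theta> \<le> y z - b z)"
      using sch z unfolding partial_schedule_def Let_def by blast
    consider "z = v" | "z = w" | "z \<noteq> v" "z \<noteq> w" by blast
    then show "let X = excess G \<tau> (block_flow (bl @ pb)) z \<theta> in (b z = 0 \<longrightarrow> X = 0) \<and>
        (0 < b z \<longrightarrow> 0 \<le> ?y z \<and> - (b z - ?y z) \<le> X \<and> X \<le> 0) \<and>
        (b z < 0 \<longrightarrow> ?y z \<le> 0 \<and> 0 \<le> X \<and> X \<le> ?y z - b z)"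
    proof cases
      case 1
      then show ?thesis using old wv vw \<delta> ov[of l "2 * T" \<theta>] l by (simp add: Let_def ex)
    next
      case 2
      then show ?thesis using old wv vw \<delta> ov[of 0 "2 * T - l" \<theta>] l by (simp add: Let_def ex)
    next
      case 3
      then show ?thesis using old by (simp add: Let_def ex)
    qed
  next
    have "flow_value G \<tau> b (2 * T) (block_flow (bl @ pb)) =
      (\<Sum>z\<in>{z \<in> verts G. b z < 0}. excess G \<tau> (block_flow bl) z (2 * T) +
        (if z = v then \<rho> * overlap l (2 * T) (2 * T) else 0))"
      unfolding flow_value_def ex using vw by (intro sum.cong) auto
    also have "\<dots> = flow_value G \<tau> b (2 * T) (block_flow bl) + \<rho> * overlap l (2 * T) (2 * T)"
      unfolding sum.distrib flow_value_def using fin vw by (subst sum.delta) auto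
    finally have val: "flow_value G \<tau> b (2 * T) (block_flow (bl @ pb)) =
      flow_value G \<tau> b (2 * T) (block_flow bl) + \<rho> * overlap l (2 * T) (2 * T)" .
    have "\<rho> * (2 * T - l) \<le> \<rho> * overlap l (2 * T) (2 * T)"
      using \<rho> by (intro mult_left_mono) (auto simp: overlap_def)
    then have "2 * T * (\<rho> * (2 * T - l)) \<le> 2 * T * (\<rho> * overlap l (2 * T) (2 * T))"
      by (rule mult_left_mono) (use T in simp)
    moreover have "2 * T * (\<rho> * (2 * T - l)) = (\<rho> * (2 * T)) * (2 * T - l)" by (simp add: algebra_simps)
    ultimately have gain: "2 * T * \<delta> - \<delta> * l \<le> 2 * T * (\<rho> * overlap l (2 * T) (2 * T))"
      unfolding \<rho>(2) by (simp add: algebra_simps)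
    have "(\<Sum>z\<in>{z \<in> verts G. 0 < b z}. ?y z) = (\<Sum>z\<in>{z \<in> verts G. 0 < b z}. y z + (if z = w then - \<delta> else 0))"
      using vw by (intro sum.cong) auto
    also have "\<dots> = (\<Sum>z\<in>{z \<in> verts G. 0 < b z}. y z) - \<delta>"
      unfolding sum.distrib using fin vw by (subst sum.delta) auto
    finally have ysum: "(\<Sum>z\<in>{z \<in> verts G. 0 < b z}. ?y z) = (\<Sum>z\<in>{z \<in> verts G. 0 < b z}. y z) - \<delta>" .
    have "(\<Sum>a\<in>arcs G. \<tau> a * ?x a) = (\<Sum>a\<in>arcs G. \<tau> a * x a - (if a \<in> set p then \<delta> * \<tau> a else 0))"
      by (rule sum.cong) (auto simp: algebra_simps)
    also have "\<dots> = (\<Sum>a\<in>arcs G. \<tau> a * x a) - (\<Sum>a\<in>set p. \<delta> * \<tau> a)"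
      unfolding sum_subtractf using fin(1) path(3)
      by (subst sum.inter_restrict[symmetric]) (auto simp: Int_absorb1)
    also have "(\<Sum>a\<in>set p. \<delta> * \<tau> a) = \<delta> * l"
      unfolding l_def sum_distrib_left[symmetric] using path(2) by (simp add: sum_list_distinct_conv_sum_set)
    finally have xsum: "(\<Sum>a\<in>arcs G. \<tau> a * ?x a) = (\<Sum>a\<in>arcs G. \<tau> a * x a) - \<delta> * l" .
    have "C \<le> 2 * T * flow_value G \<tau> b (2 * T) (block_flow bl) +
       2 * T * (\<Sum>v\<in>{v \<in> verts G. 0 < b v}. y v) - (\<Sum>a\<in>arcs G. \<tau> a * x a)"
      using sch by (simp add: partial_schedule_def)
    then show "C \<le> 2 * T * flow_value G \<tau> b (2 * T) (block_flow (bl @ pb)) +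
       2 * T * (\<Sum>v\<in>{v \<in> verts G. 0 < b v}. ?y v) - (\<Sum>a\<in>arcs G. \<tau> a * ?x a)"
      unfolding val ysum xsum using gain by (simp add: algebra_simps)
  qed
  then show ?thesis by (simp add: pb_def \<rho>_def l_def)
qed

text \<open>The set of nodes reachable by walks with distinct arcs is closed: a repeated arc shortcuts the walk.\<close>

lemma back_walk_extend:
  assumes "back_walk G v p w" "distinct p" "set p \<subseteq> A" "a \<in> A" "a \<in> arcs G" "tail G a = v"
  shows "\<exists>p'. back_walk G (head G a) p' w \<and> distinct p' \<and> set p' \<subseteq> A"
proof (cases "a \<in> set p")
  case True
  have "\<exists>p'. back_walk G (head G a) p' w \<and> distinct p' \<and> set p' \<subseteq> A"
    if "back_walk G v p w" "distinct p" "set p \<subseteq> A" "a \<in> set p" for v p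
    using that
  proof (induction p arbitrary: v)
    case (Cons c p)
    show ?case
    proof (cases "c = a")
      case True
      then show ?thesis using Cons.prems by (intro exI[of _ "c # p"]) auto
    next
      case False
      then show ?thesis using Cons.IH[of "tail G c"] Cons.prems by auto
    qed
  qed simp
  from this[OF assms(1-3) True] show ?thesis .
next
  case False
  then show ?thesis using assms by (intro exI[of _ "a # p"]) auto
qed

lemma back_walk_balance:
  assumes "back_walk G v p w"
  shows "(\<Sum>a\<leftarrow>p. of_bool (tail G a = z) - of_bool (head G a = z) :: real) = of_bool (z = w) - of_bool (z = v)"
  using assms by (induction p arbitrary: v) auto

text \<open>While a source \<open>w\<close> has supply left, a node with negative remainder is
  reachable from it along arcs carrying flow. Sending the bottleneck amount \<open>\<delta>\<close>
  along such a path empties an arc or settles one of its two ends, so the number of arcs with flow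
  plus the number of unsettled nodes decreases.\<close>

lemma partial_schedule_exhaust:
  fixes x :: "'a \<Rightarrow> real" and y :: "'v \<Rightarrow> real"
  assumes sch: "partial_schedule G u \<tau> b T C bl x y" and T: "0 < T"
    and fin: "finite (arcs G)" "finite (verts G)"
    and \<tau>: "\<And>a. a \<in> arcs G \<Longrightarrow> 0 \<le> \<tau> a"
    and ends: "\<And>a. a \<in> arcs G \<Longrightarrow> tail G a \<in> verts G \<and> head G a \<in> verts G"
    and cons: "\<And>v. v \<in> verts G \<Longrightarrow> (\<Sum>a\<in>arcs G. x a * (of_bool (tail G a = v) - of_bool (head G a = v))) = y v"
    and sgn: "\<And>v. v \<in> verts G \<Longrightarrow> b v = 0 \<Longrightarrow> y v = 0"
  shows "\<exists>bl x y. partial_schedule G u \<tau> b T C bl x y \<and> (\<forall>v\<in>verts G. 0 < b v \<longrightarrow> y v = 0)"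
  using sch cons sgn
proof (induction "card {a \<in> arcs G. 0 < x a} + card {v \<in> verts G. y v \<noteq> 0}" arbitrary: bl x y rule: less_induct)
  case less
  have x0: "0 \<le> x a" if "a \<in> arcs G" for a using less.prems(1) that by (auto simp: partial_schedule_def)
  have y0: "(0 < b v \<longrightarrow> 0 \<le> y v) \<and> (b v < 0 \<longrightarrow> y v \<le> 0)" if v: "v \<in> verts G" for v
  proof -
    have "0 \<in> {0..2 * T}" using T by simp
    then show ?thesis using less.prems(1) v unfolding partial_schedule_def Let_def by blast
  qed
  show ?case
  proof (cases "\<forall>v\<in>verts G. 0 < b v \<longrightarrow> y v = 0")
    case True
    then show ?thesis using less.prems(1) by blast
  next
    case False
    then obtain w where w: "w \<in> verts G" "0 < b w" "y w \<noteq> 0" by auto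
    then have yw: "0 < y w" using y0[OF w(1)] by auto
    define A where "A = {a \<in> arcs G. 0 < x a}"
    define S where "S = {v. \<exists>p. back_walk G v p w \<and> distinct p \<and> set p \<subseteq> A}"
    have wS: "w \<in> S" unfolding S_def by (auto intro!: exI[of _ "[]"])
    have closed: "head G a \<in> S" if "a \<in> A" "tail G a \<in> S" for a
      using that back_walk_extend[where A = A and a = a] unfolding S_def A_def by fastforce
    have SV: "v \<in> verts G" if "v \<in> S" for v
    proof -
      from that obtain p where p: "back_walk G v p w" by (auto simp: S_def)
      then show ?thesis using w(1) ends by (cases p) auto
    qed
    have finS: "finite S" by (rule finite_subset[OF _ fin(2)]) (use SV in auto)
    \<comment> \<open>Otherwise the set of nodes reachable from \<open>w\<close> would have a
      positive total remainder, although no flow leaves this set.\<close>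
    have "\<exists>v\<in>S. y v < 0"
    proof (rule ccontr)
      assume "\<not> (\<exists>v\<in>S. y v < 0)"
      then have "y w \<le> (\<Sum>v\<in>S. y v)" by (intro member_le_sum wS finS) force
      also have "\<dots> = (\<Sum>v\<in>S. \<Sum>a\<in>arcs G. x a * (of_bool (tail G a = v) - of_bool (head G a = v)))"
        using less.prems(2) SV by (intro sum.cong) auto
      also have "\<dots> = (\<Sum>a\<in>arcs G. \<Sum>v\<in>S. x a * (of_bool (tail G a = v) - of_bool (head G a = v)))"
        by (rule sum.swap)
      also have "\<dots> = (\<Sum>a\<in>arcs G. x a * (of_bool (tail G a \<in> S) - of_bool (head G a \<in> S)))"
      proof (rule sum.cong)
        fix a
        have "(\<Sum>v\<in>S. of_bool (c = v)) = (of_bool (c \<in> S) :: real)" for c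
          using finS by (simp add: of_bool_def)
        then show "(\<Sum>v\<in>S. x a * (of_bool (tail G a = v) - of_bool (head G a = v))) =
          x a * (of_bool (tail G a \<in> S) - of_bool (head G a \<in> S))"
          by (simp add: sum_distrib_left[symmetric] sum_subtractf)
      qed simp
      also have "\<dots> \<le> 0"
      proof (rule sum_nonpos)
        fix a assume a: "a \<in> arcs G"
        show "x a * (of_bool (tail G a \<in> S) - of_bool (head G a \<in> S)) \<le> 0"
          using closed[of a] x0[OF a] a by (cases "x a = 0") (auto simp: A_def)
      qed
      finally show False using yw by simp
    qed
    then obtain v where v: "v \<in> S" "y v < 0" by auto
    then obtain p where p: "back_walk G v p w" "distinct p" "set p \<subseteq> A" by (auto simp: S_def)
    have vV: "v \<in> verts G" by (rule SV[OF v(1)])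
    have bv: "b v < 0" using y0[OF vV] v(2) less.prems(3)[OF vV] by (cases "b v" "0::real" rule: linorder_cases) auto
    define X where "X = insert (y w) (insert (- y v) (x ` set p))"
    define \<delta> where "\<delta> = Min X"
    have X: "finite X" "X \<noteq> {}" by (auto simp: X_def)
    have le: "\<delta> \<le> y w" "\<delta> \<le> - y v" "\<And>a. a \<in> set p \<Longrightarrow> \<delta> \<le> x a"
      unfolding \<delta>_def by (rule Min_le[OF X(1)]; simp add: X_def)+
    have mem: "\<delta> = y w \<or> \<delta> = - y v \<or> (\<exists>a\<in>set p. \<delta> = x a)"
      using Min_in[OF X] unfolding \<delta>_def[symmetric] by (auto simp: X_def)
    have pos: "0 < \<delta>" using mem yw v(2) p(3) by (auto simp: A_def)
    define x' where "x' a = (if a \<in> set p then x a - \<delta> else x a)" for a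
    define y' where "y' = y(w := y w - \<delta>, v := y v + \<delta>)"
    have pA: "set p \<subseteq> arcs G" using p(3) by (auto simp: A_def)
    have sch': "partial_schedule G u \<tau> b T C (bl @ path_blocks \<tau> (\<delta> / (2 * T)) (\<Sum>a\<leftarrow>p. \<tau> a) (2 * T) p) x' y'"
      unfolding x'_def y'_def
      by (rule partial_schedule_path[OF less.prems(1) T fin \<tau> p(1,2) pA vV w(1) bv w(2) _ le]) (use pos in auto)
    have wv: "w \<noteq> v" using w(2) bv by auto
    have cons': "(\<Sum>a\<in>arcs G. x' a * (of_bool (tail G a = z) - of_bool (head G a = z))) = y' z" if z: "z \<in> verts G" for z
    proof -
      let ?g = "\<lambda>a. of_bool (tail G a = z) - of_bool (head G a = z) :: real"
      have "(\<Sum>a\<in>arcs G. x' a * ?g a) = (\<Sum>a\<in>arcs G. x a * ?g a - (if a \<in> set p then \<delta> * ?g a else 0))"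
        by (rule sum.cong) (auto simp: x'_def algebra_simps)
      also have "\<dots> = y z - (\<Sum>a\<in>set p. \<delta> * ?g a)"
        unfolding sum_subtractf less.prems(2)[OF z] using fin(1) pA
        by (subst sum.inter_restrict[symmetric]) (auto simp: Int_absorb1)
      also have "(\<Sum>a\<in>set p. \<delta> * ?g a) = \<delta> * (\<Sum>a\<leftarrow>p. ?g a)"
        unfolding sum_distrib_left[symmetric] using p(2) by (simp add: sum_list_distinct_conv_sum_set)
      finally show ?thesis unfolding back_walk_balance[OF p(1)] using wv by (auto simp: y'_def)
    qed
    have A': "{a \<in> arcs G. 0 < x' a} \<subseteq> A" using pos by (auto simp: A_def x'_def split: if_splits)
    have Y': "{z \<in> verts G. y' z \<noteq> 0} \<subseteq> {z \<in> verts G. y z \<noteq> 0}" using yw v(2) by (auto simp: y'_def)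
    have "card {a \<in> arcs G. 0 < x' a} + card {z \<in> verts G. y' z \<noteq> 0} <
        card {a \<in> arcs G. 0 < x a} + card {z \<in> verts G. y z \<noteq> 0}"
    proof (cases "\<exists>a\<in>set p. \<delta> = x a")
      case True
      then obtain a where a: "a \<in> set p" "\<delta> = x a" by auto
      have "{a \<in> arcs G. 0 < x' a} \<subset> A" using A' a p(3) by (auto simp: x'_def)
      then have "card {a \<in> arcs G. 0 < x' a} < card A" using fin(1) by (intro psubset_card_mono) (auto simp: A_def)
      moreover have "card {z \<in> verts G. y' z \<noteq> 0} \<le> card {z \<in> verts G. y z \<noteq> 0}"
        using Y' fin(2) by (intro card_mono) auto
      ultimately show ?thesis by (simp add: A_def)
    next
      case False
      then have "\<delta> = y w \<or> \<delta> = - y v" using mem by blast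
      then have "y' w = 0 \<or> y' v = 0" using wv by (auto simp: y'_def)
      moreover have "w \<in> {z \<in> verts G. y z \<noteq> 0}" "v \<in> {z \<in> verts G. y z \<noteq> 0}"
        using w vV v(2) by simp_all
      ultimately have "{z \<in> verts G. y' z \<noteq> 0} \<subset> {z \<in> verts G. y z \<noteq> 0}"
        using Y' by blast
      then have "card {z \<in> verts G. y' z \<noteq> 0} < card {z \<in> verts G. y z \<noteq> 0}"
        using fin(2) by (intro psubset_card_mono) auto
      moreover have "card {a \<in> arcs G. 0 < x' a} \<le> card A" using A' fin(1) by (intro card_mono) (auto simp: A_def)
      ultimately show ?thesis by (simp add: A_def)
    qed
    moreover have "y' z = 0" if "z \<in> verts G" "b z = 0" for z
      using less.prems(3)[OF that] that bv w(2) by (auto simp: y'_def)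
    ultimately show ?thesis using less.hyps[OF _ sch' cons'] by blast
  qed
qed

section \<open>Existence of the orientation for real data\<close>

lemma total_supply_zero:
  assumes "undirected_network_over_time N" "can_be_sent N (total_supply N) (horizon N)" "horizon N = 0"
    and "v \<in> nodes N"
  shows "balance N v = 0"
proof -
  let ?G = "bidirected N"
  from assms(2,3) obtain f where f: "total_supply N \<le> flow_value ?G (transit N \<circ> fst) (balance N) 0 f"
    by (auto simp: can_be_sent_def)
  have tr: "0 \<le> transit N (fst a)" if "a \<in> arcs ?G" for a
    using that assms(1) by (cases a) (auto simp: bidirected_def undirected_network_over_time_def)
  \<comment> \<open>At time 0 all periods of integration are empty, since transit times are
    nonnegative. The value is therefore 0, and so is the total supply.\<close>
  have "excess ?G (transit N \<circ> fst) f v 0 = 0" for v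
    unfolding excess_def using tr by (auto simp: set_lebesgue_integral_def in_arcs_def intro!: sum.neutral)
  then have "total_supply N \<le> 0" using f by (simp add: flow_value_def)
  moreover have fin: "finite (nodes N)" and s: "(\<Sum>v\<in>nodes N. balance N v) = 0"
    using assms(1) by (auto simp: undirected_network_over_time_def)
  ultimately have "(\<Sum>v\<in>{v \<in> nodes N. 0 < balance N v}. balance N v) = 0"
    unfolding total_supply_def by (intro order_antisym sum_nonneg) auto
  then have "\<not> 0 < balance N v" if "v \<in> nodes N" for v
    using sum_nonneg_eq_0_iff[of "{v \<in> nodes N. 0 < balance N v}" "balance N"] fin that by auto
  then have "0 \<le> - balance N v" if "v \<in> nodes N" for v using that by force
  moreover have "(\<Sum>v\<in>nodes N. - balance N v) = 0" using s by (simp add: sum_negf)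
  ultimately show ?thesis
    using sum_nonneg_eq_0_iff[OF fin, of "\<lambda>v. - balance N v"] assms(4) by auto
qed

lemma value_from_schedule:
  assumes N: "undirected_network_over_time N" and send: "can_be_sent N (total_supply N) (horizon N)"
    and G: "verts G = nodes N"
    and C: "horizon N * total_supply N \<le> 2 * horizon N * flow_value G \<tau> (balance N) \<Theta> f"
    and nn: "0 \<le> flow_value G \<tau> (balance N) \<Theta> f"
  shows "total_supply N / 2 \<le> flow_value G \<tau> (balance N) \<Theta> f"
proof (cases "horizon N = 0")
  case True
  then have "total_supply N = 0"
    unfolding total_supply_def using total_supply_zero[OF N send] by (intro sum.neutral) auto
  then show ?thesis using nn by simp
next
  case False
  then have "0 < horizon N" using N by (auto simp: undirected_network_over_time_def)
  moreover have "horizon N * total_supply N \<le> horizon N * (2 * flow_value G \<tau> (balance N) \<Theta> f)"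
    using C by (simp add: algebra_simps)
  ultimately have "total_supply N \<le> 2 * flow_value G \<tau> (balance N) \<Theta> f"
    by (simp only: mult_le_cancel_left_pos)
  then show ?thesis by simp
qed

lemma orientation_exists:
  fixes N :: "('v, 'e) network"
  assumes N: "undirected_network_over_time N" and send: "can_be_sent N (total_supply N) (horizon N)"
  shows "\<exists>G. orientation N G \<and> can_be_sent_oriented N G (total_supply N / 2) (2 * horizon N)"
proof -
  define T where "T = horizon N"
  have "\<exists>v w. ends N e = Upair v w" for e by (cases "ends N e") auto
  then obtain p q where pq: "\<And>e. ends N e = Upair (p e) (q e)" by metis
  obtain x where x: "\<And>e. e \<in> edges N \<Longrightarrow> \<bar>x e\<bar> \<le> capacity N e * T"
    "\<And>v. v \<in> nodes N \<Longrightarrow> (\<Sum>e\<in>edges N. x e * (of_bool (p e = v) - of_bool (q e = v))) = balance N v"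
    "(\<Sum>e\<in>edges N. transit N e * \<bar>x e\<bar>) \<le> T * total_supply N"
    using average_net_flow[OF N send, of p q] pq unfolding T_def by blast
  define G where "G = \<lparr>verts = nodes N, arcs = edges N,
    tail = (\<lambda>e. if 0 \<le> x e then p e else q e), head = (\<lambda>e. if 0 \<le> x e then q e else p e)\<rparr>"
  have orient: "orientation N G" unfolding orientation_def G_def using pq by (auto)
  have ed: "set_uprod (ends N e) \<subseteq> nodes N \<and> 0 \<le> capacity N e \<and> 0 \<le> transit N e" if "e \<in> edges N" for e
    using N that by (auto simp: undirected_network_over_time_def)
  have fin: "finite (arcs G)" "finite (verts G)" and T: "0 \<le> T"
    using N by (auto simp: undirected_network_over_time_def G_def T_def)
  have ends: "tail G a \<in> verts G \<and> head G a \<in> verts G" if "a \<in> arcs G" for a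
    using ed[of a] that pq[of a] by (auto simp: G_def)
  have cons: "(\<Sum>a\<in>arcs G. \<bar>x a\<bar> * (of_bool (tail G a = v) - of_bool (head G a = v))) = balance N v"
    if "v \<in> verts G" for v
  proof -
    have "(\<Sum>a\<in>arcs G. \<bar>x a\<bar> * (of_bool (tail G a = v) - of_bool (head G a = v))) =
      (\<Sum>e\<in>edges N. x e * (of_bool (p e = v) - of_bool (q e = v)))"
      by (rule sum.cong) (auto simp: G_def abs_if)
    then show ?thesis using x(2) that by (simp add: G_def)
  qed
  have init: "partial_schedule G (capacity N) (transit N) (balance N) T (T * total_supply N) [] (\<lambda>e. \<bar>x e\<bar>) (balance N)"
  proof (rule partial_schedule_init[OF T])
    show "0 \<le> \<bar>x a\<bar> \<and> \<bar>x a\<bar> \<le> capacity N a * T \<and> 0 \<le> capacity N a" if "a \<in> arcs G" for a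
      using x(1)[of a] ed[of a] that by (simp add: G_def)
    show "T * total_supply N \<le> 2 * T * (\<Sum>v\<in>{v \<in> verts G. 0 < balance N v}. balance N v) -
      (\<Sum>a\<in>arcs G. transit N a * \<bar>x a\<bar>)"
      using x(3) by (simp add: G_def total_supply_def)
  qed auto
  have "\<exists>bl x y. partial_schedule G (capacity N) (transit N) (balance N) T (T * total_supply N) bl x y \<and>
    (\<forall>v\<in>verts G. 0 < balance N v \<longrightarrow> y v = 0)"
  proof (cases "T = 0")
    case True
    then show ?thesis using init total_supply_zero[OF N send] by (auto simp: T_def G_def)
  next
    case False
    then show ?thesis using T ed ends cons fin
      by (intro partial_schedule_exhaust[OF init]) (auto simp: G_def)
  qed
  then obtain bl x' y' where
    s: "partial_schedule G (capacity N) (transit N) (balance N) T (T * total_supply N) bl x' y'"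
    "\<And>v. v \<in> verts G \<Longrightarrow> 0 < balance N v \<Longrightarrow> y' v = 0" by blast
  have tr: "0 \<le> transit N a" if "a \<in> arcs G" for a using ed[of a] that by (simp add: G_def)
  note final = partial_schedule_final[OF s(1) T fin(1) s(2) tr]
  have "total_supply N / 2 \<le> flow_value G (transit N) (balance N) (2 * T) (block_flow bl)"
    by (rule value_from_schedule[OF N send]) (use final(2,3) in \<open>auto simp: G_def T_def\<close>)
  then have "oriented_flow_of_value N G (total_supply N / 2) (2 * horizon N) (block_flow bl)"
    using final(1) by (simp add: oriented_flow_of_value_def T_def)
  then show ?thesis using orient by (auto simp: can_be_sent_oriented_def)
qed

section \<open>Reading the input\<close>

abbreviation In :: "exp \<Rightarrow> exp" where
  "In \<equiv> Read ''in''"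

fun seqs :: "com list \<Rightarrow> com" where
  "seqs [] = Skip"
| "seqs [c] = c"
| "seqs (c # d # cs) = Seq c (seqs (d # cs))"

text \<open>
  All data are scaled by the product \<open>D\<close> of the positive numbers in the input.  Edge \<open>e\<close> becomes the arcs
  \<open>e\<close> and \<open>m + e\<close> with capacity \<open>u * T\<close> and cost \<open>\<tau>\<close>; terminal \<open>v\<close> is joined by the arc \<open>2 * m + v\<close> to the
  additional node \<open>n\<close>, with cost \<open>-2 * T\<close> at sources, so that a circulation of least cost maximizes
  \<open>2 * T\<close> times its value minus the transit cost.
\<close>

definition read_sizes :: com where
  "read_sizes = seqs [
     Set_var ''n'' (In (Const 0)),
     Set_var ''m'' (In (Const 1)),
     Set_var ''M'' (Add (Add (V ''m'') (V ''m'')) (V ''n'')),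
     Set_var ''D'' (Const 1),
     For ''i'' (Add (Add (Const 4) (Mul (V ''n'') (Const 2))) (Mul (V ''m'') (Const 6)))
       (If (Less (Const 0) (In (V ''i''))) (Set_var ''D'' (Mul (V ''D'') (In (V ''i'')))) Skip)]"

text \<open>Cells \<open>B\<close> to \<open>B + 5\<close> hold the two ends and the fractions for
  capacity and transit time; cells 2 and 3 hold the horizon. The divisions are exact because the
  denominators occur as separate factors of \<open>D\<close>. The array \<open>w\<close> preserves
  the scaled transit times, since \<open>c\<close> is cleared before the decomposition.\<close>

definition read_edge :: com where
  "read_edge = seqs [
     Set_var ''B'' (Add (Add (Const 4) (Mul (V ''n'') (Const 2))) (Mul (V ''a'') (Const 6))),
     Assign ''t'' (V ''a'') (In (V ''B'')),
     Assign ''h'' (V ''a'') (In (Add (V ''B'') (Const 1))),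
     Assign ''t'' (Add (V ''m'') (V ''a'')) (In (Add (V ''B'') (Const 1))),
     Assign ''h'' (Add (V ''m'') (V ''a'')) (In (V ''B'')),
     Assign ''U'' (V ''a'') (Mul (Mul (Quot (Quot (V ''D'') (In (Add (V ''B'') (Const 3)))) (In (Const 3)))
       (In (Add (V ''B'') (Const 2)))) (In (Const 2))),
     Assign ''U'' (Add (V ''m'') (V ''a'')) (Read ''U'' (V ''a'')),
     Assign ''c'' (V ''a'') (Mul (Quot (V ''D'') (In (Add (V ''B'') (Const 5)))) (In (Add (V ''B'') (Const 4)))),
     Assign ''c'' (Add (V ''m'') (V ''a'')) (Read ''c'' (V ''a'')),
     Assign ''w'' (V ''a'') (Read ''c'' (V ''a''))]"

text \<open>The second branch treats sinks and nodes of balance 0 alike; the latter obtain an arc of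
  capacity 0.\<close>

definition read_node :: com where
  "read_node = seqs [
     Set_var ''B'' (Add (Const 4) (Mul (V ''a'') (Const 2))),
     Set_var ''j'' (Add (Mul (V ''m'') (Const 2)) (V ''a'')),
     If (Less (Const 0) (In (V ''B'')))
       (seqs [
         Assign ''t'' (V ''j'') (V ''n''),
         Assign ''h'' (V ''j'') (V ''a''),
         Assign ''U'' (V ''j'') (Mul (Quot (V ''D'') (In (Add (V ''B'') (Const 1)))) (In (V ''B''))),
         Assign ''c'' (V ''j'') (Mul (Mul (Quot (V ''D'') (In (Const 3))) (In (Const 2))) (Const (- 2)))])
       (seqs [
         Assign ''t'' (V ''j'') (V ''a''),
         Assign ''h'' (V ''j'') (V ''n''),
         Assign ''U'' (V ''j'') (Sub (Const 0) (Mul (Quot (V ''D'') (In (Add (V ''B'') (Const 1)))) (In (V ''B'')))),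
         Assign ''c'' (V ''j'') (Const 0)])]"

text \<open>The power of two \<open>P\<close> exceeds every capacity, so that all capacities
  \<open>\<lfloor>U / P\<rfloor>\<close> vanish and capacity scaling can start from zero flow and
  zero potentials.\<close>

definition find_scale :: com where
  "find_scale = seqs [
     Set_var ''Z'' (Const 1),
     For ''a'' (V ''M'') (Set_var ''Z'' (Add (V ''Z'') (Read ''U'' (V ''a'')))),
     Set_var ''P'' (Const 1),
     While (Less (V ''P'') (V ''Z'')) (Set_var ''P'' (Add (V ''P'') (V ''P'')))]"

definition clip :: "int \<Rightarrow> int" where
  "clip x = (if 0 < x then x else 1)"

definition sizes_read :: "memory \<Rightarrow> memory \<Rightarrow> bool" where
  "sizes_read s r \<longleftrightarrow> r ''n'' 0 = s ''in'' 0 \<and> r ''m'' 0 = s ''in'' 1 \<and> r ''M'' 0 = 2 * s ''in'' 1 + s ''in'' 0 \<and>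
     r ''D'' 0 = (\<Prod>i\<in>{0..<4 + 2 * s ''in'' 0 + 6 * s ''in'' 1}. clip (s ''in'' i))"

lemma wp_read_sizes:
  assumes "0 \<le> s ''in'' 0" "0 \<le> s ''in'' 1" "4 + 2 * s ''in'' 0 + 6 * s ''in'' 1 \<le> int q"
  shows "wp q read_sizes (sizes_read s) s"
proof -
  define n m where "n = s ''in'' 0" and "m = s ''in'' 1"
  let ?body = "If (Less (Const 0) (In (V ''i''))) (Set_var ''D'' (Mul (V ''D'') (In (V ''i'')))) Skip"
  define s1 where "s1 = s(''n'' := (s ''n'')(0 := n), ''m'' := (s ''m'')(0 := m),
    ''M'' := (s ''M'')(0 := m + m + n), ''D'' := (s ''D'')(0 := 1))"
  have "wp q (For ''i'' (Add (Add (Const 4) (Mul (V ''n'') (Const 2))) (Mul (V ''m'') (Const 6))) ?body) (sizes_read s) s1"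
  proof (rule wp_For[where N = "4 + 2 * n + 6 * m" and I = "\<lambda>j r. r ''D'' 0 = (\<Prod>i\<in>{0..<j}. clip (s ''in'' i))"])
    fix j r assume ag: "agree (insert ''i'' (assigned ?body)) s1 r"
    have eq: "r z = s1 z" if "z \<notin> {''i'', ''D''}" for z using that by (intro agreeD[OF ag]) simp
    then have r: "r ''n'' 0 = n" "r ''m'' 0 = m" "r ''in'' = s ''in''" "r ''M'' 0 = m + m + n"
      by (simp_all add: eq) (simp_all add: s1_def)
    show "eval_exp r (Add (Add (Const 4) (Mul (V ''n'') (Const 2))) (Mul (V ''m'') (Const 6))) = 4 + 2 * n + 6 * m"
      by (simp add: r)
    assume I: "r ''D'' 0 = (\<Prod>i\<in>{0..<j}. clip (s ''in'' i))" and j: "0 \<le> j" "r ''i'' 0 = j"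
    have "{0..<j + 1} = insert j {0..<j}" using j by auto
    then have "(\<Prod>i\<in>{0..<j + 1}. clip (s ''in'' i)) = (\<Prod>i\<in>{0..<j}. clip (s ''in'' i)) * clip (s ''in'' j)" by simp
    then show "wp q ?body (\<lambda>r'. (r'(''i'' := (r' ''i'')(0 := j + 1))) ''D'' 0 = (\<Prod>i\<in>{0..<j + 1}. clip (s ''in'' i)) \<and> r' ''i'' 0 = j) r"
      using I j by (simp add: r clip_def)
  next
    fix r assume ag: "agree (insert ''i'' (assigned ?body)) s1 r"
      and I: "r ''D'' 0 = (\<Prod>i\<in>{0..<4 + 2 * n + 6 * m}. clip (s ''in'' i))"
    have eq: "r z = s1 z" if "z \<notin> {''i'', ''D''}" for z using that by (intro agreeD[OF ag]) simp
    have r: "r ''n'' 0 = n" "r ''m'' 0 = m" "r ''M'' 0 = m + m + n"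
      by (simp_all add: eq) (simp_all add: s1_def)
    show "sizes_read s r" using r I by (simp add: sizes_read_def n_def m_def)
  qed (use assms in \<open>simp_all add: n_def m_def s1_def\<close>)
  then show ?thesis by (simp add: read_sizes_def s1_def n_def m_def)
qed

definition edge_read :: "(int \<Rightarrow> int) \<Rightarrow> int \<Rightarrow> memory \<Rightarrow> int \<Rightarrow> bool" where
  "edge_read inp D r e \<longleftrightarrow> (let m = inp 1; B = 4 + inp 0 * 2 + e * 6 in
     r ''t'' e = inp B \<and> r ''h'' e = inp (B + 1) \<and> r ''t'' (m + e) = inp (B + 1) \<and> r ''h'' (m + e) = inp B \<and>
     r ''U'' e = D div inp (B + 3) div inp 3 * inp (B + 2) * inp 2 \<and> r ''U'' (m + e) = r ''U'' e \<and>
     r ''c'' e = D div inp (B + 5) * inp (B + 4) \<and> r ''c'' (m + e) = r ''c'' e \<and> r ''w'' e = r ''c'' e)"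

definition node_read :: "(int \<Rightarrow> int) \<Rightarrow> int \<Rightarrow> memory \<Rightarrow> int \<Rightarrow> bool" where
  "node_read inp D r v \<longleftrightarrow> (let j = inp 1 * 2 + v; B = 4 + v * 2 in
     if 0 < inp B
     then r ''t'' j = inp 0 \<and> r ''h'' j = v \<and> r ''U'' j = D div inp (B + 1) * inp B \<and>
       r ''c'' j = D div inp 3 * inp 2 * (- 2)
     else r ''t'' j = v \<and> r ''h'' j = inp 0 \<and> r ''U'' j = - (D div inp (B + 1) * inp B) \<and> r ''c'' j = 0)"

lemma wp_read_edges:
  assumes s: "s ''n'' 0 = s ''in'' 0" "s ''m'' 0 = s ''in'' 1" and m: "0 \<le> s ''in'' 1" "s ''in'' 1 \<le> int q"
  shows "wp q (For ''a'' (V ''m'') read_edge) (\<lambda>r. (\<forall>e\<in>{0..<s ''in'' 1}. edge_read (s ''in'') (s ''D'' 0) r e) \<and>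
    (\<forall>a. a \<notin> {0..<s ''in'' 1} \<longrightarrow> r ''w'' a = s ''w'' a)) s"
proof (rule wp_For[where N = "s ''in'' 1" and I = "\<lambda>j r. (\<forall>e\<in>{0..<j}. edge_read (s ''in'') (s ''D'' 0) r e) \<and>
    (\<forall>a. a \<notin> {0..<j} \<longrightarrow> r ''w'' a = s ''w'' a)"])
  fix j r assume ag: "agree (insert ''a'' (assigned read_edge)) s r"
  have eq: "r z = s z" if "z \<notin> {''a'', ''B'', ''t'', ''h'', ''U'', ''c'', ''w''}" for z
    using that by (intro agreeD[OF ag]) (simp add: read_edge_def)
  have r: "r ''n'' 0 = s ''in'' 0" "r ''m'' 0 = s ''in'' 1" "r ''in'' = s ''in''" "r ''D'' = s ''D''"
    using s by (simp_all add: eq)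
  show "eval_exp r (V ''m'') = s ''in'' 1" by (simp add: r)
  assume I: "(\<forall>e\<in>{0..<j}. edge_read (s ''in'') (s ''D'' 0) r e) \<and> (\<forall>a. a \<notin> {0..<j} \<longrightarrow> r ''w'' a = s ''w'' a)"
    and j: "0 \<le> j" "j < s ''in'' 1" "r ''a'' 0 = j"
  have ivl: "{0..<j + 1} = insert j {0..<j}" using j by auto
  let ?Q = "\<lambda>r'. ((\<forall>e\<in>{0..<j + 1}. edge_read (s ''in'') (s ''D'' 0) (r'(''a'' := (r' ''a'')(0 := j + 1))) e) \<and>
    (\<forall>a. a \<notin> {0..<j + 1} \<longrightarrow> (r'(''a'' := (r' ''a'')(0 := j + 1))) ''w'' a = s ''w'' a)) \<and> r' ''a'' 0 = j"
  let ?B = "4 + s ''in'' 0 * 2 + j * 6"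
  let ?U = "s ''D'' 0 div s ''in'' (?B + 3) div s ''in'' 3 * s ''in'' (?B + 2) * s ''in'' 2"
  let ?c = "s ''D'' 0 div s ''in'' (?B + 5) * s ''in'' (?B + 4)"
  define r' where "r' = r(''B'' := (r ''B'')(0 := ?B),
    ''t'' := (r ''t'')(j := s ''in'' ?B, s ''in'' 1 + j := s ''in'' (?B + 1)),
    ''h'' := (r ''h'')(j := s ''in'' (?B + 1), s ''in'' 1 + j := s ''in'' ?B),
    ''U'' := (r ''U'')(j := ?U, s ''in'' 1 + j := ?U), ''c'' := (r ''c'')(j := ?c, s ''in'' 1 + j := ?c),
    ''w'' := (r ''w'')(j := ?c))"
  have "edge_read (s ''in'') (s ''D'' 0) (r'(''a'' := z)) j" for z
    using j by (simp add: edge_read_def Let_def r'_def)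
  moreover have "edge_read (s ''in'') (s ''D'' 0) (r'(''a'' := z)) e" if "e \<in> {0..<j}" for z e
  proof -
    have "edge_read (s ''in'') (s ''D'' 0) r e" using I that by blast
    then show ?thesis using that j by (simp add: edge_read_def Let_def r'_def)
  qed
  moreover have "r' ''a'' 0 = j" "\<forall>a. a \<notin> {0..<j + 1} \<longrightarrow> r' ''w'' a = s ''w'' a"
    using I j by (auto simp: r'_def)
  ultimately have "?Q r'" unfolding ivl by simp
  moreover have "wp q read_edge Q r = Q r'" for Q
  proof -
    have "wp q read_edge Q r = Q (r(''B'' := (r ''B'')(0 := ?B),
      ''t'' := (r ''t'')(j := s ''in'' ?B), ''h'' := (r ''h'')(j := s ''in'' (?B + 1)),
      ''t'' := (r ''t'')(j := s ''in'' ?B, s ''in'' 1 + j := s ''in'' (?B + 1)),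
      ''h'' := (r ''h'')(j := s ''in'' (?B + 1), s ''in'' 1 + j := s ''in'' ?B),
      ''U'' := (r ''U'')(j := ?U), ''U'' := (r ''U'')(j := ?U, s ''in'' 1 + j := ?U),
      ''c'' := (r ''c'')(j := ?c), ''c'' := (r ''c'')(j := ?c, s ''in'' 1 + j := ?c),
      ''w'' := (r ''w'')(j := ?c)))"
      using j by (simp add: read_edge_def r)
    also have "\<dots> = Q r'" unfolding r'_def by (rule arg_cong[where f = Q]) (simp add: fun_eq_iff)
    finally show ?thesis .
  qed
  ultimately show "wp q read_edge ?Q r" by blast
qed (use m in auto)

lemma wp_read_nodes:
  assumes s: "s ''n'' 0 = s ''in'' 0" "s ''m'' 0 = s ''in'' 1" and n: "0 \<le> s ''in'' 0" "s ''in'' 0 \<le> int q"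
  shows "wp q (For ''a'' (V ''n'') read_node) (\<lambda>r. (\<forall>v\<in>{0..<s ''in'' 0}. node_read (s ''in'') (s ''D'' 0) r v) \<and>
    (\<forall>a < 2 * s ''in'' 1. r ''t'' a = s ''t'' a \<and> r ''h'' a = s ''h'' a \<and> r ''U'' a = s ''U'' a \<and> r ''c'' a = s ''c'' a)) s"
proof (rule wp_For[where N = "s ''in'' 0" and I = "\<lambda>j r. (\<forall>v\<in>{0..<j}. node_read (s ''in'') (s ''D'' 0) r v) \<and>
    (\<forall>a < 2 * s ''in'' 1. r ''t'' a = s ''t'' a \<and> r ''h'' a = s ''h'' a \<and> r ''U'' a = s ''U'' a \<and> r ''c'' a = s ''c'' a)"])
  fix j r assume ag: "agree (insert ''a'' (assigned read_node)) s r"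
  have eq: "r z = s z" if "z \<notin> {''a'', ''B'', ''j'', ''t'', ''h'', ''U'', ''c''}" for z
    using that by (intro agreeD[OF ag]) (simp add: read_node_def)
  have r: "r ''n'' 0 = s ''in'' 0" "r ''m'' 0 = s ''in'' 1" "r ''in'' = s ''in''" "r ''D'' = s ''D''"
    using s by (simp_all add: eq)
  show "eval_exp r (V ''n'') = s ''in'' 0" by (simp add: r)
  assume I: "(\<forall>v\<in>{0..<j}. node_read (s ''in'') (s ''D'' 0) r v) \<and>
      (\<forall>a < 2 * s ''in'' 1. r ''t'' a = s ''t'' a \<and> r ''h'' a = s ''h'' a \<and> r ''U'' a = s ''U'' a \<and> r ''c'' a = s ''c'' a)"
    and j: "0 \<le> j" "j < s ''in'' 0" "r ''a'' 0 = j"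
  have ivl: "{0..<j + 1} = insert j {0..<j}" using j by auto
  let ?Q = "\<lambda>r'. ((\<forall>v\<in>{0..<j + 1}. node_read (s ''in'') (s ''D'' 0) (r'(''a'' := (r' ''a'')(0 := j + 1))) v) \<and>
    (\<forall>a < 2 * s ''in'' 1. (r'(''a'' := (r' ''a'')(0 := j + 1))) ''t'' a = s ''t'' a \<and>
      (r'(''a'' := (r' ''a'')(0 := j + 1))) ''h'' a = s ''h'' a \<and> (r'(''a'' := (r' ''a'')(0 := j + 1))) ''U'' a = s ''U'' a \<and>
      (r'(''a'' := (r' ''a'')(0 := j + 1))) ''c'' a = s ''c'' a)) \<and> r' ''a'' 0 = j"
  let ?B = "4 + j * 2" and ?j = "s ''in'' 1 * 2 + j"
  define t h U c where "t = (if 0 < s ''in'' ?B then s ''in'' 0 else j)"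
    and "h = (if 0 < s ''in'' ?B then j else s ''in'' 0)"
    and "U = (if 0 < s ''in'' ?B then s ''D'' 0 div s ''in'' (?B + 1) * s ''in'' ?B
      else - (s ''D'' 0 div s ''in'' (?B + 1) * s ''in'' ?B))"
    and "c = (if 0 < s ''in'' ?B then s ''D'' 0 div s ''in'' 3 * s ''in'' 2 * (- 2) else 0)"
  define r' where "r' = r(''B'' := (r ''B'')(0 := ?B), ''j'' := (r ''j'')(0 := ?j),
    ''t'' := (r ''t'')(?j := t), ''h'' := (r ''h'')(?j := h), ''U'' := (r ''U'')(?j := U), ''c'' := (r ''c'')(?j := c))"
  have "node_read (s ''in'') (s ''D'' 0) (r'(''a'' := z)) j" for z
    by (simp add: node_read_def Let_def r'_def t_def h_def U_def c_def)
  moreover have "node_read (s ''in'') (s ''D'' 0) (r'(''a'' := z)) v" if "v \<in> {0..<j}" for z v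
  proof -
    have "node_read (s ''in'') (s ''D'' 0) r v" using I that by blast
    then show ?thesis using that by (simp add: node_read_def Let_def r'_def)
  qed
  moreover have "r' ''a'' 0 = j" "\<forall>a < 2 * s ''in'' 1. r' ''t'' a = s ''t'' a \<and> r' ''h'' a = s ''h'' a \<and>
      r' ''U'' a = s ''U'' a \<and> r' ''c'' a = s ''c'' a"
    using I j by (auto simp: r'_def)
  ultimately have "?Q r'" unfolding ivl by simp
  moreover have "wp q read_node Q r = Q r'" for Q
    using j by (simp add: read_node_def r r'_def t_def h_def U_def c_def)
  ultimately show "wp q read_node ?Q r" by blast
qed (use n in auto)

lemma wp_find_scale:
  assumes M: "0 \<le> s ''M'' 0" "s ''M'' 0 \<le> int q"
    and U: "\<And>a. a \<in> {0..<s ''M'' 0} \<Longrightarrow> 0 \<le> s ''U'' a"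
    and N: "1 + (\<Sum>a\<in>{0..<s ''M'' 0}. s ''U'' a) \<le> 2 ^ N" "N < q"
  shows "wp q find_scale (\<lambda>r. \<exists>j<q. r ''P'' 0 = 2 ^ j \<and> (\<forall>a\<in>{0..<s ''M'' 0}. s ''U'' a < 2 ^ j)) s"
proof -
  define s1 where "s1 = s(''Z'' := (s ''Z'')(0 := 1))"
  let ?sum = "Set_var ''Z'' (Add (V ''Z'') (Read ''U'' (V ''a'')))"
  define S where "S = 1 + (\<Sum>a\<in>{0..<s ''M'' 0}. s ''U'' a)"
  let ?Q = "\<lambda>r. \<exists>j<q. r ''P'' 0 = 2 ^ j \<and> (\<forall>a\<in>{0..<s ''M'' 0}. s ''U'' a < 2 ^ j)"
  let ?loop = "While (Less (V ''P'') (V ''Z'')) (Set_var ''P'' (Add (V ''P'') (V ''P'')))"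
  have "wp q (For ''a'' (V ''M'') ?sum) (\<lambda>r. r ''Z'' 0 = S) s1"
  proof (rule wp_For[where N = "s ''M'' 0" and I = "\<lambda>j r. r ''Z'' 0 = 1 + (\<Sum>a\<in>{0..<j}. s ''U'' a)"])
    fix j r assume ag: "agree (insert ''a'' (assigned ?sum)) s1 r"
    have eq: "r z = s1 z" if "z \<notin> {''a'', ''Z''}" for z using that by (intro agreeD[OF ag]) simp
    have r: "r ''M'' = s ''M''" "r ''U'' = s ''U''" by (simp_all add: eq) (simp_all add: s1_def)
    show "eval_exp r (V ''M'') = s ''M'' 0" by (simp add: r)
    assume "r ''Z'' 0 = 1 + (\<Sum>a\<in>{0..<j}. s ''U'' a)" "0 \<le> j" "r ''a'' 0 = j"
    moreover have "{0..<j + 1} = insert j {0..<j}" using \<open>0 \<le> j\<close> by auto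
    ultimately show "wp q ?sum (\<lambda>r'. (r'(''a'' := (r' ''a'')(0 := j + 1))) ''Z'' 0 = 1 + (\<Sum>a\<in>{0..<j + 1}. s ''U'' a) \<and> r' ''a'' 0 = j) r"
      by (simp add: r)
  qed (use M in \<open>simp_all add: s1_def S_def\<close>)
  then have "wp q (For ''a'' (V ''M'') ?sum) (wp q (Seq (Set_var ''P'' (Const 1)) ?loop) ?Q) s1"
  proof (rule wp_mono)
    fix r :: memory assume Z: "r ''Z'' 0 = S"
    define r1 where "r1 = r(''P'' := (r ''P'')(0 := 1))"
    have "wp q ?loop ?Q r1"
    proof (rule wp_While[where I = "\<lambda>r. r ''Z'' 0 = S \<and> (\<exists>j\<le>N. r ''P'' 0 = 2 ^ j)" and
          \<mu> = "\<lambda>r. N - (LEAST j. r ''P'' 0 = 2 ^ j)"])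
      show "r1 ''Z'' 0 = S \<and> (\<exists>j\<le>N. r1 ''P'' 0 = 2 ^ j)" using Z by (auto simp: r1_def intro!: exI[of _ 0])
    next
      fix r2 :: memory assume "r2 ''Z'' 0 = S \<and> (\<exists>j\<le>N. r2 ''P'' 0 = 2 ^ j)"
      then obtain j where j: "r2 ''Z'' 0 = S" "r2 ''P'' 0 = 2 ^ j" "j \<le> N" by blast
      have least: "(LEAST i. (2::int) ^ k = 2 ^ i) = k" for k by (rule Least_equality) auto
      {
        assume "eval_exp r2 (Less (V ''P'') (V ''Z'')) \<noteq> 0"
        then have "(2::int) ^ j < S" using j by (simp split: if_splits)
        also have "S \<le> 2 ^ N" using N(1) by (simp add: S_def)
        finally have "j < N" by simp
        have p: "(2::int) ^ j + 2 ^ j = 2 ^ Suc j" by simp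
        show "wp q (Set_var ''P'' (Add (V ''P'') (V ''P''))) (\<lambda>r'. (r' ''Z'' 0 = S \<and> (\<exists>j\<le>N. r' ''P'' 0 = 2 ^ j)) \<and>
            N - (LEAST j. r' ''P'' 0 = 2 ^ j) < N - (LEAST j. r2 ''P'' 0 = 2 ^ j)) r2"
          using j \<open>j < N\<close> least[of j] least[of "Suc j"]
          by (auto simp: p simp del: power_Suc intro!: exI[of _ "Suc j"])
      }
      {
        assume "eval_exp r2 (Less (V ''P'') (V ''Z'')) = 0"
        then have S: "S \<le> 2 ^ j" using j by (simp split: if_splits)
        have "s ''U'' a < 2 ^ j" if "a \<in> {0..<s ''M'' 0}" for a
          using member_le_sum[of a "{0..<s ''M'' 0}" "s ''U''"] U that S by (simp add: S_def)
        then show "?Q r2" using j N(2) by (intro exI[of _ j]) auto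
      }
    qed (use N in auto)
    then show "wp q (Seq (Set_var ''P'' (Const 1)) ?loop) ?Q r" by (simp add: r1_def)
  qed
  then show ?thesis by (simp add: find_scale_def s1_def wp_Seq_fun)
qed

section \<open>Decomposing the circulation into paths\<close>

text \<open>Finds the bottleneck \<open>z\<close> and the length \<open>L\<close> in one traversal.
  The caller initializes \<open>z\<close> with the flow on the arc that closes the cycle; arcs at
  the additional node do not contribute to \<open>L\<close>, as their \<open>w\<close> is 0.\<close>

definition measure_path :: com where
  "measure_path = trace (Seq
     (If (Less (Read ''k'' (Read ''b'' (V ''u''))) (V ''z'')) (Set_var ''z'' (Read ''k'' (Read ''b'' (V ''u'')))) Skip)
     (Set_var ''L'' (Add (V ''L'') (Read ''w'' (Read ''b'' (V ''u''))))))"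

lemma wp_measure_path:
  assumes "pred_path (s ''s'' 0) (s ''p'') (s ''g'' 0) js" "length js \<le> q"
  shows "wp q measure_path (\<lambda>r. r ''L'' 0 = s ''L'' 0 + (\<Sum>j\<leftarrow>js. s ''w'' (s ''b'' j)) \<and>
    r ''z'' 0 \<le> s ''z'' 0 \<and> (\<forall>j\<in>set js. r ''z'' 0 \<le> s ''k'' (s ''b'' j)) \<and>
    (r ''z'' 0 = s ''z'' 0 \<or> (\<exists>j\<in>set js. r ''z'' 0 = s ''k'' (s ''b'' j)))) s"
proof -
  let ?body = "Seq
     (If (Less (Read ''k'' (Read ''b'' (V ''u''))) (V ''z'')) (Set_var ''z'' (Read ''k'' (Read ''b'' (V ''u'')))) Skip)
     (Set_var ''L'' (Add (V ''L'') (Read ''w'' (Read ''b'' (V ''u'')))))"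
  define J where "J l r \<longleftrightarrow> r ''L'' 0 = s ''L'' 0 + (\<Sum>j\<leftarrow>l. s ''w'' (s ''b'' j)) \<and>
    r ''z'' 0 \<le> s ''z'' 0 \<and> (\<forall>j\<in>set l. r ''z'' 0 \<le> s ''k'' (s ''b'' j)) \<and>
    (r ''z'' 0 = s ''z'' 0 \<or> (\<exists>j\<in>set l. r ''z'' 0 = s ''k'' (s ''b'' j)))" for l and r :: memory
  show ?thesis
    unfolding measure_path_def
  proof (rule wp_trace[where I = J, OF assms])
    fix l j l' r
    assume J: "J l r" and u: "r ''u'' 0 = j" and ag: "agree (insert ''u'' (assigned ?body)) s r"
    have eq: "r x = s x" if "x \<notin> {''u'', ''z'', ''L''}" for x
      using that by (intro agreeD[OF ag]) simp
    have r: "r ''k'' = s ''k''" "r ''b'' = s ''b''" "r ''w'' = s ''w''" by (simp_all add: eq)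
    show "wp q ?body (\<lambda>r'. J (l @ [j]) (r'(''u'' := (r' ''u'')(0 := s ''p'' j)))) r"
      using J u by (cases "s ''k'' (s ''b'' j) < r ''z'' 0") (auto simp: r J_def)
  qed (simp_all add: J_def)
qed

definition block_at :: "int \<Rightarrow> (int \<Rightarrow> int) \<Rightarrow> nat \<Rightarrow> nat block" where
  "block_at m out k = (let i = m + 1 + 7 * int k in
     (nat (out i), fraction_at out (i + 1), fraction_at out (i + 3), fraction_at out (i + 5)))"

definition valid_block :: "int \<Rightarrow> (int \<Rightarrow> int) \<Rightarrow> nat \<Rightarrow> bool" where
  "valid_block m out k \<longleftrightarrow> (let i = m + 1 + 7 * int k in
     0 \<le> out i \<and> out i < m \<and> 0 < out (i + 2) \<and> 0 < out (i + 4) \<and> 0 < out (i + 6))"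

definition output_blocks :: "int \<Rightarrow> (int \<Rightarrow> int) \<Rightarrow> int \<Rightarrow> nat block list \<Rightarrow> bool" where
  "output_blocks m out pos bl \<longleftrightarrow> 0 \<le> m \<and> 0 \<le> out m \<and> pos = m + 1 + 7 * out m \<and>
     (\<forall>k<nat (out m). valid_block m out k) \<and> bl = map (block_at m out) [0..<nat (out m)]"

lemma block_cong:
  assumes "\<And>i. m < i \<Longrightarrow> i < m + 1 + 7 * int K \<Longrightarrow> out' i = out i" "k < K"
  shows "block_at m out' k = block_at m out k" "valid_block m out' k = valid_block m out k"
proof -
  have "out' (m + 1 + 7 * int k + j) = out (m + 1 + 7 * int k + j)" if "j \<in> {0..6}" for j
    by (rule assms(1)) (use assms(2) that in auto)
  from this[of 0] this[of 1] this[of 2] this[of 3] this[of 4] this[of 5] this[of 6]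
  show "block_at m out' k = block_at m out k" "valid_block m out' k = valid_block m out k"
    by (simp_all add: block_at_def valid_block_def fraction_at_def Let_def add.assoc)
qed

text \<open>The new cells lie behind the old blocks and the counter in cell \<open>m\<close> lies in
  front of them, so the old blocks are read as before.\<close>

lemma output_blocks_snoc:
  fixes e D R L X Y :: int
  assumes "output_blocks m out pos bl" "0 \<le> e" "e < m" "0 < D" "0 < R"
    and out': "out' = out(pos := e, pos + 1 := L, pos + 2 := D, pos + 3 := X, pos + 4 := D, pos + 5 := Y,
      pos + 6 := R, m := out m + 1)"
  shows "output_blocks m out' (pos + 7) (bl @ [(nat e, L / D, X / D, Y / R)])"
    and "a < m \<Longrightarrow> out' a = out a"
proof -
  define K where "K = nat (out m)"
  have m: "0 \<le> m" "out m = int K" "pos = m + 1 + 7 * int K" and bl: "bl = map (block_at m out) [0..<K]"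
    and v: "\<And>k. k < K \<Longrightarrow> valid_block m out k"
    using assms(1) by (auto simp: output_blocks_def K_def)
  have old: "out' i = out i" if "m < i" "i < m + 1 + 7 * int K" for i using that m by (simp add: out')
  have K': "nat (out' m) = Suc K" using m by (simp add: out' nat_add_distrib)
  have "block_at m out' K = (nat e, L / D, X / D, Y / R)"
    by (simp add: block_at_def m(3)[symmetric] fraction_at_def out') (use m in simp)
  moreover have "valid_block m out' K"
    using assms(2-5) by (simp add: valid_block_def m(3)[symmetric] out') (use m in simp)
  moreover have "out' m = int K + 1" using m by (simp add: out')
  moreover have "map (block_at m out') [0..<K] = bl"
    unfolding bl by (rule map_cong) (use block_cong(1)[OF old] in auto)
  moreover have "valid_block m out' k" if "k < K" for k
    using block_cong(2)[OF old that] v[OF that] by simp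
  ultimately show "output_blocks m out' (pos + 7) (bl @ [(nat e, L / D, X / D, Y / R)])"
    unfolding output_blocks_def K' using m by (auto simp: less_Suc_eq)
  show "out' a = out a" if "a < m" using that m by (simp add: out')
qed

text \<open>
  A block is written as seven cells: the arc, the fractions \<open>L / D\<close> and \<open>X / D\<close> for the period, and the
  rate \<open>z / (2 * T * D)\<close>, where \<open>T\<close> is the quotient of the input cells 2 and 3.
\<close>

definition emit_block :: com where
  "emit_block = seqs [
     Assign ''out'' (V ''q'') (Read ''b'' (V ''u'')),
     Assign ''out'' (Add (V ''q'') (Const 1)) (V ''L''),
     Assign ''out'' (Add (V ''q'') (Const 2)) (V ''D''),
     Assign ''out'' (Add (V ''q'') (Const 3)) (V ''X''),
     Assign ''out'' (Add (V ''q'') (Const 4)) (V ''D''),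
     Assign ''out'' (Add (V ''q'') (Const 5)) (Mul (V ''z'') (In (Const 3))),
     Assign ''out'' (Add (V ''q'') (Const 6)) (Mul (Mul (V ''D'') (In (Const 2))) (Const 2)),
     Assign ''out'' (V ''m'') (Add (Read ''out'' (V ''m'')) (Const 1)),
     Set_var ''q'' (Add (V ''q'') (Const 7))]"

text \<open>\<open>L\<close> and \<open>X\<close> are decreased before the block is written because
  a block describes the inflow into the arc, which precedes the arrival at its head by
  \<open>w\<close>. Arcs with index at least \<open>m\<close> do not appear in the answer; only
  their flow is reduced.\<close>

definition emit_arc :: com where
  "emit_arc = seqs [
     Assign ''k'' (Read ''b'' (V ''u'')) (Sub (Read ''k'' (Read ''b'' (V ''u''))) (V ''z'')),
     Set_var ''L'' (Sub (V ''L'') (Read ''w'' (Read ''b'' (V ''u'')))),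
     Set_var ''X'' (Sub (V ''X'') (Read ''w'' (Read ''b'' (V ''u'')))),
     If (Less (Read ''b'' (V ''u'')) (V ''m'')) emit_block Skip]"

fun emitted :: "int \<Rightarrow> (int \<Rightarrow> int) \<Rightarrow> (int \<Rightarrow> int) \<Rightarrow> int \<Rightarrow> real \<Rightarrow> int \<Rightarrow> int \<Rightarrow> int list \<Rightarrow> nat block list" where
  "emitted m b w D \<rho> L X [] = []"
| "emitted m b w D \<rho> L X (j # js) =
     (if b j < m then [(nat (b j), (L - w (b j)) / D, (X - w (b j)) / D, \<rho>)] else []) @
     emitted m b w D \<rho> (L - w (b j)) (X - w (b j)) js"

lemma emitted_snoc: "emitted m b w D \<rho> L X (l @ [j]) = emitted m b w D \<rho> L X l @
    emitted m b w D \<rho> (L - (\<Sum>j\<leftarrow>l. w (b j))) (X - (\<Sum>j\<leftarrow>l. w (b j))) [j]"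
  by (induction l arbitrary: L X) (simp_all add: algebra_simps)

lemma wp_emit_path:
  assumes path: "pred_path (s ''s'' 0) (s ''p'') (s ''g'' 0) js" "length js \<le> q"
    and out: "output_blocks (s ''m'' 0) (s ''out'') (s ''q'' 0) bl"
    and b: "\<And>j. j \<in> set js \<Longrightarrow> 0 \<le> s ''b'' j"
    and D: "0 < s ''D'' 0" "0 < s ''in'' 2"
  shows "wp q (trace emit_arc) (\<lambda>r. r ''k'' = push (- s ''z'' 0) (s ''b'') (\<lambda>_. 1) js (s ''k'') \<and>
    (\<forall>a<s ''m'' 0. r ''out'' a = s ''out'' a) \<and>
    output_blocks (s ''m'' 0) (r ''out'') (r ''q'' 0) (bl @ emitted (s ''m'' 0) (s ''b'') (s ''w'') (s ''D'' 0)
      (s ''z'' 0 * s ''in'' 3 / (s ''D'' 0 * s ''in'' 2 * 2)) (s ''L'' 0) (s ''X'' 0) js)) s"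
proof -
  define \<rho> where "\<rho> = s ''z'' 0 * s ''in'' 3 / (s ''D'' 0 * s ''in'' 2 * 2)"
  define J where "J l r \<longleftrightarrow> r ''k'' = push (- s ''z'' 0) (s ''b'') (\<lambda>_. 1) l (s ''k'') \<and>
    (\<forall>a<s ''m'' 0. r ''out'' a = s ''out'' a) \<and>
    r ''L'' 0 = s ''L'' 0 - (\<Sum>j\<leftarrow>l. s ''w'' (s ''b'' j)) \<and> r ''X'' 0 = s ''X'' 0 - (\<Sum>j\<leftarrow>l. s ''w'' (s ''b'' j)) \<and>
    output_blocks (s ''m'' 0) (r ''out'') (r ''q'' 0)
      (bl @ emitted (s ''m'' 0) (s ''b'') (s ''w'') (s ''D'' 0) \<rho> (s ''L'' 0) (s ''X'' 0) l)" for l r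
  show ?thesis
  proof (rule wp_trace[where I = J, OF path])
    show "''s'' \<notin> assigned emit_arc" "''p'' \<notin> assigned emit_arc" "''u'' \<notin> assigned emit_arc"
      by (simp_all add: emit_arc_def emit_block_def)
    show "J [] (s(''u'' := (s ''u'')(0 := s ''g'' 0)))" using out by (simp add: J_def)
  next
    fix l j l' r
    assume js: "js = l @ j # l'" and J: "J l r" and u: "r ''u'' 0 = j"
      and ag: "agree (insert ''u'' (assigned emit_arc)) s r"
    have eq: "r x = s x" if "x \<notin> {''u'', ''k'', ''L'', ''X'', ''out'', ''q''}" for x
      using that by (intro agreeD[OF ag]) (simp add: emit_arc_def emit_block_def)
    have r: "r ''b'' = s ''b''" "r ''w'' = s ''w''" "r ''m'' = s ''m''" "r ''D'' = s ''D''" "r ''in'' = s ''in''"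
      "r ''z'' = s ''z''" by (simp_all add: eq)
    define L X a k where "L = r ''L'' 0 - s ''w'' (s ''b'' j)" and "X = r ''X'' 0 - s ''w'' (s ''b'' j)"
      and "a = s ''b'' j" and "k = push (- s ''z'' 0) (s ''b'') (\<lambda>_. 1) (l @ [j]) (s ''k'')"
    have k: "(r ''k'')(a := r ''k'' a - s ''z'' 0) = k"
      using J unfolding k_def push_snoc by (simp add: J_def a_def)
    show "wp q emit_arc (\<lambda>r'. J (l @ [j]) (r'(''u'' := (r' ''u'')(0 := s ''p'' j)))) r"
    proof (cases "a < s ''m'' 0")
      case False
      define r' where "r' = r(''k'' := k, ''L'' := (r ''L'')(0 := L), ''X'' := (r ''X'')(0 := X))"
      have "J (l @ [j]) (r'(''u'' := x))" for x
        using J False unfolding J_def emitted_snoc by (simp add: r'_def k_def L_def X_def a_def[symmetric])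
      then show ?thesis using False
        by (simp add: emit_arc_def r u a_def[symmetric] k L_def[folded a_def, symmetric]
            X_def[folded a_def, symmetric] r'_def)
    next
      case True
      have a: "0 \<le> a" using b js by (simp add: a_def)
      define pos R Y where "pos = r ''q'' 0" and "R = s ''D'' 0 * s ''in'' 2 * 2" and "Y = s ''z'' 0 * s ''in'' 3"
      define out' where "out' = (r ''out'')(pos := a, pos + 1 := L, pos + 2 := s ''D'' 0, pos + 3 := X,
        pos + 4 := s ''D'' 0, pos + 5 := Y, pos + 6 := R, s ''m'' 0 := r ''out'' (s ''m'' 0) + 1)"
      have ob: "output_blocks (s ''m'' 0) (r ''out'') pos
        (bl @ emitted (s ''m'' 0) (s ''b'') (s ''w'') (s ''D'' 0) \<rho> (s ''L'' 0) (s ''X'' 0) l)"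
        using J by (simp add: J_def pos_def)
      have "0 < R" using D by (simp add: R_def)
      note new = output_blocks_snoc[OF ob a True D(1) this out'_def]
      have pos_m: "s ''m'' 0 < pos" using ob by (auto simp: output_blocks_def)
      define r' where "r' = r(''k'' := k, ''L'' := (r ''L'')(0 := L), ''X'' := (r ''X'')(0 := X),
        ''out'' := out', ''q'' := (r ''q'')(0 := pos + 7))"
      have Y: "Y / R = \<rho>" by (simp add: Y_def R_def \<rho>_def)
      have "J (l @ [j]) (r'(''u'' := x))" for x
        using J True new unfolding J_def emitted_snoc
        by (simp add: r'_def k_def L_def X_def a_def[symmetric] Y[simplified])
      moreover have "wp q emit_arc Q r = Q r'" for Q
      proof -
        have "wp q emit_arc Q r = Q (r(''k'' := k, ''L'' := (r ''L'')(0 := L), ''X'' := (r ''X'')(0 := X),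
          ''out'' := out', ''q'' := (r ''q'')(0 := pos + 7)))"
          using True pos_m
          by (simp add: emit_arc_def emit_block_def r u a_def[symmetric] k L_def[folded a_def, symmetric]
            X_def[folded a_def, symmetric] pos_def[symmetric] out'_def R_def Y_def)
        then show ?thesis by (simp add: r'_def)
      qed
      ultimately show ?thesis by simp
    qed
  qed (auto simp: J_def \<rho>_def)
qed

text \<open>Cancels opposite flows. From here on the arc \<open>e\<close> is the oriented edge, with
  its ends swapped if necessary, and \<open>k\<close> holds its net flow; \<open>k = 0\<close>
  disables the copy \<open>m + e\<close>.\<close>

definition orient_edge :: com where
  "orient_edge = seqs [
     Set_var ''r'' (Sub (Read ''x'' (V ''a'')) (Read ''x'' (Add (V ''m'') (V ''a'')))),
     If (Less (V ''r'') (Const 0))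
       (seqs [
         Assign ''out'' (V ''a'') (Const 1),
         Assign ''k'' (V ''a'') (Sub (Const 0) (V ''r'')),
         Set_var ''u'' (Read ''t'' (V ''a'')),
         Assign ''t'' (V ''a'') (Read ''h'' (V ''a'')),
         Assign ''h'' (V ''a'') (V ''u'')])
       (Assign ''k'' (V ''a'') (V ''r'')),
     Assign ''k'' (Add (V ''m'') (V ''a'')) (Const 0)]"

definition edge_oriented :: "memory \<Rightarrow> memory \<Rightarrow> int \<Rightarrow> bool" where
  "edge_oriented s r e \<longleftrightarrow> (let m = s ''m'' 0; d = s ''x'' e - s ''x'' (m + e) in
     r ''k'' e = \<bar>d\<bar> \<and> r ''k'' (m + e) = 0 \<and>
     (if d < 0 then r ''out'' e = 1 \<and> r ''t'' e = s ''h'' e \<and> r ''h'' e = s ''t'' e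
      else r ''out'' e = s ''out'' e \<and> r ''t'' e = s ''t'' e \<and> r ''h'' e = s ''h'' e))"

lemma wp_orient_edges:
  assumes m: "0 \<le> s ''m'' 0" "s ''m'' 0 \<le> int q"
  shows "wp q (For ''a'' (V ''m'') orient_edge) (\<lambda>r. (\<forall>e\<in>{0..<s ''m'' 0}. edge_oriented s r e) \<and>
    (\<forall>a. a \<notin> {0..<s ''m'' 0} \<longrightarrow> r ''t'' a = s ''t'' a \<and> r ''h'' a = s ''h'' a \<and> r ''out'' a = s ''out'' a)) s"
proof (rule wp_For[where N = "s ''m'' 0" and I = "\<lambda>j r. (\<forall>e\<in>{0..<j}. edge_oriented s r e) \<and>
    (\<forall>a. a \<notin> {0..<j} \<longrightarrow> r ''t'' a = s ''t'' a \<and> r ''h'' a = s ''h'' a \<and> r ''out'' a = s ''out'' a)"])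
  fix j r assume ag: "agree (insert ''a'' (assigned orient_edge)) s r"
  have eq: "r z = s z" if "z \<notin> {''a'', ''r'', ''u'', ''t'', ''h'', ''k'', ''out''}" for z
    using that by (intro agreeD[OF ag]) (simp add: orient_edge_def)
  have r: "r ''m'' = s ''m''" "r ''x'' = s ''x''" by (simp_all add: eq)
  show "eval_exp r (V ''m'') = s ''m'' 0" by (simp add: r)
  assume I: "(\<forall>e\<in>{0..<j}. edge_oriented s r e) \<and>
    (\<forall>a. a \<notin> {0..<j} \<longrightarrow> r ''t'' a = s ''t'' a \<and> r ''h'' a = s ''h'' a \<and> r ''out'' a = s ''out'' a)"
    and j: "0 \<le> j" "j < s ''m'' 0" "r ''a'' 0 = j"
  have ivl: "{0..<j + 1} = insert j {0..<j}" using j by auto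
  define d where "d = s ''x'' j - s ''x'' (s ''m'' 0 + j)"
  have rj: "r ''t'' j = s ''t'' j" "r ''h'' j = s ''h'' j" "r ''out'' j = s ''out'' j" using I by auto
  define r' where "r' = r(''r'' := (r ''r'')(0 := d), ''u'' := (if d < 0 then (r ''u'')(0 := s ''t'' j) else r ''u''),
    ''k'' := (r ''k'')(j := \<bar>d\<bar>, s ''m'' 0 + j := 0),
    ''out'' := (if d < 0 then (r ''out'')(j := 1) else r ''out''),
    ''t'' := (if d < 0 then (r ''t'')(j := s ''h'' j) else r ''t''),
    ''h'' := (if d < 0 then (r ''h'')(j := s ''t'' j) else r ''h''))"
  let ?Q = "\<lambda>r'. ((\<forall>e\<in>{0..<j + 1}. edge_oriented s (r'(''a'' := (r' ''a'')(0 := j + 1))) e) \<and>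
    (\<forall>a. a \<notin> {0..<j + 1} \<longrightarrow> (r'(''a'' := (r' ''a'')(0 := j + 1))) ''t'' a = s ''t'' a \<and>
      (r'(''a'' := (r' ''a'')(0 := j + 1))) ''h'' a = s ''h'' a \<and>
      (r'(''a'' := (r' ''a'')(0 := j + 1))) ''out'' a = s ''out'' a)) \<and> r' ''a'' 0 = j"
  have "edge_oriented s (r'(''a'' := z)) j" for z
    unfolding edge_oriented_def Let_def d_def[symmetric] using j rj by (simp add: r'_def)
  moreover have "edge_oriented s (r'(''a'' := z)) e" if "e \<in> {0..<j}" for z e
  proof -
    have "edge_oriented s r e" using I that by blast
    then show ?thesis using that j by (simp add: edge_oriented_def Let_def r'_def)
  qed
  moreover have "r' ''a'' 0 = j" "\<forall>a. a \<notin> {0..<j + 1} \<longrightarrow> r' ''t'' a = s ''t'' a \<and> r' ''h'' a = s ''h'' a \<and> r' ''out'' a = s ''out'' a"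
    using I j by (auto simp: r'_def)
  ultimately have "?Q r'" unfolding ivl by simp
  moreover have "wp q orient_edge Q r = Q r'" for Q
  proof (cases "d < 0")
    case True
    have "wp q orient_edge Q r = Q (r(''r'' := (r ''r'')(0 := d), ''out'' := (r ''out'')(j := 1),
      ''k'' := (r ''k'')(j := - d), ''u'' := (r ''u'')(0 := s ''t'' j), ''t'' := (r ''t'')(j := s ''h'' j),
      ''h'' := (r ''h'')(j := s ''t'' j), ''k'' := (r ''k'')(j := - d, s ''m'' 0 + j := 0)))"
      using j True rj by (simp add: orient_edge_def r d_def[symmetric])
    also have "\<dots> = Q r'" unfolding r'_def using True by (intro arg_cong[where f = Q]) (simp add: fun_eq_iff)
    finally show ?thesis .
  next
    case False
    have "wp q orient_edge Q r = Q (r(''r'' := (r ''r'')(0 := d), ''k'' := (r ''k'')(j := d),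
      ''k'' := (r ''k'')(j := d, s ''m'' 0 + j := 0)))"
      using j False by (simp add: orient_edge_def r d_def[symmetric])
    also have "\<dots> = Q r'" unfolding r'_def using False by (intro arg_cong[where f = Q]) (simp add: fun_eq_iff)
    finally show ?thesis .
  qed
  ultimately show "wp q orient_edge ?Q r" by blast
qed (use m in auto)

text \<open>On the terminal arcs the computed flow moves from \<open>x\<close> to \<open>k\<close>;
  the edges have received their net flow from \<open>orient_edge\<close>.\<close>

definition reset_arc :: com where
  "reset_arc = seqs [
     If (Less (V ''a'') (Mul (V ''m'') (Const 2))) Skip (Assign ''k'' (V ''a'') (Read ''x'' (V ''a''))),
     Assign ''x'' (V ''a'') (Const 0),
     Assign ''c'' (V ''a'') (Const 0)]"

lemma wp_reset_arcs:
  assumes M: "0 \<le> s ''M'' 0" "s ''M'' 0 \<le> int q"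
  shows "wp q (For ''a'' (V ''M'') reset_arc) (\<lambda>r. \<forall>a\<in>{0..<s ''M'' 0}. r ''x'' a = 0 \<and> r ''c'' a = 0 \<and>
    r ''k'' a = (if a < s ''m'' 0 * 2 then s ''k'' a else s ''x'' a)) s"
proof (rule wp_For[where N = "s ''M'' 0" and I = "\<lambda>j r. (\<forall>a\<in>{0..<j}. r ''x'' a = 0 \<and> r ''c'' a = 0 \<and>
    r ''k'' a = (if a < s ''m'' 0 * 2 then s ''k'' a else s ''x'' a)) \<and>
    (\<forall>a\<ge>j. r ''x'' a = s ''x'' a \<and> r ''k'' a = s ''k'' a)"])
  fix j r assume ag: "agree (insert ''a'' (assigned reset_arc)) s r"
  have eq: "r z = s z" if "z \<notin> {''a'', ''x'', ''c'', ''k''}" for z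
    using that by (intro agreeD[OF ag]) (simp add: reset_arc_def)
  have r: "r ''m'' = s ''m''" "r ''M'' = s ''M''" by (simp_all add: eq)
  show "eval_exp r (V ''M'') = s ''M'' 0" by (simp add: r)
  assume I: "(\<forall>a\<in>{0..<j}. r ''x'' a = 0 \<and> r ''c'' a = 0 \<and>
    r ''k'' a = (if a < s ''m'' 0 * 2 then s ''k'' a else s ''x'' a)) \<and>
    (\<forall>a\<ge>j. r ''x'' a = s ''x'' a \<and> r ''k'' a = s ''k'' a)"
    and j: "0 \<le> j" "j < s ''M'' 0" "r ''a'' 0 = j"
  have ivl: "{0..<j + 1} = insert j {0..<j}" using j by auto
  show "wp q reset_arc (\<lambda>r'. ((\<forall>a\<in>{0..<j + 1}. (r'(''a'' := (r' ''a'')(0 := j + 1))) ''x'' a = 0 \<and>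
      (r'(''a'' := (r' ''a'')(0 := j + 1))) ''c'' a = 0 \<and>
      (r'(''a'' := (r' ''a'')(0 := j + 1))) ''k'' a = (if a < s ''m'' 0 * 2 then s ''k'' a else s ''x'' a)) \<and>
    (\<forall>a\<ge>j + 1. (r'(''a'' := (r' ''a'')(0 := j + 1))) ''x'' a = s ''x'' a \<and>
      (r'(''a'' := (r' ''a'')(0 := j + 1))) ''k'' a = s ''k'' a)) \<and> r' ''a'' 0 = j) r"
    unfolding ivl using I j by (cases "j < s ''m'' 0 * 2") (simp_all add: reset_arc_def r)
qed (use M in auto)

section \<open>Instances\<close>

lemma of_rat_quotient:
  "(of_rat r :: real) = real_of_int (fst (quotient_of r)) / real_of_int (snd (quotient_of r))"
  "0 < snd (quotient_of r)"
proof -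
  obtain a b where q: "quotient_of r = (a, b)" by fastforce
  then have "r = of_int a / of_int b" by (rule quotient_of_div)
  then have "(of_rat r :: real) = of_rat (of_int a / of_int b)" by (rule arg_cong)
  then show "(of_rat r :: real) = real_of_int (fst (quotient_of r)) / real_of_int (snd (quotient_of r))"
    unfolding q by (simp add: of_rat_divide)
  show "0 < snd (quotient_of r)" by (rule quotient_of_denom_pos')
qed

lemma nth_concat_blocks:
  assumes "\<And>x. x \<in> set xs \<Longrightarrow> length (f x) = k" "i < length xs" "j < k"
  shows "concat (map f xs) ! (k * i + j) = f (xs ! i) ! j"
  using assms
proof (induction xs arbitrary: i)
  case (Cons x xs)
  have len: "length (f x) = k" using Cons.prems by simp
  show ?case
  proof (cases i)
    case 0
    then show ?thesis using len Cons.prems by (simp add: nth_append)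
  next
    case (Suc i')
    have "concat (map f xs) ! (k * i' + j) = f (xs ! i') ! j"
      using Cons.IH[of i'] Cons.prems Suc by simp
    then show ?thesis using len Suc by (simp add: nth_append)
  qed
qed simp

lemma length_concat_blocks:
  "(\<And>x. x \<in> set xs \<Longrightarrow> length (f x) = k) \<Longrightarrow> length (concat (map f xs)) = k * length xs"
  by (induction xs) auto

section \<open>Encoded instances and scaling to integers\<close>

locale rational_instance =
  fixes I :: rational_network
  assumes net: "undirected_network_over_time (network_of I)"
    and send: "can_be_sent (network_of I) (total_supply (network_of I)) (horizon (network_of I))"
begin

definition nn :: nat where "nn = length (balance_list I)"
definition mm :: nat where "mm = length (edge_list I)"
definition inp :: "int \<Rightarrow> int" where "inp = initial_memory (encode_network I) ''in''"
definition L :: nat where "L = (\<Sum>x\<leftarrow>encode_network I. bits x)"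
definition T :: real where "T = of_rat (time_horizon I)"
definition b :: "nat \<Rightarrow> real" where "b v = of_rat (balance_list I ! v)"
definition p :: "nat \<Rightarrow> nat" where "p e = fst (edge_list I ! e)"
definition q :: "nat \<Rightarrow> nat" where "q e = fst (snd (edge_list I ! e))"
definition u :: "nat \<Rightarrow> real" where "u e = of_rat (fst (snd (snd (edge_list I ! e))))"
definition \<tau> :: "nat \<Rightarrow> real" where "\<tau> e = of_rat (snd (snd (snd (edge_list I ! e))))"
definition D :: int where "D = (\<Prod>i\<in>{0..<4 + 2 * int nn + 6 * int mm}. clip (inp i))"

lemma network_simps:
  "nodes (network_of I) = {..<nn}" "edges (network_of I) = {..<mm}" "ends (network_of I) e = Upair (p e) (q e)"
  "capacity (network_of I) = u" "transit (network_of I) = \<tau>" "balance (network_of I) = b" "horizon (network_of I) = T"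
  by (auto simp: network_of_def nn_def mm_def p_def q_def u_def \<tau>_def b_def T_def fun_eq_iff split: prod.splits)

lemma net_facts:
  shows "e < mm \<Longrightarrow> p e < nn" "e < mm \<Longrightarrow> q e < nn" "e < mm \<Longrightarrow> 0 \<le> u e" "e < mm \<Longrightarrow> 0 \<le> \<tau> e"
    and "(\<Sum>v<nn. b v) = 0" "0 \<le> T"
  using net by (auto simp: undirected_network_over_time_def network_simps)

lemma length_encode: "length (encode_network I) = 4 + 2 * nn + 6 * mm"
  unfolding encode_network_def
  by (simp add: encode_rat_def nn_def mm_def length_concat_blocks[where k = 2] length_concat_blocks[where k = 6] split_beta)

lemma inp_nth: "i < 4 + 2 * nn + 6 * mm \<Longrightarrow> inp (int i) = encode_network I ! i"
  by (simp add: inp_def initial_memory_def length_encode)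

lemma inp_header: "inp 0 = int nn" "inp 1 = int mm" "inp 2 = fst (quotient_of (time_horizon I))"
  "inp 3 = snd (quotient_of (time_horizon I))"
  using inp_nth[of 0] inp_nth[of 1] inp_nth[of 2] inp_nth[of 3]
  by (simp_all add: encode_network_def encode_rat_def nn_def mm_def nth_append numeral_eq_Suc)

lemma inp_balance:
  assumes "v < nn"
  shows "inp (4 + 2 * int v) = fst (quotient_of (balance_list I ! v))"
    and "inp (4 + 2 * int v + 1) = snd (quotient_of (balance_list I ! v))"
proof -
  let ?xs = "concat (map encode_rat (balance_list I))"
  have l: "length ?xs = 2 * nn" by (simp add: length_concat_blocks[where k = 2] encode_rat_def nn_def)
  have e: "encode_network I ! (4 + i) = ?xs ! i" if "i < 2 * nn" for i
    unfolding encode_network_def using that l by (simp add: encode_rat_def nth_append numeral_eq_Suc)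
  have "?xs ! (2 * v + j) = encode_rat (balance_list I ! v) ! j" if "j < 2" for j
    by (rule nth_concat_blocks) (use assms that in \<open>auto simp: encode_rat_def nn_def\<close>)
  from this[of 0] this[of 1] have x: "?xs ! (2 * v) = fst (quotient_of (balance_list I ! v))"
    "?xs ! (2 * v + 1) = snd (quotient_of (balance_list I ! v))" by (simp_all add: encode_rat_def)
  have "inp (int (4 + 2 * v)) = ?xs ! (2 * v)" using inp_nth[of "4 + 2 * v"] e[of "2 * v"] assms by simp
  then show "inp (4 + 2 * int v) = fst (quotient_of (balance_list I ! v))" using x by simp
  have "inp (int (4 + (2 * v + 1))) = ?xs ! (2 * v + 1)"
    using inp_nth[of "4 + (2 * v + 1)"] e[of "2 * v + 1"] assms by simp
  then show "inp (4 + 2 * int v + 1) = snd (quotient_of (balance_list I ! v))" using x by (simp add: add.commute)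
qed

lemma inp_edge:
  assumes "e < mm"
  defines "B \<equiv> 4 + 2 * int nn + 6 * int e"
  shows "inp B = int (p e)" "inp (B + 1) = int (q e)"
    "inp (B + 2) = fst (quotient_of (fst (snd (snd (edge_list I ! e)))))"
    "inp (B + 3) = snd (quotient_of (fst (snd (snd (edge_list I ! e)))))"
    "inp (B + 4) = fst (quotient_of (snd (snd (snd (edge_list I ! e)))))"
    "inp (B + 5) = snd (quotient_of (snd (snd (snd (edge_list I ! e)))))"
proof -
  let ?f = "\<lambda>(v, w, u, \<tau>). [int v, int w] @ encode_rat u @ encode_rat \<tau>"
  let ?xs = "concat (map encode_rat (balance_list I))" and ?ys = "concat (map ?f (edge_list I))"
  have l: "length ?xs = 2 * nn" by (simp add: length_concat_blocks[where k = 2] encode_rat_def nn_def)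
  have en: "encode_network I ! (4 + 2 * nn + i) = ?ys ! i" for i
    unfolding encode_network_def using l by (simp add: encode_rat_def nth_append numeral_eq_Suc)
  have y: "?ys ! (6 * e + j) = ?f (edge_list I ! e) ! j" if "j < 6" for j
    by (rule nth_concat_blocks) (use assms that in \<open>auto simp: encode_rat_def mm_def\<close>)
  have i: "inp (B + int j) = ?f (edge_list I ! e) ! j" if "j < 6" for j
  proof -
    have B: "B + int j = int (4 + 2 * nn + (6 * e + j))" by (simp add: B_def)
    have "inp (B + int j) = encode_network I ! (4 + 2 * nn + (6 * e + j))"
      unfolding B by (rule inp_nth) (use assms that in simp)
    also have "\<dots> = ?f (edge_list I ! e) ! j" unfolding en by (rule y[OF that])
    finally show ?thesis .
  qed
  show "inp B = int (p e)" "inp (B + 1) = int (q e)"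
    "inp (B + 2) = fst (quotient_of (fst (snd (snd (edge_list I ! e)))))"
    "inp (B + 3) = snd (quotient_of (fst (snd (snd (edge_list I ! e)))))"
    "inp (B + 4) = fst (quotient_of (snd (snd (snd (edge_list I ! e)))))"
    "inp (B + 5) = snd (quotient_of (snd (snd (snd (edge_list I ! e)))))"
    using i[of 0] i[of 1] i[of 2] i[of 3] i[of 4] i[of 5]
    by (simp_all add: p_def q_def encode_rat_def split_beta numeral_eq_Suc)
qed

lemma D_pos: "0 < D"
  unfolding D_def by (rule prod_pos) (simp add: clip_def)

lemma dvd_D:
  assumes "i \<in> {0..<4 + 2 * int nn + 6 * int mm}" "0 < inp i"
  shows "inp i dvd D"
proof -
  have "clip (inp i) dvd D" unfolding D_def by (rule dvd_prodI) (use assms in auto)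
  then show ?thesis using assms by (simp add: clip_def)
qed

text \<open>\<open>D\<close> is a product over positions rather than values, so equal numbers in two
  different cells both count.\<close>

lemma dvd_D2:
  assumes "i \<in> {0..<4 + 2 * int nn + 6 * int mm}" "j \<in> {0..<4 + 2 * int nn + 6 * int mm}" "i \<noteq> j"
    and "0 < inp i" "0 < inp j"
  shows "inp i * inp j dvd D"
proof -
  let ?R = "{0..<4 + 2 * int nn + 6 * int mm}"
  have "D = clip (inp i) * (\<Prod>k\<in>?R - {i}. clip (inp k))"
    unfolding D_def by (rule prod.remove) (use assms in auto)
  also have "(\<Prod>k\<in>?R - {i}. clip (inp k)) = clip (inp j) * (\<Prod>k\<in>?R - {i} - {j}. clip (inp k))"
    by (rule prod.remove) (use assms in auto)
  finally show ?thesis using assms by (simp add: clip_def mult.assoc[symmetric])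
qed

lemma L_ge: "4 + 2 * nn + 6 * mm \<le> L"
proof -
  have "length xs \<le> (\<Sum>x\<leftarrow>xs. bits x)" for xs by (induction xs) (auto simp: bits_def)
  then show ?thesis unfolding L_def length_encode[symmetric] .
qed

lemma inp_less: "\<bar>inp i\<bar> < 2 ^ L"
proof (cases "0 \<le> i \<and> i < 4 + 2 * int nn + 6 * int mm")
  case True
  then have "inp i \<in> set (encode_network I)" using inp_nth[of "nat i"] length_encode by auto
  then have "bits (inp i) \<le> L" unfolding L_def by (intro member_le_sum_list) auto
  then show ?thesis using abs_less_bits[of "inp i"] pow2_le[of "bits (inp i)" L] by linarith
next
  case False
  then have "inp i = 0" by (auto simp: inp_def initial_memory_def length_encode)
  then show ?thesis by simp
qed

text \<open>A product is at most two to the power of the total bit length of its factors, so the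
  common denominator is no longer than the input.\<close>

lemma D_le: "D \<le> 2 ^ L"
proof -
  let ?xs = "encode_network I"
  have "D = (\<Prod>i\<in>int ` {..<length ?xs}. clip (inp i))"
    unfolding D_def by (rule prod.cong) (auto simp: length_encode image_int_atLeastLessThan lessThan_atLeast0)
  also have "\<dots> = (\<Prod>i<length ?xs. clip (inp (int i)))" by (subst prod.reindex) auto
  also have "\<dots> \<le> (\<Prod>i<length ?xs. 2 ^ bits (?xs ! i))"
  proof (rule prod_mono)
    fix i assume "i \<in> {..<length ?xs}"
    then have "inp (int i) = ?xs ! i" using inp_nth by (simp add: length_encode)
    then show "0 \<le> clip (inp (int i)) \<and> clip (inp (int i)) \<le> 2 ^ bits (?xs ! i)"
      using abs_less_bits[of "?xs ! i"] by (auto simp: clip_def)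
  qed
  also have "\<dots> = 2 ^ (\<Sum>i<length ?xs. bits (?xs ! i))" by (simp add: power_sum)
  also have "(\<Sum>i<length ?xs. bits (?xs ! i)) = L" unfolding L_def by (simp add: sum_list_sum_nth lessThan_atLeast0)
  finally show ?thesis .
qed

lemma T_eq: "T = inp 2 / inp 3" and inp3_pos: "0 < inp 3" and inp2_nonneg: "0 \<le> inp 2"
proof -
  show T: "T = inp 2 / inp 3" unfolding T_def inp_header by (rule of_rat_quotient(1))
  show p: "0 < inp 3" unfolding inp_header by (rule of_rat_quotient(2))
  have "0 \<le> T" using net_facts by simp
  then show "0 \<le> inp 2" unfolding T using p by (simp add: zero_le_divide_iff)
qed

lemma real_div: "c dvd a \<Longrightarrow> real_of_int (a div c) = real_of_int a / real_of_int c"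
  by (rule real_of_int_div)

lemma scaled_capacity:
  assumes "e < mm"
  defines "B \<equiv> 4 + 2 * int nn + 6 * int e"
  shows "real_of_int (D div inp (B + 3) div inp 3 * inp (B + 2) * inp 2) = u e * T * D"
    and "real_of_int (D div inp (B + 5) * inp (B + 4)) = \<tau> e * D"
proof -
  note B = inp_edge[OF assms(1), folded B_def]
  have pos: "0 < inp (B + 3)" "0 < inp (B + 5)" unfolding B by (rule of_rat_quotient(2))+
  have u: "u e = inp (B + 2) / inp (B + 3)" and t: "\<tau> e = inp (B + 4) / inp (B + 5)"
    unfolding B u_def \<tau>_def by (rule of_rat_quotient(1))+
  have d: "inp (B + 3) * inp 3 dvd D"
    by (rule dvd_D2) (use assms pos inp3_pos in \<open>auto simp: B_def\<close>)
  then have "D div inp (B + 3) div inp 3 = D div (inp (B + 3) * inp 3)"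
    using inp3_pos by (simp add: zdiv_zmult2_eq)
  then have "real_of_int (D div inp (B + 3) div inp 3) = D / (inp (B + 3) * inp 3)" using real_div[OF d] by simp
  then show "real_of_int (D div inp (B + 3) div inp 3 * inp (B + 2) * inp 2) = u e * T * D"
    unfolding u T_eq by (simp add: field_simps)
  have d: "inp (B + 5) dvd D" by (rule dvd_D) (use assms pos in \<open>auto simp: B_def\<close>)
  then show "real_of_int (D div inp (B + 5) * inp (B + 4)) = \<tau> e * D"
    unfolding t using real_div[OF d] by (simp add: field_simps)
qed

lemma scaled_balance:
  assumes "v < nn"
  shows "real_of_int (D div inp (4 + 2 * int v + 1) * inp (4 + 2 * int v)) = b v * D"
    and "0 < inp (4 + 2 * int v) \<longleftrightarrow> 0 < b v"
proof -
  note B = inp_balance[OF assms]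
  have pos: "0 < inp (4 + 2 * int v + 1)" unfolding B by (rule of_rat_quotient(2))
  have bv: "b v = inp (4 + 2 * int v) / inp (4 + 2 * int v + 1)" unfolding B b_def by (rule of_rat_quotient(1))
  have d: "inp (4 + 2 * int v + 1) dvd D" by (rule dvd_D) (use assms pos in auto)
  then show "real_of_int (D div inp (4 + 2 * int v + 1) * inp (4 + 2 * int v)) = b v * D"
    unfolding bv using real_div[OF d] by (simp add: field_simps)
  show "0 < inp (4 + 2 * int v) \<longleftrightarrow> 0 < b v" unfolding bv using pos by (simp add: zero_less_divide_iff)
qed

lemma scaled_horizon: "real_of_int (D div inp 3 * inp 2) = T * D"
proof -
  have d: "inp 3 dvd D" by (rule dvd_D) (use inp3_pos in auto)
  then show ?thesis unfolding T_eq using real_div[OF d] by (simp add: field_simps)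
qed

lemma scaled_capacity_bounds:
  assumes "e < mm"
  defines "B \<equiv> 4 + 2 * int nn + 6 * int e"
  shows "0 \<le> D div inp (B + 3) div inp 3 * inp (B + 2) * inp 2"
    and "D div inp (B + 3) div inp 3 * inp (B + 2) * inp 2 \<le> 2 ^ (3 * L)"
proof -
  have "0 \<le> real_of_int (D div inp (B + 3) div inp 3 * inp (B + 2) * inp 2)"
    unfolding B_def scaled_capacity(1)[OF assms(1)] using net_facts assms(1) D_pos by simp
  then show nn: "0 \<le> D div inp (B + 3) div inp 3 * inp (B + 2) * inp 2" by (simp only: of_int_0_le_iff)
  have "\<bar>D div inp (B + 3) div inp 3\<bar> \<le> 2 ^ L"
    using abs_div_le[of "D div inp (B + 3)" "inp 3"] abs_div_le[of D "inp (B + 3)"] D_le D_pos by linarith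
  then have "\<bar>D div inp (B + 3) div inp 3\<bar> * \<bar>inp (B + 2)\<bar> * \<bar>inp 2\<bar> \<le> 2 ^ L * 2 ^ L * 2 ^ L"
    using inp_less[of "B + 2"] inp_less[of 2] by (intro mult_mono) auto
  also have "\<dots> = 2 ^ (3 * L)" by (simp add: power_add[symmetric])
  finally have "\<bar>D div inp (B + 3) div inp 3 * inp (B + 2) * inp 2\<bar> \<le> 2 ^ (3 * L)"
    by (simp only: abs_mult)
  then show "D div inp (B + 3) div inp 3 * inp (B + 2) * inp 2 \<le> 2 ^ (3 * L)" by linarith
qed

lemma scaled_balance_bound: "\<bar>D div inp i * inp j\<bar> \<le> 2 ^ (3 * L)"
proof -
  have "\<bar>D div inp i\<bar> \<le> 2 ^ L" using abs_div_le[of D "inp i"] D_le D_pos by linarith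
  then have "\<bar>D div inp i\<bar> * \<bar>inp j\<bar> \<le> 2 ^ L * 2 ^ L" using inp_less[of j] by (intro mult_mono) auto
  also have "\<dots> \<le> 2 ^ (3 * L)" by (simp add: power_add[symmetric])
  finally show ?thesis by (simp add: abs_mult)
qed

end

definition read_network :: com where
  "read_network = seqs [read_sizes, For ''a'' (V ''m'') read_edge, For ''a'' (V ''n'') read_node, find_scale]"

definition orient :: com where
  "orient = seqs [
     For ''a'' (V ''m'') orient_edge,
     For ''a'' (V ''M'') reset_arc,
     For ''i'' (Add (V ''n'') (Const 1)) (Assign ''y'' (V ''i'') (Const 0)),
     Set_var ''T'' (Mul (Mul (Quot (V ''D'') (In (Const 3))) (In (Const 2))) (Const 2)),
     Set_var ''q'' (Add (V ''m'') (Const 1))]"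

lemma sum_arcs:
  fixes g :: "int \<Rightarrow> 'a :: comm_monoid_add"
  shows "(\<Sum>a\<in>{0..<2 * int m + int n}. g a) =
    (\<Sum>e<m. g (int e) + g (int m + int e)) + (\<Sum>v<n. g (2 * int m + int v))"
proof -
  have 1: "(\<Sum>a\<in>{0..<int k}. f a) = (\<Sum>e<k. f (int e))" for k and f :: "int \<Rightarrow> 'a"
  proof -
    have "{0..<int k} = int ` {..<k}" by (simp add: image_int_atLeastLessThan lessThan_atLeast0)
    then show ?thesis by (simp add: sum.reindex)
  qed
  have 2: "(\<Sum>a\<in>{c..<c + int k}. g a) = (\<Sum>e<k. g (c + int e))" for c k
  proof -
    have "(\<Sum>a\<in>{c..<c + int k}. g a) = (\<Sum>a\<in>{0..<int k}. g (c + a))"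
      by (rule sum.reindex_bij_witness[of _ "\<lambda>a. c + a" "\<lambda>a. a - c"]) auto
    then show ?thesis using 1 by simp
  qed
  have "{0..<2 * int m + int n} = {0..<int m} \<union> {int m..<int m + int m} \<union> {2 * int m..<2 * int m + int n}" by auto
  then have "(\<Sum>a\<in>{0..<2 * int m + int n}. g a) =
      (\<Sum>a\<in>{0..<int m} \<union> {int m..<int m + int m}. g a) + (\<Sum>a\<in>{2 * int m..<2 * int m + int n}. g a)"
    by (simp only:) (rule sum.union_disjoint; auto)
  also have "(\<Sum>a\<in>{0..<int m} \<union> {int m..<int m + int m}. g a) =
      (\<Sum>a\<in>{0..<int m}. g a) + (\<Sum>a\<in>{int m..<int m + int m}. g a)"
    by (rule sum.union_disjoint) auto
  finally show ?thesis unfolding 1 2 by (simp only: sum.distrib)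
qed

lemma arc_cases:
  assumes "a \<in> {0..<2 * int m + int n}"
  obtains (forward) e where "e < m" "a = int e" | (backward) e where "e < m" "a = int m + int e"
    | (node) v where "v < n" "a = 2 * int m + int v"
proof -
  consider "a < int m" | "int m \<le> a" "a < 2 * int m" | "2 * int m \<le> a" by linarith
  then show thesis
  proof cases
    case 1 then show thesis using forward[of "nat a"] assms by auto
  next
    case 2 then show thesis using backward[of "nat (a - int m)"] by auto
  next
    case 3 then show thesis using node[of "nat (a - 2 * int m)"] assms by auto
  qed
qed

section \<open>The network in memory and the cost of the optimum\<close>

context rational_instance
begin

text \<open>\<open>4 * L\<close> bounds the exponent for the capacity scaling: there are fewer than
  \<open>2 ^ L\<close> arcs, each of capacity at most \<open>2 ^ (3 * L)\<close>. All other loops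
  make at most \<open>L\<close> rounds.\<close>

definition qq :: nat where "qq = 5 * L + 5"

lemma qq: "4 + 2 * nn + 6 * mm \<le> qq" "nn + 2 \<le> qq" "2 * mm + nn \<le> qq" "mm \<le> qq" "nn \<le> qq" "4 * L < qq"
  using L_ge by (auto simp: qq_def)

definition B :: real where "B = total_supply (network_of I)"

definition network_memory :: "memory \<Rightarrow> bool" where
  "network_memory r \<longleftrightarrow> r ''n'' 0 = int nn \<and> r ''m'' 0 = int mm \<and> r ''M'' 0 = 2 * int mm + int nn \<and>
     r ''D'' 0 = D \<and> r ''in'' = inp \<and> (\<forall>e\<in>{0..<int mm}. edge_read inp D r e) \<and>
     (\<forall>v\<in>{0..<int nn}. node_read inp D r v) \<and> (\<forall>a. a \<notin> {0..<int mm} \<longrightarrow> r ''w'' a = 0) \<and> r ''out'' = (\<lambda>_. 0)"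

lemma network_memory_edge:
  assumes "network_memory r" "e < mm"
  shows "r ''t'' (int e) = int (p e)" "r ''h'' (int e) = int (q e)"
    "r ''t'' (int mm + int e) = int (q e)" "r ''h'' (int mm + int e) = int (p e)"
    "real_of_int (r ''U'' (int e)) = u e * T * D" "r ''U'' (int mm + int e) = r ''U'' (int e)"
    "real_of_int (r ''c'' (int e)) = \<tau> e * D" "r ''c'' (int mm + int e) = r ''c'' (int e)"
    "r ''w'' (int e) = r ''c'' (int e)" "0 \<le> r ''U'' (int e)" "r ''U'' (int e) \<le> 2 ^ (3 * L)"
proof -
  have "edge_read inp D r (int e)" using assms by (auto simp: network_memory_def)
  note r = this[unfolded edge_read_def Let_def inp_header(1,2) mult.commute[of _ 2] mult.commute[of _ 6]]
  show "r ''t'' (int e) = int (p e)" "r ''h'' (int e) = int (q e)"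
    "r ''t'' (int mm + int e) = int (q e)" "r ''h'' (int mm + int e) = int (p e)"
    using r inp_edge[OF assms(2)] by auto
  let ?B = "4 + 2 * int nn + 6 * int e"
  have U: "r ''U'' (int e) = D div inp (?B + 3) div inp 3 * inp (?B + 2) * inp 2"
    and c: "r ''c'' (int e) = D div inp (?B + 5) * inp (?B + 4)"
    using r by blast+
  show "real_of_int (r ''U'' (int e)) = u e * T * D" "real_of_int (r ''c'' (int e)) = \<tau> e * D"
    unfolding U c by (fact scaled_capacity[OF assms(2)])+
  show "r ''U'' (int mm + int e) = r ''U'' (int e)" "r ''c'' (int mm + int e) = r ''c'' (int e)"
    "r ''w'' (int e) = r ''c'' (int e)" using r by auto
  show "0 \<le> r ''U'' (int e)" "r ''U'' (int e) \<le> 2 ^ (3 * L)"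
    unfolding U by (fact scaled_capacity_bounds[OF assms(2)])+
qed

lemma network_memory_node:
  assumes "network_memory r" "v < nn"
  defines "j \<equiv> 2 * int mm + int v"
  shows "r ''t'' j = (if 0 < b v then int nn else int v)" "r ''h'' j = (if 0 < b v then int v else int nn)"
    "real_of_int (r ''U'' j) = \<bar>b v\<bar> * D" "real_of_int (r ''c'' j) = (if 0 < b v then - 2 * T * D else 0)"
    "0 \<le> r ''U'' j" "r ''U'' j \<le> 2 ^ (3 * L)"
proof -
  have "node_read inp D r (int v)" using assms by (auto simp: network_memory_def)
  note r = this[unfolded node_read_def Let_def inp_header(1,2) mult.commute[of _ 2], folded j_def]
  note bv = scaled_balance[OF assms(2)]
  show "r ''t'' j = (if 0 < b v then int nn else int v)" "r ''h'' j = (if 0 < b v then int v else int nn)"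
    using r bv(2) by (auto split: if_splits)
  show U: "real_of_int (r ''U'' j) = \<bar>b v\<bar> * D"
    using r bv by (cases "0 < b v") (simp_all)
  show "real_of_int (r ''c'' j) = (if 0 < b v then - 2 * T * D else 0)"
  proof (cases "0 < b v")
    case True
    then have "r ''c'' j = (D div inp 3 * inp 2) * (- 2)" using r bv(2) by simp
    then have "real_of_int (r ''c'' j) = real_of_int (D div inp 3 * inp 2) * real_of_int (- 2)"
      by (simp only: of_int_mult)
    then show ?thesis unfolding scaled_horizon using True by simp
  qed (use r bv(2) in simp)
  have "0 \<le> real_of_int (r ''U'' j)" unfolding U using D_pos by simp
  then show "0 \<le> r ''U'' j" by (simp only: of_int_0_le_iff)
  have "\<bar>r ''U'' j\<bar> = \<bar>D div inp (4 + 2 * int v + 1) * inp (4 + 2 * int v)\<bar>"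
    using r by (cases "0 < inp (4 + 2 * int v)") simp_all
  then have "\<bar>r ''U'' j\<bar> \<le> 2 ^ (3 * L)" using scaled_balance_bound by simp
  then show "r ''U'' j \<le> 2 ^ (3 * L)" by simp
qed

lemma network_memory_cong:
  assumes "network_memory r" "\<And>x. x \<in> {''n'', ''m'', ''M'', ''D'', ''in'', ''t'', ''h'', ''U'', ''c'', ''w'', ''out''} \<Longrightarrow> r' x = r x"
  shows "network_memory r'"
  using assms unfolding network_memory_def edge_read_def node_read_def Let_def by simp

lemma wp_read_network:
  "wp qq read_network (\<lambda>r. network_memory r \<and> r ''x'' = (\<lambda>_. 0) \<and> r ''k'' = (\<lambda>_. 0) \<and> r ''y'' = (\<lambda>_. 0) \<and>
     (\<exists>j<qq. r ''P'' 0 = 2 ^ j \<and> (\<forall>a\<in>{0..<2 * int mm + int nn}. r ''U'' a < 2 ^ j)))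
   (initial_memory (encode_network I))"
  (is "wp qq _ ?Q ?s")
proof -
  define s where "s = ?s"
  have zero: "s z = (\<lambda>_. 0)" if "z \<noteq> ''in''" for z using that by (simp add: s_def initial_memory_def)
  have s_in: "s ''in'' = inp" by (simp add: s_def inp_def)
  have "wp qq read_sizes (sizes_read s) s"
    by (rule wp_read_sizes) (use qq in \<open>auto simp: s_in inp_header\<close>)
  then have "wp qq read_sizes (wp qq (For ''a'' (V ''m'') read_edge)
    (wp qq (For ''a'' (V ''n'') read_node) (wp qq find_scale ?Q))) s"
  proof (rule wp_frameI)
    fix r1 assume "sizes_read s r1" and ag: "agree (assigned read_sizes) s r1"
    then have r1: "r1 ''n'' 0 = int nn" "r1 ''m'' 0 = int mm" "r1 ''M'' 0 = 2 * int mm + int nn" "r1 ''D'' 0 = D"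
      by (auto simp: sizes_read_def s_in inp_header D_def)
    have eq1: "r1 z = s z" if "z \<notin> {''n'', ''m'', ''M'', ''D'', ''i''}" for z
      using that by (intro agreeD[OF ag]) (simp add: read_sizes_def)
    have in1: "r1 ''in'' = inp" by (simp add: eq1 s_in)
    have "wp qq (For ''a'' (V ''m'') read_edge) (\<lambda>r. (\<forall>e\<in>{0..<r1 ''in'' 1}. edge_read (r1 ''in'') (r1 ''D'' 0) r e) \<and>
      (\<forall>a. a \<notin> {0..<r1 ''in'' 1} \<longrightarrow> r ''w'' a = r1 ''w'' a)) r1"
      by (rule wp_read_edges) (use qq in \<open>simp_all add: r1 in1 inp_header\<close>)
    then show "wp qq (For ''a'' (V ''m'') read_edge)
      (wp qq (For ''a'' (V ''n'') read_node) (wp qq find_scale ?Q)) r1"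
    proof (rule wp_frameI)
      fix r2 assume e2: "(\<forall>e\<in>{0..<r1 ''in'' 1}. edge_read (r1 ''in'') (r1 ''D'' 0) r2 e) \<and>
        (\<forall>a. a \<notin> {0..<r1 ''in'' 1} \<longrightarrow> r2 ''w'' a = r1 ''w'' a)"
        and ag: "agree (assigned (For ''a'' (V ''m'') read_edge)) r1 r2"
      have eq2: "r2 z = r1 z" if "z \<notin> {''a'', ''B'', ''t'', ''h'', ''U'', ''c'', ''w''}" for z
        using that by (intro agreeD[OF ag]) (simp add: read_edge_def)
      have r2: "r2 ''n'' 0 = int nn" "r2 ''m'' 0 = int mm" "r2 ''M'' 0 = 2 * int mm + int nn" "r2 ''D'' 0 = D"
        "r2 ''in'' = inp" by (simp_all add: eq2 r1 in1)
      have "wp qq (For ''a'' (V ''n'') read_node) (\<lambda>r. (\<forall>v\<in>{0..<r2 ''in'' 0}. node_read (r2 ''in'') (r2 ''D'' 0) r v) \<and>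
        (\<forall>a < 2 * r2 ''in'' 1. r ''t'' a = r2 ''t'' a \<and> r ''h'' a = r2 ''h'' a \<and> r ''U'' a = r2 ''U'' a \<and> r ''c'' a = r2 ''c'' a)) r2"
        by (rule wp_read_nodes) (use qq in \<open>simp_all add: r2 inp_header\<close>)
      then show "wp qq (For ''a'' (V ''n'') read_node) (wp qq find_scale ?Q) r2"
      proof (rule wp_frameI)
        fix r3 assume n3: "(\<forall>v\<in>{0..<r2 ''in'' 0}. node_read (r2 ''in'') (r2 ''D'' 0) r3 v) \<and>
          (\<forall>a < 2 * r2 ''in'' 1. r3 ''t'' a = r2 ''t'' a \<and> r3 ''h'' a = r2 ''h'' a \<and> r3 ''U'' a = r2 ''U'' a \<and> r3 ''c'' a = r2 ''c'' a)"
          and ag: "agree (assigned (For ''a'' (V ''n'') read_node)) r2 r3"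
        have eq3: "r3 z = r2 z" if "z \<notin> {''a'', ''B'', ''j'', ''t'', ''h'', ''U'', ''c''}" for z
          using that by (intro agreeD[OF ag]) (simp add: read_node_def)
        have e3: "edge_read inp D r3 e" if e: "e \<in> {0..<int mm}" for e
        proof -
          have old: "edge_read inp D r2 e" using e2 e by (simp add: in1 inp_header r1)
          have "r3 z a = r2 z a" if "z \<in> {''t'', ''h'', ''U'', ''c''}" "a < 2 * int mm" for z a
            using n3 that by (auto simp: r2 inp_header)
          then show ?thesis using old e eq3[of "''w''"] by (simp add: edge_read_def Let_def inp_header)
        qed
        have net3: "network_memory r3"
          unfolding network_memory_def
        proof (intro conjI)
          show "\<forall>a. a \<notin> {0..<int mm} \<longrightarrow> r3 ''w'' a = 0"
            using e2 by (simp add: eq3 in1 inp_header eq1 zero)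
          show "\<forall>e\<in>{0..<int mm}. edge_read inp D r3 e" using e3 by blast
          show "\<forall>v\<in>{0..<int nn}. node_read inp D r3 v" using n3 by (simp add: r2 inp_header)
        qed (simp_all add: eq3 r2 eq2 r1 in1 eq1 zero)
        have U3: "0 \<le> r3 ''U'' a \<and> r3 ''U'' a \<le> 2 ^ (3 * L)" if "a \<in> {0..<2 * int mm + int nn}" for a
          using that
        proof (cases rule: arc_cases)
          case (forward e) then show ?thesis using network_memory_edge(10,11)[OF net3] by simp
        next
          case (backward e) then show ?thesis using network_memory_edge(6,10,11)[OF net3] by simp
        next
          case (node v) then show ?thesis using network_memory_node(5,6)[OF net3] by simp
        qed
        have "(\<Sum>a\<in>{0..<2 * int mm + int nn}. r3 ''U'' a) \<le> (\<Sum>a\<in>{0..<2 * int mm + int nn}. 2 ^ (3 * L))"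
          by (rule sum_mono) (use U3 in blast)
        also have "\<dots> = (2 * int mm + int nn) * 2 ^ (3 * L)" by simp
        finally have "(\<Sum>a\<in>{0..<2 * int mm + int nn}. r3 ''U'' a) \<le> (2 * int mm + int nn) * 2 ^ (3 * L)" .
        moreover have "(1 :: int) \<le> 2 ^ (3 * L)" by simp
        ultimately have "1 + (\<Sum>a\<in>{0..<2 * int mm + int nn}. r3 ''U'' a) \<le> 2 ^ (3 * L) + (2 * int mm + int nn) * 2 ^ (3 * L)"
          by linarith
        also have "\<dots> = (2 * int mm + int nn + 1) * 2 ^ (3 * L)" by (simp add: algebra_simps)
        also have "\<dots> \<le> 2 ^ L * 2 ^ (3 * L)"
        proof (rule mult_right_mono)
          have "2 * int mm + int nn + 1 \<le> int L" using L_ge by linarith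
          also have "int L < 2 ^ L" by (rule of_nat_less_two_power)
          finally show "2 * int mm + int nn + 1 \<le> 2 ^ L" by simp
        qed simp
        also have "\<dots> = 2 ^ (4 * L)" by (simp add: power_add[symmetric])
        finally have bnd: "1 + (\<Sum>a\<in>{0..<2 * int mm + int nn}. r3 ''U'' a) \<le> 2 ^ (4 * L)" .
        have M3: "r3 ''M'' 0 = 2 * int mm + int nn" by (simp add: eq3 r2)
        have "wp qq find_scale (\<lambda>r. \<exists>j<qq. r ''P'' 0 = 2 ^ j \<and> (\<forall>a\<in>{0..<r3 ''M'' 0}. r3 ''U'' a < 2 ^ j)) r3"
          by (rule wp_find_scale[where N = "4 * L"]) (use U3 bnd qq in \<open>simp_all add: M3\<close>)
        then show "wp qq find_scale ?Q r3"
        proof (rule wp_frameI)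
          fix r4 assume P: "\<exists>j<qq. r4 ''P'' 0 = 2 ^ j \<and> (\<forall>a\<in>{0..<r3 ''M'' 0}. r3 ''U'' a < 2 ^ j)"
            and ag: "agree (assigned find_scale) r3 r4"
          have eq4: "r4 z = r3 z" if "z \<notin> {''a'', ''Z'', ''P''}" for z
            using that by (intro agreeD[OF ag]) (simp add: find_scale_def)
          have "network_memory r4" by (rule network_memory_cong[OF net3]) (auto simp: eq4)
          then show "?Q r4" using P[unfolded M3] by (simp add: eq4 eq3 eq2 eq1 zero)
        qed
      qed
    qed
  qed
  then show ?thesis by (simp add: read_network_def s_def wp_Seq_fun)
qed

lemma network_memory_good:
  assumes net: "network_memory r" and "optimal (2 * int mm + int nn) (r ''t'') (r ''h'') (r ''c'') (r ''k'') (r ''x'') (r ''y'')"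
    and "circulation (2 * int mm + int nn) (r ''t'') (r ''h'') (r ''x'')"
  shows "good_state r qq"
proof -
  have r: "r ''M'' 0 = 2 * int mm + int nn" "r ''n'' 0 = int nn" using net by (auto simp: network_memory_def)
  have "r ''t'' a \<in> {0..int nn} \<and> r ''h'' a \<in> {0..int nn}" if "a \<in> {0..<2 * int mm + int nn}" for a
    using that
  proof (cases rule: arc_cases)
    case (forward e) then show ?thesis using network_memory_edge(1,2)[OF net] net_facts(1,2)[of e] by simp
  next
    case (backward e) then show ?thesis using network_memory_edge(3,4)[OF net] net_facts(1,2)[of e] by simp
  next
    case (node v) then show ?thesis using network_memory_node(1,2)[OF net] by simp
  qed
  then show ?thesis unfolding good_state_def r using assms(2,3) qq by simp
qed

lemmas net_I = net

text \<open>The competitor \<open>y\<close> is the averaged flow: its positive and negative parts on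
  the two copies of each edge, and all terminal arcs saturated. Its cost is at most
  \<open>T * B - 2 * T * B\<close>, multiplied by \<open>D\<close> once for the scaled amounts and
  once for the scaled costs.\<close>

lemma optimal_cost_bound:
  assumes net: "network_memory r" and good: "good_state r qq"
    and k: "\<And>a. a \<in> {0..<2 * int mm + int nn} \<Longrightarrow> r ''k'' a = r ''U'' a"
  shows "real_of_int (\<Sum>a\<in>{0..<2 * int mm + int nn}. r ''c'' a * r ''x'' a) \<le> - (T * B * D * D)"
proof -
  have rM: "r ''M'' 0 = 2 * int mm + int nn" using net by (auto simp: network_memory_def)
  have D: "0 < real_of_int D" using D_pos by simp
  have "ends (network_of I) e = Upair (p e) (q e)" if "e \<in> edges (network_of I)" for e
    by (simp add: network_simps)
  note average = average_net_flow[OF net_I send this, unfolded network_simps lessThan_iff, folded B_def]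
  obtain x where x: "\<And>e. e < mm \<Longrightarrow> \<bar>x e\<bar> \<le> u e * T"
    "\<And>v. v < nn \<Longrightarrow> (\<Sum>e<mm. x e * (of_bool (p e = v) - of_bool (q e = v))) = b v"
    "(\<Sum>e<mm. \<tau> e * \<bar>x e\<bar>) \<le> T * B"
    by (rule average) blast+
  define y where "y a = (if a < int mm then D * max 0 (x (nat a))
    else if a < 2 * int mm then D * max 0 (- x (nat (a - int mm))) else D * \<bar>b (nat (a - 2 * int mm))\<bar>)" for a
  have y1: "y (int e) = D * max 0 (x e)" "y (int mm + int e) = D * max 0 (- x e)" if "e < mm" for e
    using that by (simp_all add: y_def)
  have y2: "y (2 * int mm + int v) = D * \<bar>b v\<bar>" for v by (simp add: y_def)
  note E = network_memory_edge[OF net] and N = network_memory_node[OF net]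
  have "real_of_int (\<Sum>a\<in>{0..<r ''M'' 0}. r ''c'' a * r ''x'' a) \<le> (\<Sum>a\<in>{0..<r ''M'' 0}. r ''c'' a * y a)"
  proof (rule optimal_cost_le)
    show "optimal (r ''M'' 0) (r ''t'') (r ''h'') (r ''c'') (r ''k'') (r ''x'') (r ''y'')"
      "circulation (r ''M'' 0) (r ''t'') (r ''h'') (r ''x'')" using good by (simp_all add: good_state_def)
    fix a assume "a \<in> {0..<r ''M'' 0}"
    then have a: "a \<in> {0..<2 * int mm + int nn}" by (simp add: rM)
    show "0 \<le> y a \<and> y a \<le> real_of_int (r ''k'' a)"
      unfolding k[OF a] using a
    proof (cases rule: arc_cases)
      case (forward e)
      have "max 0 (x e) \<le> u e * T" using x(1)[OF forward(1)] by linarith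
      then have "D * max 0 (x e) \<le> D * (u e * T)" using D by (intro mult_left_mono) auto
      then show "0 \<le> y a \<and> y a \<le> real_of_int (r ''U'' a)"
        unfolding forward(2) y1(1)[OF forward(1)] E(5)[OF forward(1)]
        using D by (simp add: mult_ac)
    next
      case (backward e)
      have "max 0 (- x e) \<le> u e * T" using x(1)[OF backward(1)] by linarith
      then have "D * max 0 (- x e) \<le> D * (u e * T)" using D by (intro mult_left_mono) auto
      then show "0 \<le> y a \<and> y a \<le> real_of_int (r ''U'' a)"
        unfolding backward(2) y1(2)[OF backward(1)] E(6)[OF backward(1)] E(5)[OF backward(1)]
        using D by (simp add: mult_ac)
    next
      case (node v)
      then show "0 \<le> y a \<and> y a \<le> real_of_int (r ''U'' a)" using D by (simp add: y2 N(3))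
    qed
  next
    fix \<pi> :: "int \<Rightarrow> real"
    have "(\<Sum>v<nn. b v * \<pi> (int v)) = (\<Sum>v<nn. \<Sum>e<mm. x e * (of_bool (p e = v) - of_bool (q e = v)) * \<pi> (int v))"
      by (intro sum.cong) (simp_all add: sum_distrib_right[symmetric] x(2))
    also have "\<dots> = (\<Sum>e<mm. \<Sum>v<nn. x e * (of_bool (p e = v) - of_bool (q e = v)) * \<pi> (int v))"
      by (rule sum.swap)
    also have "\<dots> = (\<Sum>e<mm. x e * (\<pi> (int (p e)) - \<pi> (int (q e))))"
    proof (rule sum.cong)
      fix e assume "e \<in> {..<mm}"
      then have pq: "p e < nn" "q e < nn" using net_facts(1,2) by auto
      have "(\<Sum>v<nn. x e * (of_bool (p e = v) - of_bool (q e = v)) * \<pi> (int v)) =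
        (\<Sum>v<nn. (if p e = v then x e * \<pi> (int v) else 0) - (if q e = v then x e * \<pi> (int v) else 0))"
        by (rule sum.cong) auto
      also have "\<dots> = x e * (\<pi> (int (p e)) - \<pi> (int (q e)))"
        unfolding sum_subtractf using pq by (simp add: sum.delta algebra_simps)
      finally show "(\<Sum>v<nn. x e * (of_bool (p e = v) - of_bool (q e = v)) * \<pi> (int v)) =
        x e * (\<pi> (int (p e)) - \<pi> (int (q e)))" .
    qed simp
    finally have bal: "(\<Sum>v<nn. b v * \<pi> (int v)) = (\<Sum>e<mm. x e * (\<pi> (int (p e)) - \<pi> (int (q e))))" .
    have "(\<Sum>a\<in>{0..<r ''M'' 0}. y a * (\<pi> (r ''h'' a) - \<pi> (r ''t'' a))) =
      (\<Sum>e<mm. - (D * (x e * (\<pi> (int (p e)) - \<pi> (int (q e)))))) + (\<Sum>v<nn. D * (b v * \<pi> (int v)) - D * \<pi> (int nn) * b v)"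
      unfolding rM sum_arcs
    proof (intro arg_cong2[where f = "(+)"] sum.cong)
      fix e assume "e \<in> {..<mm}"
      then have e: "e < mm" by simp
      show "y (int e) * (\<pi> (r ''h'' (int e)) - \<pi> (r ''t'' (int e))) +
        y (int mm + int e) * (\<pi> (r ''h'' (int mm + int e)) - \<pi> (r ''t'' (int mm + int e))) =
        - (D * (x e * (\<pi> (int (p e)) - \<pi> (int (q e)))))"
        unfolding y1[OF e] E(1-4)[OF e] by (cases "0 \<le> x e") (simp_all add: algebra_simps)
    next
      fix v assume "v \<in> {..<nn}"
      then have v: "v < nn" by simp
      show "y (2 * int mm + int v) * (\<pi> (r ''h'' (2 * int mm + int v)) - \<pi> (r ''t'' (2 * int mm + int v))) =
        D * (b v * \<pi> (int v)) - D * \<pi> (int nn) * b v"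
        unfolding y2 N(1,2)[OF v] by (cases "0 < b v") (simp_all add: algebra_simps)
    qed simp_all
    also have "\<dots> = 0"
      unfolding sum_subtractf sum_negf sum_distrib_left[symmetric] bal net_facts(5) by simp
    finally show "(\<Sum>a\<in>{0..<r ''M'' 0}. y a * (\<pi> (r ''h'' a) - \<pi> (r ''t'' a))) = 0" .
  qed
  also have "(\<Sum>a\<in>{0..<r ''M'' 0}. r ''c'' a * y a) =
    (\<Sum>e<mm. D * D * (\<tau> e * \<bar>x e\<bar>)) + (\<Sum>v<nn. if 0 < b v then - (2 * T * D * D) * b v else 0)"
    unfolding rM sum_arcs
  proof (intro arg_cong2[where f = "(+)"] sum.cong)
    fix e assume "e \<in> {..<mm}"
    then have e: "e < mm" by simp
    show "real_of_int (r ''c'' (int e)) * y (int e) + real_of_int (r ''c'' (int mm + int e)) * y (int mm + int e) =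
      D * D * (\<tau> e * \<bar>x e\<bar>)"
      unfolding y1[OF e] E(8)[OF e] E(7)[OF e] by (cases "0 \<le> x e") (simp_all add: algebra_simps)
  next
    fix v assume "v \<in> {..<nn}"
    then have v: "v < nn" by simp
    show "real_of_int (r ''c'' (2 * int mm + int v)) * y (2 * int mm + int v) =
      (if 0 < b v then - (2 * T * D * D) * b v else 0)"
      unfolding y2 N(4)[OF v] by simp
  qed simp_all
  also have "(\<Sum>v<nn. if 0 < b v then - (2 * T * D * D) * b v else 0) = - (2 * T * D * D) * B"
  proof -
    have "B = (\<Sum>v\<in>{v \<in> {..<nn}. 0 < b v}. b v)" by (simp add: B_def total_supply_def network_simps)
    also have "\<dots> = (\<Sum>v<nn. if 0 < b v then b v else 0)" by (rule sum.inter_filter) simp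
    finally show ?thesis by (simp add: sum_distrib_left if_distrib cong: if_cong)
  qed
  also have "(\<Sum>e<mm. D * D * (\<tau> e * \<bar>x e\<bar>)) \<le> D * D * (T * B)"
    unfolding sum_distrib_left[symmetric] using x(3) D by (intro mult_left_mono) auto
  finally show ?thesis unfolding rM by (simp add: algebra_simps)
qed

end

section \<open>Extracting paths from the circulation\<close>

lemma partial_schedule_cong:
  assumes "partial_schedule G u \<tau> b T C bl x y" "\<And>a. a \<in> arcs G \<Longrightarrow> x' a = x a" "\<And>v. v \<in> verts G \<Longrightarrow> y' v = y v"
  shows "partial_schedule G u \<tau> b T C bl x' y'"
proof -
  have "(\<Sum>v\<in>{v \<in> verts G. 0 < b v}. y' v) = (\<Sum>v\<in>{v \<in> verts G. 0 < b v}. y v)"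
    "(\<Sum>a\<in>arcs G. \<tau> a * x' a) = (\<Sum>a\<in>arcs G. \<tau> a * x a)"
    using assms(2,3) by (auto intro: sum.cong)
  then show ?thesis using assms unfolding partial_schedule_def Let_def by simp
qed

lemma emitted_path_blocks:
  assumes "\<And>j. j \<in> set js \<Longrightarrow> 0 \<le> \<beta> j \<and> \<beta> j < m \<and> real_of_int (w (\<beta> j)) = \<tau> (nat (\<beta> j)) * D" "0 < D"
  shows "emitted m \<beta> w D \<rho> L X js = path_blocks \<tau> \<rho> (L / D) (X / D) (map (\<lambda>j. nat (\<beta> j)) js)"
  using assms(1)
proof (induction js arbitrary: L X)
  case (Cons j js)
  have j: "0 \<le> \<beta> j" "\<beta> j < m" "real_of_int (w (\<beta> j)) = \<tau> (nat (\<beta> j)) * D" using Cons.prems[of j] by auto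
  have "(L - w (\<beta> j)) / D = L / D - \<tau> (nat (\<beta> j))" "(X - w (\<beta> j)) / D = X / D - \<tau> (nat (\<beta> j))"
    using j(3) assms(2) by (simp_all add: field_simps)
  moreover have "emitted m \<beta> w D \<rho> (L - w (\<beta> j)) (X - w (\<beta> j)) js =
      path_blocks \<tau> \<rho> ((L - w (\<beta> j)) / D) ((X - w (\<beta> j)) / D) (map (\<lambda>j. nat (\<beta> j)) js)"
    using Cons.IH[of "L - w (\<beta> j)" "X - w (\<beta> j)"] Cons.prems by simp
  ultimately show ?case using j by simp
qed simp

lemma pred_path_back_walk:
  assumes "pred_path w pr i js"
    and "\<And>j. j \<in> set js \<Longrightarrow> nat (\<beta> j) \<in> arcs G \<and> head G (nat (\<beta> j)) = nat j \<and> tail G (nat (\<beta> j)) = nat (pr j)"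
  shows "back_walk G (nat i) (map (\<lambda>j. nat (\<beta> j)) js) (nat w)"
  using assms by (induction js arbitrary: i) auto

text \<open>
  From here on \<open>k\<close> holds the flow that remains to be decomposed; with zero costs and zero flow \<open>x\<close>, the search
  started at a source \<open>v\<close> with limit 1 follows arcs with \<open>k > 0\<close> to the additional node \<open>n\<close>, unless none exist.
\<close>

definition send_path :: com where
  "send_path = seqs [
     Set_var ''s'' (V ''a''), Set_var ''g'' (V ''n''), Set_var ''l'' (Const 1), search,
     Set_var ''z'' (Read ''k'' (V ''j'')), Set_var ''L'' (Const 0), measure_path,
     Assign ''k'' (V ''j'') (Sub (Read ''k'' (V ''j'')) (V ''z'')), Set_var ''X'' (V ''T''),
     trace emit_arc]"

definition decompose_node :: com where
  "decompose_node = If (Less (Const 0) (In (Add (Const 4) (Mul (V ''a'') (Const 2)))))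
     (seqs [Set_var ''j'' (Add (Mul (V ''m'') (Const 2)) (V ''a'')), While (Less (Const 0) (Read ''k'' (V ''j''))) send_path])
     Skip"

definition solve :: com where
  "solve = seqs [read_network, min_cost, orient, For ''a'' (V ''n'') decompose_node]"

context rational_instance
begin

abbreviation G :: "(int \<Rightarrow> int) \<Rightarrow> (nat, nat) pre_digraph" where
  "G out \<equiv> output_orientation I out"

text \<open>The terminal amounts that remain to be scheduled, in original units; sinks count
  negatively, as in the balances.\<close>

definition rest :: "(int \<Rightarrow> int) \<Rightarrow> nat \<Rightarrow> real" where
  "rest k v = (if 0 < b v then k (2 * int mm + int v) / D else - (k (2 * int mm + int v) / D))"

abbreviation M :: int where
  "M \<equiv> 2 * int mm + int nn"

text \<open>\<open>out\<close> is a separate parameter because only the first \<open>mm\<close>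
  cells of the output array, which fix the orientation, stay unchanged while blocks are appended.
  The condition on the heads of the copies \<open>mm + e\<close> serves to show that a path enters
  the additional node through a terminal arc.\<close>

definition decomposing :: "(int \<Rightarrow> int) \<Rightarrow> memory \<Rightarrow> nat block list \<Rightarrow> bool" where
  "decomposing out r bl \<longleftrightarrow>
     r ''n'' 0 = int nn \<and> r ''m'' 0 = int mm \<and> r ''M'' 0 = M \<and> r ''D'' 0 = D \<and> r ''in'' = inp \<and>
     real_of_int (r ''T'' 0) = 2 * T * D \<and>
     (\<forall>e<mm. r ''t'' (int e) = int (tail (G out) e) \<and> r ''h'' (int e) = int (head (G out) e) \<and>
        real_of_int (r ''w'' (int e)) = \<tau> e * D \<and> r ''k'' (int mm + int e) = 0 \<and>
        r ''h'' (int mm + int e) < int nn) \<and>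
     (\<forall>a. a \<notin> {0..<int mm} \<longrightarrow> r ''w'' a = 0) \<and>
     (\<forall>v<nn. r ''t'' (2 * int mm + int v) = (if 0 < b v then int nn else int v) \<and>
        r ''h'' (2 * int mm + int v) = (if 0 < b v then int v else int nn) \<and>
        (b v = 0 \<longrightarrow> r ''k'' (2 * int mm + int v) = 0)) \<and>
     (\<forall>a\<in>{0..<M}. r ''x'' a = 0 \<and> r ''c'' a = 0) \<and> good_state r qq \<and>
     circulation M (r ''t'') (r ''h'') (r ''k'') \<and>
     (\<forall>a<int mm. r ''out'' a = out a) \<and> output_blocks (int mm) (r ''out'') (r ''q'' 0) bl \<and>
     partial_schedule (G out) u \<tau> b T (T * B) bl (\<lambda>e. r ''k'' (int e) / D) (rest (r ''k''))"

lemma verts_G: "verts (G out) = {..<nn}" and arcs_G: "arcs (G out) = {..<mm}"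
  and tail_G: "tail (G out) e = (if out (int e) = 0 then p e else q e)"
  and head_G: "head (G out) e = (if out (int e) = 0 then q e else p e)"
  by (simp_all add: output_orientation_def nn_def mm_def p_def q_def split: prod.splits)

lemma wp_orient:
  assumes net: "network_memory r" and good: "good_state r qq"
    and k: "\<And>a. a \<in> {0..<M} \<Longrightarrow> r ''k'' a = r ''U'' a"
  shows "wp qq orient (\<lambda>r'. decomposing (r' ''out'') r' []) r"
proof -
  note E = network_memory_edge[OF net] and N = network_memory_node[OF net]
  have r: "r ''n'' 0 = int nn" "r ''m'' 0 = int mm" "r ''M'' 0 = M" "r ''D'' 0 = D" "r ''in'' = inp"
    "r ''out'' = (\<lambda>_. 0)" "\<And>a. a \<notin> {0..<int mm} \<Longrightarrow> r ''w'' a = 0"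
    using net by (auto simp: network_memory_def)
  have D: "0 < real_of_int D" using D_pos by simp
  define x where "x = r ''x''"
  define d where "d e = x (int e) - x (int mm + int e)" for e
  have xb: "0 \<le> x a \<and> x a \<le> r ''U'' a" if "a \<in> {0..<M}" for a
  proof -
    have "optimal M (r ''t'') (r ''h'') (r ''c'') (r ''k'') (r ''x'') (r ''y'')"
      using good unfolding good_state_def r by blast
    then have "0 \<le> r ''x'' a \<and> r ''x'' a \<le> r ''k'' a" using that unfolding optimal_def by blast
    then show ?thesis by (simp add: x_def k[OF that])
  qed
  have xe: "0 \<le> x (int e)" "x (int e) \<le> r ''U'' (int e)" "0 \<le> x (int mm + int e)" "x (int mm + int e) \<le> r ''U'' (int e)"
    if "e < mm" for e
    using xb[of "int e"] xb[of "int mm + int e"] E(6)[OF that] that by auto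
  have xv: "0 \<le> x (2 * int mm + int v)" "real_of_int (x (2 * int mm + int v)) \<le> \<bar>b v\<bar> * D" if "v < nn" for v
    using xb[of "2 * int mm + int v"] N(3)[OF that] that by auto
  let ?Q = "\<lambda>r'. decomposing (r' ''out'') r' []"
  let ?clear = "For ''i'' (Add (V ''n'') (Const 1)) (Assign ''y'' (V ''i'') (Const 0))"
  let ?end = "Seq (Set_var ''T'' (Mul (Mul (Quot (V ''D'') (In (Const 3))) (In (Const 2))) (Const 2)))
     (Set_var ''q'' (Add (V ''m'') (Const 1)))"
  have "wp qq (For ''a'' (V ''m'') orient_edge) (\<lambda>r'. (\<forall>e\<in>{0..<r ''m'' 0}. edge_oriented r r' e) \<and>
    (\<forall>a. a \<notin> {0..<r ''m'' 0} \<longrightarrow> r' ''t'' a = r ''t'' a \<and> r' ''h'' a = r ''h'' a \<and> r' ''out'' a = r ''out'' a)) r"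
    by (rule wp_orient_edges) (use qq in \<open>simp_all add: r\<close>)
  then have "wp qq (For ''a'' (V ''m'') orient_edge) (wp qq (For ''a'' (V ''M'') reset_arc) (wp qq ?clear (wp qq ?end ?Q))) r"
  proof (rule wp_frameI)
    fix r1 assume o1: "(\<forall>e\<in>{0..<r ''m'' 0}. edge_oriented r r1 e) \<and>
        (\<forall>a. a \<notin> {0..<r ''m'' 0} \<longrightarrow> r1 ''t'' a = r ''t'' a \<and> r1 ''h'' a = r ''h'' a \<and> r1 ''out'' a = r ''out'' a)"
      and ag: "agree (assigned (For ''a'' (V ''m'') orient_edge)) r r1"
    have eq1: "r1 z = r z" if "z \<notin> {''a'', ''r'', ''u'', ''t'', ''h'', ''k'', ''out''}" for z
      using that by (intro agreeD[OF ag]) (simp add: orient_edge_def)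
    have e1: "r1 ''k'' (int e) = \<bar>d e\<bar>" "r1 ''k'' (int mm + int e) = 0" "r1 ''out'' (int e) = (if d e < 0 then 1 else 0)"
      "r1 ''t'' (int e) = int (tail (G (r1 ''out'')) e)" "r1 ''h'' (int e) = int (head (G (r1 ''out'')) e)" if "e < mm" for e
    proof -
      have eo: "edge_oriented r r1 (int e)" using o1 that by (auto simp: r)
      show "r1 ''k'' (int e) = \<bar>d e\<bar>" "r1 ''k'' (int mm + int e) = 0"
        using eo by (simp_all add: edge_oriented_def Let_def r d_def x_def)
      show o: "r1 ''out'' (int e) = (if d e < 0 then 1 else 0)"
        using eo unfolding edge_oriented_def Let_def r d_def x_def by (simp split: if_splits)
      show "r1 ''t'' (int e) = int (tail (G (r1 ''out'')) e)" "r1 ''h'' (int e) = int (head (G (r1 ''out'')) e)"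
        unfolding tail_G head_G o using eo unfolding edge_oriented_def Let_def r E(1,2)[OF that]
        by (auto simp: d_def x_def split: if_splits)
    qed
    have th1: "r1 ''t'' a = r ''t'' a" "r1 ''h'' a = r ''h'' a" "r1 ''out'' a = 0" if "int mm \<le> a" for a
      using o1 that by (auto simp: r)
    have "wp qq (For ''a'' (V ''M'') reset_arc) (\<lambda>r'. \<forall>a\<in>{0..<r1 ''M'' 0}. r' ''x'' a = 0 \<and> r' ''c'' a = 0 \<and>
        r' ''k'' a = (if a < r1 ''m'' 0 * 2 then r1 ''k'' a else r1 ''x'' a)) r1"
      by (rule wp_reset_arcs) (use qq in \<open>simp_all add: eq1 r\<close>)
    then show "wp qq (For ''a'' (V ''M'') reset_arc) (wp qq ?clear (wp qq ?end ?Q)) r1"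
    proof (rule wp_frameI)
      fix r2 assume o2: "\<forall>a\<in>{0..<r1 ''M'' 0}. r2 ''x'' a = 0 \<and> r2 ''c'' a = 0 \<and>
          r2 ''k'' a = (if a < r1 ''m'' 0 * 2 then r1 ''k'' a else r1 ''x'' a)"
        and ag: "agree (assigned (For ''a'' (V ''M'') reset_arc)) r1 r2"
      have eq2: "r2 z = r1 z" if "z \<notin> {''a'', ''k'', ''x'', ''c''}" for z
        using that by (intro agreeD[OF ag]) (simp add: reset_arc_def)
      have xc2: "r2 ''x'' a = 0" "r2 ''c'' a = 0" if "a \<in> {0..<M}" for a using o2 that by (auto simp: eq1 r)
      have k2: "r2 ''k'' (int e) = \<bar>d e\<bar>" "r2 ''k'' (int mm + int e) = 0" if "e < mm" for e
        using o2 that e1[OF that] by (auto simp: eq1 r)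
      have kv2: "r2 ''k'' (2 * int mm + int v) = x (2 * int mm + int v)" if "v < nn" for v
        using o2 that by (auto simp: eq1 r x_def)
      have r2n: "r2 ''n'' 0 = int nn" by (simp add: eq2 eq1 r)
      have "wp qq ?clear (\<lambda>r'. \<forall>i\<in>{0..<int nn + 1}. r' ''y'' i = 0) r2"
      proof (rule wp_For[where N = "int nn + 1" and I = "\<lambda>j r'. \<forall>i\<in>{0..<j}. r' ''y'' i = 0"])
        fix j r' assume "agree (insert ''i'' (assigned (Assign ''y'' (V ''i'') (Const 0)))) r2 r'"
        then have "r' ''n'' = r2 ''n''" by (rule agreeD) simp
        then show "eval_exp r' (Add (V ''n'') (Const 1)) = int nn + 1" by (simp add: r2n)
      qed (use qq in auto)
      then show "wp qq ?clear (wp qq ?end ?Q) r2"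
      proof (rule wp_frameI)
        fix r3 assume y3: "\<forall>i\<in>{0..<int nn + 1}. r3 ''y'' i = 0" and ag: "agree (assigned ?clear) r2 r3"
        have eq3: "r3 z = r2 z" if "z \<notin> {''i'', ''y''}" for z
          using that by (intro agreeD[OF ag]) simp
        define out where "out = r1 ''out''"
        define r4 where "r4 = r3(''T'' := (r3 ''T'')(0 := D div inp 3 * inp 2 * 2), ''q'' := (r3 ''q'')(0 := int mm + 1))"
        have s4: "r4 ''n'' 0 = int nn" "r4 ''m'' 0 = int mm" "r4 ''M'' 0 = M" "r4 ''D'' 0 = D" "r4 ''in'' = inp"
          "r4 ''out'' = out" "r4 ''t'' = r1 ''t''" "r4 ''h'' = r1 ''h''" "r4 ''w'' = r ''w''" "r4 ''k'' = r2 ''k''"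
          "r4 ''x'' = r2 ''x''" "r4 ''c'' = r2 ''c''" "r4 ''y'' = r3 ''y''" "r4 ''q'' 0 = int mm + 1"
          by (simp_all add: r4_def eq3 eq2 eq1 r out_def)
        have nodes: "r1 ''t'' a \<in> {0..int nn} \<and> r1 ''h'' a \<in> {0..int nn}" if "a \<in> {0..<M}" for a
          using that
        proof (cases rule: arc_cases)
          case (forward e)
          then show ?thesis using e1(4,5) net_facts(1,2)[of e] by (simp add: tail_G head_G)
        next
          case (backward e)
          then show ?thesis using th1(1,2) E(3,4) net_facts(1,2)[of e] by simp
        next
          case (node v)
          then show ?thesis using th1(1,2) N(1,2) by simp
        qed
        have k4: "0 \<le> r2 ''k'' a" if "a \<in> {0..<M}" for a
          using that
        proof (cases rule: arc_cases)
          case (node v) then show ?thesis using kv2 xv by simp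
        qed (simp_all add: k2)
        have opt: "optimal M (r1 ''t'') (r1 ''h'') (r2 ''c'') (r2 ''k'') (r2 ''x'') (r3 ''y'')"
          unfolding optimal_def
        proof
          fix a assume a: "a \<in> {0..<M}"
          have "r3 ''y'' (r1 ''t'' a) = 0" "r3 ''y'' (r1 ''h'' a) = 0" using y3 nodes[OF a] by auto
          then show "0 \<le> r2 ''x'' a \<and> r2 ''x'' a \<le> r2 ''k'' a \<and>
            (r2 ''x'' a < r2 ''k'' a \<longrightarrow> 0 \<le> r2 ''c'' a + r3 ''y'' (r1 ''t'' a) - r3 ''y'' (r1 ''h'' a)) \<and>
            (0 < r2 ''x'' a \<longrightarrow> r2 ''c'' a + r3 ''y'' (r1 ''t'' a) - r3 ''y'' (r1 ''h'' a) \<le> 0)"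
            using xc2[OF a] k4[OF a] by simp
        qed
        have circ: "circulation M (r1 ''t'') (r1 ''h'') (r2 ''k'')"
          unfolding circulation_def
        proof
          fix \<pi> :: "int \<Rightarrow> int"
          have "(\<Sum>a\<in>{0..<M}. r2 ''k'' a * (\<pi> (r1 ''h'' a) - \<pi> (r1 ''t'' a))) =
            (\<Sum>a\<in>{0..<M}. x a * (\<pi> (r ''h'' a) - \<pi> (r ''t'' a)))"
            unfolding sum_arcs
          proof (rule arg_cong2[where f = "(+)"]; rule sum.cong)
            fix e assume "e \<in> {..<mm}"
            then have e: "e < mm" by simp
            show "r2 ''k'' (int e) * (\<pi> (r1 ''h'' (int e)) - \<pi> (r1 ''t'' (int e))) +
                r2 ''k'' (int mm + int e) * (\<pi> (r1 ''h'' (int mm + int e)) - \<pi> (r1 ''t'' (int mm + int e))) =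
              x (int e) * (\<pi> (r ''h'' (int e)) - \<pi> (r ''t'' (int e))) +
                x (int mm + int e) * (\<pi> (r ''h'' (int mm + int e)) - \<pi> (r ''t'' (int mm + int e)))"
              unfolding k2[OF e] e1(4,5)[OF e] tail_G head_G e1(3)[OF e] E(1-4)[OF e]
              by (auto simp: d_def algebra_simps abs_if)
          next
            fix v assume "v \<in> {..<nn}"
            then show "r2 ''k'' (2 * int mm + int v) * (\<pi> (r1 ''h'' (2 * int mm + int v)) - \<pi> (r1 ''t'' (2 * int mm + int v))) =
              x (2 * int mm + int v) * (\<pi> (r ''h'' (2 * int mm + int v)) - \<pi> (r ''t'' (2 * int mm + int v)))"
              by (simp add: kv2 th1)
          qed simp_all
          also have "\<dots> = 0" using good by (simp add: good_state_def circulation_def r x_def)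
          finally show "(\<Sum>a\<in>{0..<M}. r2 ''k'' a * (\<pi> (r1 ''h'' a) - \<pi> (r1 ''t'' a))) = 0" .
        qed
        have good4: "good_state r4 qq"
          unfolding good_state_def s4 using opt nodes qq xc2 by (auto simp: circulation_def)
        \<comment> \<open>This is the bound on the optimal cost divided by \<open>D * D\<close>;
          replacing two opposite flows by their difference can only lower the transit cost.\<close>
        have cost: "T * B \<le> 2 * T * (\<Sum>v\<in>{v \<in> {..<nn}. 0 < b v}. rest (r2 ''k'') v) -
            (\<Sum>e<mm. \<tau> e * (r2 ''k'' (int e) / D))"
        proof -
          have "real_of_int (\<Sum>a\<in>{0..<M}. r ''c'' a * x a) =
            (\<Sum>e<mm. D * (\<tau> e * (real_of_int (x (int e)) + real_of_int (x (int mm + int e))))) +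
            (\<Sum>v<nn. if 0 < b v then - 2 * T * D * x (2 * int mm + int v) else 0)"
            unfolding sum_arcs of_int_add of_int_sum of_int_mult
          proof (rule arg_cong2[where f = "(+)"]; rule sum.cong)
            fix e assume "e \<in> {..<mm}"
            then have e: "e < mm" by simp
            show "real_of_int (r ''c'' (int e)) * real_of_int (x (int e)) +
              real_of_int (r ''c'' (int mm + int e)) * real_of_int (x (int mm + int e)) =
              D * (\<tau> e * (real_of_int (x (int e)) + real_of_int (x (int mm + int e))))"
              unfolding E(8)[OF e] E(7)[OF e] by (simp add: algebra_simps)
          next
            fix v assume "v \<in> {..<nn}"
            then have v: "v < nn" by simp
            show "real_of_int (r ''c'' (2 * int mm + int v)) * real_of_int (x (2 * int mm + int v)) =
              (if 0 < b v then - 2 * T * D * x (2 * int mm + int v) else 0)"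
              unfolding N(4)[OF v] by simp
          qed simp_all
          also have "(\<Sum>v<nn. if 0 < b v then - 2 * T * D * x (2 * int mm + int v) else 0) =
            - (D * D * (2 * T * (\<Sum>v\<in>{v \<in> {..<nn}. 0 < b v}. rest (r2 ''k'') v)))"
          proof -
            have "(\<Sum>v\<in>{v \<in> {..<nn}. 0 < b v}. rest (r2 ''k'') v) =
              (\<Sum>v\<in>{v \<in> {..<nn}. 0 < b v}. x (2 * int mm + int v) / D)"
              by (rule sum.cong) (auto simp: rest_def kv2)
            also have "\<dots> = (\<Sum>v<nn. if 0 < b v then x (2 * int mm + int v) / D else 0)"
              by (rule sum.inter_filter) simp
            finally show ?thesis
              using D by (simp add: sum_distrib_left sum_negf[symmetric] if_distrib cong: if_cong)
                (rule sum.cong; simp)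
          qed
          finally have "(\<Sum>e<mm. D * (\<tau> e * (real_of_int (x (int e)) + real_of_int (x (int mm + int e))))) \<le>
              D * D * (2 * T * (\<Sum>v\<in>{v \<in> {..<nn}. 0 < b v}. rest (r2 ''k'') v)) - T * B * D * D"
            using optimal_cost_bound[OF net good k] by (simp add: x_def)
          moreover have "D * D * (\<Sum>e<mm. \<tau> e * (r2 ''k'' (int e) / D)) \<le>
              (\<Sum>e<mm. D * (\<tau> e * (real_of_int (x (int e)) + real_of_int (x (int mm + int e)))))"
            unfolding sum_distrib_left
          proof (rule sum_mono)
            fix e assume "e \<in> {..<mm}"
            then have e: "e < mm" by simp
            have "D * D * (\<tau> e * (r2 ''k'' (int e) / D)) = D * (\<tau> e * \<bar>d e\<bar>)"
              using D by (simp add: k2[OF e])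
            also have "\<dots> \<le> D * (\<tau> e * (real_of_int (x (int e)) + real_of_int (x (int mm + int e))))"
            proof (intro mult_left_mono)
              have "\<bar>d e\<bar> \<le> x (int e) + x (int mm + int e)" using xe[OF e] by (simp add: d_def)
              then show "real_of_int \<bar>d e\<bar> \<le> real_of_int (x (int e)) + real_of_int (x (int mm + int e))"
                by (metis of_int_add of_int_le_iff)
            qed (use D net_facts(4)[OF e] in auto)
            finally show "D * D * (\<tau> e * (r2 ''k'' (int e) / D)) \<le> D * (\<tau> e * (real_of_int (x (int e)) + real_of_int (x (int mm + int e))))" .
          qed
          ultimately have "D * D * (T * B) \<le> D * D * (2 * T * (\<Sum>v\<in>{v \<in> {..<nn}. 0 < b v}. rest (r2 ''k'') v) -
              (\<Sum>e<mm. \<tau> e * (r2 ''k'' (int e) / D)))"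
            by (simp add: algebra_simps)
          moreover have "0 < real_of_int (D * D)" using D by simp
          ultimately show ?thesis by (simp only: mult_le_cancel_left_pos)
        qed
        have sch: "partial_schedule (G out) u \<tau> b T (T * B) [] (\<lambda>e. r2 ''k'' (int e) / D) (rest (r2 ''k''))"
        proof (rule partial_schedule_init)
          fix e assume "e \<in> arcs (G out)"
          then have e: "e < mm" by (simp add: arcs_G)
          have "real_of_int \<bar>d e\<bar> \<le> real_of_int (r ''U'' (int e))" using xe[OF e] by (simp add: d_def)
          then have "real_of_int \<bar>d e\<bar> / D \<le> u e * T" unfolding E(5)[OF e] using D by (simp add: divide_le_eq)
          then show "0 \<le> r2 ''k'' (int e) / D \<and> r2 ''k'' (int e) / D \<le> u e * T \<and> 0 \<le> u e"
            using D net_facts(3)[OF e] by (simp add: k2[OF e])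
        next
          fix v assume "v \<in> verts (G out)"
          then have v: "v < nn" by (simp add: verts_G)
          have "x (2 * int mm + int v) / D \<le> \<bar>b v\<bar>" using xv[OF v] D by (simp add: divide_le_eq)
          then show "(0 < b v \<longrightarrow> 0 \<le> rest (r2 ''k'') v \<and> rest (r2 ''k'') v \<le> b v) \<and>
            (b v < 0 \<longrightarrow> rest (r2 ''k'') v \<le> 0 \<and> b v \<le> rest (r2 ''k'') v)"
            using xv(1)[OF v] D by (auto simp: rest_def kv2[OF v])
        qed (use net_facts cost in \<open>simp_all add: verts_G arcs_G\<close>)
        have "?Q r4"
          unfolding decomposing_def s4
        proof (intro conjI allI impI ballI)
          have "real_of_int (r4 ''T'' 0) = real_of_int (D div inp 3 * inp 2) * 2" by (simp add: r4_def)
          then show "real_of_int (r4 ''T'' 0) = 2 * T * D" unfolding scaled_horizon by simp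
        next
          fix v assume v: "v < nn" "b v = 0"
          then show "r2 ''k'' (2 * int mm + int v) = 0" using xv[OF v(1)] by (simp add: kv2)
        next
          fix e assume e: "e < mm"
          show "r1 ''h'' (int mm + int e) < int nn" using th1 E(4)[OF e] net_facts(1)[OF e] by simp
          show "real_of_int (r ''w'' (int e)) = \<tau> e * D" using E(7,9)[OF e] by simp
        next
          have "out (int mm) = 0" by (simp add: out_def th1)
          then show "output_blocks (int mm) out (int mm + 1) []" by (simp add: output_blocks_def)
        qed (use e1 k2 th1 N xc2 good4 circ sch r(7) in \<open>simp_all add: out_def\<close>)
        then show "wp qq ?end ?Q r3"
          by (simp add: r4_def eq3 eq2 eq1 r)
      qed
    qed
  qed
  then show ?thesis by (simp add: orient_def wp_Seq_fun)
qed

end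

context rational_instance
begin

lemma horizon_pos: "v < nn \<Longrightarrow> b v \<noteq> 0 \<Longrightarrow> 0 < T"
  using total_supply_zero[OF net send, of v] net_facts(6) by (cases "T = 0") (auto simp: network_simps)

definition positive_arcs :: "memory \<Rightarrow> int set" where
  "positive_arcs r = {a \<in> {0..<M}. 0 < r ''k'' a}"

text \<open>The arc \<open>j\<close> from the additional node to \<open>v\<close> and a path of arcs
  with \<open>k > 0\<close> back to that node form a cycle in the remaining circulation
  \<open>k\<close>. Subtracting the bottleneck \<open>z\<close> leaves a nonnegative circulation, so
  there is such a cycle again as long as \<open>k\<close> is positive on the arc of a
  source.\<close>

lemma wp_send_path:
  assumes dec: "decomposing out r bl" and v: "v < nn" "0 < b v"
    and a: "r ''a'' 0 = int v" "r ''j'' 0 = 2 * int mm + int v" and kj: "0 < r ''k'' (2 * int mm + int v)"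
  shows "wp qq send_path (\<lambda>r'. (\<exists>bl. decomposing out r' bl) \<and> r' ''a'' = r ''a'' \<and> r' ''j'' = r ''j'' \<and>
    positive_arcs r' \<subset> positive_arcs r) r"
proof -
  define j where "j = 2 * int mm + int v"
  have jM: "j \<in> {0..<M}" using v by (simp add: j_def)
  have rs: "r ''n'' 0 = int nn" "r ''m'' 0 = int mm" "r ''M'' 0 = M" "r ''D'' 0 = D" "r ''in'' = inp"
    "real_of_int (r ''T'' 0) = 2 * T * D"
    using dec by (simp_all add: decomposing_def)
  have re: "r ''t'' (int e) = int (tail (G out) e)" "r ''h'' (int e) = int (head (G out) e)"
    "real_of_int (r ''w'' (int e)) = \<tau> e * D" "r ''k'' (int mm + int e) = 0"
    "r ''h'' (int mm + int e) < int nn" if "e < mm" for e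
    using dec that unfolding decomposing_def by blast+
  have rw: "r ''w'' a = 0" if "a \<notin> {0..<int mm}" for a using dec that unfolding decomposing_def by blast
  have rv: "r ''t'' (2 * int mm + int v) = (if 0 < b v then int nn else int v)"
    "r ''h'' (2 * int mm + int v) = (if 0 < b v then int v else int nn)"
    "b v = 0 \<Longrightarrow> r ''k'' (2 * int mm + int v) = 0" if "v < nn" for v
    using dec that unfolding decomposing_def by blast+
  have rx: "r ''x'' a = 0" "r ''c'' a = 0" if "a \<in> {0..<M}" for a using dec that unfolding decomposing_def by blast+
  have good: "good_state r qq" and circ: "circulation M (r ''t'') (r ''h'') (r ''k'')"
    and ro: "\<And>a. a < int mm \<Longrightarrow> r ''out'' a = out a" "output_blocks (int mm) (r ''out'') (r ''q'' 0) bl"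
    and sch: "partial_schedule (G out) u \<tau> b T (T * B) bl (\<lambda>e. r ''k'' (int e) / D) (rest (r ''k''))"
    using dec unfolding decomposing_def by blast+
  have opt: "optimal M (r ''t'') (r ''h'') (r ''c'') (r ''k'') (r ''x'') (r ''y'')"
    and nodes: "\<And>a. a \<in> {0..<M} \<Longrightarrow> r ''t'' a \<in> {0..int nn} \<and> r ''h'' a \<in> {0..int nn}"
    using good unfolding good_state_def rs by blast+
  have j: "r ''t'' j = int nn" "r ''h'' j = int v" using rv[OF v(1)] v(2) by (simp_all add: j_def)
  have k0: "0 \<le> r ''k'' a" if "a \<in> {0..<M}" for a
    using opt that rx[OF that] unfolding optimal_def by (metis order_trans)
  have feasible: "\<pi> (r ''h'' a) \<le> \<pi> (r ''t'' a)"
    if "optimal M (r ''t'') (r ''h'') (r ''c'') (r ''k'') (r ''x'') \<pi>" "a \<in> {0..<M}" "0 < r ''k'' a" for \<pi> a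
  proof -
    have "r ''x'' a < r ''k'' a \<longrightarrow> 0 \<le> r ''c'' a + \<pi> (r ''t'' a) - \<pi> (r ''h'' a)"
      using that(1,2) unfolding optimal_def by blast
    then show ?thesis using that(3) rx[OF that(2)] by simp
  qed
  have T: "0 < T" by (rule horizon_pos[OF v(1)]) (use v(2) in simp)
  have D: "0 < real_of_int D" using D_pos by simp
  have inp2: "0 < inp 2" using T inp3_pos unfolding T_eq by (simp add: zero_less_divide_iff)
  let ?Q = "\<lambda>r'. (\<exists>bl. decomposing out r' bl) \<and> r' ''a'' = r ''a'' \<and> r' ''j'' = r ''j'' \<and> positive_arcs r' \<subset> positive_arcs r"
  let ?c2 = "Seq (Set_var ''z'' (Read ''k'' (V ''j''))) (Set_var ''L'' (Const 0))"
  let ?c3 = "Seq (Assign ''k'' (V ''j'') (Sub (Read ''k'' (V ''j'')) (V ''z''))) (Set_var ''X'' (V ''T''))"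
  define s1 where "s1 = r(''s'' := (r ''s'')(0 := int v), ''g'' := (r ''g'')(0 := int nn), ''l'' := (r ''l'')(0 := 1))"
  have s1: "s1 ''M'' = r ''M''" "s1 ''t'' = r ''t''" "s1 ''h'' = r ''h''" "s1 ''c'' = r ''c''" "s1 ''k'' = r ''k''"
    "s1 ''x'' = r ''x''" "s1 ''y'' = r ''y''" "s1 ''n'' = r ''n''" "s1 ''s'' 0 = int v" "s1 ''g'' 0 = int nn" "s1 ''l'' 0 = 1"
    by (simp_all add: s1_def)
  have "wp qq search (\<lambda>r'. optimal M (r ''t'') (r ''h'') (r ''c'') (r ''k'') (r ''x'') (r' ''y'') \<and>
     r' ''y'' (int v) = r ''y'' (int v) \<and>
     r' ''y'' (int nn) = r ''y'' (int nn) + (1 - r' ''l'' 0) \<and>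
     (r' ''l'' 0 = 0 \<or> 0 < r' ''l'' 0 \<and> reaches M (r ''t'') (r ''h'') (r ''c'') (r ''k'')
        (r ''x'') (r' ''y'') (r' ''p'') (r' ''b'') (r' ''d'') (int v) {0..int nn} (int nn))) s1"
    by (rule wp_search[of s1, unfolded s1 rs]) (use opt qq nodes v in auto)
  then have "wp qq search (wp qq ?c2 (wp qq measure_path (wp qq ?c3 (wp qq (trace emit_arc) ?Q)))) s1"
  proof (rule wp_frameI)
    fix r1 assume 1: "optimal M (r ''t'') (r ''h'') (r ''c'') (r ''k'') (r ''x'') (r1 ''y'') \<and>
     r1 ''y'' (int v) = r ''y'' (int v) \<and>
     r1 ''y'' (int nn) = r ''y'' (int nn) + (1 - r1 ''l'' 0) \<and>
     (r1 ''l'' 0 = 0 \<or> 0 < r1 ''l'' 0 \<and> reaches M (r ''t'') (r ''h'') (r ''c'') (r ''k'')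
        (r ''x'') (r1 ''y'') (r1 ''p'') (r1 ''b'') (r1 ''d'') (int v) {0..int nn} (int nn))"
      and ag: "agree (assigned search) s1 r1"
    have eq1: "r1 z = r z" if "z \<in> {''n'', ''m'', ''M'', ''D'', ''in'', ''T'', ''t'', ''h'', ''w'', ''k'', ''x'', ''c'', ''out'', ''q'', ''a'', ''j''}" for z
    proof -
      have "r1 z = s1 z" by (rule search_frame[OF ag]) (use that in auto)
      also have "\<dots> = r z" using that by (auto simp: s1_def)
      finally show ?thesis .
    qed
    have sg1: "r1 ''s'' 0 = int v" "r1 ''g'' 0 = int nn"
      using search_frame[OF ag, of "''s''"] search_frame[OF ag, of "''g''"] s1 by simp_all
    define pr \<beta> y where "pr = r1 ''p''" and "\<beta> = r1 ''b''" and "y = r1 ''y''"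
    have opt1: "optimal M (r ''t'') (r ''h'') (r ''c'') (r ''k'') (r ''x'') y" using 1 by (simp add: y_def)
    text \<open>Otherwise the search has separated the root from \<open>v\<close> by a cut without flow into the root's side.\<close>
    have "r1 ''l'' 0 \<noteq> 0"
    proof
      assume "r1 ''l'' 0 = 0"
      then have "y (int v) < y (int nn)"
        using 1 feasible[OF opt jM] kj j by (simp add: y_def j_def)
      moreover have "(\<Sum>a\<in>{0..<M}. r ''k'' a * (y (r ''h'' a) - y (r ''t'' a))) < (\<Sum>a\<in>{0..<M}. 0)"
      proof (rule sum_strict_mono_ex1)
        show "\<forall>a\<in>{0..<M}. r ''k'' a * (y (r ''h'' a) - y (r ''t'' a)) \<le> 0"
        proof
          fix a assume a: "a \<in> {0..<M}"
          show "r ''k'' a * (y (r ''h'' a) - y (r ''t'' a)) \<le> 0"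
          proof (cases "r ''k'' a = 0")
            case False
            then have "0 < r ''k'' a" using k0[OF a] by simp
            then show ?thesis using feasible[OF opt1 a] by (intro mult_nonneg_nonpos) auto
          qed simp
        qed
        have "r ''k'' j * (y (r ''h'' j) - y (r ''t'' j)) < 0"
          using calculation kj by (intro mult_pos_neg) (auto simp: j j_def[symmetric])
        then show "\<exists>a\<in>{0..<M}. r ''k'' a * (y (r ''h'' a) - y (r ''t'' a)) < 0" using jM by blast
      qed simp
      ultimately show False using circ by (simp add: circulation_def)
    qed
    then have "reaches M (r ''t'') (r ''h'') (r ''c'') (r ''k'') (r ''x'') y pr \<beta> (r1 ''d'') (int v) {0..int nn} (int nn)"
      using 1 by (simp add: y_def pr_def \<beta>_def)
    then obtain js where js: "pred_path (int v) pr (int nn) js" "set js \<subseteq> {0..int nn}"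
      "\<And>i. i \<in> set js \<Longrightarrow> entered M (r ''t'') (r ''h'') (r ''k'') (r ''x'') pr \<beta> (r1 ''d'') i"
      unfolding reaches_def by blast
    \<comment> \<open>As \<open>x = 0\<close>, no arc is residual backwards, so the path follows
      arcs with \<open>k > 0\<close> in their own direction.\<close>
    have arc: "\<beta> i \<in> {0..<M} \<and> r ''t'' (\<beta> i) = pr i \<and> r ''h'' (\<beta> i) = i \<and> 0 < r ''k'' (\<beta> i)" if "i \<in> set js" for i
      using js(3)[OF that] rx(1)[of "\<beta> i"] by (auto simp: entered_def)
    have entered1: "entered M (r ''t'') (r ''h'') (r ''k'') (r ''x'') pr \<beta> (\<lambda>_. 1) i" if "i \<in> set js" for i
      using arc[OF that] rx(1)[of "\<beta> i"] by (auto simp: entered_def)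
    have dist: "distinct js" "int v \<notin> set js" using pred_path_distinct[OF js(1)] by auto
    have inj: "inj_on \<beta> (set js)" by (rule entered_inj_on[OF js(1) entered1])
    \<comment> \<open>Terminal arcs are incident with the additional node and the copies
      \<open>mm + e\<close> carry no flow, so only oriented edges remain.\<close>
    have edge: "\<beta> i < int mm" if "i \<in> set js" "i \<noteq> int nn" "pr i \<noteq> int nn" for i
    proof -
      have "\<beta> i \<in> {0..<M}" using arc[OF that(1)] by simp
      then show ?thesis
      proof (cases rule: arc_cases)
        case (backward e) then show ?thesis using arc[OF that(1)] re(4) by simp
      next
        case (node v) then show ?thesis using arc[OF that(1)] rv(1,2)[of v] that by (auto split: if_splits)
      qed simp
    qed
    obtain js' where js': "js = int nn # js'" using js(1) v(1) by (cases js) auto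
    \<comment> \<open>The last arc of the path enters the additional node. Edges and their copies
      have proper nodes as heads, so it is the terminal arc of some \<open>v'\<close>; its direction
      and its positive flow make \<open>v'\<close> a sink.\<close>
    have "\<beta> (int nn) \<in> {0..<M}" using arc[of "int nn"] js' by simp
    then obtain v' where v': "v' < nn" "\<beta> (int nn) = 2 * int mm + int v'"
    proof (cases rule: arc_cases)
      case (forward e)
      then show thesis using arc[of "int nn"] js' re(2)[of e] net_facts(1,2)[of e] by (simp add: head_G split: if_splits)
    next
      case (backward e)
      then show thesis using arc[of "int nn"] js' re(5)[of e] by simp
    qed blast
    have bv': "b v' < 0" "pr (int nn) = int v'"
    proof -
      have "r ''h'' (2 * int mm + int v') = int nn" "0 < r ''k'' (2 * int mm + int v')" "r ''t'' (2 * int mm + int v') = pr (int nn)"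
        using arc[of "int nn"] js' v'(2) by auto
      moreover have nb: "\<not> 0 < b v'" using calculation(1) rv(2)[OF v'(1)] v'(1) by auto
      moreover have "b v' \<noteq> 0" using calculation(2) rv(3)[OF v'(1)] by auto
      ultimately show "b v' < 0" "pr (int nn) = int v'" using rv(1)[OF v'(1)] by simp_all
    qed
    have path': "pred_path (int v) pr (int v') js'" and nnjs: "int nn \<notin> set js'" using js(1) bv'(2) by (auto simp: js')
    have edge': "0 \<le> \<beta> i" "\<beta> i < int mm" "0 \<le> i" "0 \<le> pr i" if "i \<in> set js'" for i
    proof -
      have i: "i \<in> set js" using that js' by simp
      show "0 \<le> \<beta> i" using arc[OF i] by simp
      have p: "pr i \<in> insert (int v) (set js')" by (rule pred_path_closed[OF path' that])
      have "i \<in> {0..int nn}" using js(2) i by blast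
      then show "0 \<le> i" by simp
      have "pr i \<in> insert (int v) {0..int nn}" using js(2) js' p by auto
      then show "0 \<le> pr i" by auto
      have "i \<noteq> int nn" "pr i \<noteq> int nn" using that nnjs p v(1) by auto
      then show "\<beta> i < int mm" by (rule edge[OF i])
    qed
    define P where "P = map (\<lambda>i. nat (\<beta> i)) js'"
    have walk: "back_walk (G out) v' P v"
    proof -
      have "back_walk (G out) (nat (int v')) (map (\<lambda>i. nat (\<beta> i)) js') (nat (int v))"
      proof (rule pred_path_back_walk[OF path'])
        fix i assume i: "i \<in> set js'"
        have e: "nat (\<beta> i) < mm" using edge'[OF i] by auto
        have "int (tail (G out) (nat (\<beta> i))) = pr i" "int (head (G out) (nat (\<beta> i))) = i"
          using re(1,2)[OF e] arc[of i] i edge'[OF i] js' by auto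
        then show "nat (\<beta> i) \<in> arcs (G out) \<and> head (G out) (nat (\<beta> i)) = nat i \<and> tail (G out) (nat (\<beta> i)) = nat (pr i)"
          using e by (simp add: arcs_G) linarith
      qed
      then show ?thesis by (simp add: P_def)
    qed
    have "inj_on (\<lambda>i. nat (\<beta> i)) (set js')"
    proof (rule inj_onI)
      fix i k assume "i \<in> set js'" "k \<in> set js'" "nat (\<beta> i) = nat (\<beta> k)"
      then show "i = k" using inj edge'(1) js' by (auto dest: inj_onD simp: eq_nat_nat_iff)
    qed
    then have distP: "distinct P" using dist(1) by (simp add: P_def distinct_map js')
    have setP: "set P \<subseteq> arcs (G out)"
    proof -
      have "nat (\<beta> i) < mm" if "i \<in> set js'" for i using edge'(1,2)[OF that] by simp
      then show ?thesis by (auto simp: P_def arcs_G)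
    qed
    have len: "length js \<le> qq" by (rule reaches_length[OF js(1,2)]) (use qq in auto)
    define s2 where "s2 = r1(''z'' := (r1 ''z'')(0 := r ''k'' j), ''L'' := (r1 ''L'')(0 := 0))"
    have s2: "s2 ''s'' 0 = int v" "s2 ''p'' = pr" "s2 ''g'' 0 = int nn" "s2 ''b'' = \<beta>" "s2 ''k'' = r ''k''" "s2 ''w'' = r ''w''"
      "s2 ''L'' 0 = 0" "s2 ''z'' 0 = r ''k'' j" "s2 ''y'' = y"
      by (simp_all add: s2_def sg1 pr_def \<beta>_def y_def eq1)
    have eq2: "s2 z = r z" if "z \<in> {''n'', ''m'', ''M'', ''D'', ''in'', ''T'', ''t'', ''h'', ''w'', ''k'', ''x'', ''c'', ''out'', ''q'', ''a'', ''j''}" for z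
      using eq1[OF that] that by (auto simp: s2_def)
    have "wp qq measure_path (\<lambda>r'. r' ''L'' 0 = s2 ''L'' 0 + (\<Sum>j\<leftarrow>js. s2 ''w'' (s2 ''b'' j)) \<and>
      r' ''z'' 0 \<le> s2 ''z'' 0 \<and> (\<forall>j\<in>set js. r' ''z'' 0 \<le> s2 ''k'' (s2 ''b'' j)) \<and>
      (r' ''z'' 0 = s2 ''z'' 0 \<or> (\<exists>j\<in>set js. r' ''z'' 0 = s2 ''k'' (s2 ''b'' j)))) s2"
      by (rule wp_measure_path) (use js len in \<open>simp_all add: s2\<close>)
    then have "wp qq measure_path (wp qq ?c3 (wp qq (trace emit_arc) ?Q)) s2"
    proof (rule wp_frameI)
      fix r3 assume 3: "r3 ''L'' 0 = s2 ''L'' 0 + (\<Sum>j\<leftarrow>js. s2 ''w'' (s2 ''b'' j)) \<and>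
      r3 ''z'' 0 \<le> s2 ''z'' 0 \<and> (\<forall>j\<in>set js. r3 ''z'' 0 \<le> s2 ''k'' (s2 ''b'' j)) \<and>
      (r3 ''z'' 0 = s2 ''z'' 0 \<or> (\<exists>j\<in>set js. r3 ''z'' 0 = s2 ''k'' (s2 ''b'' j)))"
        and ag: "agree (assigned measure_path) s2 r3"
      have eq3: "r3 x = s2 x" if "x \<notin> {''u'', ''z'', ''L''}" for x
        using that by (intro agreeD[OF ag]) (simp add: measure_path_def)
      have eq3': "r3 z = r z" if "z \<in> {''n'', ''m'', ''M'', ''D'', ''in'', ''T'', ''t'', ''h'', ''w'', ''k'', ''x'', ''c'', ''out'', ''q'', ''a'', ''j''}" for z
      proof -
        have "r3 z = s2 z" by (rule eq3) (use that in auto)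
        then show ?thesis using eq2[OF that] by simp
      qed
      define z where "z = r3 ''z'' 0"
      define Len where "Len = r3 ''L'' 0"
      have z: "z \<le> r ''k'' j" "\<And>i. i \<in> set js \<Longrightarrow> z \<le> r ''k'' (\<beta> i)"
        "z = r ''k'' j \<or> (\<exists>i\<in>set js. z = r ''k'' (\<beta> i))"
        using 3 by (auto simp: z_def s2)
      have zpos: "0 < z" using z(3) kj arc by (auto simp: j_def)
      \<comment> \<open>\<open>j\<close> leads into \<open>v\<close>, the start of the path, while
        every arc of the path leads into a node of \<open>js\<close>.\<close>
      have jn: "j \<notin> \<beta> ` set js" using arc j dist(2) by force
      define s4 where "s4 = r3(''k'' := (r ''k'')(j := r ''k'' j - z), ''X'' := (r3 ''X'')(0 := r ''T'' 0))"
      have s4: "s4 ''s'' 0 = int v" "s4 ''p'' = pr" "s4 ''g'' 0 = int nn" "s4 ''b'' = \<beta>" "s4 ''k'' = (r ''k'')(j := r ''k'' j - z)"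
        "s4 ''w'' = r ''w''" "s4 ''L'' 0 = Len" "s4 ''X'' 0 = r ''T'' 0" "s4 ''z'' 0 = z" "s4 ''y'' = y" "s4 ''m'' 0 = int mm"
        "s4 ''out'' = r ''out''" "s4 ''q'' = r ''q''" "s4 ''D'' 0 = D" "s4 ''in'' = inp"
        by (simp_all add: s4_def eq3 s2 z_def Len_def) (simp_all add: eq2 rs)
      define k2 where "k2 = push (- z) \<beta> (\<lambda>_. 1) js ((r ''k'')(j := r ''k'' j - z))"
      have k2j: "k2 j = r ''k'' j - z" unfolding k2_def by (subst push_other[OF jn]) simp
      have k2b: "k2 (\<beta> i) = r ''k'' (\<beta> i) - z" if "i \<in> set js" for i
        unfolding k2_def using push_at[OF dist(1) inj that, of "- z" "\<lambda>_. 1" "(r ''k'')(j := r ''k'' j - z)"] jn that by auto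
      have k2o: "k2 a = r ''k'' a" if "a \<noteq> j" "a \<notin> \<beta> ` set js" for a
        unfolding k2_def by (subst push_other[OF that(2)]) (use that in simp)
      have k2push: "k2 = (push (- z) \<beta> (\<lambda>_. 1) js (r ''k''))(j := r ''k'' j + (- z))"
      proof
        fix a
        show "k2 a = ((push (- z) \<beta> (\<lambda>_. 1) js (r ''k''))(j := r ''k'' j + (- z))) a"
          using k2j by (cases "a = j") (simp_all add: k2_def push_def)
      qed
      have circ2: "circulation M (r ''t'') (r ''h'') k2"
        unfolding k2push by (rule circulation_push[OF circ jM _ entered1 jn]) (use js(1) in \<open>simp_all add: j\<close>)
      have k2_nonneg: "0 \<le> k2 a \<and> k2 a \<le> r ''k'' a" if "a \<in> {0..<M}" for a
      proof (cases "a = j")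
        case True then show ?thesis using k2j z(1) zpos by simp
      next
        case False
        then show ?thesis using k2o[OF False] k2b z(2) k0[OF that] zpos by (cases "a \<in> \<beta> ` set js") auto
      qed
      have opt2: "optimal M (r ''t'') (r ''h'') (r ''c'') k2 (r ''x'') y"
        unfolding optimal_def
      proof
        fix a assume a: "a \<in> {0..<M}"
        have "r ''x'' a < r ''k'' a \<longrightarrow> 0 \<le> r ''c'' a + y (r ''t'' a) - y (r ''h'' a)"
          using opt1 a unfolding optimal_def by blast
        then show "0 \<le> r ''x'' a \<and> r ''x'' a \<le> k2 a \<and>
          (r ''x'' a < k2 a \<longrightarrow> 0 \<le> r ''c'' a + y (r ''t'' a) - y (r ''h'' a)) \<and>
          (0 < r ''x'' a \<longrightarrow> r ''c'' a + y (r ''t'' a) - y (r ''h'' a) \<le> 0)"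
          using k2_nonneg[OF a] rx[OF a] by simp
      qed
      define \<rho> where "\<rho> = real_of_int z * real_of_int (inp 3) / (real_of_int D * real_of_int (inp 2) * 2)"
      have \<rho>: "\<rho> = z / D / (2 * T)" using inp3_pos inp2 D by (simp add: \<rho>_def T_eq field_simps)
      have wsum: "real_of_int Len / D = (\<Sum>e\<leftarrow>P. \<tau> e)"
      proof -
        have w0: "r ''w'' (\<beta> (int nn)) = 0" using rw v'(2) by simp
        have "Len = (\<Sum>i\<leftarrow>js'. r ''w'' (\<beta> i))" using 3 w0 by (simp add: s2 Len_def js')
        also have "real_of_int \<dots> / D = (\<Sum>i\<leftarrow>js'. real_of_int (r ''w'' (\<beta> i)) / D)"
          by (induction js') (simp_all add: add_divide_distrib)
        also have "\<dots> = (\<Sum>i\<leftarrow>js'. \<tau> (nat (\<beta> i)))"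
        proof (rule arg_cong[where f = sum_list], rule map_cong)
          fix i assume "i \<in> set js'"
          then show "real_of_int (r ''w'' (\<beta> i)) / D = \<tau> (nat (\<beta> i))"
            using re(3)[of "nat (\<beta> i)"] edge'[of i] D by (simp add: nat_less_iff)
        qed simp
        finally show ?thesis by (simp add: P_def comp_def)
      qed
      have blocks: "emitted (int mm) \<beta> (r ''w'') D \<rho> Len (r ''T'' 0) js = path_blocks \<tau> \<rho> (\<Sum>e\<leftarrow>P. \<tau> e) (2 * T) P"
      proof -
        \<comment> \<open>The first step back from the additional node uses a terminal arc, which
          emits no block and has \<open>w = 0\<close>.\<close>
        have "emitted (int mm) \<beta> (r ''w'') D \<rho> Len (r ''T'' 0) js = emitted (int mm) \<beta> (r ''w'') D \<rho> Len (r ''T'' 0) js'"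
          using rw v'(2) by (simp add: js')
        also have "\<dots> = path_blocks \<tau> \<rho> (Len / D) (r ''T'' 0 / D) P"
          unfolding P_def
        proof (rule emitted_path_blocks)
          fix i assume i: "i \<in> set js'"
          then show "0 \<le> \<beta> i \<and> \<beta> i < int mm \<and> real_of_int (r ''w'' (\<beta> i)) = \<tau> (nat (\<beta> i)) * D"
            using re(3)[of "nat (\<beta> i)"] edge'[of i] by (simp add: nat_less_iff)
        qed (rule D_pos)
        finally show ?thesis using wsum rs(6) D by simp
      qed
      have sch2: "partial_schedule (G out) u \<tau> b T (T * B) (bl @ path_blocks \<tau> \<rho> (\<Sum>e\<leftarrow>P. \<tau> e) (2 * T) P)
        (\<lambda>e. k2 (int e) / D) (rest k2)"
      proof -
        have "partial_schedule (G out) u \<tau> b T (T * B) (bl @ path_blocks \<tau> (z / D / (2 * T)) (\<Sum>e\<leftarrow>P. \<tau> e) (2 * T) P)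
          (\<lambda>e. if e \<in> set P then r ''k'' (int e) / D - z / D else r ''k'' (int e) / D)
          ((rest (r ''k''))(v := rest (r ''k'') v - z / D, v' := rest (r ''k'') v' + z / D))"
        proof (rule partial_schedule_path[OF sch T _ _ _ walk distP setP])
          show "finite (arcs (G out))" "finite (verts (G out))" by (simp_all add: arcs_G verts_G)
          show "0 \<le> \<tau> e" if "e \<in> arcs (G out)" for e using that net_facts(4) by (simp add: arcs_G)
          show "v' \<in> verts (G out)" "v \<in> verts (G out)" using v v' by (simp_all add: verts_G)
          show "b v' < 0" "0 < b v" using bv' v by simp_all
          show "0 \<le> z / D" using zpos D by simp
          show "z / D \<le> rest (r ''k'') v" using z(1) v(2) D by (simp add: rest_def j_def divide_right_mono)
          have "z \<le> r ''k'' (2 * int mm + int v')" using z(2)[of "int nn"] js' v'(2) by simp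
          then show "z / D \<le> - rest (r ''k'') v'" using bv'(1) D by (simp add: rest_def divide_right_mono)
          fix e assume "e \<in> set P"
          then obtain i where i: "i \<in> set js'" "e = nat (\<beta> i)" by (auto simp: P_def)
          then have "z \<le> r ''k'' (int e)" using z(2)[of i] edge'[of i] js' by simp
          then show "z / D \<le> r ''k'' (int e) / D" using D by (simp add: divide_right_mono)
        qed
        then show ?thesis unfolding \<rho>[symmetric]
        proof (rule partial_schedule_cong)
          fix e assume "e \<in> arcs (G out)"
          then have e: "e < mm" by (simp add: arcs_G)
          have ej: "int e \<noteq> j" using e by (simp add: j_def)
          show "k2 (int e) / D = (if e \<in> set P then r ''k'' (int e) / D - z / D else r ''k'' (int e) / D)"
          proof (cases "e \<in> set P")
            case True
            then obtain i where i: "i \<in> set js'" "e = nat (\<beta> i)" by (auto simp: P_def)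
            then have "int e = \<beta> i" "i \<in> set js" using edge'[of i] js' by auto
            then show ?thesis using True k2b[of i] by (simp add: diff_divide_distrib)
          next
            case False
            have "int e \<notin> \<beta> ` set js"
            proof
              assume "int e \<in> \<beta> ` set js"
              then obtain i where i: "i \<in> set js" "int e = \<beta> i" by auto
              then have "i \<in> set js'" using v'(2) e js' by auto
              then have "e \<in> set P" using i(2)[symmetric] by (force simp: P_def)
              then show False using False by simp
            qed
            then show ?thesis using False k2o[OF ej] by simp
          qed
        next
          fix x assume "x \<in> verts (G out)"
          then have x: "x < nn" by (simp add: verts_G)
          have vv: "v \<noteq> v'" using v(2) bv'(1) by auto
          consider "x = v" | "x = v'" | "x \<noteq> v" "x \<noteq> v'" by blast
          then show "rest k2 x = ((rest (r ''k''))(v := rest (r ''k'') v - z / D, v' := rest (r ''k'') v' + z / D)) x"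
          proof cases
            case 1
            then show ?thesis using vv v(2) k2j by (simp add: rest_def j_def diff_divide_distrib)
          next
            case 2
            then show ?thesis using bv'(1) k2b[of "int nn"] js' v'(2) by (simp add: rest_def diff_divide_distrib)
          next
            case 3
            have "2 * int mm + int x \<notin> \<beta> ` set js"
            proof
              assume "2 * int mm + int x \<in> \<beta> ` set js"
              then obtain i where i: "i \<in> set js" "2 * int mm + int x = \<beta> i" by auto
              then have "i = int nn \<or> i \<in> set js'" using js' by auto
              then show False using i(2) v'(2) 3 edge'[of i] by auto
            qed
            then show ?thesis using 3 k2o[of "2 * int mm + int x"] by (simp add: rest_def j_def)
          qed
        qed
      qed
      have "wp qq (trace emit_arc) (\<lambda>r'. r' ''k'' = push (- s4 ''z'' 0) (s4 ''b'') (\<lambda>_. 1) js (s4 ''k'') \<and>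
        (\<forall>a<s4 ''m'' 0. r' ''out'' a = s4 ''out'' a) \<and>
        output_blocks (s4 ''m'' 0) (r' ''out'') (r' ''q'' 0) (bl @ emitted (s4 ''m'' 0) (s4 ''b'') (s4 ''w'') (s4 ''D'' 0)
          (real_of_int (s4 ''z'' 0) * real_of_int (s4 ''in'' 3) / (real_of_int (s4 ''D'' 0) * real_of_int (s4 ''in'' 2) * 2)) (s4 ''L'' 0) (s4 ''X'' 0) js)) s4"
        by (rule wp_emit_path) (use js len ro arc D_pos inp2 in \<open>simp_all add: s4\<close>)
      then have "wp qq (trace emit_arc) ?Q s4"
      proof (rule wp_frameI)
        fix r5 assume "r5 ''k'' = push (- s4 ''z'' 0) (s4 ''b'') (\<lambda>_. 1) js (s4 ''k'') \<and>
        (\<forall>a<s4 ''m'' 0. r5 ''out'' a = s4 ''out'' a) \<and>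
        output_blocks (s4 ''m'' 0) (r5 ''out'') (r5 ''q'' 0) (bl @ emitted (s4 ''m'' 0) (s4 ''b'') (s4 ''w'') (s4 ''D'' 0)
          (real_of_int (s4 ''z'' 0) * real_of_int (s4 ''in'' 3) / (real_of_int (s4 ''D'' 0) * real_of_int (s4 ''in'' 2) * 2)) (s4 ''L'' 0) (s4 ''X'' 0) js)"
          and ag: "agree (assigned (trace emit_arc)) s4 r5"
        then have 5: "r5 ''k'' = k2" "\<And>a. a < int mm \<Longrightarrow> r5 ''out'' a = out a"
          "output_blocks (int mm) (r5 ''out'') (r5 ''q'' 0) (bl @ path_blocks \<tau> \<rho> (\<Sum>e\<leftarrow>P. \<tau> e) (2 * T) P)"
          unfolding blocks[symmetric] by (auto simp: s4 k2_def ro \<rho>_def)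
        have eq5: "r5 z = s4 z" if "z \<notin> {''u'', ''k'', ''L'', ''X'', ''out'', ''q''}" for z
          using that by (intro agreeD[OF ag]) (simp add: emit_arc_def emit_block_def)
        have eq5': "r5 z = r z" if "z \<in> {''n'', ''m'', ''M'', ''D'', ''in'', ''T'', ''t'', ''h'', ''w'', ''x'', ''c'', ''a'', ''j''}" for z
        proof -
          have "r5 z = s4 z" by (rule eq5) (use that in auto)
          also have "\<dots> = r3 z" using that by (auto simp: s4_def)
          also have "\<dots> = r z" by (rule eq3') (use that in auto)
          finally show ?thesis .
        qed
        have y5: "r5 ''y'' = y" by (simp add: eq5 s4)
        have e5: "r5 ''n'' = r ''n''" "r5 ''m'' = r ''m''" "r5 ''M'' = r ''M''" "r5 ''D'' = r ''D''" "r5 ''in'' = r ''in''"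
          "r5 ''T'' = r ''T''" "r5 ''t'' = r ''t''" "r5 ''h'' = r ''h''" "r5 ''w'' = r ''w''" "r5 ''x'' = r ''x''"
          "r5 ''c'' = r ''c''" "r5 ''a'' = r ''a''" "r5 ''j'' = r ''j''"
          by (rule eq5', simp)+
        have zero: "k2 a = 0" if "a \<in> {0..<M}" "r ''k'' a = 0" for a
          using k2_nonneg[OF that(1)] that(2) by simp
        have "good_state r5 qq"
          using good opt2 unfolding good_state_def e5 y5 5(1) rs by blast
        then have "decomposing out r5 (bl @ path_blocks \<tau> \<rho> (\<Sum>e\<leftarrow>P. \<tau> e) (2 * T) P)"
          unfolding decomposing_def e5 5(1)
          using rs re rw rv rx circ2 5(2,3) sch2 zero by simp
        \<comment> \<open>No arc gains flow, and the arc that attains the bottleneck is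
          emptied.\<close>
        moreover have "positive_arcs r5 \<subset> positive_arcs r"
        proof -
          have "positive_arcs r5 \<subseteq> positive_arcs r"
            using k2_nonneg unfolding positive_arcs_def 5(1) by force
          moreover obtain a where "a \<in> {0..<M}" "0 < r ''k'' a" "k2 a = 0"
          proof (cases "z = r ''k'' j")
            case True
            then show ?thesis using k2j jM kj by (intro that[of j]) (simp_all add: j_def)
          next
            case False
            then obtain i where "i \<in> set js" "z = r ''k'' (\<beta> i)" using z(3) by blast
            then show ?thesis using k2b[of i] arc[of i] by (intro that[of "\<beta> i"]) simp_all
          qed
          moreover have "a \<in> positive_arcs r" "a \<notin> positive_arcs r5"
            using \<open>a \<in> {0..<M}\<close> \<open>0 < r ''k'' a\<close> \<open>k2 a = 0\<close> unfolding positive_arcs_def 5(1) by simp_all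
          ultimately show ?thesis by blast
        qed
        ultimately show "?Q r5" using e5 by blast
      qed
      moreover have "r3 ''j'' 0 = j" using eq3'[of "''j''"] a(2) by (simp add: j_def)
      ultimately show "wp qq ?c3 (wp qq (trace emit_arc) ?Q) r3"
        by (simp add: s4_def z_def eq3'[of "''k''"] eq3'[of "''T''"])
    qed
    moreover have "r1 ''j'' 0 = j" using eq1[of "''j''"] a(2) by (simp add: j_def)
    ultimately show "wp qq ?c2 (wp qq measure_path (wp qq ?c3 (wp qq (trace emit_arc) ?Q))) r1"
      by (simp add: s2_def eq1[of "''k''"])
  qed
  then show ?thesis by (simp add: send_path_def s1_def a rs wp_Seq_fun)
qed

lemma wp_decompose_node:
  assumes dec: "decomposing out r bl" and v: "v < nn" and a: "r ''a'' 0 = int v"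
  shows "wp qq decompose_node (\<lambda>r'. (\<exists>bl. decomposing out r' bl) \<and> r' ''a'' = r ''a'' \<and>
    positive_arcs r' \<subseteq> positive_arcs r \<and> (0 < b v \<longrightarrow> 2 * int mm + int v \<notin> positive_arcs r')) r"
proof -
  have rs: "r ''m'' 0 = int mm" "r ''in'' = inp" using dec by (simp_all add: decomposing_def)
  have sgn: "0 < inp (4 + int v * 2) \<longleftrightarrow> 0 < b v" using scaled_balance(2)[OF v] by (simp add: mult.commute)
  show ?thesis
  proof (cases "0 < b v")
    case False
    then show ?thesis using dec by (auto simp: decompose_node_def rs a sgn)
  next
    case True
    let ?j = "2 * int mm + int v"
    define s where "s = r(''j'' := (r ''j'')(0 := ?j))"
    have s: "s ''n'' = r ''n''" "s ''m'' = r ''m''" "s ''M'' = r ''M''" "s ''D'' = r ''D''" "s ''in'' = r ''in''" "s ''T'' = r ''T''" "s ''t'' = r ''t''" "s ''h'' = r ''h''" "s ''w'' = r ''w''" "s ''k'' = r ''k''" "s ''x'' = r ''x''" "s ''c'' = r ''c''" "s ''y'' = r ''y''" "s ''out'' = r ''out''" "s ''q'' = r ''q''"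
      by (simp_all add: s_def)
    have dec_s: "decomposing out s bl" using dec unfolding decomposing_def good_state_def s .
    have jM: "?j \<in> {0..<M}" using v by simp
    have "wp qq (While (Less (Const 0) (Read ''k'' (V ''j''))) send_path) (\<lambda>r'. (\<exists>bl. decomposing out r' bl) \<and> r' ''a'' = r ''a'' \<and>
      positive_arcs r' \<subseteq> positive_arcs r \<and> ?j \<notin> positive_arcs r') s"
    proof (rule wp_While[where \<mu> = "\<lambda>r. card (positive_arcs r)" and
          I = "\<lambda>r'. (\<exists>bl. decomposing out r' bl) \<and> r' ''a'' = r ''a'' \<and> r' ''j'' 0 = ?j \<and> positive_arcs r' \<subseteq> positive_arcs r"])
      show "(\<exists>bl. decomposing out s bl) \<and> s ''a'' = r ''a'' \<and> s ''j'' 0 = ?j \<and> positive_arcs s \<subseteq> positive_arcs r"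
        using dec_s by (auto simp: s_def positive_arcs_def)
      have "card (positive_arcs s) \<le> card {0..<M}" by (rule card_mono) (auto simp: positive_arcs_def)
      then show "card (positive_arcs s) \<le> qq" using qq(3) by simp
    next
      fix r1 assume I: "(\<exists>bl. decomposing out r1 bl) \<and> r1 ''a'' = r ''a'' \<and> r1 ''j'' 0 = ?j \<and> positive_arcs r1 \<subseteq> positive_arcs r"
      {
        assume "eval_exp r1 (Less (Const 0) (Read ''k'' (V ''j''))) \<noteq> 0"
        then have kj: "0 < r1 ''k'' ?j" using I by (simp split: if_splits)
        obtain bl1 where d1: "decomposing out r1 bl1" using I by blast
        show "wp qq send_path (\<lambda>r'. ((\<exists>bl. decomposing out r' bl) \<and> r' ''a'' = r ''a'' \<and> r' ''j'' 0 = ?j \<and>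
          positive_arcs r' \<subseteq> positive_arcs r) \<and> card (positive_arcs r') < card (positive_arcs r1)) r1"
        proof (rule wp_mono[OF wp_send_path[OF d1 v True _ _ kj]])
          fix r2 assume 2: "(\<exists>bl. decomposing out r2 bl) \<and> r2 ''a'' = r1 ''a'' \<and> r2 ''j'' = r1 ''j'' \<and>
            positive_arcs r2 \<subset> positive_arcs r1"
          have "finite (positive_arcs r1)" by (rule finite_subset[of _ "{0..<M}"]) (auto simp: positive_arcs_def)
          then have "card (positive_arcs r2) < card (positive_arcs r1)" using 2 by (intro psubset_card_mono) auto
          then show "((\<exists>bl. decomposing out r2 bl) \<and> r2 ''a'' = r ''a'' \<and> r2 ''j'' 0 = ?j \<and>
            positive_arcs r2 \<subseteq> positive_arcs r) \<and> card (positive_arcs r2) < card (positive_arcs r1)"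
            using 2 I by auto
        qed (use I a in auto)
      }
      {
        assume "eval_exp r1 (Less (Const 0) (Read ''k'' (V ''j''))) = 0"
        then have "?j \<notin> positive_arcs r1" using I by (simp add: positive_arcs_def split: if_splits)
        then show "(\<exists>bl. decomposing out r1 bl) \<and> r1 ''a'' = r ''a'' \<and> positive_arcs r1 \<subseteq> positive_arcs r \<and> ?j \<notin> positive_arcs r1"
          using I by blast
      }
    qed
    then show ?thesis using True by (simp add: decompose_node_def rs a sgn s_def mult.commute)
  qed
qed

lemma wp_solve:
  "wp qq solve (\<lambda>r. \<exists>out bl. decomposing out r bl \<and> (\<forall>v<nn. 0 < b v \<longrightarrow> 2 * int mm + int v \<notin> positive_arcs r))
    (initial_memory (encode_network I))" (is "wp qq _ ?Q _")
proof -
  let ?loop = "For ''a'' (V ''n'') decompose_node"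
  have "wp qq read_network (wp qq min_cost (wp qq orient (wp qq ?loop ?Q))) (initial_memory (encode_network I))"
  proof (rule wp_mono[OF wp_read_network])
    fix r0 assume 0: "network_memory r0 \<and> r0 ''x'' = (\<lambda>_. 0) \<and> r0 ''k'' = (\<lambda>_. 0) \<and> r0 ''y'' = (\<lambda>_. 0) \<and>
      (\<exists>j<qq. r0 ''P'' 0 = 2 ^ j \<and> (\<forall>a\<in>{0..<M}. r0 ''U'' a < 2 ^ j))"
    then obtain j where j: "j < qq" "r0 ''P'' 0 = 2 ^ j" "\<And>a. a \<in> {0..<M} \<Longrightarrow> r0 ''U'' a < 2 ^ j" by blast
    have net0: "network_memory r0" using 0 by blast
    have M0: "r0 ''M'' 0 = M" using net0 by (simp add: network_memory_def)
    have good0: "good_state r0 qq"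
      by (rule network_memory_good[OF net0]) (use 0 in \<open>auto simp: optimal_def circulation_def\<close>)
    have U0: "0 \<le> r0 ''U'' a" if "a \<in> {0..<M}" for a
      using that
    proof (cases rule: arc_cases)
      case (forward e) then show ?thesis using network_memory_edge(10)[OF net0] by simp
    next
      case (backward e) then show ?thesis using network_memory_edge(6,10)[OF net0] by simp
    next
      case (node v) then show ?thesis using network_memory_node(5)[OF net0] by simp
    qed
    have "wp qq min_cost (\<lambda>r. good_state r qq \<and> (\<forall>a\<in>{0..<r0 ''M'' 0}. r ''k'' a = r0 ''U'' a)) r0"
      by (rule wp_min_cost[OF good0 j(2,1)]) (use 0 U0 j(3) in \<open>auto simp: M0\<close>)
    then show "wp qq min_cost (wp qq orient (wp qq ?loop ?Q)) r0"
    proof (rule wp_frameI)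
      fix r1 assume 1: "good_state r1 qq \<and> (\<forall>a\<in>{0..<r0 ''M'' 0}. r1 ''k'' a = r0 ''U'' a)"
        and ag: "agree (assigned min_cost) r0 r1"
      have eq1: "r1 z = r0 z" if "z \<notin> {''P'', ''a'', ''x'', ''k''}" "z \<notin> search_vars" for z
        by (rule agreeD[OF ag])
          (use that assigned_raise_capacity in \<open>auto simp: min_cost_def scale_arc_def\<close>)
      have net1: "network_memory r1"
        by (rule network_memory_cong[OF net0], rule eq1) (auto simp: search_vars_def)
      have "r1 ''U'' = r0 ''U''" by (rule eq1) (auto simp: search_vars_def)
      then have k1: "r1 ''k'' a = r1 ''U'' a" if "a \<in> {0..<M}" for a using 1 that by (simp add: M0)
      show "wp qq orient (wp qq ?loop ?Q) r1"
      proof (rule wp_mono[OF wp_orient[OF net1 _ k1]])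
        fix r2 assume d2: "decomposing (r2 ''out'') r2 []"
        define out where "out = r2 ''out''"
        show "wp qq ?loop ?Q r2"
        proof (rule wp_For[where N = "int nn" and I = "\<lambda>j r. (\<exists>bl. decomposing out r bl) \<and>
            (\<forall>v. int v < j \<longrightarrow> 0 < b v \<longrightarrow> 2 * int mm + int v \<notin> positive_arcs r)"])
          show "(\<exists>bl. decomposing out (r2(''a'' := (r2 ''a'')(0 := 0))) bl) \<and>
            (\<forall>v. int v < 0 \<longrightarrow> 0 < b v \<longrightarrow> 2 * int mm + int v \<notin> positive_arcs (r2(''a'' := (r2 ''a'')(0 := 0))))"
            using d2 by (auto simp: decomposing_def good_state_def out_def intro!: exI[of _ "[]"])
        next
          fix j r3 assume "(\<exists>bl. decomposing out r3 bl) \<and>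
            (\<forall>v. int v < j \<longrightarrow> 0 < b v \<longrightarrow> 2 * int mm + int v \<notin> positive_arcs r3)"
          then show "eval_exp r3 (V ''n'') = int nn" by (auto simp: decomposing_def)
        next
          fix j r3 assume I3: "(\<exists>bl. decomposing out r3 bl) \<and>
            (\<forall>v. int v < j \<longrightarrow> 0 < b v \<longrightarrow> 2 * int mm + int v \<notin> positive_arcs r3)"
            and j: "0 \<le> j" "j < int nn" "r3 ''a'' 0 = j"
          define v where "v = nat j"
          have v: "v < nn" "r3 ''a'' 0 = int v" "j = int v" using j by (auto simp: v_def)
          obtain bl3 where d3: "decomposing out r3 bl3" using I3 by blast
          show "wp qq decompose_node (\<lambda>r'. ((\<exists>bl. decomposing out (r'(''a'' := (r' ''a'')(0 := j + 1))) bl) \<and>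
            (\<forall>v. int v < j + 1 \<longrightarrow> 0 < b v \<longrightarrow> 2 * int mm + int v \<notin> positive_arcs (r'(''a'' := (r' ''a'')(0 := j + 1))))) \<and>
            r' ''a'' 0 = j) r3"
          proof (rule wp_mono[OF wp_decompose_node[OF d3 v(1,2)]])
            fix r4 assume 4: "(\<exists>bl. decomposing out r4 bl) \<and> r4 ''a'' = r3 ''a'' \<and>
              positive_arcs r4 \<subseteq> positive_arcs r3 \<and> (0 < b v \<longrightarrow> 2 * int mm + int v \<notin> positive_arcs r4)"
            have pos: "positive_arcs (r4(''a'' := z)) = positive_arcs r4" for z by (simp add: positive_arcs_def)
            have "decomposing out (r4(''a'' := z)) bl = decomposing out r4 bl" for z bl
              by (simp add: decomposing_def good_state_def)
            moreover have "2 * int mm + int w \<notin> positive_arcs r4" if "int w < j + 1" "0 < b w" for w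
            proof (cases "w = v")
              case False
              then have "int w < j" using that(1) v(3) by simp
              then show ?thesis using I3 4 that(2) by blast
            qed (use 4 that in auto)
            ultimately show "((\<exists>bl. decomposing out (r4(''a'' := (r4 ''a'')(0 := j + 1))) bl) \<and>
            (\<forall>v. int v < j + 1 \<longrightarrow> 0 < b v \<longrightarrow> 2 * int mm + int v \<notin> positive_arcs (r4(''a'' := (r4 ''a'')(0 := j + 1))))) \<and>
            r4 ''a'' 0 = j"
              using 4 j(3) by (simp add: pos)
          qed
        next
          fix r3 assume "(\<exists>bl. decomposing out r3 bl) \<and>
            (\<forall>v. int v < int nn \<longrightarrow> 0 < b v \<longrightarrow> 2 * int mm + int v \<notin> positive_arcs r3)"
          then show "?Q r3" by auto
        qed (use qq in auto)
      qed (use 1 in auto)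
    qed
  qed
  then show ?thesis by (simp add: solve_def wp_Seq_fun)
qed

text \<open>The schedule was maintained for the orientation given by \<open>out\<close>, which
  agrees with the final output array on the first \<open>mm\<close> cells; the orientation, and with
  it every excess, depends on these cells only. The step functions read from the written cells are
  those of the block list \<open>bl\<close>.\<close>

lemma output_correct:
  assumes dec: "decomposing out r bl" and finished: "\<And>v. v < nn \<Longrightarrow> 0 < b v \<Longrightarrow> 2 * int mm + int v \<notin> positive_arcs r"
  shows "wellformed_output I (r ''out'')"
    and "orientation (network_of I) (output_orientation I (r ''out''))"
    and "oriented_flow_of_value (network_of I) (output_orientation I (r ''out''))
      (total_supply (network_of I) / 2) (2 * horizon (network_of I)) (output_flow I (r ''out''))"
proof -
  have ro: "\<And>a. a < int mm \<Longrightarrow> r ''out'' a = out a" and ob: "output_blocks (int mm) (r ''out'') (r ''q'' 0) bl"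
    and sch: "partial_schedule (G out) u \<tau> b T (T * B) bl (\<lambda>e. r ''k'' (int e) / D) (rest (r ''k''))"
    and good: "good_state r qq" "r ''M'' 0 = M" and rx: "\<And>a. a \<in> {0..<M} \<Longrightarrow> r ''x'' a = 0"
    using dec unfolding decomposing_def by blast+
  have k0: "0 \<le> r ''k'' a" if "a \<in> {0..<M}" for a
    using good that rx[OF that] unfolding good_state_def optimal_def by (metis order_trans)
  let ?G = "output_orientation I (r ''out'')"
  have arcs: "in_arcs ?G v = in_arcs (G out) v" "out_arcs ?G v = out_arcs (G out) v" for v
    unfolding in_arcs_def out_arcs_def arcs_G by (auto simp: tail_G head_G ro)
  have ex: "excess ?G \<tau> f v \<theta> = excess (G out) \<tau> f v \<theta>" for f v \<theta>
    by (simp add: excess_def arcs)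
  show "wellformed_output I (r ''out'')"
    using ob unfolding wellformed_output_def output_blocks_def valid_block_def block_count_def block_start_def mm_def by simp
  show "orientation (network_of I) ?G"
    unfolding orientation_def network_simps verts_G arcs_G by (auto simp: tail_G head_G)
  have flow: "output_flow I (r ''out'') = block_flow bl"
  proof (intro ext)
    fix e \<theta>
    have bl: "bl = map (block_at (int mm) (r ''out'')) [0..<nat (r ''out'' (int mm))]"
      and valid: "\<And>k. k < nat (r ''out'' (int mm)) \<Longrightarrow> valid_block (int mm) (r ''out'') k"
      using ob by (auto simp: output_blocks_def)
    have "block_flow bl e \<theta> = (\<Sum>k<nat (r ''out'' (int mm)). case block_at (int mm) (r ''out'') k of (c, r, s, \<rho>) \<Rightarrow>
        if c = e \<and> r \<le> \<theta> \<and> \<theta> < s then \<rho> else 0)"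
      unfolding block_flow_def bl by (simp add: comp_def interv_sum_list_conv_sum_set_nat lessThan_atLeast0)
    also have "\<dots> = output_flow I (r ''out'') e \<theta>"
      unfolding output_flow_def block_count_def mm_def[symmetric]
    proof (rule sum.cong)
      fix k assume "k \<in> {..<nat (r ''out'' (int mm))}"
      then have "valid_block (int mm) (r ''out'') k" using valid by simp
      then have "0 \<le> r ''out'' (int mm + 1 + 7 * int k)" by (simp add: valid_block_def Let_def)
      then have e: "nat (r ''out'' (int mm + 1 + 7 * int k)) = e \<longleftrightarrow> r ''out'' (int mm + 1 + 7 * int k) = int e"
        by auto
      show "(case block_at (int mm) (r ''out'') k of (c, r, s, \<rho>) \<Rightarrow> if c = e \<and> r \<le> \<theta> \<and> \<theta> < s then \<rho> else 0) =
        (let i = block_start I k in if r ''out'' i = int e \<and> \<theta> \<in> {fraction_at (r ''out'') (i + 1)..<fraction_at (r ''out'') (i + 3)}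
          then fraction_at (r ''out'') (i + 5) else 0)"
        unfolding block_at_def block_start_def mm_def[symmetric] Let_def prod.case e by simp
    qed simp
    finally show "output_flow I (r ''out'') e \<theta> = block_flow bl e \<theta>" ..
  qed
  have rest0: "rest (r ''k'') v = 0" if "v \<in> verts (G out)" "0 < b v" for v
  proof -
    have v: "v < nn" using that by (simp add: verts_G)
    then have "2 * int mm + int v \<in> {0..<M}" by simp
    then have "r ''k'' (2 * int mm + int v) = 0"
      using finished[OF v that(2)] k0[of "2 * int mm + int v"] by (simp add: positive_arcs_def)
    then show ?thesis by (simp add: rest_def)
  qed
  have fin: "finite (arcs (G out))" by (simp add: arcs_G)
  have tr: "0 \<le> \<tau> e" if "e \<in> arcs (G out)" for e using that net_facts(4) by (simp add: arcs_G)
  note final = partial_schedule_final[OF sch net_facts(6) fin rest0 tr]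
  have val: "flow_value ?G \<tau> b (2 * T) f = flow_value (G out) \<tau> b (2 * T) f" for f
    by (simp add: flow_value_def ex verts_G)
  have "flow_over_time ?G u \<tau> b (2 * T) (block_flow bl)"
    using final(1) unfolding flow_over_time_def inflow_rates_def flow_conservation_def ex arcs_G verts_G .
  moreover have "total_supply (network_of I) / 2 \<le> flow_value ?G (transit (network_of I)) (balance (network_of I)) (2 * T) (block_flow bl)"
    by (rule value_from_schedule[OF net send])
      (use final(2,3) in \<open>simp_all add: network_simps verts_G val B_def\<close>)
  ultimately show "oriented_flow_of_value (network_of I) ?G
      (total_supply (network_of I) / 2) (2 * horizon (network_of I)) (output_flow I (r ''out''))"
    unfolding oriented_flow_of_value_def network_simps flow by simp
qed

end

lemma tame_solve: "tame ''in'' solve"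
  by (simp add: solve_def read_network_def read_sizes_def read_edge_def read_node_def find_scale_def min_cost_def
    scale_arc_def raise_capacity_def reduced_cost_def search_def search_step_def scan_arc_def augment_def trace_def
    orient_def orient_edge_def reset_arc_def decompose_node_def send_path_def measure_path_def emit_arc_def
    emit_block_def For_def)

theorem theorem5:
  shows "(\<forall>N :: ('v, 'e) network.
            undirected_network_over_time N \<and> can_be_sent N (total_supply N) (horizon N) \<longrightarrow>
              (\<exists>G. orientation N G \<and>
                   can_be_sent_oriented N G (total_supply N / 2) (2 * horizon N)))
       \<and> computable_in_polynomial_time encode_network
           (\<lambda>I. undirected_network_over_time (network_of I) \<and>
                can_be_sent (network_of I) (total_supply (network_of I)) (horizon (network_of I)))
           (\<lambda>I out. wellformed_output I out \<and>
                orientation (network_of I) (output_orientation I out) \<and>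
                oriented_flow_of_value (network_of I) (output_orientation I out)
                  (total_supply (network_of I) / 2) (2 * horizon (network_of I))
                  (output_flow I out))"
proof (intro conjI allI impI)
  fix N :: "('v, 'e) network"
  assume "undirected_network_over_time N \<and> can_be_sent N (total_supply N) (horizon N)"
  then show "\<exists>G. orientation N G \<and> can_be_sent_oriented N G (total_supply N / 2) (2 * horizon N)"
    using orientation_exists by blast
next
  show "computable_in_polynomial_time encode_network
           (\<lambda>I. undirected_network_over_time (network_of I) \<and>
                can_be_sent (network_of I) (total_supply (network_of I)) (horizon (network_of I)))
           (\<lambda>I out. wellformed_output I out \<and>
                orientation (network_of I) (output_orientation I out) \<and>
                oriented_flow_of_value (network_of I) (output_orientation I out)
                  (total_supply (network_of I) / 2) (2 * horizon (network_of I))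
                  (output_flow I out))"
  proof (rule polynomial_time[OF tame_solve, where q = "\<lambda>L. 5 * L + 5"])
    show "poly_fun (\<lambda>L. 5 * L + 5)" by (intro poly_funs)
    fix I assume "undirected_network_over_time (network_of I) \<and>
      can_be_sent (network_of I) (total_supply (network_of I)) (horizon (network_of I))"
    then interpret rational_instance I by unfold_locales auto
    show "wp (5 * (\<Sum>x\<leftarrow>encode_network I. bits x) + 5) solve (\<lambda>s. wellformed_output I (s ''out'') \<and>
      orientation (network_of I) (output_orientation I (s ''out'')) \<and>
      oriented_flow_of_value (network_of I) (output_orientation I (s ''out''))
        (total_supply (network_of I) / 2) (2 * horizon (network_of I)) (output_flow I (s ''out'')))
      (initial_memory (encode_network I))"
      unfolding L_def[symmetric] qq_def[symmetric]
      by (rule wp_mono[OF wp_solve]) (use output_correct in blast)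
  qed
qed

end
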